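(* Let $d\ge 1$, let $\delta>0$ (arbitrarily small) and $\gamma>\delta$ (arbitrarily large), let $\alpha=\alpha(L)$ satisfy $L^{-\gamma}\le\alpha\le L^{-\delta}$, let $n_{in}\in\mathcal S(\mathbb R^d)$ be non-negative, let $(g_k(\omega))_{k\in\mathbb Z^d}$ be a family of i.i.d. centered normalized complex Gaussian random variables on a probability space $(\Omega,\mathbb P)$, and consider the random initial data on $\mathbb T_L^d$ $$u_0(x)=\frac{\alpha}{L^{d/2}}\sum_{k\in\mathbb Z^d}\sqrt{n_{in}(k/L)}\,g_k(\omega)\,e^{2\pi i (k/L)\cdot x}.$$ Then there exist $\theta>0$, $K=K(\theta,\gamma)>0$, $c=c(\theta,\gamma)>0$, $s>d/2$ and $b>1/2$ close to $1/2$ such that for all $L$ large enough there exists an event $E_L\subset\Omega$ with $\mathbb P(E_L^c)\le Ke^{-cL^\theta}$ such that, on $E_L$, the solution $u$ to $$i\partial_t u-\Delta u=u^2\quad\text{on }\mathbb R\times\mathbb T_L^d,\qquad u(0,\cdot)=u_0,$$ is defined up to time $T_{max}$ in $h^{s,b}_{T_{max}}$, where $$T_{max}=\alpha^{-1}L^{-\delta}.$$ Furthermore, there exists $C>0$ such that, for all such $L$ and on $E_L$, $$\|u\|_{L^\infty_t((0,T_{max}),L^\infty_x)}\le\alpha L^{\theta+C(b-1/2)}.$$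
   Context: $L\ge1$ is the size of the torus $\mathbb T_L^d=\mathbb R^d/(L\mathbb Z)^d$, $\mathbb Z_L^d=\frac1L\mathbb Z^d$, $\Delta=\sum_{i=1}^d\partial_{x_i}^2$. A centered normalized complex Gaussian is $g=\frac1{\sqrt2}(\eta_1+i\eta_2)$ with $\eta_1,\eta_2$ independent real standard Gaussians. $\langle x\rangle=\sqrt{1+4\pi^2|x|^2}$. Fourier conventions: for $u:\mathbb T_L^d\to\mathbb C$ and $k\in\mathbb Z_L^d$, $\mathcal F_x(u)(k)=L^{-d/2}\int_{\mathbb T_L^d}u(x)e^{-2\pi i k\cdot x}dx$; in time, $\mathcal F_t(f)(\tau)=\int_{\mathbb R}e^{-2\pi i t\tau}f(t)dt$; $\mathcal F_{t,x}$ is the space-time transform. The space $h^{s,b}$ is endowed with the norm $$\|u\|_{h^{s,b}}^2=L^{-d}\sum_{k\in\mathbb Z_L^d}\int_{\mathbb R}\langle k\rangle^{2s}\langle\tau\rangle^{2b}|\mathcal F_{t,x}u(\tau,k)|^2d\tau,$$ and for $T>0$ the restriction space $h^{s,b}_T$ has norm $\|u\|_{h^{s,b}_T}=\inf\{\|f\|_{h^{s,b}}: f|_{(0,T)}=u|_{(0,T)}\}$. For $b>1/2$, $h^{s,b}_T\subset C^0([0,T],H^s(\mathbb T_L^d))$. Solutions are understood in the mild (Duhamel) sense, hence also in the sense of distributions on $(0,T_{max})$. *)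

theory Defs
  imports "HOL-Probability.Probability"
begin

text \<open>
  Space dimension \<open>d = CARD('n)\<close>. Functions on the torus of size \<open>L\<close> are
  \<open>L\<close>-periodic functions on \<open>real ^ 'n\<close>, integrated over the cube \<open>[0,L]^d\<close>.
\<close>

definition cube :: "real \<Rightarrow> (real ^ 'n) set" where
  "cube L = cbox 0 (\<chi> i. L)"

definition int_vec :: "int ^ 'n \<Rightarrow> real ^ 'n" where
  "int_vec m = (\<chi> i. of_int (m $ i))"

definition lattice :: "real \<Rightarrow> (real ^ 'n) set" where
  "lattice L = range (\<lambda>m. (1 / L) *\<^sub>R int_vec m)"

definition periodic :: "real \<Rightarrow> (real ^ 'n \<Rightarrow> complex) \<Rightarrow> bool" where
  "periodic L f \<longleftrightarrow> (\<forall>x m. f (x + L *\<^sub>R int_vec m) = f x)"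

definition jap :: "'v::real_normed_vector \<Rightarrow> real" where
  "jap x = sqrt (1 + 4 * pi\<^sup>2 * (norm x)\<^sup>2)"

definition ennsqrt :: "ennreal \<Rightarrow> ennreal" where
  "ennsqrt x = (if x = \<infinity> then \<infinity> else ennreal (sqrt (enn2real x)))"

definition fourier_x :: "real \<Rightarrow> (real ^ 'n \<Rightarrow> complex) \<Rightarrow> real ^ 'n \<Rightarrow> complex" where
  "fourier_x L f k = of_real (L powr (- real CARD('n) / 2)) *
     (LINT x:cube L|lborel. f x * cis (- 2 * pi * (k \<bullet> x)))"

text \<open>
  The Fourier transform in time on \<open>L\<^sup>2\<close>: the \<open>L\<^sup>2\<close>-limit of the transforms of the truncations
  to \<open>[-R,R]\<close>, which is almost everywhere the defining integral when \<open>f\<close> is also integrable.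
  It is determined up to null sets, and only its \<open>L\<^sup>2\<close>-class is used.
\<close>

definition fourier_t :: "(real \<Rightarrow> complex) \<Rightarrow> real \<Rightarrow> complex" where
  "fourier_t f = (SOME F. F \<in> borel_measurable borel \<and>
     ((\<lambda>R. \<integral>\<^sup>+ \<tau>. ennreal ((cmod (F \<tau> -
          (LINT t:{-R..R}|lborel. f t * cis (- 2 * pi * t * \<tau>))))\<^sup>2) \<partial>lborel) \<longlongrightarrow> 0) at_top)"

definition fourier_tx :: "real \<Rightarrow> (real \<Rightarrow> real ^ 'n \<Rightarrow> complex) \<Rightarrow> real \<Rightarrow> real ^ 'n \<Rightarrow> complex" where
  "fourier_tx L u \<tau> k = fourier_t (\<lambda>t. fourier_x L (u t) k) \<tau>"

definition torus_L2 :: "real \<Rightarrow> (real ^ 'n \<Rightarrow> complex) \<Rightarrow> bool" where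
  "torus_L2 L f \<longleftrightarrow> f \<in> borel_measurable borel \<and> periodic L f \<and>
     set_integrable lborel (cube L) (\<lambda>x. (cmod (f x))\<^sup>2)"

definition spacetime_L2 :: "real \<Rightarrow> (real \<Rightarrow> real ^ 'n \<Rightarrow> complex) \<Rightarrow> bool" where
  "spacetime_L2 L u \<longleftrightarrow> case_prod u \<in> borel_measurable (borel \<Otimes>\<^sub>M borel) \<and> (\<forall>t. periodic L (u t)) \<and>
     set_integrable (lborel \<Otimes>\<^sub>M lborel) (UNIV \<times> cube L) (\<lambda>(t, x). (cmod (u t x))\<^sup>2)"

text \<open>
  The norms below are extended-valued, membership in the space being finiteness of the norm.
  They are meant for \<open>s \<ge> 0\<close> and \<open>b \<ge> 0\<close>, where every element is a square-integrable function.
\<close>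

definition Hs_norm :: "real \<Rightarrow> real \<Rightarrow> (real ^ 'n \<Rightarrow> complex) \<Rightarrow> ennreal" where
  "Hs_norm L s f = (if torus_L2 L f
     then ennsqrt (ennreal (L powr (- real CARD('n))) *
       (\<Sum>\<^sub>\<infinity>k\<in>lattice L. ennreal (jap k powr (2 * s) * (cmod (fourier_x L f k))\<^sup>2)))
     else \<infinity>)"

definition h_norm :: "real \<Rightarrow> real \<Rightarrow> real \<Rightarrow> (real \<Rightarrow> real ^ 'n \<Rightarrow> complex) \<Rightarrow> ennreal" where
  "h_norm L s b u = (if spacetime_L2 L u
     then ennsqrt (ennreal (L powr (- real CARD('n))) *
       (\<Sum>\<^sub>\<infinity>k\<in>lattice L. \<integral>\<^sup>+ \<tau>. ennreal (jap k powr (2 * s) * jap \<tau> powr (2 * b) *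
          (cmod (fourier_tx L u \<tau> k))\<^sup>2) \<partial>lborel))
     else \<infinity>)"

definition h_norm_restr ::
  "real \<Rightarrow> real \<Rightarrow> real \<Rightarrow> real \<Rightarrow> (real \<Rightarrow> real ^ 'n \<Rightarrow> complex) \<Rightarrow> ennreal" where
  "h_norm_restr L s b T u =
     Inf {h_norm L s b f | f. AE (t, x) in lborel \<Otimes>\<^sub>M lborel. t \<in> {0<..<T} \<longrightarrow> f t x = u t x}"

definition Linf_norm :: "real \<Rightarrow> real \<Rightarrow> (real \<Rightarrow> real ^ 'n \<Rightarrow> complex) \<Rightarrow> ereal" where
  "Linf_norm L T u = esssup (restrict_space lborel {0<..<T})
     (\<lambda>t. esssup (restrict_space lborel (cube L)) (\<lambda>x. ereal (cmod (u t x))))"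

text \<open>
  \<open>propagator L t = exp(-i t \<Delta>)\<close>, the flow of \<open>i \<partial>\<^sub>t u - \<Delta> u = 0\<close>: since \<open>-\<Delta>\<close> has symbol
  \<open>4 \<pi>\<^sup>2 |k|\<^sup>2\<close>, the multiplier is \<open>exp(4 \<pi>\<^sup>2 i t |k|\<^sup>2)\<close>. It is evaluated pointwise, the
  Fourier series being absolutely convergent for data in \<open>H\<^sup>s\<close> with \<open>s > d/2\<close>.
\<close>

definition propagator ::
  "real \<Rightarrow> real \<Rightarrow> (real ^ 'n \<Rightarrow> complex) \<Rightarrow> real ^ 'n \<Rightarrow> complex" where
  "propagator L t f x = of_real (L powr (- real CARD('n) / 2)) *
     (\<Sum>\<^sub>\<infinity>k\<in>lattice L. cis (4 * pi\<^sup>2 * t * (norm k)\<^sup>2) * fourier_x L f k * cis (2 * pi * (k \<bullet> x)))"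

text \<open>
  \<open>u\<close> is a mild solution on \<open>[0,T]\<close> of \<open>i \<partial>\<^sub>t u - \<Delta> u = u\<^sup>2\<close>, \<open>u(0) = u\<^sub>0\<close>, in the restriction
  space of exponents \<open>s > d/2\<close> and \<open>b > 1/2\<close>. The elements of that space are identified with their
  representatives in \<open>C([0,T], H\<^sup>s)\<close>. Values of \<open>u\<close> at times outside \<open>[0,T]\<close> are irrelevant.
\<close>

definition mild_solution ::
  "real \<Rightarrow> real \<Rightarrow> real \<Rightarrow> real \<Rightarrow> (real ^ 'n \<Rightarrow> complex) \<Rightarrow> (real \<Rightarrow> real ^ 'n \<Rightarrow> complex) \<Rightarrow> bool" where
  "mild_solution L s b T u0 u \<longleftrightarrow>
     h_norm_restr L s b T u < \<infinity> \<and>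
     (\<forall>t\<in>{0..T}. Hs_norm L s (u t) < \<infinity>) \<and>
     (\<forall>t\<in>{0..T}. ((\<lambda>t'. Hs_norm L s (\<lambda>x. u t' x - u t x)) \<longlongrightarrow> 0) (at t within {0..T})) \<and>
     (\<forall>x. u 0 x = u0 x) \<and>
     (\<forall>t\<in>{0..T}. \<forall>x. u t x = propagator L t u0 x -
        \<i> * (LINT t':{0..t}|lborel. propagator L (t - t') (\<lambda>y. (u t' y)\<^sup>2) x))"

primrec iter_partial :: "'n list \<Rightarrow> (real ^ 'n \<Rightarrow> real) \<Rightarrow> real ^ 'n \<Rightarrow> real" where
  "iter_partial [] f = f"
| "iter_partial (i # is) f = (\<lambda>x. frechet_derivative (iter_partial is f) (at x) (axis i 1))"

definition schwartz :: "(real ^ 'n \<Rightarrow> real) \<Rightarrow> bool" where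
  "schwartz f \<longleftrightarrow>
     (\<forall>is x. iter_partial is f differentiable (at x)) \<and>
     (\<forall>is (N::nat). \<exists>B. \<forall>x. (1 + norm x) ^ N * \<bar>iter_partial is f x\<bar> \<le> B)"

definition complex_gaussian :: "'w measure \<Rightarrow> ('w \<Rightarrow> complex) \<Rightarrow> bool" where
  "complex_gaussian M g \<longleftrightarrow> (\<exists>\<eta>1 \<eta>2.
     distributed M lborel \<eta>1 std_normal_density \<and>
     distributed M lborel \<eta>2 std_normal_density \<and>
     prob_space.indep_var M borel \<eta>1 borel \<eta>2 \<and>
     (\<forall>\<omega>\<in>space M. g \<omega> = (of_real (\<eta>1 \<omega>) + \<i> * of_real (\<eta>2 \<omega>)) / of_real (sqrt 2)))"

definition iid_complex_gaussians :: "'w measure \<Rightarrow> ('k \<Rightarrow> 'w \<Rightarrow> complex) \<Rightarrow> bool" where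
  "iid_complex_gaussians M g \<longleftrightarrow>
     (\<forall>k. complex_gaussian M (g k)) \<and> prob_space.indep_vars M (\<lambda>_. borel) g UNIV"

text \<open>
  \<open>G\<close> is one realization of the Gaussian family. The sum is almost surely absolutely convergent;
  it takes the default value \<open>0\<close> on the exceptional null event.
\<close>

definition initial_datum ::
  "real \<Rightarrow> real \<Rightarrow> (real ^ 'n \<Rightarrow> real) \<Rightarrow> (int ^ 'n \<Rightarrow> complex) \<Rightarrow> real ^ 'n \<Rightarrow> complex" where
  "initial_datum L \<alpha> n_in G x = of_real (\<alpha> / L powr (real CARD('n) / 2)) *
     (\<Sum>\<^sub>\<infinity>k\<in>UNIV. of_real (sqrt (n_in ((1 / L) *\<^sub>R int_vec k))) * G k *
        cis (2 * pi * (((1 / L) *\<^sub>R int_vec k) \<bullet> x)))"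

end

theory Submission
  imports Defs "HOL-Combinatorics.Multiset_Permutations" "HOL-Real_Asymp.Real_Asymp"
begin

text \<open>
  Write \<open>u(t,x) = \<Sum>\<^sub>m a\<^sub>m(t) e\<^sup>2\<^sup>\<pi>\<^sup>i\<^sup>m\<^sup>x\<^sup>/\<^sup>L\<close>. The Picard iterates of the low-frequency part (\<open>|m\<^sub>i| \<le> L\<^sup>2\<close>) of the datum are sums over
  binary trees, and the iterate of order \<open>a\<close> is a homogeneous polynomial of degree \<open>a + 1\<close> in the Gaussians whose
  coefficients have square sum at most of order \<open>(\<alpha> (\<alpha> T)\<^sup>a)\<^sup>2 = (\<alpha> L\<^sup>-\<^sup>\<delta>\<^sup>a)\<^sup>2\<close>; no dispersive effect is needed. Since
  the monomials in the Gaussians are orthogonal, high moments of such a polynomial are controlled, and on a finite net of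
  polynomial size in space-time all iterates of order \<open>a \<le> N\<close> are pointwise at most \<open>\<alpha> L\<^sup>3\<^sup>\<theta>\<^sup>/\<^sup>4\<^sup>-\<^sup>a\<^sup>\<delta>\<^sup>/\<^sup>2\<close> outside an event of
  probability \<open>exp(- L\<^sup>\<theta>)\<close>. For \<open>N\<close> large the truncated expansion solves the equation up to an error beating any
  power of \<open>L\<close>, and multiplication by the truncated expansion is bounded by its sup norm without
  loss, so a contraction argument yields a solution close to it up to time \<open>T\<close>.
\<close>

section \<open>Absolutely convergent Fourier series\<close>

text \<open>The nonlinearity contains no complex conjugate, so a Picard term involves products of
  the \<open>g k\<close> and never of their conjugates. Two Gaussian monomials are then correlated
  only if they agree as multisets, no pairing occurs inside a tree, and counting permutations takes
  the place of renormalization and hypercontractivity. The obstacle is deterministic: a contraction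
  in a Sobolev space uses the algebra property, which costs about \<open>L ^ (2 * d)\<close> with
  \<open>d = CARD('n)\<close>, while the time span leaves only the gain
  \<open>L powr (- \<delta>)\<close>. Hence the derivative weights are scaled to the highest
  frequency of the truncated expansion, where they are at most \<open>1\<close>, and the lossy bound
  is applied to the remainder alone. Taking \<open>N * \<delta> \<ge> 4 * (d + 1)\<close> makes this
  remainder smaller than the loss. Uniqueness is claimed among all mild solutions, of which only
  summable coefficients are known; it rests on the fact that a function on the torus is determined
  by its Fourier coefficients, derived from Stone-Weierstrass.\<close>

abbreviation l1 :: "('a \<Rightarrow> 'b::real_normed_vector) \<Rightarrow> bool" where
  "l1 a \<equiv> (\<lambda>m. norm (a m)) summable_on UNIV"

text \<open>A product weight instead of a power of a norm: sums over the lattice factor into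
  one-dimensional sums, and \<open>hw\<close> itself is square summable in every dimension. Decay is
  measured in powers of \<open>hw\<close> throughout.\<close>

definition hw :: "int ^ 'n \<Rightarrow> real" where
  "hw m = (\<Prod>i\<in>UNIV. inverse (1 + \<bar>real_of_int (m $ i)\<bar>))"

lemma hw_pos: "0 < hw m"
  unfolding hw_def by (intro prod_pos) auto

lemma hw_le_1: "hw m \<le> 1"
  unfolding hw_def by (intro prod_le_1) (auto simp: field_simps)

text \<open>Peetre-type inequality, coordinate by coordinate; it lets powers of \<open>hw\<close>
  survive convolution in \<open>conv_decay\<close>.\<close>

lemma hw_mult_le: "hw l * hw (m - l) \<le> hw (m :: int ^ 'n)"
proof -
  have "hw l * hw (m - l) = (\<Prod>i\<in>UNIV. inverse ((1 + \<bar>real_of_int (l $ i)\<bar>) * (1 + \<bar>real_of_int ((m - l) $ i)\<bar>)))"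
    unfolding hw_def by (simp add: prod.distrib[symmetric] mult.commute)
  also have "\<dots> \<le> hw m"
    unfolding hw_def
  proof (intro prod_mono conjI)
    fix i :: 'n
    have "1 + \<bar>real_of_int (m $ i)\<bar> \<le> 1 + (\<bar>real_of_int (l $ i)\<bar> + \<bar>real_of_int ((m - l) $ i)\<bar>)"
      by (simp add: abs_triangle_ineq)
    also have "\<dots> \<le> (1 + \<bar>real_of_int (l $ i)\<bar>) * (1 + \<bar>real_of_int ((m - l) $ i)\<bar>)"
      by (simp add: algebra_simps)
    finally show "inverse ((1 + \<bar>real_of_int (l $ i)\<bar>) * (1 + \<bar>real_of_int ((m - l) $ i)\<bar>))
        \<le> inverse (1 + \<bar>real_of_int (m $ i)\<bar>)"
      by (intro le_imp_inverse_le) auto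
  qed auto
  finally show ?thesis .
qed

lemma norm_int_vec_le_hw: "1 + norm (int_vec m) \<le> 1 / hw m"
proof -
  have "1 + (\<Sum>i\<in>A. \<bar>real_of_int (m $ i)\<bar>) \<le> (\<Prod>i\<in>A. 1 + \<bar>real_of_int (m $ i)\<bar>)" if "finite A" for A
    using that
  proof (induction A rule: finite_induct)
    case (insert i A)
    have "1 + (\<Sum>j\<in>insert i A. \<bar>real_of_int (m $ j)\<bar>)
        \<le> (1 + \<bar>real_of_int (m $ i)\<bar>) * (1 + (\<Sum>j\<in>A. \<bar>real_of_int (m $ j)\<bar>))"
      using insert by (simp add: algebra_simps sum_nonneg)
    also have "\<dots> \<le> (1 + \<bar>real_of_int (m $ i)\<bar>) * (\<Prod>j\<in>A. 1 + \<bar>real_of_int (m $ j)\<bar>)"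
      using insert by (intro mult_left_mono) auto
    finally show ?case using insert by simp
  qed simp
  from this[of UNIV] have "1 + (\<Sum>i\<in>UNIV. \<bar>real_of_int (m $ i)\<bar>) \<le> 1 / hw m"
    by (simp add: hw_def prod_inversef[symmetric] o_def divide_inverse)
  moreover have "norm (int_vec m) \<le> (\<Sum>i\<in>UNIV. \<bar>real_of_int (m $ i)\<bar>)"
    using norm_le_l1_cart[of "int_vec m"] by (simp add: int_vec_def)
  ultimately show ?thesis by simp
qed

text \<open>A finite set of integer vectors lies in a product of finite sets of integers, over which
  the sum of products factors. With \<open>S = 3\<close> this gives the square sum of
  \<open>hw\<close>, with \<open>S = 3 * L\<close> a Riemann sum for the spectrum.\<close>

lemma sum_prod_coords_le:
  fixes f :: "int \<Rightarrow> real"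
  assumes nn: "\<And>n. f n \<ge> 0" and bd: "\<And>A. finite A \<Longrightarrow> sum f A \<le> S" and F: "finite (F :: (int ^ 'n) set)"
  shows "(\<Sum>m\<in>F. \<Prod>i\<in>UNIV. f (m $ i)) \<le> S ^ CARD('n)"
proof -
  define A where "A = (\<Union>m\<in>F. range (\<lambda>i::'n. m $ i))"
  have fA: "finite A" using F by (auto simp: A_def)
  have "(\<Sum>m\<in>F. \<Prod>i\<in>UNIV. f (m $ i)) = (\<Sum>g\<in>(\<lambda>m. vec_nth m) ` F. \<Prod>i\<in>UNIV. f (g i))"
    by (subst sum.reindex) (auto simp: inj_on_def vec_nth_inject)
  also have "\<dots> \<le> (\<Sum>g\<in>PiE (UNIV::'n set) (\<lambda>_. A). \<Prod>i\<in>UNIV. f (g i))"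
  proof (rule sum_mono2)
    show "finite (PiE (UNIV::'n set) (\<lambda>_. A))" by (intro finite_PiE fA) auto
  qed (auto simp: A_def intro!: prod_nonneg nn)
  also have "\<dots> = (\<Prod>i\<in>(UNIV::'n set). \<Sum>j\<in>A. f j)"
    by (subst prod_sum_PiE) (auto simp: fA)
  also have "\<dots> \<le> (\<Prod>i\<in>(UNIV::'n set). S)"
    by (intro prod_mono) (auto simp: sum_nonneg nn bd fA)
  finally show ?thesis by simp
qed

lemma int_sum_inverse_square_le:
  assumes "finite A" and L: "L \<ge> (1::real)"
  shows "(\<Sum>n\<in>A. (inverse (1 + \<bar>real_of_int n\<bar> / L))\<^sup>2) \<le> 3 * L"
proof -
  define f where "f n = (inverse (1 + real n / L))\<^sup>2" for n :: nat
  \<comment> \<open>Telescoping comparison: \<open>1 / (x + 1/L)^2\<close> is at most the product of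
    the reciprocals of \<open>x\<close> and \<open>x + 1/L\<close>, which is \<open>L\<close> times
    their difference.\<close>
  have pos: "(\<Sum>n\<in>{1..N}. f n) \<le> L - L * inverse (1 + real N / L)" for N
  proof (induction N)
    case (Suc N)
    define x where "x = 1 + real N / L"
    have x: "x \<ge> 1" and y: "1 + real (Suc N) / L = x + 1 / L" using L by (auto simp: x_def field_simps)
    have "f (Suc N) \<le> inverse (x + 1/L) * inverse x"
      unfolding f_def y power2_eq_square using x L by (intro mult_left_mono le_imp_inverse_le) auto
    also have "\<dots> = L * inverse x - L * inverse (x + 1 / L)"
    proof -
      have "inverse x - inverse (x + 1 / L) = (1/L) * (inverse (x + 1/L) * inverse x)"
        using x L add_pos_pos[of x "1/L"] by (subst division_ring_inverse_diff) auto
      then have "L * (inverse x - inverse (x + 1 / L)) = inverse (x + 1/L) * inverse x" using L by simp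
      then show ?thesis by (simp only: right_diff_distrib)
    qed
    finally show ?case using Suc by (simp add: y x_def[symmetric] del: of_nat_Suc)
  qed simp
  obtain N where N: "A \<subseteq> {-int N..int N}"
  proof
    show "A \<subseteq> {- int (Max ((\<lambda>n. nat \<bar>n\<bar>) ` A)) .. int (Max ((\<lambda>n. nat \<bar>n\<bar>) ` A))}"
    proof
      fix n assume "n \<in> A"
      then have "nat \<bar>n\<bar> \<le> Max ((\<lambda>n. nat \<bar>n\<bar>) ` A)" using assms by (intro Max_ge) auto
      then show "n \<in> {- int (Max ((\<lambda>n. nat \<bar>n\<bar>) ` A)) .. int (Max ((\<lambda>n. nat \<bar>n\<bar>) ` A))}" by auto
    qed
  qed
  have split: "{-int N..int N} = (\<lambda>n. - int n) ` {1..N} \<union> ({0} \<union> int ` {1..N})"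
  proof (intro equalityI subsetI)
    fix n assume n: "n \<in> {-int N..int N}"
    consider "n < 0" | "n = 0" | "n > 0" by linarith
    then show "n \<in> (\<lambda>n. - int n) ` {1..N} \<union> ({0} \<union> int ` {1..N})"
    proof cases
      case 1 then have "n = - int (nat (-n))" "nat (-n) \<in> {1..N}" using n by auto
      then show ?thesis by blast
    next
      case 3 then have "n = int (nat n)" "nat n \<in> {1..N}" using n by auto
      then show ?thesis by blast
    qed auto
  qed auto
  have "(\<Sum>n\<in>A. (inverse (1 + \<bar>real_of_int n\<bar> / L))\<^sup>2) \<le> (\<Sum>n\<in>{-int N..int N}. (inverse (1 + \<bar>real_of_int n\<bar> / L))\<^sup>2)"
    using N by (intro sum_mono2) auto
  also have "\<dots> \<le> (\<Sum>n\<in>{1..N}. f n) + (1 + (\<Sum>n\<in>{1..N}. f n))"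
    unfolding split
    by (subst sum.union_disjoint, force, force, force, subst sum.union_disjoint, force, force, force)
       (auto simp: sum.reindex inj_on_def f_def)
  also have "\<dots> \<le> 3 * L"
  proof -
    have "L * inverse (1 + real N / L) \<ge> 0" using L by simp
    then show ?thesis using pos[of N] L by linarith
  qed
  finally show ?thesis .
qed

lemma hw_square_sum_le: "finite F \<Longrightarrow> (\<Sum>m\<in>F. (hw m)\<^sup>2) \<le> 3 ^ CARD('n)" for F :: "(int ^ 'n) set"
  using sum_prod_coords_le[of "\<lambda>n. (inverse (1 + \<bar>real_of_int n\<bar>))\<^sup>2" 3 F]
    int_sum_inverse_square_le[of _ 1]
  by (simp add: hw_def prod_power_distrib)

lemma hw_square_summable: "(\<lambda>m. (hw m)\<^sup>2) summable_on (UNIV :: (int ^ 'n) set)"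
  by (rule nonneg_bounded_partial_sums_imp_summable_on[where C = "3 ^ CARD('n)"])
     (auto intro!: eventually_finite_subsets_at_top_weakI hw_square_sum_le)

lemma hw_power_summable: "j \<ge> 2 \<Longrightarrow> (\<lambda>m. hw m ^ j) summable_on (UNIV :: (int ^ 'n) set)"
  by (rule summable_on_comparison_test[OF hw_square_summable])
     (auto intro!: power_decreasing hw_le_1 simp: less_imp_le[OF hw_pos])

lemma hw_summable_bound:
  fixes a :: "int ^ 'n \<Rightarrow> 'b::banach"
  assumes "\<And>m. norm (a m) \<le> C * hw m ^ j" "j \<ge> 2"
  shows "l1 a"
proof (rule Infinite_Sum.abs_summable_on_comparison_test'[where g = "\<lambda>m. C * hw m ^ j"])
  show "(\<lambda>m. C * hw m ^ j) summable_on UNIV"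
    by (intro summable_on_cmult_right hw_power_summable assms)
qed (use assms in auto)

section \<open>Characters of the unit torus and trigonometric series\<close>

definition ch :: "int ^ 'n \<Rightarrow> real ^ 'n \<Rightarrow> complex" where
  "ch m x = cis (2 * pi * (int_vec m \<bullet> x))"

lemma int_vec_simps [simp]: "int_vec 0 = 0" "int_vec (l + m) = int_vec l + int_vec m"
  "int_vec (l - m) = int_vec l - int_vec m" "int_vec (- m) = - int_vec m"
  by (auto simp: int_vec_def vec_eq_iff)

lemma int_vec_nth [simp]: "int_vec m $ i = of_int (m $ i)"
  by (simp add: int_vec_def)

lemma inj_int_vec: "inj int_vec"
  by (auto simp: inj_on_def int_vec_def vec_eq_iff)

lemma norm_ch [simp]: "cmod (ch m x) = 1" by (simp add: ch_def)
lemma ch_0 [simp]: "ch 0 x = 1" "ch m 0 = 1" by (auto simp: ch_def)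
lemma ch_add: "ch (l + m) x = ch l x * ch m x" by (simp add: ch_def cis_mult algebra_simps)
lemma ch_minus: "ch (- m) x = cnj (ch m x)" by (simp add: ch_def cis_cnj)
lemma ch_diff: "ch (l - m) x = ch l x * cnj (ch m x)"
  using ch_add[of l "-m" x] by (simp add: ch_minus)
lemma ch_period: "ch m (x + int_vec k) = ch m x"
proof -
  have "int_vec m \<bullet> int_vec k = of_int (\<Sum>i\<in>UNIV. m $ i * k $ i)"
    by (simp add: inner_vec_def)
  then have "cis (2 * pi * (int_vec m \<bullet> int_vec k)) = 1"
    by (metis cis_multiple_2pi Ints_of_int mult.assoc mult.commute)
  then show ?thesis by (simp add: ch_def inner_add_right distrib_left cis_mult[symmetric])
qed
lemma continuous_on_ch [continuous_intros]:
  "continuous_on A f \<Longrightarrow> continuous_on A (\<lambda>x. ch m (f x))"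
  unfolding ch_def cis_conv_exp by (intro continuous_intros)

definition trig :: "(int ^ 'n \<Rightarrow> complex) \<Rightarrow> real ^ 'n \<Rightarrow> complex" where
  "trig a x = (\<Sum>\<^sub>\<infinity>m. a m * ch m x)"

lemma trig_abs_summable: "l1 a \<Longrightarrow> l1 (\<lambda>m. a m * ch m x)"
  by (simp add: norm_mult)

lemma trig_summable: "l1 a \<Longrightarrow> (\<lambda>m. a m * ch m x) summable_on UNIV"
  by (rule Infinite_Sum.abs_summable_summable) (rule trig_abs_summable)

lemma norm_trig_le: "l1 a \<Longrightarrow> cmod (trig a x) \<le> (\<Sum>\<^sub>\<infinity>m. cmod (a m))"
  unfolding trig_def using norm_infsum_bound[OF trig_abs_summable[of a x]] by (simp add: norm_mult)

lemma trig_period: "trig a (x + int_vec k) = trig a x"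
  by (simp add: trig_def ch_period)

lemma trig_uniform_limit:
  assumes "l1 a"
  shows "uniform_limit A (\<lambda>F x. \<Sum>m\<in>F. a m * ch m x) (trig a) (finite_subsets_at_top UNIV)"
  unfolding trig_def
  by (rule Weierstrass_m_test_general[OF _ assms]) (simp add: norm_mult)

lemma continuous_on_trig:
  assumes "l1 a"
  shows "continuous_on A (trig a)"
  by (rule uniform_limit_theorem[OF _ trig_uniform_limit[OF assms]])
     (auto intro!: always_eventually continuous_intros)

lemma trig_add: "l1 a \<Longrightarrow> l1 b \<Longrightarrow> trig (\<lambda>m. a m + b m) x = trig a x + trig b x"
  unfolding trig_def by (simp add: distrib_right infsum_add trig_summable)

lemma trig_cmult: "trig (\<lambda>m. c * a m) x = c * trig a x"
  unfolding trig_def by (simp add: mult.assoc infsum_cmult_right')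

lemma trig_diff: "l1 a \<Longrightarrow> l1 b \<Longrightarrow> trig (\<lambda>m. a m - b m) x = trig a x - trig b x"
  using trig_add[of a "\<lambda>m. -1 * b m" x] trig_cmult[of "-1" b x] by simp

lemma integral_cis_interval:
  assumes "L > 0"
  shows "(LINT t:{0..L}|lborel. cis (2 * pi * real_of_int n * t / L)) = (if n = 0 then of_real L else 0)"
    "set_integrable lborel {0..L} (\<lambda>t. cis (2 * pi * real_of_int n * t / L))"
proof -
  show int: "set_integrable lborel {0..L} (\<lambda>t. cis (2 * pi * real_of_int n * t / L))"
    by (intro borel_integrable_atLeastAtMost') (use assms in \<open>auto simp: cis_conv_exp intro!: continuous_intros\<close>)
  show "(LINT t:{0..L}|lborel. cis (2 * pi * real_of_int n * t / L)) = (if n = 0 then of_real L else 0)"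
  proof (cases "n = 0")
    case True
    have "(LINT t:{0..L}|lborel. (1::complex)) = of_real L"
      by (subst set_integral_const) (use assms in \<open>auto simp: scaleR_conv_of_real\<close>)
    with True show ?thesis by simp
  next
    case False
    define c where "c = \<i> * of_real (2 * pi * real_of_int n / L)"
    have c0: "c \<noteq> 0" using False assms by (auto simp: c_def)
    have eq: "cis (2 * pi * real_of_int n * t / L) = exp (c * of_real t)" for t
      by (simp add: cis_conv_exp c_def mult_ac)
    have "((\<lambda>t. exp (c * of_real t)) has_integral (exp (c * of_real L) / c - exp (c * of_real 0) / c)) {0..L}"
    proof (rule fundamental_theorem_of_calculus)
      fix t assume "t \<in> {0..L}"
      have "((\<lambda>z. exp (c * z) / c) has_field_derivative exp (c * of_real t)) (at (of_real t))"
        using c0 by (auto intro!: derivative_eq_intros)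
      then show "((\<lambda>t. exp (c * of_real t) / c) has_vector_derivative exp (c * of_real t)) (at t within {0..L})"
        by (rule has_vector_derivative_real_field)
    qed (use assms in auto)
    moreover have "exp (c * of_real L) = 1"
    proof -
      have "exp (c * of_real L) = cis (2 * pi * real_of_int n)"
        using assms by (simp add: c_def cis_conv_exp)
      then show ?thesis by (simp add: cis_multiple_2pi)
    qed
    ultimately have "((\<lambda>t. exp (c * of_real t)) has_integral 0) {0..L}" by simp
    then have "integral {0..L} (\<lambda>t. exp (c * of_real t)) = 0" by (rule integral_unique)
    then show ?thesis using False set_borel_integral_eq_integral(2)[OF int] by (simp add: eq)
  qed
qed

lemma cube_eq: "cube L = {x :: real ^ 'n. \<forall>i. 0 \<le> x $ i \<and> x $ i \<le> L}"
  by (auto simp: cube_def cbox_def Basis_vec_def inner_axis)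

text \<open>Lebesgue measure is the product measure over the vectors of \<open>Basis\<close>, so the
  integral splits into those of \<open>integral_cis_interval\<close>.\<close>

lemma orthogonality:
  fixes m :: "int ^ 'n"
  assumes L: "L > 0"
  shows "(LINT x:cube L|lborel. ch m ((1 / L) *\<^sub>R x)) = (if m = 0 then of_real (L ^ CARD('n)) else 0)"
proof -
  \<comment> \<open>The product is indexed by basis vectors and not by coordinates; the sum over
    \<open>i\<close> in the exponent selects the \<open>m $ i\<close> with
    \<open>b = axis i 1\<close>.\<close>
  let ?f = "\<lambda>(b::real^'n) t. indicator {0..L} t *\<^sub>R cis (2 * pi * real_of_int (\<Sum>i\<in>UNIV. if b = axis i 1 then m $ i else 0) * t / L)"
  have ip: "int_vec m \<bullet> x = (\<Sum>i\<in>UNIV. real_of_int (m $ i) * x $ i)" for x :: "real^'n"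
    by (simp add: inner_vec_def)
  have sel: "(\<Sum>j\<in>UNIV. if axis i 1 = (axis j 1 :: real^'n) then m $ j else 0) = m $ i" for i
    by (simp add: axis_eq_axis if_distrib cong: if_cong)
  have BI: "(Basis :: (real^'n) set) = (\<lambda>i. axis i 1) ` UNIV" by (auto simp: Basis_vec_def)
  have inj: "inj_on (\<lambda>i. axis i 1 :: real^'n) UNIV" by (auto simp: inj_on_def axis_eq_axis)
  have fac: "indicator (cube L) (\<Sum>b\<in>Basis. f b *\<^sub>R b) *\<^sub>R ch m ((1 / L) *\<^sub>R (\<Sum>b\<in>Basis. f b *\<^sub>R b)) = (\<Prod>b\<in>Basis. ?f b (f b))"
    for f :: "real^'n \<Rightarrow> real"
  proof -
    define x where "x = (\<Sum>b\<in>Basis. f b *\<^sub>R b)"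
    have xi: "x $ i = f (axis i 1)" for i
    proof -
      have "x \<bullet> axis i 1 = f (axis i 1)" unfolding x_def
        by (subst inner_sum_left) (simp add: inner_Basis BI sum.reindex[OF inj] axis_eq_axis inner_axis_axis if_distrib cong: if_cong)
      then show ?thesis by (simp add: inner_axis)
    qed
    have "(\<Prod>b\<in>Basis. ?f b (f b)) = (\<Prod>i\<in>UNIV. indicator {0..L} (x $ i) *\<^sub>R cis (2 * pi * real_of_int (m $ i) * x $ i / L))"
      unfolding BI by (subst prod.reindex[OF inj]) (simp add: sel xi del: of_int_sum)
    also have "\<dots> = (\<Prod>i\<in>UNIV. indicator {0..L} (x $ i)) *\<^sub>R (\<Prod>i\<in>UNIV. cis (2 * pi * real_of_int (m $ i) * x $ i / L))"
      by (simp add: scaleR_conv_of_real prod.distrib)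
    also have "(\<Prod>i\<in>UNIV. indicator {0..L} (x $ i)) = (indicator (cube L) x :: real)"
      by (auto simp: cube_eq indicator_def prod_zero_iff)
    also have "(\<Prod>i\<in>UNIV. cis (2 * pi * real_of_int (m $ i) * x $ i / L)) = ch m ((1 / L) *\<^sub>R x)"
    proof -
      have "(\<Prod>i\<in>UNIV. cis (2 * pi * real_of_int (m $ i) * x $ i / L)) = cis (\<Sum>i\<in>UNIV. 2 * pi * real_of_int (m $ i) * x $ i / L)"
        by (induction rule: infinite_finite_induct) (auto simp: cis_mult)
      also have "(\<Sum>i\<in>UNIV. 2 * pi * real_of_int (m $ i) * x $ i / L) = 2 * pi * (int_vec m \<bullet> ((1 / L) *\<^sub>R x))"
        by (simp add: ip sum_distrib_left sum_divide_distrib mult_ac)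
      finally show ?thesis by (simp add: ch_def)
    qed
    finally show ?thesis by (simp add: x_def)
  qed
  interpret product_sigma_finite "\<lambda>_::real^'n. lborel :: real measure" ..
  have int: "integrable lborel (?f b)" for b
    using integral_cis_interval(2)[OF L] by (simp add: set_integrable_def del: of_int_sum)
  have val: "(\<integral>t. ?f b t \<partial>lborel) = (if (\<Sum>i\<in>UNIV. if b = axis i 1 then m $ i else 0) = 0 then of_real L else 0)" for b
    using integral_cis_interval(1)[OF L] by (simp add: set_lebesgue_integral_def del: of_int_sum)
  have meas: "(\<lambda>x::real^'n. indicator (cube L) x *\<^sub>R ch m ((1 / L) *\<^sub>R x)) \<in> borel_measurable borel"
    by (intro borel_measurable_scaleR borel_measurable_indicator borel_measurable_continuous_onI continuous_intros)
       (simp add: cube_def)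
  have "(LINT x:cube L|lborel. ch m ((1 / L) *\<^sub>R x)) = (\<integral>f. (\<Prod>b\<in>Basis. ?f b (f b)) \<partial>(\<Pi>\<^sub>M b\<in>(Basis :: (real^'n) set). lborel))"
    unfolding set_lebesgue_integral_def
    by (subst lborel_eq, subst integral_distr) (use meas in \<open>auto simp: fac\<close>)
  also have "\<dots> = (\<Prod>b\<in>(Basis :: (real^'n) set). \<integral>t. ?f b t \<partial>lborel)"
    by (rule product_integral_prod) (simp, rule int)
  also have "\<dots> = (\<Prod>i\<in>(UNIV::'n set). if m $ i = 0 then of_real L else 0)"
    unfolding val BI by (subst prod.reindex[OF inj]) (simp add: sel)
  also have "\<dots> = (if m = 0 then of_real (L ^ CARD('n)) else 0)"
  proof (cases "m = 0")
    case False
    then obtain i where "m $ i \<noteq> 0" by (auto simp: vec_eq_iff)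
    then show ?thesis using False by auto
  qed simp
  finally show ?thesis .
qed

lemma measure_cube: "L \<ge> 0 \<Longrightarrow> measure lborel (cube L :: (real ^ 'n) set) = L ^ CARD('n)"
proof -
  assume L: "L \<ge> 0"
  have inj: "inj_on (\<lambda>i. axis i 1 :: real^'n) UNIV" by (auto simp: inj_on_def axis_eq_axis)
  have "\<forall>b\<in>Basis. (0::real^'n) \<bullet> b \<le> (\<chi> i. L) \<bullet> b" using L by (auto simp: Basis_vec_def inner_axis)
  then have "measure lborel (cube L :: (real ^ 'n) set) = (\<Prod>b\<in>Basis. ((\<chi> i. L) - 0 :: real^'n) \<bullet> b)"
    unfolding cube_def by (subst content_cbox) auto
  also have "\<dots> = (\<Prod>b\<in>(\<lambda>i. axis i 1 :: real^'n) ` UNIV. ((\<chi> i. L) :: real^'n) \<bullet> b)"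
    by (intro prod.cong) (auto simp: Basis_vec_def)
  also have "\<dots> = L ^ CARD('n)" by (subst prod.reindex[OF inj]) (simp add: inner_axis)
  finally show ?thesis .
qed

lemma cube_sets [measurable]: "cube L \<in> sets borel" "cube L \<in> sets lborel" "emeasure lborel (cube L) < \<infinity>"
  "emeasure lborel (cube L) \<noteq> \<infinity>"
  unfolding cube_def by (auto simp: emeasure_lborel_cbox_eq)

section \<open>Convolution of square-summable sequences\<close>

lemma has_sum_sum':
  fixes f :: "'a \<Rightarrow> 'b \<Rightarrow> 'c::{topological_comm_monoid_add}"
  assumes "\<And>i. i \<in> I \<Longrightarrow> (f i has_sum S i) A"
  shows "((\<lambda>x. \<Sum>i\<in>I. f i x) has_sum (\<Sum>i\<in>I. S i)) A"
  using assms by (induction I rule: infinite_finite_induct) (auto intro!: has_sum_add)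

text \<open>Bounds over all finite subsets instead of statements on infinite sums: they include
  summability, are stable under pointwise limits, and reduce the estimates to finite sums.\<close>

definition l1b :: "('i \<Rightarrow> complex) \<Rightarrow> real \<Rightarrow> bool" where
  "l1b w B \<longleftrightarrow> (\<forall>F. finite F \<longrightarrow> (\<Sum>m\<in>F. cmod (w m)) \<le> B)"

definition l2b :: "('i \<Rightarrow> complex) \<Rightarrow> real \<Rightarrow> bool" where
  "l2b w B \<longleftrightarrow> (\<forall>F. finite F \<longrightarrow> L2_set (\<lambda>m. cmod (w m)) F \<le> B)"

lemma l2bD: "l2b w B \<Longrightarrow> finite F \<Longrightarrow> L2_set (\<lambda>m. cmod (w m)) F \<le> B"
  by (auto simp: l2b_def)

lemma l2b_nonneg: "l2b w B \<Longrightarrow> B \<ge> 0"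
  using l2bD[of w B "{}"] by simp

lemma l2b_mono: "l2b w B \<Longrightarrow> B \<le> B' \<Longrightarrow> l2b w B'"
  by (force simp: l2b_def)

lemma l2b_point: "l2b w B \<Longrightarrow> cmod (w m) \<le> B"
  using l2bD[of w B "{m}"] by (simp add: L2_set_def)

lemma l2b_le: "l2b w B \<Longrightarrow> (\<And>m. cmod (v m) \<le> cmod (w m)) \<Longrightarrow> l2b v B"
  unfolding l2b_def by (intro allI impI, rule order_trans[OF L2_set_mono[where g = "\<lambda>m. cmod (w m)"]]) auto

lemma l2b_add:
  assumes "l2b v A" "l2b w B" shows "l2b (\<lambda>m. v m + w m) (A + B)"
  unfolding l2b_def
proof (intro allI impI)
  fix F :: "'a set" assume F: "finite F"
  have "L2_set (\<lambda>m. cmod (v m + w m)) F \<le> L2_set (\<lambda>m. cmod (v m) + cmod (w m)) F"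
    by (intro L2_set_mono norm_triangle_ineq) auto
  also have "\<dots> \<le> L2_set (\<lambda>m. cmod (v m)) F + L2_set (\<lambda>m. cmod (w m)) F"
    by (rule L2_set_triangle_ineq)
  also have "\<dots> \<le> A + B" using l2bD[OF assms(1) F] l2bD[OF assms(2) F] by simp
  finally show "L2_set (\<lambda>m. cmod (v m + w m)) F \<le> A + B" .
qed

lemma l2b_cmult:
  assumes "l2b w B" "cmod c \<le> C" shows "l2b (\<lambda>m. c * w m) (C * B)"
  unfolding l2b_def
proof (intro allI impI)
  fix F :: "'a set" assume F: "finite F"
  have "L2_set (\<lambda>m. cmod (c * w m)) F = cmod c * L2_set (\<lambda>m. cmod (w m)) F"
    by (simp add: norm_mult L2_set_right_distrib)
  also have "\<dots> \<le> C * B"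
    using l2bD[OF assms(1) F] assms(2) order_trans[OF norm_ge_zero assms(2)] by (intro mult_mono) auto
  finally show "L2_set (\<lambda>m. cmod (c * w m)) F \<le> C * B" .
qed

lemma l2b_sum:
  "(\<And>l. l \<in> G \<Longrightarrow> l2b (f l) (B l)) \<Longrightarrow> l2b (\<lambda>m. \<Sum>l\<in>G. f l m) (\<Sum>l\<in>G. B l)"
proof (induction G rule: infinite_finite_induct)
  case (insert x F) then show ?case by (simp add: l2b_add)
qed (auto simp: l2b_def L2_set_def)

text \<open>Lower semicontinuity of the norm under coordinatewise convergence, as in Fatou's
  lemma.\<close>

lemma l2b_limit:
  assumes lim: "\<And>m. ((\<lambda>k. f k m) \<longlongrightarrow> w m) F" and ev: "eventually (\<lambda>k. l2b (f k) B) F" and F: "F \<noteq> bot"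
  shows "l2b w B"
  unfolding l2b_def
proof (intro allI impI)
  fix G :: "'a set" assume G: "finite G"
  have "((\<lambda>k. L2_set (\<lambda>m. cmod (f k m)) G) \<longlongrightarrow> L2_set (\<lambda>m. cmod (w m)) G) F"
    unfolding L2_set_def by (intro tendsto_intros lim)
  moreover have "eventually (\<lambda>k. L2_set (\<lambda>m. cmod (f k m)) G \<le> B) F"
    using ev by eventually_elim (use G in \<open>auto simp: l2b_def\<close>)
  ultimately show "L2_set (\<lambda>m. cmod (w m)) G \<le> B"
    using F tendsto_upperbound by blast
qed

lemma l2b_reindex: "l2b w B \<Longrightarrow> inj h \<Longrightarrow> l2b (\<lambda>m. w (h m)) B"
  unfolding l2b_def
proof (intro allI impI)
  fix F :: "'b set" assume *: "\<forall>F. finite F \<longrightarrow> L2_set (\<lambda>m. cmod (w m)) F \<le> B" and h: "inj h" and F: "finite F"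
  have "L2_set (\<lambda>m. cmod (w (h m))) F = L2_set (\<lambda>m. cmod (w m)) (h ` F)"
    using h unfolding L2_set_def by (subst sum.reindex) (auto intro: inj_on_subset)
  then show "L2_set (\<lambda>m. cmod (w (h m))) F \<le> B" using * F by simp
qed

lemma l2b_mult_l1b:
  assumes "l2b v A" "l2b w B" shows "l1b (\<lambda>m. v m * w m) (A * B)"
  unfolding l1b_def
proof (intro allI impI)
  fix F :: "'a set" assume F: "finite F"
  have "(\<Sum>m\<in>F. cmod (v m * w m)) \<le> L2_set (\<lambda>m. cmod (v m)) F * L2_set (\<lambda>m. cmod (w m)) F"
    using L2_set_mult_ineq[of "\<lambda>m. cmod (v m)" "\<lambda>m. cmod (w m)" F] by (simp add: norm_mult)
  also have "\<dots> \<le> A * B"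
    using l2bD[OF assms(1) F] l2bD[OF assms(2) F] l2b_nonneg[OF assms(1)] by (intro mult_mono) auto
  finally show "(\<Sum>m\<in>F. cmod (v m * w m)) \<le> A * B" .
qed

lemma l1b_l1: "l1b w B \<Longrightarrow> l1 w"
  unfolding l1b_def
  by (rule nonneg_bounded_partial_sums_imp_summable_on[where C = B])
     (auto intro!: eventually_finite_subsets_at_top_weakI)

lemma l1b_infsum_le: "l1b w B \<Longrightarrow> (\<Sum>\<^sub>\<infinity>m. cmod (w m)) \<le> B"
  by (rule infsum_le_finite_sums[OF l1b_l1]) (auto simp: l1b_def)

text \<open>Minkowski's integral inequality by duality: on a finite set the vector of integrals is
  paired with its own conjugate, and the pairing is estimated by Cauchy-Schwarz under the
  integral.\<close>

lemma l2b_integral: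
  assumes cont: "\<And>m. continuous_on {0..t} (\<lambda>s. f s m)" and b: "\<And>s. s \<in> {0..t} \<Longrightarrow> l2b (f s) B" and t: "t \<ge> 0"
  shows "l2b (\<lambda>m. integral {0..t} (\<lambda>s. f s m)) (t * B)"
  unfolding l2b_def
proof (intro allI impI)
  fix F :: "'a set" assume F: "finite F"
  define c where "c m = integral {0..t} (\<lambda>s. f s m)" for m
  define N where "N = L2_set (\<lambda>m. cmod (c m)) F"
  have N2: "N\<^sup>2 = (\<Sum>m\<in>F. (cmod (c m))\<^sup>2)" by (simp add: N_def L2_set_def sum_nonneg)
  have "complex_of_real (N\<^sup>2) = (\<Sum>m\<in>F. cnj (c m) * c m)"
    unfolding N2 by (simp add: complex_norm_square mult.commute del: of_real_power)
  also have "\<dots> = integral {0..t} (\<lambda>s. \<Sum>m\<in>F. cnj (c m) * f s m)"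
    by (subst integral_sum)
       (auto intro!: integrable_continuous_interval continuous_intros cont F simp: c_def)
  finally have "N\<^sup>2 = cmod (integral {0..t} (\<lambda>s. \<Sum>m\<in>F. cnj (c m) * f s m))"
    by (metis abs_power2 norm_of_real real_norm_def)
  also have "\<dots> \<le> (N * B) * (t - 0)"
  proof (rule integral_bound)
    show "continuous_on {0..t} (\<lambda>s. \<Sum>m\<in>F. cnj (c m) * f s m)" by (intro continuous_intros cont)
    fix s assume s: "s \<in> {0..t}"
    have "cmod (\<Sum>m\<in>F. cnj (c m) * f s m) \<le> (\<Sum>m\<in>F. cmod (c m) * cmod (f s m))"
      by (rule order_trans[OF norm_sum]) (simp add: norm_mult)
    also have "\<dots> \<le> N * L2_set (\<lambda>m. cmod (f s m)) F"
      unfolding N_def using L2_set_mult_ineq[of "\<lambda>m. cmod (c m)" "\<lambda>m. cmod (f s m)" F] by simp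
    also have "\<dots> \<le> N * B" using l2bD[OF b[OF s] F] by (intro mult_left_mono) (auto simp: N_def)
    finally show "cmod (\<Sum>m\<in>F. cnj (c m) * f s m) \<le> N * B" .
  qed (use t in auto)
  finally have *: "N * N \<le> N * (t * B)" by (simp add: power2_eq_square mult_ac)
  have "B \<ge> 0" using b[of 0] t l2b_nonneg by fastforce
  show "L2_set (\<lambda>m. cmod (integral {0..t} (\<lambda>s. f s m))) F \<le> t * B"
  proof (cases "N > 0")
    case True with * show ?thesis by (simp add: N_def c_def)
  next
    case False
    then have "N \<le> t * B" using t \<open>B \<ge> 0\<close> by (meson linorder_not_less mult_nonneg_nonneg order_trans)
    then show ?thesis by (simp add: N_def c_def)
  qed
qed

section \<open>Convolution and its bilinearity\<close>

definition conv :: "('a::ab_group_add \<Rightarrow> complex) \<Rightarrow> ('a \<Rightarrow> complex) \<Rightarrow> 'a \<Rightarrow> complex" where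
  "conv f g m = (\<Sum>\<^sub>\<infinity>l. f l * g (m - l))"

lemma inj_diff: "inj ((-) (m :: 'a::ab_group_add))" by (auto simp: inj_on_def)

lemma conv_l1:
  fixes f g :: "'a::ab_group_add \<Rightarrow> complex"
  assumes "l2b f A" "l2b g B" shows "l1 (\<lambda>l. f l * g (m - l))"
  by (rule l1b_l1[OF l2b_mult_l1b[OF assms(1) l2b_reindex[OF assms(2) inj_diff]]])

lemma conv_has_sum:
  assumes "l2b f A" "l2b g B" shows "((\<lambda>l. f l * g (m - l)) has_sum conv f g m) UNIV"
  unfolding conv_def
  by (rule has_sum_infsum, rule Infinite_Sum.abs_summable_summable, rule conv_l1[OF assms])

lemma norm_conv_le:
  assumes "l2b f A" "l2b g B" shows "cmod (conv f g m) \<le> A * B"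
  unfolding conv_def
  using norm_infsum_bound[OF conv_l1[OF assms, of m]]
    l1b_infsum_le[OF l2b_mult_l1b[OF assms(1) l2b_reindex[OF assms(2) inj_diff]], of m] by linarith

lemma conv_commute: "conv f g m = conv g f m"
  unfolding conv_def
  by (rule infsum_reindex_bij_witness[of _ "\<lambda>l. m - l" "\<lambda>l. m - l"]) (auto simp: mult.commute)

lemma conv_add_left:
  assumes "l2b f A" "l2b f' A'" "l2b g B"
  shows "conv (\<lambda>l. f l + f' l) g m = conv f g m + conv f' g m"
  using has_sum_add[OF conv_has_sum[OF assms(1,3), of m] conv_has_sum[OF assms(2,3), of m]]
  by (intro infsumI[THEN trans[OF conv_def]]) (simp add: distrib_right)

lemma conv_cmult_left: "conv (\<lambda>l. c * f l) g m = c * conv f g m"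
  unfolding conv_def by (simp add: infsum_cmult_right' mult.assoc)

lemma conv_cmult_right: "conv f (\<lambda>l. c * g l) m = c * conv f g m"
  by (simp add: conv_commute[of f] conv_cmult_left)

lemma conv_add_right:
  assumes "l2b f A" "l2b g B" "l2b g' B'"
  shows "conv f (\<lambda>l. g l + g' l) m = conv f g m + conv f g' m"
  using conv_add_left[OF assms(2,3,1)] by (simp add: conv_commute[of f])

lemma conv_sum_left:
  assumes "\<And>a. a \<in> I \<Longrightarrow> l2b (f a) (A a)" "l2b g B"
  shows "conv (\<lambda>l. \<Sum>a\<in>I. f a l) g m = (\<Sum>a\<in>I. conv (f a) g m)"
  using has_sum_sum'[where I = I and f = "\<lambda>a l. f a l * g (m - l)" and S = "\<lambda>a. conv (f a) g m" and A = UNIV] conv_has_sum[OF assms(1) assms(2)]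
  by (intro infsumI[THEN trans[OF conv_def]]) (simp add: sum_distrib_right)

lemma conv_sum_right:
  assumes "l2b f A" "\<And>a. a \<in> I \<Longrightarrow> l2b (g a) (B a)"
  shows "conv f (\<lambda>l. \<Sum>a\<in>I. g a l) m = (\<Sum>a\<in>I. conv f (g a) m)"
  using conv_sum_left[OF assms(2,1), of I] by (simp add: conv_commute[of f])

lemma conv_square_diff:
  assumes "l2b f A" "l2b g B"
  shows "conv f f m - conv g g m = conv (\<lambda>l. f l + g l) (\<lambda>l. f l - g l) m"
proof -
  have mg: "l2b (\<lambda>m. - 1 * g m) (1 * B)" by (rule l2b_cmult[OF assms(2)]) simp
  have "conv (\<lambda>l. f l + g l) (\<lambda>l. f l + (-1) * g l) m
     = (conv f f m + (-1) * conv f g m) + (conv g f m + (-1) * conv g g m)"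
    by (subst conv_add_left[OF assms l2b_add[OF assms(1) mg]],
        subst conv_add_right[OF assms(1,1) mg], subst conv_add_right[OF assms(2,1) mg])
       (simp only: conv_cmult_right)
  then show ?thesis by (simp add: conv_commute[of g f])
qed

text \<open>Young's inequality: the partial sums are combinations of reflected translates of
  \<open>g\<close>, and the bound passes to the limit.\<close>

lemma l2b_conv_l1b:
  fixes f g :: "'a::ab_group_add \<Rightarrow> complex"
  assumes f: "l1b f A" and g: "l2b g B" and f2: "l2b f A'"
  shows "l2b (conv f g) (A * B)"
proof (rule l2b_limit[where F = "finite_subsets_at_top UNIV" and f = "\<lambda>G m. \<Sum>l\<in>G. f l * g (m - l)"])
  show "((\<lambda>G. \<Sum>l\<in>G. f l * g (m - l)) \<longlongrightarrow> conv f g m) (finite_subsets_at_top UNIV)" for m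
    using conv_has_sum[OF f2 g, of m] by (simp add: has_sum_def)
  show "eventually (\<lambda>G. l2b (\<lambda>m. \<Sum>l\<in>G. f l * g (m - l)) (A * B)) (finite_subsets_at_top UNIV)"
  proof (rule eventually_finite_subsets_at_top_weakI)
    fix G :: "'a set" assume G: "finite G"
    have "l2b (\<lambda>m. \<Sum>l\<in>G. f l * g (m - l)) (\<Sum>l\<in>G. cmod (f l) * B)"
      by (intro l2b_sum l2b_cmult l2b_reindex[OF g]) (auto simp: inj_on_def)
    moreover have "(\<Sum>l\<in>G. cmod (f l) * B) \<le> A * B"
      using f G l2b_nonneg[OF g] by (auto simp: l1b_def sum_distrib_right[symmetric] intro!: mult_right_mono)
    ultimately show "l2b (\<lambda>m. \<Sum>l\<in>G. f l * g (m - l)) (A * B)" by (rule l2b_mono)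
  qed
qed simp

section \<open>Parseval's identity and multiplication by bounded functions\<close>

lemma finite_parseval:
  fixes c :: "int ^ 'n \<Rightarrow> complex"
  assumes G: "finite G"
  shows "(LINT x:cube 1|lborel. (cmod (\<Sum>m\<in>G. c m * ch m x))\<^sup>2) = (\<Sum>m\<in>G. (cmod (c m))\<^sup>2)"
    and "set_integrable lborel (cube 1) (\<lambda>x. (cmod (\<Sum>m\<in>G. c m * ch m x))\<^sup>2)"
proof -
  have cpt: "compact (cube 1 :: (real^'n) set)" unfolding cube_def by simp
  show "set_integrable lborel (cube 1) (\<lambda>x. (cmod (\<Sum>m\<in>G. c m * ch m x))\<^sup>2)"
    unfolding set_integrable_def by (intro borel_integrable_compact[OF cpt] continuous_intros)
  have int: "set_integrable lborel (cube 1) (\<lambda>x. c m * cnj (c l) * ch (m - l) x)" for m l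
    unfolding set_integrable_def by (intro borel_integrable_compact[OF cpt] continuous_intros)
  have orth: "(LINT x:cube 1|lborel. ch m x) = (if m = 0 then 1 else 0)" for m :: "int ^ 'n"
    using orthogonality[of 1 m] by simp
  have "complex_of_real (LINT x:cube 1|lborel. (cmod (\<Sum>m\<in>G. c m * ch m x))\<^sup>2)
     = (LINT x:cube 1|lborel. of_real ((cmod (\<Sum>m\<in>G. c m * ch m x))\<^sup>2))"
    unfolding set_lebesgue_integral_def by (subst integral_complex_of_real[symmetric]) (simp add: scaleR_conv_of_real)
  also have "\<dots> = (LINT x:cube 1|lborel. (\<Sum>m\<in>G. \<Sum>l\<in>G. c m * cnj (c l) * ch (m - l) x))"
    by (simp add: complex_norm_square sum_product ch_diff mult_ac del: of_real_power)
  also have "\<dots> = (\<Sum>m\<in>G. \<Sum>l\<in>G. (LINT x:cube 1|lborel. c m * cnj (c l) * ch (m - l) x))"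
    using int unfolding set_lebesgue_integral_def set_integrable_def scaleR_sum_right
    by (simp only: Bochner_Integration.integral_sum Bochner_Integration.integrable_sum)
  also have "\<dots> = (\<Sum>m\<in>G. \<Sum>l\<in>G. if m = l then c m * cnj (c l) else 0)"
    using orth by (intro sum.cong refl) auto
  also have "\<dots> = of_real (\<Sum>m\<in>G. (cmod (c m))\<^sup>2)"
    using G by (simp add: complex_norm_square del: of_real_power)
  finally show "(LINT x:cube 1|lborel. (cmod (\<Sum>m\<in>G. c m * ch m x))\<^sup>2) = (\<Sum>m\<in>G. (cmod (c m))\<^sup>2)"
    using of_real_eq_iff by blast
qed

lemma trig_finite: "finite K \<Longrightarrow> (\<And>m. m \<notin> K \<Longrightarrow> v m = 0) \<Longrightarrow> trig v x = (\<Sum>m\<in>K. v m * ch m x)"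
  unfolding trig_def by (rule infsumI) (auto intro!: has_sum_finite_neutralI[where B = K])

lemma conv_finite: "finite K \<Longrightarrow> (\<And>m. m \<notin> K \<Longrightarrow> v m = 0) \<Longrightarrow> conv v w m = (\<Sum>l\<in>K. v l * w (m - l))"
  unfolding conv_def by (rule infsumI) (auto intro!: has_sum_finite_neutralI[where B = K])

text \<open>In physical space a product is bounded in mean square by the sup norm of one factor;
  Parseval transfers this to coefficients once everything has been made finite.\<close>

lemma l2b_conv_sup:
  fixes v :: "int ^ 'n \<Rightarrow> complex"
  assumes K: "finite K" "\<And>m. m \<notin> K \<Longrightarrow> v m = 0" and S: "\<And>x. cmod (trig v x) \<le> S" and w: "l2b w B"
  shows "l2b (conv v w) (S * B)"
  unfolding l2b_def
proof (intro allI impI)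
  fix F :: "(int ^ 'n) set" assume F: "finite F"
  \<comment> \<open>\<open>G\<close> holds the frequencies of \<open>w\<close> that can reach
    \<open>F\<close> through \<open>K\<close>, and \<open>H\<close> contains all frequencies of the
    product of \<open>v\<close> with the part of \<open>w\<close> on \<open>G\<close>, which is
    therefore a finite trigonometric sum over \<open>H\<close>.\<close>
  define G where "G = (\<lambda>(m, l). m - l) ` (F \<times> K)"
  define H where "H = F \<union> (\<lambda>(m, l). m + l) ` (G \<times> K)"
  define w' where "w' m = (if m \<in> G then w m else 0)" for m
  define c where "c m = (\<Sum>l\<in>K. v l * w' (m - l))" for m
  have fin: "finite G" "finite H" using F K by (auto simp: G_def H_def)
  have S0: "S \<ge> 0" using order_trans[OF norm_ge_zero S] by blast
  have eq: "conv v w m = c m" if "m \<in> F" for m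
  proof -
    have "conv v w m = (\<Sum>l\<in>K. v l * w (m - l))" by (rule conv_finite) (use K in auto)
    also have "\<dots> = c m" unfolding c_def using that by (intro sum.cong refl) (auto simp: w'_def G_def)
    finally show ?thesis .
  qed
  have prod: "(\<Sum>m\<in>H. c m * ch m x) = (\<Sum>l\<in>K. v l * ch l x) * (\<Sum>m\<in>G. w m * ch m x)" for x
  proof -
    have "(\<Sum>m\<in>H. c m * ch m x) = (\<Sum>l\<in>K. v l * ch l x * (\<Sum>m\<in>H. w' (m - l) * ch (m - l) x))"
    proof -
      have "c m * ch m x = (\<Sum>l\<in>K. v l * ch l x * (w' (m - l) * ch (m - l) x))" for m
      proof -
        have "ch l x * ch (m - l) x = ch m x" for l using ch_add[of l "m - l" x] by simp
        then show ?thesis by (simp add: c_def sum_distrib_right) (simp add: mult_ac sum_distrib_left)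
      qed
      then have "(\<Sum>m\<in>H. c m * ch m x) = (\<Sum>m\<in>H. \<Sum>l\<in>K. v l * ch l x * (w' (m - l) * ch (m - l) x))" by simp
      also have "\<dots> = (\<Sum>l\<in>K. \<Sum>m\<in>H. v l * ch l x * (w' (m - l) * ch (m - l) x))" by (rule sum.swap)
      finally show ?thesis by (simp add: sum_distrib_left)
    qed
    also have "\<dots> = (\<Sum>l\<in>K. v l * ch l x * (\<Sum>m\<in>G. w m * ch m x))"
    proof (rule sum.cong[OF refl], rule arg_cong2[where f = "(*)", OF refl])
      fix l assume l: "l \<in> K"
      have "(\<Sum>m\<in>H. w' (m - l) * ch (m - l) x) = (\<Sum>m\<in>(\<lambda>m. m - l) ` H. w' m * ch m x)"
        by (subst sum.reindex) (auto simp: inj_on_def)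
      also have "\<dots> = (\<Sum>m\<in>G. w' m * ch m x)"
      proof (rule sum.mono_neutral_right)
        show "G \<subseteq> (\<lambda>m. m - l) ` H"
        proof
          fix m assume "m \<in> G"
          then have "m + l \<in> H" using l by (force simp: H_def)
          then show "m \<in> (\<lambda>m. m - l) ` H" by force
        qed
      qed (auto simp: fin w'_def)
      finally show "(\<Sum>m\<in>H. w' (m - l) * ch (m - l) x) = (\<Sum>m\<in>G. w m * ch m x)" by (simp add: w'_def)
    qed
    finally show ?thesis by (simp add: sum_distrib_right)
  qed
  have "(\<Sum>m\<in>F. (cmod (conv v w m))\<^sup>2) \<le> (\<Sum>m\<in>H. (cmod (c m))\<^sup>2)"
    using eq fin by (simp add: H_def sum_mono2)
  also have "\<dots> = (LINT x:cube 1|lborel. (cmod (\<Sum>m\<in>H. c m * ch m x))\<^sup>2)"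
    by (rule finite_parseval(1)[symmetric, OF fin(2)])
  also have "\<dots> \<le> (LINT x:cube 1|lborel. S\<^sup>2 * (cmod (\<Sum>m\<in>G. w m * ch m x))\<^sup>2)"
  proof (rule set_integral_mono)
    show "set_integrable lborel (cube 1) (\<lambda>x. (cmod (\<Sum>m\<in>H. c m * ch m x))\<^sup>2)" by (intro finite_parseval(2) fin)
    show "set_integrable lborel (cube 1) (\<lambda>x. S\<^sup>2 * (cmod (\<Sum>m\<in>G. w m * ch m x))\<^sup>2)"
      by (intro set_integrable_mult_right finite_parseval fin)
    fix x
    show "(cmod (\<Sum>m\<in>H. c m * ch m x))\<^sup>2 \<le> S\<^sup>2 * (cmod (\<Sum>m\<in>G. w m * ch m x))\<^sup>2"
      unfolding prod norm_mult power_mult_distrib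
      using S[of x] trig_finite[OF K, where x = x] by (intro mult_right_mono power_mono) auto
  qed
  also have "\<dots> = S\<^sup>2 * (\<Sum>m\<in>G. (cmod (w m))\<^sup>2)"
    by (simp add: finite_parseval(1)[OF fin(1)])
  also have "\<dots> \<le> S\<^sup>2 * B\<^sup>2"
  proof (rule mult_left_mono)
    have "(L2_set (\<lambda>m. cmod (w m)) G)\<^sup>2 \<le> B\<^sup>2"
      using l2bD[OF w fin(1)] by (intro power_mono) auto
    then show "(\<Sum>m\<in>G. (cmod (w m))\<^sup>2) \<le> B\<^sup>2" by (simp add: L2_set_def sum_nonneg)
  qed simp
  finally have "(\<Sum>m\<in>F. (cmod (conv v w m))\<^sup>2) \<le> (S * B)\<^sup>2" by (simp add: power_mult_distrib)
  then show "L2_set (\<lambda>m. cmod (conv v w m)) F \<le> S * B"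
    unfolding L2_set_def using S0 l2b_nonneg[OF w] by (intro real_le_lsqrt) (auto simp: sum_nonneg)
qed

text \<open>Read off by letting \<open>v\<close> multiply the constant function \<open>1\<close>,
  whose coefficient sequence is \<open>\<delta>\<close>.\<close>

lemma l2b_sup:
  fixes v :: "int ^ 'n \<Rightarrow> complex"
  assumes K: "finite K" "\<And>m. m \<notin> K \<Longrightarrow> v m = 0" and S: "\<And>x. cmod (trig v x) \<le> S"
  shows "l2b v S"
proof -
  define \<delta> where "\<delta> m = (if m = 0 then 1 else 0 :: complex)" for m :: "int ^ 'n"
  have "l2b \<delta> 1"
    unfolding l2b_def
  proof (intro allI impI)
    fix F :: "(int ^ 'n) set" assume "finite F"
    then have "(\<Sum>m\<in>F. (cmod (\<delta> m))\<^sup>2) = (if 0 \<in> F then 1 else 0)"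
      unfolding \<delta>_def using sum.delta[of F 0 "\<lambda>_. 1 :: real"]
      by (simp add: if_distrib[of cmod] if_distrib[of "\<lambda>z. z\<^sup>2"] cong: if_cong)
    then show "L2_set (\<lambda>m. cmod (\<delta> m)) F \<le> 1" by (simp add: L2_set_def)
  qed
  from l2b_conv_sup[OF K S this] have "l2b (conv v \<delta>) S" by simp
  moreover have "conv v \<delta> = v"
  proof
    fix m
    have "conv v \<delta> m = (\<Sum>l\<in>K. v l * \<delta> (m - l))" by (rule conv_finite) (use K in auto)
    also have "\<dots> = (\<Sum>l\<in>K. if l = m then v l else 0)"
      unfolding \<delta>_def by (intro sum.cong) auto
    finally have "conv v \<delta> m = (\<Sum>l\<in>K. if l = m then v l else 0)" .
    then show "conv v \<delta> m = v m" using K by auto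
  qed
  ultimately show ?thesis by simp
qed

section \<open>Weighted spaces and the Duhamel operator\<close>

locale duhamel =
  fixes \<phi> :: "int ^ 'n \<Rightarrow> real" and \<Lambda> T :: real and \<sigma> :: nat
  assumes \<Lambda>: "\<Lambda> \<ge> 1" and T: "T \<ge> 0" and \<sigma>: "2 * CARD('n) \<le> \<sigma>"
begin

text \<open>The multiplier of the \<open>j\<close>-th derivative in direction \<open>i\<close>, up
  to a constant and rescaled by \<open>\<Lambda>\<close>. Pure derivatives suffice: together they
  control powers of every coordinate, and the Leibniz rule does not leave this family.\<close>

definition wt :: "'n \<Rightarrow> nat \<Rightarrow> int ^ 'n \<Rightarrow> complex" where
  "wt i j m = of_real ((real_of_int (m $ i) / \<Lambda>) ^ j)"

text \<open>A discrete Sobolev bound whose weights \<open>(m\<^sub>i/\<Lambda>)\<^sup>j\<close> are at most \<open>1\<close> at frequencies below \<open>\<Lambda>\<close>: in these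
  norms a low-frequency sequence costs no power of \<open>\<Lambda>\<close>. The parameter \<open>\<sigma>\<close> is the number of derivatives.\<close>

definition xb :: "(int ^ 'n \<Rightarrow> complex) \<Rightarrow> real \<Rightarrow> bool" where
  "xb w B \<longleftrightarrow> (\<forall>i. \<forall>j\<le>\<sigma>. l2b (\<lambda>m. wt i j m * w m) B)"

definition sb :: "(int ^ 'n \<Rightarrow> complex) \<Rightarrow> real \<Rightarrow> bool" where
  "sb w S \<longleftrightarrow> finite {m. w m \<noteq> 0} \<and> (\<forall>i. \<forall>j\<le>\<sigma>. \<forall>x. cmod (trig (\<lambda>m. wt i j m * w m) x) \<le> S)"

text \<open>Sup bounds in physical space (\<open>sb\<close>) make convolution bounded on \<open>xb\<close> with a constant independent of \<open>\<Lambda>\<close>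
  (\<open>sb_mult\<close>), whereas the algebra property of \<open>xb\<close> itself (\<open>xb_mult\<close>) loses the factor \<open>Q\<close>.\<close>

definition mult :: "(int ^ 'n \<Rightarrow> complex) \<Rightarrow> real \<Rightarrow> bool" where
  "mult v B \<longleftrightarrow> (\<forall>w b. xb w b \<longrightarrow> xb (conv v w) (B * b))"

lemma xbD: "xb w B \<Longrightarrow> j \<le> \<sigma> \<Longrightarrow> l2b (\<lambda>m. wt i j m * w m) B"
  by (auto simp: xb_def)

lemma wt_0 [simp]: "wt i 0 m = 1" by (simp add: wt_def)

lemma xb_l2b: "xb w B \<Longrightarrow> l2b w B"
  using xbD[of w B 0] by simp

lemma xb_nonneg: "xb w B \<Longrightarrow> B \<ge> 0"
  using xb_l2b l2b_nonneg by blast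

lemma xb_mono: "xb w B \<Longrightarrow> B \<le> B' \<Longrightarrow> xb w B'"
  by (auto simp: xb_def intro: l2b_mono)

lemma xb_add: "xb v A \<Longrightarrow> xb w B \<Longrightarrow> xb (\<lambda>m. v m + w m) (A + B)"
  by (auto simp: xb_def distrib_left intro: l2b_add)

lemma xb_cmult:
  assumes "xb w B" "\<And>m. cmod (c m) \<le> 1" shows "xb (\<lambda>m. c m * w m) B"
  unfolding xb_def
proof (intro allI impI)
  fix i j assume "j \<le> \<sigma>"
  show "l2b (\<lambda>m. wt i j m * (c m * w m)) B"
  proof (rule l2b_le[OF xbD[OF assms(1) \<open>j \<le> \<sigma>\<close>, of i]])
    fix m
    have "cmod (c m) * cmod (wt i j m * w m) \<le> 1 * cmod (wt i j m * w m)"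
      by (intro mult_right_mono assms) auto
    then show "cmod (wt i j m * (c m * w m)) \<le> cmod (wt i j m * w m)" by (simp add: norm_mult mult_ac)
  qed
qed

lemma xb_diff: "xb v A \<Longrightarrow> xb w B \<Longrightarrow> xb (\<lambda>m. v m - w m) (A + B)"
  using xb_add[of v A "\<lambda>m. -1 * w m" B] xb_cmult[of w B "\<lambda>_. -1"] by simp

lemma xb_zero: "xb (\<lambda>_. 0) 0" by (simp add: xb_def l2b_def L2_set_def)

lemma xb_sum: "(\<And>l. l \<in> G \<Longrightarrow> xb (f l) (B l)) \<Longrightarrow> xb (\<lambda>m. \<Sum>l\<in>G. f l m) (\<Sum>l\<in>G. B l)"
  by (induction G rule: infinite_finite_induct) (auto intro!: xb_add xb_zero)

lemma xb_limit:
  assumes "\<And>m. ((\<lambda>k. f k m) \<longlongrightarrow> w m) F" "eventually (\<lambda>k. xb (f k) B) F" "F \<noteq> bot"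
  shows "xb w B"
  unfolding xb_def
proof (intro allI impI)
  fix i j assume j: "j \<le> \<sigma>"
  show "l2b (\<lambda>m. wt i j m * w m) B"
    by (rule l2b_limit[OF _ _ assms(3), where f = "\<lambda>k m. wt i j m * f k m"])
       (auto intro!: tendsto_intros assms(1) eventually_mono[OF assms(2)] xbD j)
qed

text \<open>Leibniz rule; on the Fourier side it is the binomial theorem for
  \<open>m = p + (m - p)\<close>.\<close>

lemma wt_conv:
  assumes f: "\<And>l. l \<le> j \<Longrightarrow> l2b (\<lambda>m. wt i l m * f m) A" and g: "\<And>l. l \<le> j \<Longrightarrow> l2b (\<lambda>m. wt i l m * g m) B"
  shows "wt i j m * conv f g m = (\<Sum>l\<le>j. of_nat (j choose l) * conv (\<lambda>m. wt i l m * f m) (\<lambda>m. wt i (j - l) m * g m) m)"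
proof -
  have "((\<lambda>p. \<Sum>l\<le>j. of_nat (j choose l) * ((wt i l p * f p) * (wt i (j - l) (m - p) * g (m - p)))) has_sum
      (\<Sum>l\<le>j. of_nat (j choose l) * conv (\<lambda>m. wt i l m * f m) (\<lambda>m. wt i (j - l) m * g m) m)) UNIV"
    by (intro has_sum_sum' has_sum_cmult_right conv_has_sum[OF f g]) auto
  moreover have "(\<Sum>l\<le>j. of_nat (j choose l) * ((wt i l p * f p) * (wt i (j - l) (m - p) * g (m - p)))) = wt i j m * (f p * g (m - p))" for p
  proof -
    have "wt i j m = (of_real (real_of_int (p $ i) / \<Lambda>) + of_real (real_of_int ((m - p) $ i) / \<Lambda>)) ^ j"
      unfolding of_real_add[symmetric] wt_def of_real_power[symmetric] by (simp add: diff_divide_distrib)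
    also have "\<dots> = (\<Sum>l\<le>j. of_nat (j choose l) * wt i l p * wt i (j - l) (m - p))"
      unfolding binomial_ring wt_def of_real_power ..
    finally show ?thesis by (simp add: sum_distrib_right sum_distrib_left mult_ac)
  qed
  ultimately have "((\<lambda>p. wt i j m * (f p * g (m - p))) has_sum
      (\<Sum>l\<le>j. of_nat (j choose l) * conv (\<lambda>m. wt i l m * f m) (\<lambda>m. wt i (j - l) m * g m) m)) UNIV" by simp
  moreover have "((\<lambda>p. wt i j m * (f p * g (m - p))) has_sum (wt i j m * conv f g m)) UNIV"
    using conv_has_sum[OF f[of 0] g[of 0]] by (intro has_sum_cmult_right) auto
  ultimately show ?thesis using has_sum_unique by blast
qed

lemma xb_conv_leibniz:
  assumes f: "xb f A" and g: "xb g B" and C: "C \<ge> 0"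
    and b: "\<And>i j l. j \<le> \<sigma> \<Longrightarrow> l \<le> j \<Longrightarrow> l2b (conv (\<lambda>m. wt i l m * f m) (\<lambda>m. wt i (j - l) m * g m)) C"
  shows "xb (conv f g) (2 ^ \<sigma> * C)"
  unfolding xb_def
proof (intro allI impI)
  fix i j assume j: "j \<le> \<sigma>"
  have "l2b (\<lambda>m. \<Sum>l\<le>j. of_nat (j choose l) * conv (\<lambda>m. wt i l m * f m) (\<lambda>m. wt i (j - l) m * g m) m) (\<Sum>l\<le>j. of_nat (j choose l) * C)"
    by (intro l2b_sum l2b_cmult b j) auto
  moreover have "(\<Sum>l\<le>j. of_nat (j choose l) * C) = 2 ^ j * C"
    by (simp add: sum_distrib_right[symmetric] choose_row_sum flip: of_nat_sum)
  moreover have "wt i j m * conv f g m = (\<Sum>l\<le>j. of_nat (j choose l) * conv (\<lambda>m. wt i l m * f m) (\<lambda>m. wt i (j - l) m * g m) m)" for m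
    by (rule wt_conv) (use j in \<open>auto intro: xbD f g\<close>)
  moreover have "2 ^ j * C \<le> 2 ^ \<sigma> * C" using j C by (intro mult_right_mono power_increasing) auto
  ultimately show "l2b (\<lambda>m. wt i j m * conv f g m) (2 ^ \<sigma> * C)" by (simp add: l2b_mono)
qed

lemma sb_xb: "sb v S \<Longrightarrow> xb v S"
  unfolding xb_def
proof (intro allI impI)
  fix i j assume v: "sb v S" "j \<le> \<sigma>"
  show "l2b (\<lambda>m. wt i j m * v m) S"
    by (rule l2b_sup[where K = "{m. v m \<noteq> 0}"]) (use v in \<open>auto simp: sb_def\<close>)
qed

lemma sb_mult: assumes v: "sb v S" shows "mult v (2 ^ \<sigma> * S)"
  unfolding mult_def
proof (intro allI impI)
  fix w b assume w: "xb w b"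
  have S0: "S * b \<ge> 0" using xb_nonneg[OF w] xb_nonneg[OF sb_xb[OF v]] by simp
  show "xb (conv v w) (2 ^ \<sigma> * S * b)"
    unfolding mult.assoc
  proof (rule xb_conv_leibniz[OF sb_xb[OF v] w S0])
    fix i j l assume j: "j \<le> \<sigma>" "l \<le> j"
    show "l2b (conv (\<lambda>m. wt i l m * v m) (\<lambda>m. wt i (j - l) m * w m)) (S * b)"
      by (rule l2b_conv_sup[where K = "{m. v m \<noteq> 0}", OF _ _ _ xbD[OF w]]) (use v j in \<open>auto simp: sb_def\<close>)
  qed
qed

text \<open>Let \<open>z\<close> be the largest \<open>|m $ i| / \<Lambda>\<close>. Then
  \<open>1 / hw m\<close> is at most \<open>(\<Lambda> * (1 + z)) ^ CARD('n)\<close>, so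
  \<open>p\<close> inverse powers of \<open>hw\<close> together with \<open>j\<close> derivatives
  are paid by \<open>\<sigma>\<close> derivatives in the direction where \<open>z\<close> is
  attained.\<close>

lemma hw_wt_le:
  assumes "CARD('n) * p + j \<le> \<sigma>"
  shows "cmod (wt i j m) \<le> \<Lambda> ^ (CARD('n) * p) * 2 ^ \<sigma> * hw m ^ p * (1 + (\<Sum>i\<in>UNIV. cmod (wt i \<sigma> m)))"
proof -
  define z where "z = Max (range (\<lambda>i. \<bar>real_of_int (m $ i)\<bar> / \<Lambda>))"
  have zi: "\<bar>real_of_int (m $ i)\<bar> / \<Lambda> \<le> z" for i unfolding z_def by (intro Max_ge) auto
  have "z \<in> range (\<lambda>i. \<bar>real_of_int (m $ i)\<bar> / \<Lambda>)" unfolding z_def by (intro Max_in) auto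
  then obtain k where k: "z = \<bar>real_of_int (m $ k)\<bar> / \<Lambda>" by auto
  have z0: "z \<ge> 0" using k \<Lambda> by simp
  have "1 / hw m = (\<Prod>i\<in>UNIV. 1 + \<bar>real_of_int (m $ i)\<bar>)"
    by (simp add: hw_def prod_inversef[symmetric] o_def divide_inverse)
  also have "\<dots> \<le> (\<Prod>i\<in>(UNIV :: 'n set). \<Lambda> * (1 + z))"
  proof (intro prod_mono conjI)
    fix i :: 'n
    have "\<bar>real_of_int (m $ i)\<bar> \<le> z * \<Lambda>" using zi[of i] \<Lambda> by (simp add: pos_divide_le_eq)
    then show "1 + \<bar>real_of_int (m $ i)\<bar> \<le> \<Lambda> * (1 + z)" using \<Lambda> by (simp add: algebra_simps)
  qed auto
  finally have "(1 / hw m) ^ p \<le> ((\<Lambda> * (1 + z)) ^ CARD('n)) ^ p"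
    using hw_pos[of m] by (intro power_mono) auto
  then have "1 \<le> hw m ^ p * (\<Lambda> ^ (CARD('n) * p) * (1 + z) ^ (CARD('n) * p))"
    using hw_pos[of m] by (simp add: power_divide divide_le_eq power_mult_distrib power_mult[symmetric] mult_ac)
  moreover have "cmod (wt i j m) \<le> (1 + z) ^ j"
  proof -
    have "cmod (wt i j m) = (\<bar>real_of_int (m $ i)\<bar> / \<Lambda>) ^ j"
      unfolding wt_def norm_of_real using \<Lambda> by (simp add: power_abs)
    also have "\<dots> \<le> (1 + z) ^ j" using zi[of i] \<Lambda> by (intro power_mono) auto
    finally show ?thesis .
  qed
  ultimately have "1 * cmod (wt i j m) \<le> hw m ^ p * (\<Lambda> ^ (CARD('n) * p) * (1 + z) ^ (CARD('n) * p)) * (1 + z) ^ j"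
    using z0 by (intro mult_mono) auto
  also have "\<dots> = \<Lambda> ^ (CARD('n) * p) * hw m ^ p * (1 + z) ^ (CARD('n) * p + j)"
    by (simp add: power_add mult_ac)
  also have "\<dots> \<le> \<Lambda> ^ (CARD('n) * p) * hw m ^ p * (2 ^ \<sigma> * (1 + (\<Sum>i\<in>UNIV. cmod (wt i \<sigma> m))))"
  proof (intro mult_left_mono)
    have "(1 + z) ^ (CARD('n) * p + j) \<le> (1 + z) ^ \<sigma>" using z0 assms by (intro power_increasing) auto
    also have "\<dots> \<le> (2 * max 1 z) ^ \<sigma>" using z0 by (intro power_mono) auto
    also have "\<dots> = 2 ^ \<sigma> * (max 1 z) ^ \<sigma>" by (simp add: power_mult_distrib)
    also have "(max 1 z) ^ \<sigma> \<le> 1 + z ^ \<sigma>" using z0 by (auto simp: max_def)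
    also have "z ^ \<sigma> = cmod (wt k \<sigma> m)" unfolding wt_def norm_of_real k using \<Lambda> by (simp add: power_abs)
    also have "\<dots> \<le> (\<Sum>i\<in>UNIV. cmod (wt i \<sigma> m))" by (rule member_le_sum) auto
    finally show "(1 + z) ^ (CARD('n) * p + j) \<le> 2 ^ \<sigma> * (1 + (\<Sum>i\<in>UNIV. cmod (wt i \<sigma> m)))" by simp
  qed (use \<Lambda> hw_pos[of m] in auto)
  finally show ?thesis by (simp add: mult_ac)
qed

lemma xb_sum_wt:
  assumes "xb w B"
  shows "l2b (\<lambda>m. of_real ((1 + (\<Sum>i\<in>UNIV. cmod (wt i \<sigma> m))) * cmod (w m))) ((1 + real CARD('n)) * B)"
proof -
  have n: "l2b f b \<Longrightarrow> l2b (\<lambda>m. of_real (cmod (f m))) b" for f :: "int ^ 'n \<Rightarrow> complex" and b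
    by (erule l2b_le) simp
  have "l2b (\<lambda>m. of_real (cmod (w m)) + (\<Sum>i\<in>UNIV. of_real (cmod (wt i \<sigma> m * w m)))) (B + (\<Sum>i\<in>(UNIV::'n set). B))"
    by (intro l2b_add l2b_sum n xb_l2b xbD assms order_refl)
  then show ?thesis by (simp add: norm_mult sum_distrib_right distrib_right flip: of_real_mult of_real_add of_real_sum)
qed

text \<open>The price of passing from \<open>xb\<close> to absolutely summable coefficients, with
  \<open>d = CARD('n)\<close>: \<open>3 ^ d\<close> from the square sum of \<open>hw\<close>,
  \<open>\<Lambda> ^ d * 2 ^ \<sigma>\<close> from \<open>hw_wt_le\<close> with
  \<open>p = 1\<close>, and \<open>1 + d\<close> for the number of weights involved.\<close>

definition Q :: real where "Q = 3 ^ CARD('n) * \<Lambda> ^ CARD('n) * 2 ^ \<sigma> * (1 + real CARD('n))"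

lemma Q_nonneg: "Q \<ge> 0" using \<Lambda> by (simp add: Q_def)

text \<open>Cauchy-Schwarz against \<open>hw\<close>. One factor \<open>hw\<close> costs
  \<open>CARD('n)\<close> derivatives, and these fit beside the \<open>j\<close> given ones because
  both numbers are at most half of \<open>\<sigma>\<close>.\<close>

lemma xb_l1b:
  assumes w: "xb w B" and j: "2 * j \<le> \<sigma>"
  shows "l1b (\<lambda>m. wt i j m * w m) (Q * B)"
proof -
  have "l2b (\<lambda>m :: int ^ 'n. of_real (hw m)) (3 ^ CARD('n))" unfolding l2b_def
  proof (intro allI impI)
    fix F :: "(int ^ 'n) set" assume "finite F"
    from hw_square_sum_le[OF this] have "L2_set (\<lambda>m. cmod (of_real (hw m))) F \<le> sqrt (3 ^ CARD('n))"
      by (simp add: L2_set_def)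
    also have "\<dots> \<le> 3 ^ CARD('n)" by (rule real_le_lsqrt) (auto simp: power2_eq_square)
    finally show "L2_set (\<lambda>m. cmod (of_real (hw m))) F \<le> 3 ^ CARD('n)" .
  qed
  from l2b_mult_l1b[OF this l2b_cmult[OF xb_sum_wt[OF w], where c = "of_real (\<Lambda> ^ CARD('n) * 2 ^ \<sigma>)" and C = "\<Lambda> ^ CARD('n) * 2 ^ \<sigma>"]]
  have *: "l1b (\<lambda>m. of_real (hw m) * (of_real (\<Lambda> ^ CARD('n) * 2 ^ \<sigma>) * of_real ((1 + (\<Sum>i\<in>UNIV. cmod (wt i \<sigma> m))) * cmod (w m)))) (Q * B)"
    using \<Lambda> by (simp add: Q_def mult_ac norm_mult norm_power)
  define G where "G m = (of_real (hw m) * (of_real (\<Lambda> ^ CARD('n) * 2 ^ \<sigma>) * of_real ((1 + (\<Sum>i\<in>UNIV. cmod (wt i \<sigma> m))) * cmod (w m))) :: complex)" for m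
  have le: "cmod (wt i j m * w m) \<le> cmod (G m)" for m
  proof -
    have "cmod (wt i j m) * cmod (w m) \<le> (\<Lambda> ^ (CARD('n) * 1) * 2 ^ \<sigma> * hw m ^ 1 * (1 + (\<Sum>i\<in>UNIV. cmod (wt i \<sigma> m)))) * cmod (w m)"
      by (intro mult_right_mono hw_wt_le) (use \<sigma> j in auto)
    also have "\<dots> = cmod (G m)"
      unfolding G_def of_real_mult[symmetric] norm_of_real using \<Lambda> hw_pos[of m]
      by (subst abs_of_nonneg) (auto intro!: mult_nonneg_nonneg add_nonneg_nonneg sum_nonneg simp: mult_ac)
    finally show ?thesis by (simp add: norm_mult)
  qed
  show ?thesis unfolding l1b_def
  proof (intro allI impI)
    fix F :: "(int ^ 'n) set" assume F: "finite F"
    have "(\<Sum>m\<in>F. cmod (wt i j m * w m)) \<le> (\<Sum>m\<in>F. cmod (G m))" by (intro sum_mono le)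
    also have "\<dots> \<le> Q * B" using *[folded G_def] F by (auto simp: l1b_def)
    finally show "(\<Sum>m\<in>F. cmod (wt i j m * w m)) \<le> Q * B" .
  qed
qed

text \<open>Decay by \<open>p\<close> powers of \<open>hw\<close> costs \<open>CARD('n) * p\<close>
  derivatives; the decay wanted for mild solutions is what fixes \<open>\<sigma>\<close>
  later.\<close>

lemma xb_decay:
  assumes w: "xb w B" and p: "CARD('n) * p \<le> \<sigma>"
  shows "cmod (w m) \<le> \<Lambda> ^ (CARD('n) * p) * 2 ^ \<sigma> * (1 + real CARD('n)) * B * hw m ^ p"
proof -
  obtain i :: 'n where True by simp
  have "cmod (w m) = cmod (wt i 0 m) * cmod (w m)" by simp
  also have "\<dots> \<le> (\<Lambda> ^ (CARD('n) * p) * 2 ^ \<sigma> * hw m ^ p * (1 + (\<Sum>i\<in>UNIV. cmod (wt i \<sigma> m)))) * cmod (w m)"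
    by (intro mult_right_mono hw_wt_le) (use p in auto)
  also have "\<dots> = (\<Lambda> ^ (CARD('n) * p) * 2 ^ \<sigma> * hw m ^ p) * ((1 + (\<Sum>i\<in>UNIV. cmod (wt i \<sigma> m))) * cmod (w m))"
    by (simp add: mult_ac)
  also have "\<dots> \<le> (\<Lambda> ^ (CARD('n) * p) * 2 ^ \<sigma> * hw m ^ p) * ((1 + real CARD('n)) * B)"
  proof (rule mult_left_mono)
    have nn: "0 \<le> (1 + (\<Sum>i\<in>UNIV. cmod (wt i \<sigma> m))) * cmod (w m)"
      by (intro mult_nonneg_nonneg add_nonneg_nonneg sum_nonneg) auto
    show "(1 + (\<Sum>i\<in>UNIV. cmod (wt i \<sigma> m))) * cmod (w m) \<le> (1 + real CARD('n)) * B"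
      using l2b_point[OF xb_sum_wt[OF w], of m] nn by (simp only: norm_of_real abs_of_nonneg)
  qed (use \<Lambda> hw_pos[of m] in auto)
  finally show ?thesis by (simp add: mult_ac)
qed

text \<open>Of two derivative orders with sum at most \<open>\<sigma>\<close> one is at most half of
  it. The factor carrying that one goes into l1 by \<open>xb_l1b\<close>, and Young's inequality
  applies.\<close>

lemma xb_mult: assumes v: "xb v A" shows "mult v (2 ^ \<sigma> * (Q * A))"
  unfolding mult_def
proof (intro allI impI)
  fix w b assume w: "xb w b"
  have S0: "Q * A * b \<ge> 0" using xb_nonneg[OF w] xb_nonneg[OF v] Q_nonneg by simp
  show "xb (conv v w) (2 ^ \<sigma> * (Q * A) * b)"
    unfolding mult.assoc[of "2 ^ \<sigma>"]
  proof (rule xb_conv_leibniz[OF v w S0])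
    fix i j l assume j: "j \<le> \<sigma>" "l \<le> j"
    consider "2 * l \<le> \<sigma>" | "2 * (j - l) \<le> \<sigma>" using j by linarith
    then show "l2b (conv (\<lambda>m. wt i l m * v m) (\<lambda>m. wt i (j - l) m * w m)) (Q * A * b)"
    proof cases
      case 1
      show ?thesis by (rule l2b_conv_l1b[OF xb_l1b[OF v 1] xbD[OF w] xbD[OF v]]) (use j in auto)
    next
      case 2
      have "l2b (conv (\<lambda>m. wt i (j - l) m * w m) (\<lambda>m. wt i l m * v m)) (Q * b * A)"
        by (rule l2b_conv_l1b[OF xb_l1b[OF w 2] xbD[OF v] xbD[OF w]]) (use j in auto)
      moreover have "conv (\<lambda>m. wt i (j - l) m * w m) (\<lambda>m. wt i l m * v m) = conv (\<lambda>m. wt i l m * v m) (\<lambda>m. wt i (j - l) m * w m)"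
        by (rule ext) (rule conv_commute)
      ultimately show ?thesis by (simp add: mult_ac)
    qed
  qed
qed

lemma multD: "mult v A \<Longrightarrow> xb w b \<Longrightarrow> xb (conv v w) (A * b)"
  by (auto simp: mult_def)

lemma mult_add:
  assumes "mult v A" "mult w B" "l2b v a" "l2b w b"
  shows "mult (\<lambda>m. v m + w m) (A + B)"
  unfolding mult_def
proof (intro allI impI)
  fix u c assume u: "xb u c"
  have "conv (\<lambda>m. v m + w m) u = (\<lambda>m. conv v u m + conv w u m)"
    by (rule ext) (rule conv_add_left[OF assms(3,4) xb_l2b[OF u]])
  then show "xb (conv (\<lambda>m. v m + w m) u) ((A + B) * c)"
    using xb_add[OF multD[OF assms(1) u] multD[OF assms(2) u]] by (simp add: distrib_right)
qed

section \<open>Curves of sequences and the bilinear Duhamel operator\<close>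

definition cont :: "(real \<Rightarrow> int ^ 'n \<Rightarrow> complex) \<Rightarrow> bool" where
  "cont f \<longleftrightarrow> (\<forall>m. continuous_on {0..T} (\<lambda>t. f t m))"

definition nice :: "(real \<Rightarrow> int ^ 'n \<Rightarrow> complex) \<Rightarrow> real \<Rightarrow> bool" where
  "nice f B \<longleftrightarrow> cont f \<and> (\<forall>t\<in>{0..T}. xb (f t) B)"

definition D :: "(real \<Rightarrow> int ^ 'n \<Rightarrow> complex) \<Rightarrow> (real \<Rightarrow> int ^ 'n \<Rightarrow> complex) \<Rightarrow> real \<Rightarrow> int ^ 'n \<Rightarrow> complex" where
  "D f g t m = - \<i> * integral {0..t} (\<lambda>s. cis (\<phi> m * (t - s)) * conv (f s) (g s) m)"

lemma nice_add: "nice f A \<Longrightarrow> nice g B \<Longrightarrow> nice (\<lambda>t m. f t m + g t m) (A + B)"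
  by (auto simp: nice_def cont_def xb_add intro!: continuous_intros)

lemma nice_diff: "nice f A \<Longrightarrow> nice g B \<Longrightarrow> nice (\<lambda>t m. f t m - g t m) (A + B)"
  by (auto simp: nice_def cont_def xb_diff intro!: continuous_intros)

lemma nice_sum: "(\<And>a. a \<in> G \<Longrightarrow> nice (f a) (B a)) \<Longrightarrow> nice (\<lambda>t m. \<Sum>a\<in>G. f a t m) (\<Sum>a\<in>G. B a)"
  by (auto simp: nice_def cont_def intro!: continuous_intros xb_sum)

lemma nice_decay:
  "nice f A \<Longrightarrow> CARD('n) * p \<le> \<sigma> \<Longrightarrow> \<exists>C\<ge>0. \<forall>t\<in>{0..T}. \<forall>m. cmod (f t m) \<le> C * hw m ^ p"
proof (intro exI conjI ballI allI)
  assume f: "nice f A" and p: "CARD('n) * p \<le> \<sigma>"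
  have "A \<ge> 0" using f T by (auto simp: nice_def intro: xb_nonneg)
  then show "0 \<le> \<Lambda> ^ (CARD('n) * p) * 2 ^ \<sigma> * (1 + real CARD('n)) * A" using \<Lambda> by simp
  fix t m assume "t \<in> {0..T}"
  then show "cmod (f t m) \<le> \<Lambda> ^ (CARD('n) * p) * 2 ^ \<sigma> * (1 + real CARD('n)) * A * hw m ^ p"
    using xb_decay[OF _ p] f by (auto simp: nice_def)
qed

lemma conv_cont:
  assumes f: "nice f A" and g: "nice g B"
  shows "continuous_on {0..T} (\<lambda>s. conv (f s) (g s) m)"
proof -
  obtain C where C: "C \<ge> 0" "\<And>t m. t \<in> {0..T} \<Longrightarrow> cmod (f t m) \<le> C * hw m ^ 2"
    using nice_decay[OF f, of 2] \<sigma> by auto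
  obtain C' where C': "C' \<ge> 0" "\<And>t m. t \<in> {0..T} \<Longrightarrow> cmod (g t m) \<le> C' * hw m ^ 2"
    using nice_decay[OF g, of 2] \<sigma> by auto
  have "uniform_limit {0..T} (\<lambda>F s. \<Sum>l\<in>F. f s l * g s (m - l)) (\<lambda>s. conv (f s) (g s) m) (finite_subsets_at_top UNIV)"
    unfolding conv_def
  proof (rule Weierstrass_m_test_general[where M = "\<lambda>l. (C * C') * hw l ^ 2"])
    fix l s assume s: "s \<in> {0..T}"
    have "cmod (g s (m - l)) \<le> C' * hw (m - l) ^ 2" by (rule C'(2)[OF s])
    also have "\<dots> \<le> C' * 1" using C'(1) hw_le_1[of "m - l"] hw_pos[of "m - l"]
      by (intro mult_left_mono power_le_one) auto
    finally have "cmod (f s l) * cmod (g s (m - l)) \<le> (C * hw l ^ 2) * C'"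
      using C(2)[OF s] C(1) by (intro mult_mono) auto
    then show "cmod (f s l * g s (m - l)) \<le> (C * C') * hw l ^ 2" by (simp add: norm_mult mult_ac)
  qed (intro summable_on_cmult_right hw_square_summable)
  then show ?thesis
  proof (rule uniform_limit_theorem[rotated])
    show "\<forall>\<^sub>F F in finite_subsets_at_top UNIV. continuous_on {0..T} (\<lambda>s. \<Sum>l\<in>F. f s l * g s (m - l))"
      using f g by (intro always_eventually allI continuous_intros) (auto simp: nice_def cont_def)
  qed simp
qed

lemma D_integrand_cont:
  assumes "continuous_on {0..T} (\<lambda>s. conv (f s) (g s) m)" "t \<in> {0..T}"
  shows "continuous_on {0..t} (\<lambda>s. cis (\<phi> m * (t - s)) * conv (f s) (g s) m)"
  unfolding cis_conv_exp
  by (intro continuous_intros continuous_on_subset[OF assms(1)]) (use assms in auto)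

text \<open>The phases are unimodular and invisible to \<open>xb\<close>, so the time integral is
  estimated by Minkowski's inequality; no oscillation is exploited and the factor is the full length
  \<open>T\<close>.\<close>

lemma D_bound:
  assumes c: "\<And>m. continuous_on {0..T} (\<lambda>s. conv (f s) (g s) m)"
    and b: "\<And>s. s \<in> {0..T} \<Longrightarrow> xb (conv (f s) (g s)) C" and t: "t \<in> {0..T}"
  shows "xb (D f g t) (T * C)"
  unfolding xb_def
proof (intro allI impI)
  fix i j assume j: "j \<le> \<sigma>"
  define h where "h s m = wt i j m * ((- \<i>) * cis (\<phi> m * (t - s)) * conv (f s) (g s) m)" for s m
  have "l2b (\<lambda>m. integral {0..t} (\<lambda>s. h s m)) (t * C)"
  proof (rule l2b_integral)
    show "continuous_on {0..t} (\<lambda>s. h s m)" for m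
      using continuous_on_mult_left[OF D_integrand_cont[OF c t], of "wt i j m * (- \<i>)"]
      by (simp add: h_def mult.assoc)
    fix s assume s: "s \<in> {0..t}"
    then show "l2b (h s) C" unfolding h_def
      by (intro xbD[OF xb_cmult[OF b] j]) (use t in \<open>auto simp: norm_mult\<close>)
  qed (use t in auto)
  moreover have "integral {0..t} (\<lambda>s. h s m) = wt i j m * D f g t m" for m
    unfolding h_def D_def by (simp add: integral_mult_right mult.assoc flip: integral_mult_right)
  moreover have "t * C \<le> T * C" using t xb_nonneg[OF b[of 0]] T by (intro mult_right_mono) auto
  ultimately show "l2b (\<lambda>m. wt i j m * D f g t m) (T * C)" by (simp add: l2b_mono)
qed

text \<open>With the phase in \<open>t\<close> pulled out an indefinite integral remains, from which
  continuity in \<open>t\<close> follows.\<close>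

lemma D_alt:
  assumes "continuous_on {0..T} (\<lambda>s. conv (f s) (g s) m)" "t \<in> {0..T}"
  shows "D f g t m = - \<i> * cis (\<phi> m * t) * integral {0..t} (\<lambda>s. cis (- (\<phi> m * s)) * conv (f s) (g s) m)"
proof -
  have "cis (\<phi> m * (t - s)) = cis (\<phi> m * t) * cis (- (\<phi> m * s))" for s
    by (simp add: cis_mult algebra_simps)
  then show ?thesis unfolding D_def by (simp add: mult.assoc)
qed

lemma D_cont:
  assumes "\<And>m. continuous_on {0..T} (\<lambda>s. conv (f s) (g s) m)"
  shows "cont (D f g)"
  unfolding cont_def
proof
  fix m
  have "continuous_on {0..T} (\<lambda>s. cis (- (\<phi> m * s)) * conv (f s) (g s) m)"
    unfolding cis_conv_exp by (intro continuous_intros assms)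
  then have "continuous_on {0..T} (\<lambda>t. integral {0..t} (\<lambda>s. cis (- (\<phi> m * s)) * conv (f s) (g s) m))"
    by (intro indefinite_integral_continuous_1 integrable_continuous_interval)
  then have "continuous_on {0..T} (\<lambda>t. - \<i> * cis (\<phi> m * t) * integral {0..t} (\<lambda>s. cis (- (\<phi> m * s)) * conv (f s) (g s) m))"
    unfolding cis_conv_exp by (intro continuous_intros)
  then show "continuous_on {0..T} (\<lambda>t. D f g t m)"
    by (rule continuous_on_eq) (simp add: D_alt[OF assms])
qed

lemma D_nice:
  assumes f: "nice f A" and g: "nice g B" and m: "\<And>t. t \<in> {0..T} \<Longrightarrow> mult (f t) M"
  shows "nice (D f g) (T * (M * B))"
  unfolding nice_def
proof (intro conjI ballI)
  show "cont (D f g)" by (rule D_cont) (rule conv_cont[OF f g])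
  fix t assume "t \<in> {0..T}"
  then show "xb (D f g t) (T * (M * B))"
    using g by (intro D_bound conv_cont[OF f g] multD[OF m]) (auto simp: nice_def)
qed

text \<open>Difference of two squares: in the contraction the sum acts as the multiplier and the
  difference is the quantity measured.\<close>

lemma D_square_diff:
  assumes f: "nice f A" and g: "nice g B" and t: "t \<in> {0..T}"
  shows "D f f t m - D g g t m = D (\<lambda>t l. f t l + g t l) (\<lambda>t l. f t l - g t l) t m"
proof -
  have eq: "conv (\<lambda>l. f s l + g s l) (\<lambda>l. f s l - g s l) m = conv (f s) (f s) m - conv (g s) (g s) m" if "s \<in> {0..t}" for s
    by (rule conv_square_diff[symmetric, OF xb_l2b[of _ A] xb_l2b[of _ B]])
       (use f g t that in \<open>auto simp: nice_def\<close>)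
  have "D (\<lambda>t l. f t l + g t l) (\<lambda>t l. f t l - g t l) t m
     = - \<i> * integral {0..t} (\<lambda>s. cis (\<phi> m * (t - s)) * conv (f s) (f s) m - cis (\<phi> m * (t - s)) * conv (g s) (g s) m)"
    unfolding D_def by (intro arg_cong[where f = "(*) (- \<i>)"] integral_cong) (simp only: eq right_diff_distrib)
  also have "\<dots> = D f f t m - D g g t m"
  proof -
    have i: "(\<lambda>s. cis (\<phi> m * (t - s)) * conv (f s) (f s) m) integrable_on {0..t}"
      "(\<lambda>s. cis (\<phi> m * (t - s)) * conv (g s) (g s) m) integrable_on {0..t}"
      by (intro integrable_continuous_interval D_integrand_cont conv_cont[OF f f] conv_cont[OF g g] t)+
    show ?thesis unfolding D_def integral_diff[OF i] by (simp only: right_diff_distrib)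
  qed
  finally show ?thesis by simp
qed

lemma D_sum:
  assumes "\<And>a. a \<in> I \<Longrightarrow> nice (f a) (A a)" "\<And>b. b \<in> J \<Longrightarrow> nice (g b) (B b)" and t: "t \<in> {0..T}"
  shows "D (\<lambda>t m. \<Sum>a\<in>I. f a t m) (\<lambda>t m. \<Sum>b\<in>J. g b t m) t m = (\<Sum>a\<in>I. \<Sum>b\<in>J. D (f a) (g b) t m)"
proof (cases "finite I \<and> finite J")
  case True
  have n: "l2b (f a s) (A a)" "b \<in> J \<Longrightarrow> l2b (g b s) (B b)" if "a \<in> I" "s \<in> {0..t}" for a b s
    using assms that by (auto simp: nice_def intro!: xb_l2b)
  have "conv (\<lambda>m. \<Sum>a\<in>I. f a s m) (\<lambda>m. \<Sum>b\<in>J. g b s m) m = (\<Sum>a\<in>I. \<Sum>b\<in>J. conv (f a s) (g b s) m)"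
    if s: "s \<in> {0..t}" for s
  proof -
    have g: "l2b (\<lambda>m. \<Sum>b\<in>J. g b s m) (\<Sum>b\<in>J. B b)"
      using assms(2) s t by (intro l2b_sum) (auto simp: nice_def intro!: xb_l2b)
    show ?thesis
      using n s by (subst conv_sum_left[OF _ g]) (auto intro!: sum.cong conv_sum_right[where B = B])
  qed
  then have "D (\<lambda>t m. \<Sum>a\<in>I. f a t m) (\<lambda>t m. \<Sum>b\<in>J. g b t m) t m
     = - \<i> * integral {0..t} (\<lambda>s. \<Sum>a\<in>I. \<Sum>b\<in>J. cis (\<phi> m * (t - s)) * conv (f a s) (g b s) m)"
    unfolding D_def by (intro arg_cong[where f = "(*) (- \<i>)"] integral_cong) (simp add: sum_distrib_left)
  also have "\<dots> = (\<Sum>a\<in>I. \<Sum>b\<in>J. D (f a) (g b) t m)"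
  proof -
    have i: "(\<lambda>s. cis (\<phi> m * (t - s)) * conv (f a s) (g b s) m) integrable_on {0..t}" if "a \<in> I" "b \<in> J" for a b
      using that by (auto intro!: integrable_continuous_interval D_integrand_cont conv_cont assms)
    then have "integral {0..t} (\<lambda>s. \<Sum>a\<in>I. \<Sum>b\<in>J. cis (\<phi> m * (t - s)) * conv (f a s) (g b s) m)
      = (\<Sum>a\<in>I. \<Sum>b\<in>J. integral {0..t} (\<lambda>s. cis (\<phi> m * (t - s)) * conv (f a s) (g b s) m))"
      using True by (subst integral_sum) (auto intro!: integrable_sum sum.cong integral_sum)
    then show ?thesis by (simp add: D_def sum_distrib_left)
  qed
  finally show ?thesis .
next
  case False
  then show ?thesis by (auto simp: D_def conv_def)
qed

end

section \<open>Contraction around an approximate solution\<close>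

context duhamel begin

text \<open>The multiplier \<open>f + g\<close> is split into \<open>v + v\<close> and the
  differences \<open>f - v\<close>, \<open>g - v\<close>. The large part multiplies with the
  constant \<open>M\<close>, and the algebra bound with its loss \<open>Q\<close> meets only the
  differences, of size \<open>2 * E\<close>; this is the origin of \<open>small\<close>.\<close>

lemma fixed_point:
  assumes v: "nice v V" and mv: "\<And>t. t \<in> {0..T} \<Longrightarrow> mult (v t) M"
    and res: "\<And>t. t \<in> {0..T} \<Longrightarrow> xb (\<lambda>m. cis (\<phi> m * t) * c m + D v v t m - v t m) E"
    and small: "T * (2 * M + 2 ^ \<sigma> * (Q * (4 * E))) \<le> 1 / 2"
  obtains u where "nice u (V + 2 * E)"
    "\<And>t m. t \<in> {0..T} \<Longrightarrow> u t m = cis (\<phi> m * t) * c m + D u u t m"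
    "\<And>t. t \<in> {0..T} \<Longrightarrow> xb (\<lambda>m. u t m - v t m) (2 * E)"
proof -
  define \<Phi> where "\<Phi> f t m = cis (\<phi> m * t) * c m + D f f t m" for f t m
  define ball where "ball f \<longleftrightarrow> cont f \<and> (\<forall>t\<in>{0..T}. xb (\<lambda>m. f t m - v t m) (2 * E))" for f
  have E0: "E \<ge> 0" using res[of 0] T xb_nonneg by auto
  have ball_nice: "nice f (V + 2 * E)" if "ball f" for f
  proof -
    have "xb (\<lambda>m. v t m + (f t m - v t m)) (V + 2 * E)" if "t \<in> {0..T}" for t
      using that \<open>ball f\<close> v by (intro xb_add) (auto simp: ball_def nice_def)
    then show ?thesis using that by (auto simp: nice_def ball_def)
  qed
  have cont_\<Phi>: "cont (\<Phi> f)" if "ball f" for f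
  proof -
    have "cont (D f f)" by (rule D_cont) (rule conv_cont[OF ball_nice[OF that] ball_nice[OF that]])
    then show ?thesis unfolding cont_def \<Phi>_def cis_conv_exp by (auto intro!: continuous_intros)
  qed
  have contr: "xb (\<lambda>m. \<Phi> f t m - \<Phi> g t m) (\<delta> / 2)"
    if f: "ball f" and g: "ball g" and fg: "\<And>t. t \<in> {0..T} \<Longrightarrow> xb (\<lambda>m. f t m - g t m) \<delta>" and t: "t \<in> {0..T}" for f g \<delta> t
  proof -
    have fg': "nice (\<lambda>t l. f t l + g t l) ((V + 2 * E) + (V + 2 * E))" "nice (\<lambda>t l. f t l - g t l) ((V + 2 * E) + (V + 2 * E))"
      by (intro nice_add nice_diff ball_nice f g)+
    have "mult (\<lambda>l. (v s l + v s l) + ((f s l - v s l) + (g s l - v s l))) ((M + M) + (2 ^ \<sigma> * (Q * (2 * E)) + 2 ^ \<sigma> * (Q * (2 * E))))"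
      if "s \<in> {0..T}" for s
    proof -
      have l: "xb (v s) V" "xb (\<lambda>l. f s l - v s l) (2 * E)" "xb (\<lambda>l. g s l - v s l) (2 * E)"
        using that f g v by (auto simp: ball_def nice_def)
      note l' = l[THEN xb_l2b]
      show ?thesis
        by (rule mult_add[OF mult_add[OF mv[OF that] mv[OF that] l'(1) l'(1)]
              mult_add[OF xb_mult[OF l(2)] xb_mult[OF l(3)] l'(2) l'(3)] l2b_add[OF l'(1) l'(1)] l2b_add[OF l'(2) l'(3)]])
    qed
    moreover have "(v s l + v s l) + ((f s l - v s l) + (g s l - v s l)) = f s l + g s l" for s l by simp
    ultimately have "mult (\<lambda>l. f s l + g s l) ((M + M) + (2 ^ \<sigma> * (Q * (2 * E)) + 2 ^ \<sigma> * (Q * (2 * E))))"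
      if "s \<in> {0..T}" for s using that by simp
    then have "xb (D (\<lambda>t l. f t l + g t l) (\<lambda>t l. f t l - g t l) t)
        (T * (((M + M) + (2 ^ \<sigma> * (Q * (2 * E)) + 2 ^ \<sigma> * (Q * (2 * E)))) * \<delta>))"
      by (intro D_bound conv_cont[OF fg'] multD fg t)
    moreover have "T * (((M + M) + (2 ^ \<sigma> * (Q * (2 * E)) + 2 ^ \<sigma> * (Q * (2 * E)))) * \<delta>) \<le> \<delta> / 2"
    proof -
      have "T * (((M + M) + (2 ^ \<sigma> * (Q * (2 * E)) + 2 ^ \<sigma> * (Q * (2 * E)))) * \<delta>) = (T * (2 * M + 2 ^ \<sigma> * (Q * (4 * E)))) * \<delta>"
        by (simp add: algebra_simps)
      also have "\<dots> \<le> (1 / 2) * \<delta>" using xb_nonneg[OF fg[OF t]] small by (intro mult_right_mono) auto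
      finally show ?thesis by simp
    qed
    moreover have "\<Phi> f t m - \<Phi> g t m = D (\<lambda>t l. f t l + g t l) (\<lambda>t l. f t l - g t l) t m" for m
      using D_square_diff[OF ball_nice[OF f] ball_nice[OF g] t] by (simp add: \<Phi>_def)
    ultimately show ?thesis by (simp add: xb_mono)
  qed
  define z where "z k = (\<Phi> ^^ k) v" for k
  have z0: "z 0 = v" and zS: "z (Suc k) = \<Phi> (z k)" for k by (auto simp: z_def)
  \<comment> \<open>The radii \<open>2 * E * (1 - (1/2) ^ k)\<close> are the partial sums of the
    steps \<open>E * (1/2) ^ k\<close>; they keep every iterate in the ball on which
    \<open>contr\<close> is available.\<close>
  have inv: "cont (z k) \<and> (\<forall>t\<in>{0..T}. xb (\<lambda>m. z k t m - v t m) (2 * E * (1 - (1/2) ^ k))) \<and>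
     (\<forall>t\<in>{0..T}. xb (\<lambda>m. z (Suc k) t m - z k t m) (E * (1/2) ^ k))" for k
  proof (induction k)
    case 0
    then show ?case using v res xb_zero by (auto simp: z0 zS[of 0, unfolded z0] \<Phi>_def nice_def)
  next
    case (Suc k)
    have le2E: "2 * E * (1 - (1/2) ^ k) \<le> 2 * E" for k
      using E0 by (intro mult_left_le) auto
    have bk: "ball (z k)"
      unfolding ball_def using Suc xb_mono[OF _ le2E] by blast
    have c: "cont (z (Suc k))" unfolding zS by (rule cont_\<Phi>[OF bk])
    have d: "xb (\<lambda>m. z (Suc k) t m - v t m) (2 * E * (1 - (1/2) ^ Suc k))" if "t \<in> {0..T}" for t
      using xb_add[of "\<lambda>m. z (Suc k) t m - z k t m" "E * (1/2) ^ k" "\<lambda>m. z k t m - v t m" "2 * E * (1 - (1/2) ^ k)"] Suc that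
      by (simp add: algebra_simps)
    have bS: "ball (z (Suc k))"
      unfolding ball_def using c xb_mono[OF d le2E] by blast
    have "xb (\<lambda>m. z (Suc (Suc k)) t m - z (Suc k) t m) (E * (1/2) ^ Suc k)" if "t \<in> {0..T}" for t
      unfolding zS[of "Suc k"] using contr[OF bS bk _ that, of "E * (1/2) ^ k"] Suc
      by (simp add: zS[of k])
    then show ?case using c d by blast
  qed
  have step: "xb (\<lambda>m. z (Suc k) t m - z k t m) (E * (1/2) ^ k)" if "t \<in> {0..T}" for k t using inv[of k] that by blast
  have cz: "cont (z k)" for k using inv[of k] by blast
  have far: "xb (\<lambda>m. z (k + n) t m - z k t m) (2 * E * (1/2) ^ k)" if t: "t \<in> {0..T}" for k n t
  proof -
    have "xb (\<lambda>m. \<Sum>j<n. z (Suc (k + j)) t m - z (k + j) t m) (\<Sum>j<n. E * (1/2) ^ (k + j))"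
      by (intro xb_sum step t)
    moreover have "(\<Sum>j<n. z (Suc (k + j)) t m - z (k + j) t m) = z (k + n) t m - z k t m" for m
      using sum_lessThan_telescope[of "\<lambda>j. z (k + j) t m" n] by simp
    moreover have "(\<Sum>j<n. E * (1/2) ^ (k + j)) \<le> 2 * E * (1/2) ^ k"
    proof -
      have "(\<Sum>j<n. E * (1/2) ^ (k + j)) = E * (1/2) ^ k * (\<Sum>j<n. (1/2) ^ j)"
        by (simp add: sum_distrib_left power_add mult_ac)
      also have "\<dots> \<le> E * (1/2) ^ k * 2"
      proof (intro mult_left_mono)
        show "(\<Sum>j<n. (1/2::real) ^ j) \<le> 2" by (subst sum_gp_strict) (auto simp: field_simps)
      qed (use E0 in auto)
      finally show ?thesis by simp
    qed
    ultimately show ?thesis by (simp add: xb_mono)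
  qed
  \<comment> \<open>The limit is written as a telescoping series so that the Weierstrass test gives
    continuity in time, one frequency after the other.\<close>
  define u where "u t m = v t m + (\<Sum>k. z (Suc k) t m - z k t m)" for t m
  have ul: "uniform_limit {0..T} (\<lambda>n t. \<Sum>k<n. z (Suc k) t m - z k t m) (\<lambda>t. \<Sum>k. z (Suc k) t m - z k t m) sequentially" for m
  proof (rule Weierstrass_m_test[where M = "\<lambda>k. E * (1/2) ^ k"])
    fix k t assume "t \<in> {0..T}"
    then show "cmod (z (Suc k) t m - z k t m) \<le> E * (1/2) ^ k" by (intro l2b_point[OF xb_l2b[OF step]])
  qed (auto intro!: summable_mult summable_geometric)
  have tele: "(\<Sum>k<n. z (Suc k) t m - z k t m) = z n t m - v t m" for n t m
    using sum_lessThan_telescope[of "\<lambda>j. z j t m" n] by (simp add: z0)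
  have lim: "(\<lambda>n. z n t m) \<longlonglongrightarrow> u t m" if "t \<in> {0..T}" for t m
  proof -
    have "(\<lambda>n. \<Sum>k<n. z (Suc k) t m - z k t m) \<longlonglongrightarrow> (\<Sum>k. z (Suc k) t m - z k t m)"
      by (rule tendsto_uniform_limitI[OF ul that])
    then have "(\<lambda>n. v t m + (\<Sum>k<n. z (Suc k) t m - z k t m)) \<longlonglongrightarrow> u t m"
      unfolding u_def by (intro tendsto_add tendsto_const)
    then show ?thesis unfolding tele by simp
  qed
  have cu: "cont u" unfolding cont_def
  proof
    fix m
    have "continuous_on {0..T} (\<lambda>t. \<Sum>k. z (Suc k) t m - z k t m)"
    proof (rule uniform_limit_theorem[OF _ ul])
      show "\<forall>\<^sub>F n in sequentially. continuous_on {0..T} (\<lambda>t. \<Sum>k<n. z (Suc k) t m - z k t m)"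
        unfolding tele using cz v by (intro always_eventually allI continuous_intros) (auto simp: cont_def nice_def)
    qed simp
    then show "continuous_on {0..T} (\<lambda>t. u t m)"
      unfolding u_def using v by (intro continuous_on_add) (auto simp: cont_def nice_def)
  qed
  have uz: "xb (\<lambda>m. u t m - z k t m) (2 * E * (1/2) ^ k)" if t: "t \<in> {0..T}" for t k
    by (rule xb_limit[where F = sequentially and f = "\<lambda>n m. z (k + n) t m - z k t m"])
       (use far[OF t] in \<open>auto intro!: tendsto_intros LIMSEQ_ignore_initial_segment[OF lim[OF t], of k, unfolded add.commute[of _ k]]\<close>)
  have bu: "ball u" unfolding ball_def using cu uz[of _ 0] by (simp add: z0)
  have bz: "ball (z k)" for k
    unfolding ball_def using cz far[of _ 0 k] by (simp add: z0)
  have fix_u: "u t m = \<Phi> u t m" if t: "t \<in> {0..T}" for t m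
  proof -
    have "(\<lambda>k. z (Suc k) t m - \<Phi> u t m) \<longlonglongrightarrow> 0"
    proof (rule Lim_null_comparison)
      have "cmod (z (Suc k) t m - \<Phi> u t m) \<le> E * (1/2) ^ k" for k
        using l2b_point[OF xb_l2b[OF contr[OF bu bz uz t]], of m k] by (simp add: zS norm_minus_commute)
      then show "\<forall>\<^sub>F k in sequentially. cmod (z (Suc k) t m - \<Phi> u t m) \<le> E * (1/2) ^ k" by simp
      have "(\<lambda>k. E * (1/2) ^ k) \<longlonglongrightarrow> E * 0" by (intro tendsto_intros LIMSEQ_power_zero) auto
      then show "(\<lambda>k. E * (1/2) ^ k) \<longlonglongrightarrow> 0" by simp
    qed
    then have "(\<lambda>k. z (Suc k) t m) \<longlonglongrightarrow> \<Phi> u t m" by (rule LIM_zero_cancel)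
    then show ?thesis using LIMSEQ_Suc[OF lim[OF t, of m]] LIMSEQ_unique by blast
  qed
  show ?thesis
    by (rule that[OF ball_nice[OF bu]]) (use fix_u bu in \<open>auto simp: \<Phi>_def ball_def\<close>)
qed

lemma mult_sum:
  assumes "finite G" "\<And>a. a \<in> G \<Longrightarrow> mult (f a) (A a)" "\<And>a. a \<in> G \<Longrightarrow> l2b (f a) (B a)"
  shows "mult (\<lambda>m. \<Sum>a\<in>G. f a m) (\<Sum>a\<in>G. A a)"
  using assms
proof (induction G rule: finite_induct)
  case empty
  have "conv (\<lambda>_. 0) w = (\<lambda>_. 0)" for w :: "int ^ 'n \<Rightarrow> complex" by (rule ext) (simp add: conv_def)
  then show ?case by (simp add: mult_def xb_zero)
next
  case (insert a G)
  have "mult (\<lambda>m. f a m + (\<Sum>a\<in>G. f a m)) (A a + (\<Sum>a\<in>G. A a))"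
    by (rule mult_add[where b = "\<Sum>a\<in>G. B a" and a = "B a"]) (use insert in \<open>auto intro!: l2b_sum\<close>)
  then show ?case using insert by simp
qed

end

section \<open>Lipschitz dependence of Duhamel integrals on time\<close>

lemma cmod_cis_diff_le: "cmod (cis a - cis b) \<le> \<bar>a - b\<bar>"
proof -
  have "cis a - cis b = cis b * (cis (a - b) - 1)" by (simp add: cis_mult algebra_simps)
  then have "cmod (cis a - cis b) = cmod (cis (a - b) - 1)" by (simp add: norm_mult)
  also have "\<dots> \<le> \<bar>a - b\<bar>" using iexp_approx1[of "a - b" 0] by (simp add: cis_conv_exp)
  finally show ?thesis .
qed

text \<open>The integral is a phase times an indefinite integral of size at most
  \<open>T * H\<close>: varying the phase contributes \<open>|p| * T * H\<close>, varying the end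
  point \<open>H\<close>.\<close>

lemma duhamel_integral_lipschitz:
  fixes h :: "real \<Rightarrow> complex"
  assumes h: "continuous_on {0..T} h" "\<And>s. s \<in> {0..T} \<Longrightarrow> cmod (h s) \<le> H" and t: "t \<in> {0..T}" "t' \<in> {0..T}"
  shows "cmod (integral {0..t} (\<lambda>s. cis (p * (t - s)) * h s) - integral {0..t'} (\<lambda>s. cis (p * (t' - s)) * h s))
    \<le> \<bar>t - t'\<bar> * ((\<bar>p\<bar> * T + 1) * H)"
proof -
  define G where "G t = integral {0..t} (\<lambda>s. cis (- (p * s)) * h s)" for t
  have T: "T \<ge> 0" using t by auto
  have H: "H \<ge> 0" using h(2)[of 0] T norm_ge_zero[of "h 0"] by (meson atLeastAtMost_iff order_refl order_trans)
  have c: "continuous_on {a..b} (\<lambda>s. cis (- (p * s)) * h s)" if "0 \<le> a" "b \<le> T" for a b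
    unfolding cis_conv_exp by (intro continuous_intros continuous_on_subset[OF h(1)]) (use that in auto)
  have eq: "integral {0..t} (\<lambda>s. cis (p * (t - s)) * h s) = cis (p * t) * G t" for t
  proof -
    have "cis (p * (t - s)) = cis (p * t) * cis (- (p * s))" for s by (simp add: cis_mult algebra_simps)
    then show ?thesis by (simp add: G_def mult.assoc)
  qed
  have G: "cmod (G t) \<le> T * H" if "t \<in> {0..T}" for t
  proof -
    have "cmod (G t) \<le> H * (t - 0)" unfolding G_def
      by (rule integral_bound) (use that h(2) in \<open>auto intro!: c simp: norm_mult\<close>)
    also have "\<dots> \<le> H * T" using that H by (intro mult_left_mono) auto
    finally show ?thesis by (simp add: mult.commute)
  qed
  have Gd: "cmod (G t - G t') \<le> H * (t - t')" if "t' \<le> t" "t \<in> {0..T}" "t' \<in> {0..T}" for t t'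
  proof -
    have "G t' + integral {t'..t} (\<lambda>s. cis (- (p * s)) * h s) = G t"
      unfolding G_def by (rule Henstock_Kurzweil_Integration.integral_combine) (use that in \<open>auto intro!: integrable_continuous_interval c\<close>)
    then have "cmod (G t - G t') = cmod (integral {t'..t} (\<lambda>s. cis (- (p * s)) * h s))" by (metis add_diff_cancel_left')
    also have "\<dots> \<le> H * (t - t')"
      by (rule integral_bound) (use that h(2) in \<open>auto intro!: c simp: norm_mult\<close>)
    finally show ?thesis .
  qed
  have Gd': "cmod (G t - G t') \<le> H * \<bar>t - t'\<bar>"
    using Gd[of t' t] Gd[of t t'] t by (cases "t' \<le> t") (auto simp: norm_minus_commute)
  have "cis (p * t) * G t - cis (p * t') * G t' = (cis (p * t) - cis (p * t')) * G t + cis (p * t') * (G t - G t')"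
    by (simp add: algebra_simps)
  then have "cmod (cis (p * t) * G t - cis (p * t') * G t') \<le> cmod (cis (p * t) - cis (p * t')) * cmod (G t) + cmod (G t - G t')"
    by (metis (no_types) norm_cis norm_mult norm_triangle_ineq mult_1)
  also have "\<dots> \<le> (\<bar>p\<bar> * \<bar>t - t'\<bar>) * (T * H) + H * \<bar>t - t'\<bar>"
  proof (intro add_mono mult_mono G Gd' t)
    show "cmod (cis (p * t) - cis (p * t')) \<le> \<bar>p\<bar> * \<bar>t - t'\<bar>"
      using cmod_cis_diff_le[of "p * t" "p * t'"] by (simp add: abs_mult right_diff_distrib[symmetric])
  qed auto
  finally show ?thesis unfolding eq by (simp add: algebra_simps)
qed

section \<open>Expansion in binary trees\<close>

text \<open>Words of length \<open>n\<close>. Ordered words rather than multisets index the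
  monomials, so that products of polynomials become concatenations and coefficients may stay
  unsymmetrized.\<close>

definition Ls :: "'a set \<Rightarrow> nat \<Rightarrow> 'a list set" where
  "Ls K n = {ks. set ks \<subseteq> K \<and> length ks = n}"

lemma finite_Ls: "finite K \<Longrightarrow> finite (Ls K n)"
  unfolding Ls_def by (rule finite_lists_length_eq)

lemma card_Ls: "finite K \<Longrightarrow> card (Ls K n) = card K ^ n"
  unfolding Ls_def by (rule card_lists_length_eq)

lemma sum_Ls_append:
  "(\<Sum>ks\<in>Ls K (p + q). F (take p ks) (drop p ks)) = (\<Sum>ks\<in>Ls K p. \<Sum>ls\<in>Ls K q. F ks ls)"
proof -
  have "(\<Sum>ks\<in>Ls K p. \<Sum>ls\<in>Ls K q. F ks ls) = (\<Sum>(ks, ls)\<in>Ls K p \<times> Ls K q. F ks ls)"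
    by (rule sum.cartesian_product)
  also have "\<dots> = (\<Sum>ks\<in>Ls K (p + q). F (take p ks) (drop p ks))"
  proof (rule sum.reindex_bij_witness[where i = "\<lambda>ks. (take p ks, drop p ks)" and j = "\<lambda>(ks, ls). ks @ ls"])
    fix ks assume "ks \<in> Ls K (p + q)"
    then show "(take p ks, drop p ks) \<in> Ls K p \<times> Ls K q"
      by (auto simp: Ls_def dest: in_set_takeD in_set_dropD)
  qed (auto simp: Ls_def)
  finally show ?thesis by simp
qed

lemma Ls_1: "Ls K 1 = (\<lambda>k. [k]) ` K"
  by (auto simp: Ls_def length_Suc_conv)

context duhamel begin

text \<open>\<open>Th n t ks\<close> is the sum, over the binary trees with the \<open>n + 1\<close> leaves \<open>ks\<close> in this order, of the
  iterated oscillatory time integrals of the tree; \<open>Lv K y n t\<close> is the term of degree \<open>n + 1\<close>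
  in \<open>y\<close> of the Picard expansion.\<close>

function Th :: "nat \<Rightarrow> real \<Rightarrow> (int ^ 'n) list \<Rightarrow> complex" where
  "Th 0 t ks = cis (\<phi> (sum_list ks) * t)"
| "Th (Suc n) t ks = (\<Sum>a\<in>{..n}. - \<i> * integral {0..t} (\<lambda>s. cis (\<phi> (sum_list ks) * (t - s)) *
     (Th a s (take (Suc a) ks) * Th (n - a) s (drop (Suc a) ks))))"
  by pat_completeness auto
termination by (relation "Wellfounded.measure (\<lambda>(n, _, _). n)") auto

declare Th.simps(2) [simp del]

lemma fact_mult_le: "a \<le> n \<Longrightarrow> fact a * fact (n - a) \<le> (fact n :: real)"
proof -
  assume a: "a \<le> n"
  have "fact a * fact (n - a) * 1 \<le> fact a * fact (n - a) * real (n choose a)"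
    using a by (intro mult_left_mono) (auto simp: Suc_le_eq)
  also have "\<dots> = fact n" using binomial_fact_lemma[OF a] by (metis of_nat_fact of_nat_mult)
  finally show ?thesis by simp
qed

text \<open>A tree of order \<open>k + 1\<close> splits at the root in \<open>k + 1\<close> ways,
  each bounded by \<open>fact k * T ^ k * T\<close>. The factorial is a crude but inductively stable
  majorant of the number of trees.\<close>

lemma Th_props:
  "continuous_on {0..T} (\<lambda>t. Th n t ks) \<and> (\<forall>t\<in>{0..T}. cmod (Th n t ks) \<le> fact n * T ^ n)"
proof (induction n arbitrary: ks rule: less_induct)
  case (less n)
  show ?case
  proof (cases n)
    case 0
    then show ?thesis by (auto simp: cis_conv_exp intro!: continuous_intros)
  next
    case (Suc k)
    define h where "h a s = Th a s (take (Suc a) ks) * Th (k - a) s (drop (Suc a) ks)" for a s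
    have h: "continuous_on {0..T} (h a)" if "a \<le> k" for a
      unfolding h_def using less[of a] less[of "k - a"] that Suc by (intro continuous_on_mult) auto
    have hb: "cmod (h a s) \<le> fact k * T ^ k" if "a \<le> k" "s \<in> {0..T}" for a s
    proof -
      have "cmod (h a s) \<le> (fact a * T ^ a) * (fact (k - a) * T ^ (k - a))"
        unfolding h_def norm_mult using less[of a] less[of "k - a"] that Suc T by (intro mult_mono) auto
      also have "\<dots> = (fact a * fact (k - a)) * T ^ k" using that by (simp add: power_add[symmetric] mult_ac)
      also have "\<dots> \<le> fact k * T ^ k" using T that by (intro mult_right_mono fact_mult_le) auto
      finally show ?thesis .
    qed
    have Th: "Th n t ks = (\<Sum>a\<in>{..k}. - \<i> * integral {0..t} (\<lambda>s. cis (\<phi> (sum_list ks) * (t - s)) * h a s))" for t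
      by (simp add: Suc Th.simps(2) h_def)
    have c: "continuous_on {0..T} (\<lambda>t. integral {0..t} (\<lambda>s. cis (\<phi> (sum_list ks) * (t - s)) * h a s))" if a: "a \<le> k" for a
    proof (rule lipschitz_on_continuous_on, rule lipschitz_onI)
      fix t t' assume t: "t \<in> {0..T}" "t' \<in> {0..T}"
      show "dist (integral {0..t} (\<lambda>s. cis (\<phi> (sum_list ks) * (t - s)) * h a s))
          (integral {0..t'} (\<lambda>s. cis (\<phi> (sum_list ks) * (t' - s)) * h a s))
          \<le> ((\<bar>\<phi> (sum_list ks)\<bar> * T + 1) * (fact k * T ^ k)) * dist t t'"
        using duhamel_integral_lipschitz[OF h[OF a] hb[OF a] t, of "\<phi> (sum_list ks)"]
        by (simp only: dist_norm real_norm_def mult.commute[of "\<bar>t - t'\<bar>"])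
    qed (use T in auto)
    have b: "cmod (integral {0..t} (\<lambda>s. cis (\<phi> (sum_list ks) * (t - s)) * h a s)) \<le> fact k * T ^ k * T"
      if a: "a \<le> k" and t: "t \<in> {0..T}" for a t
    proof -
      have "cmod (integral {0..t} (\<lambda>s. cis (\<phi> (sum_list ks) * (t - s)) * h a s)) \<le> fact k * T ^ k * (t - 0)"
        by (rule integral_bound)
           (use t hb[OF a] in \<open>auto simp: norm_mult cis_conv_exp intro!: continuous_intros continuous_on_subset[OF h[OF a]]\<close>)
      also have "\<dots> \<le> fact k * T ^ k * T" using t T by (intro mult_left_mono) auto
      finally show ?thesis .
    qed
    have "cmod (Th n t ks) \<le> fact n * T ^ n" if t: "t \<in> {0..T}" for t
    proof -
      have "cmod (Th n t ks) \<le> (\<Sum>a\<in>{..k}. fact k * T ^ k * T)"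
        unfolding Th by (rule sum_norm_le) (use b t in \<open>auto simp: norm_mult\<close>)
      then show ?thesis by (simp add: Suc mult_ac)
    qed
    moreover have "continuous_on {0..T} (\<lambda>t. Th n t ks)"
      unfolding Th using c by (intro continuous_intros) auto
    ultimately show ?thesis by blast
  qed
qed

lemmas Th_cont = Th_props[THEN conjunct1] and Th_bound = Th_props[THEN conjunct2, rule_format]

lemma Th_lipschitz:
  assumes t: "t \<in> {0..T}" "t' \<in> {0..T}"
  shows "cmod (Th n t ks - Th n t' ks) \<le> \<bar>t - t'\<bar> * ((\<bar>\<phi> (sum_list ks)\<bar> + 1) * fact n * (1 + T) ^ n)"
proof (cases n)
  case 0
  have "cmod (Th n t ks - Th n t' ks) \<le> \<bar>\<phi> (sum_list ks)\<bar> * \<bar>t - t'\<bar>"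
    using cmod_cis_diff_le[of "\<phi> (sum_list ks) * t" "\<phi> (sum_list ks) * t'"] 0
    by (simp add: right_diff_distrib[symmetric] abs_mult)
  then show ?thesis using 0 by (simp add: algebra_simps)
next
  case (Suc k)
  define h where "h a s = Th a s (take (Suc a) ks) * Th (k - a) s (drop (Suc a) ks)" for a s
  have h: "continuous_on {0..T} (h a)" for a
    unfolding h_def by (intro continuous_on_mult Th_cont)
  have hb: "cmod (h a s) \<le> fact k * T ^ k" if "a \<le> k" "s \<in> {0..T}" for a s
  proof -
    have "cmod (h a s) \<le> (fact a * T ^ a) * (fact (k - a) * T ^ (k - a))"
      unfolding h_def norm_mult using that T by (intro mult_mono Th_bound) auto
    also have "\<dots> = (fact a * fact (k - a)) * T ^ k" using that by (simp add: power_add[symmetric] mult_ac)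
    also have "\<dots> \<le> fact k * T ^ k" using T that by (intro mult_right_mono fact_mult_le) auto
    finally show ?thesis .
  qed
  have Th: "Th n t ks = (\<Sum>a\<in>{..k}. - \<i> * integral {0..t} (\<lambda>s. cis (\<phi> (sum_list ks) * (t - s)) * h a s))" for t
    by (simp add: Suc Th.simps(2) h_def)
  have eq: "Th n t ks - Th n t' ks = (\<Sum>a\<in>{..k}. - \<i> * (integral {0..t} (\<lambda>s. cis (\<phi> (sum_list ks) * (t - s)) * h a s)
      - integral {0..t'} (\<lambda>s. cis (\<phi> (sum_list ks) * (t' - s)) * h a s)))"
    unfolding Th sum_subtractf[symmetric] right_diff_distrib ..
  have "cmod (Th n t ks - Th n t' ks) \<le> (\<Sum>a\<in>{..k}. \<bar>t - t'\<bar> * ((\<bar>\<phi> (sum_list ks)\<bar> * T + 1) * (fact k * T ^ k)))"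
    unfolding eq using duhamel_integral_lipschitz[OF h hb t] by (intro sum_norm_le) (simp add: norm_mult)
  also have "\<dots> = \<bar>t - t'\<bar> * ((\<bar>\<phi> (sum_list ks)\<bar> * T + 1) * fact n * T ^ k)"
    by (simp add: Suc algebra_simps)
  also have "\<dots> \<le> \<bar>t - t'\<bar> * (((\<bar>\<phi> (sum_list ks)\<bar> + 1) * (1 + T)) * fact n * (1 + T) ^ k)"
    using T by (intro mult_left_mono mult_mono power_mono) (auto simp: algebra_simps)
  also have "\<dots> = \<bar>t - t'\<bar> * ((\<bar>\<phi> (sum_list ks)\<bar> + 1) * fact n * (1 + T) ^ n)"
    by (simp add: Suc mult_ac)
  finally show ?thesis .
qed

definition Lv :: "(int ^ 'n) set \<Rightarrow> (int ^ 'n \<Rightarrow> complex) \<Rightarrow> nat \<Rightarrow> real \<Rightarrow> int ^ 'n \<Rightarrow> complex" where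
  "Lv K y a t m = (\<Sum>ks\<in>Ls K (Suc a). if sum_list ks = m then Th a t ks * prod_list (map y ks) else 0)"

lemma Lv_support: "m \<notin> sum_list ` Ls K (Suc a) \<Longrightarrow> Lv K y a t m = 0"
  unfolding Lv_def by (rule sum.neutral) auto

text \<open>At a fixed time and point the Picard term, under any Fourier multiplier
  \<open>w\<close>, is a homogeneous polynomial of degree \<open>a + 1\<close> in \<open>y\<close>;
  to this form the Gaussian tail bound applies.\<close>

lemma trig_Lv:
  assumes K: "finite K"
  shows "trig (\<lambda>m. w m * Lv K y a t m) x = (\<Sum>ks\<in>Ls K (Suc a). w (sum_list ks) * Th a t ks * ch (sum_list ks) x * prod_list (map y ks))"
proof -
  have "trig (\<lambda>m. w m * Lv K y a t m) x = (\<Sum>m\<in>sum_list ` Ls K (Suc a). w m * Lv K y a t m * ch m x)"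
    by (rule trig_finite) (auto simp: Lv_support finite_Ls K)
  also have "\<dots> = (\<Sum>m\<in>sum_list ` Ls K (Suc a). \<Sum>ks\<in>Ls K (Suc a). if sum_list ks = m then w m * Th a t ks * ch m x * prod_list (map y ks) else 0)"
    unfolding Lv_def sum_distrib_left sum_distrib_right by (intro sum.cong refl) auto
  also have "\<dots> = (\<Sum>ks\<in>Ls K (Suc a). \<Sum>m\<in>sum_list ` Ls K (Suc a). if sum_list ks = m then w m * Th a t ks * ch m x * prod_list (map y ks) else 0)"
    by (rule sum.swap)
  also have "\<dots> = (\<Sum>ks\<in>Ls K (Suc a). w (sum_list ks) * Th a t ks * ch (sum_list ks) x * prod_list (map y ks))"
    by (intro sum.cong refl, subst sum.delta') (auto simp: finite_Ls K)
  finally show ?thesis .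
qed

lemma Lv_0: "finite K \<Longrightarrow> (\<And>m. m \<notin> K \<Longrightarrow> y m = 0) \<Longrightarrow> Lv K y 0 t m = cis (\<phi> m * t) * y m"
proof -
  assume K: "finite K" "\<And>m. m \<notin> K \<Longrightarrow> y m = 0"
  have "Lv K y 0 t m = (\<Sum>k\<in>K. if k = m then cis (\<phi> k * t) * y k else 0)"
    unfolding Lv_def using Ls_1[of K] by (auto simp: sum.reindex inj_on_def intro!: sum.cong)
  then show ?thesis using K by (simp add: sum.delta)
qed

lemma conv_delta:
  "conv (\<lambda>l. if p = l then c else 0) (\<lambda>l. if q = l then d else 0) m = (if p + q = m then c * d else 0)" for p :: "'z::ab_group_add"
  using conv_finite[of "{p}" "\<lambda>l. if p = l then c else 0" "\<lambda>l. if q = l then d else 0" m]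
  by (auto simp: algebra_simps)

lemma l2b_delta: "l2b (\<lambda>l. if p = l then c else 0) (cmod c)" for p :: 'z
  unfolding l2b_def
proof (intro allI impI)
  fix F :: "'z set" assume F: "finite F"
  have "L2_set (\<lambda>m. cmod (if p = m then c else 0)) F \<le> (\<Sum>m\<in>F. cmod (if p = m then c else 0))"
    by (rule L2_set_le_sum) auto
  also have "\<dots> = (\<Sum>m\<in>F. if p = m then cmod c else 0)" by (intro sum.cong) auto
  also have "\<dots> \<le> cmod c" using F by simp
  finally show "L2_set (\<lambda>m. cmod (if p = m then c else 0)) F \<le> cmod c" .
qed

lemma conv_sum_delta:
  fixes p :: "'i \<Rightarrow> 'z::ab_group_add" and q :: "'j \<Rightarrow> 'z"
  shows "conv (\<lambda>m. \<Sum>i\<in>I. if p i = m then c i else 0) (\<lambda>m. \<Sum>j\<in>J. if q j = m then d j else 0) m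
    = (\<Sum>i\<in>I. \<Sum>j\<in>J. if p i + q j = m then c i * d j else 0)"
proof -
  define f where "f i m = (if p i = m then c i else 0)" for i m
  define g where "g j m = (if q j = m then d j else 0)" for j m
  have f: "l2b (f i) (cmod (c i))" and g: "l2b (g j) (cmod (d j))" for i j
    unfolding f_def g_def by (rule l2b_delta)+
  have gs: "l2b (\<lambda>m. \<Sum>j\<in>J. g j m) (\<Sum>j\<in>J. cmod (d j))" by (rule l2b_sum) (rule g)
  have "conv (\<lambda>m. \<Sum>i\<in>I. f i m) (\<lambda>m. \<Sum>j\<in>J. g j m) m = (\<Sum>i\<in>I. conv (f i) (\<lambda>m. \<Sum>j\<in>J. g j m) m)"
    by (rule conv_sum_left[where A = "\<lambda>i. cmod (c i)" and B = "\<Sum>j\<in>J. cmod (d j)", OF f gs])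
  also have "\<dots> = (\<Sum>i\<in>I. \<Sum>j\<in>J. conv (f i) (g j) m)"
    by (rule sum.cong[OF refl]) (rule conv_sum_right[where B = "\<lambda>j. cmod (d j)", OF f g])
  also have "\<dots> = (\<Sum>i\<in>I. \<Sum>j\<in>J. if p i + q j = m then c i * d j else 0)"
    unfolding f_def g_def conv_delta ..
  finally show ?thesis unfolding f_def g_def .
qed

lemma conv_Lv:
  "conv (Lv K y a s) (Lv K y b s) m = (\<Sum>ks\<in>Ls K (Suc a). \<Sum>ls\<in>Ls K (Suc b).
     if sum_list ks + sum_list ls = m then (Th a s ks * Th b s ls) * (prod_list (map y ks) * prod_list (map y ls)) else 0)"
proof -
  have "conv (Lv K y a s) (Lv K y b s) m = (\<Sum>ks\<in>Ls K (Suc a). \<Sum>ls\<in>Ls K (Suc b).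
     if sum_list ks + sum_list ls = m then (Th a s ks * prod_list (map y ks)) * (Th b s ls * prod_list (map y ls)) else 0)"
    unfolding Lv_def by (rule conv_sum_delta)
  also have "\<dots> = (\<Sum>ks\<in>Ls K (Suc a). \<Sum>ls\<in>Ls K (Suc b).
     if sum_list ks + sum_list ls = m then (Th a s ks * Th b s ls) * (prod_list (map y ks) * prod_list (map y ls)) else 0)"
    by (intro sum.cong refl if_cong) (simp only: mult_ac)
  finally show ?thesis .
qed

text \<open>Picard recursion: cutting a word after \<open>a + 1\<close> letters separates the leaves
  of the two subtrees at the root, whose product in physical space is the convolution.\<close>

lemma Lv_Suc:
  assumes K: "finite K" and t: "t \<in> {0..T}"
  shows "Lv K y (Suc n) t m = (\<Sum>a\<le>n. D (Lv K y a) (Lv K y (n - a)) t m)"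
proof -
  have D: "D (Lv K y a) (Lv K y (n - a)) t m = (\<Sum>ks\<in>Ls K (Suc (Suc n)). if sum_list ks = m then
      (- \<i> * integral {0..t} (\<lambda>s. cis (\<phi> (sum_list ks) * (t - s)) * (Th a s (take (Suc a) ks) * Th (n - a) s (drop (Suc a) ks))))
      * prod_list (map y ks) else 0)" if a: "a \<le> n" for a
  proof -
    have len: "Suc (Suc n) = Suc a + Suc (n - a)" using a by simp
    have c: "conv (Lv K y a s) (Lv K y (n - a) s) m = (\<Sum>ks\<in>Ls K (Suc (Suc n)).
        if sum_list ks = m then (Th a s (take (Suc a) ks) * Th (n - a) s (drop (Suc a) ks)) * prod_list (map y ks) else 0)" for s
    proof -
      have sl: "sum_list (take (Suc a) ks) + sum_list (drop (Suc a) ks) = sum_list ks" for ks :: "(int ^ 'n) list"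
        by (simp flip: sum_list_append)
      have pl: "prod_list (map y (take (Suc a) ks)) * prod_list (map y (drop (Suc a) ks)) = prod_list (map y ks)" for ks
        by (simp flip: prod_list.append map_append)
      have "conv (Lv K y a s) (Lv K y (n - a) s) m = (\<Sum>ks\<in>Ls K (Suc a + Suc (n - a)).
        if sum_list (take (Suc a) ks) + sum_list (drop (Suc a) ks) = m then (Th a s (take (Suc a) ks) * Th (n - a) s (drop (Suc a) ks)) *
          (prod_list (map y (take (Suc a) ks)) * prod_list (map y (drop (Suc a) ks))) else 0)"
        unfolding conv_Lv
        by (rule sum_Ls_append[symmetric, where F = "\<lambda>ks ls. if sum_list ks + sum_list ls = m then (Th a s ks * Th (n - a) s ls) * (prod_list (map y ks) * prod_list (map y ls)) else 0"])
      then show ?thesis by (simp only: sl pl len)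
    qed
    have i: "(\<lambda>s. if sum_list ks = m then cis (\<phi> (sum_list ks) * (t - s)) * (Th a s (take (Suc a) ks) * Th (n - a) s (drop (Suc a) ks)) * prod_list (map y ks) else 0)
      integrable_on {0..t}" for ks
      using t unfolding cis_conv_exp
      by (cases "sum_list ks = m")
         (auto intro!: integrable_continuous_interval continuous_intros continuous_on_subset[OF Th_cont])
    have "D (Lv K y a) (Lv K y (n - a)) t m = - \<i> * integral {0..t} (\<lambda>s. \<Sum>ks\<in>Ls K (Suc (Suc n)).
      if sum_list ks = m then cis (\<phi> (sum_list ks) * (t - s)) * (Th a s (take (Suc a) ks) * Th (n - a) s (drop (Suc a) ks)) * prod_list (map y ks) else 0)"
      unfolding D_def c sum_distrib_left by (intro arg_cong[where f = "(*) (- \<i>)"] integral_cong sum.cong refl) auto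
    also have "\<dots> = (\<Sum>ks\<in>Ls K (Suc (Suc n)). - \<i> * integral {0..t} (\<lambda>s.
      if sum_list ks = m then cis (\<phi> (sum_list ks) * (t - s)) * (Th a s (take (Suc a) ks) * Th (n - a) s (drop (Suc a) ks)) * prod_list (map y ks) else 0))"
      by (subst integral_sum) (auto simp: finite_Ls K i sum_distrib_left)
    finally show ?thesis by (auto intro!: sum.cong)
  qed
  have "Lv K y (Suc n) t m = (\<Sum>ks\<in>Ls K (Suc (Suc n)). \<Sum>a\<le>n. if sum_list ks = m then
      (- \<i> * integral {0..t} (\<lambda>s. cis (\<phi> (sum_list ks) * (t - s)) * (Th a s (take (Suc a) ks) * Th (n - a) s (drop (Suc a) ks))))
      * prod_list (map y ks) else 0)"
    unfolding Lv_def Th.simps(2) sum_distrib_right by (intro sum.cong refl) simp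
  also have "\<dots> = (\<Sum>a\<le>n. D (Lv K y a) (Lv K y (n - a)) t m)"
    by (subst sum.swap) (simp add: D)
  finally show ?thesis .
qed

lemma cont_Lv: "cont (Lv K y a)"
  unfolding cont_def Lv_def
proof (intro allI continuous_intros)
  fix m ks
  show "continuous_on {0..T} (\<lambda>t. if sum_list ks = m then Th a t ks * prod_list (map y ks) else 0)"
    by (cases "sum_list ks = m") (auto intro!: continuous_intros Th_cont)
qed

text \<open>Truncating the tree expansion at level \<open>N\<close> leaves only the interactions with \<open>a + b \<ge> N\<close>, so the residual
  \<open>E\<close> is small enough to absorb the loss \<open>Q\<close> in a contraction around the truncated expansion.\<close>

theorem solution_near_trees:
  assumes K: "finite K" "\<And>m. m \<notin> K \<Longrightarrow> y m = 0" and r: "xb r \<rho>"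
    and s: "\<And>a t. a \<le> N \<Longrightarrow> t \<in> {0..T} \<Longrightarrow> sb (Lv K y a t) (S a)"
    and E: "E = \<rho> + T * (2 ^ \<sigma> * (\<Sum>a\<le>N. \<Sum>b\<le>N. if N \<le> a + b then S a * S b else 0))"
    and small: "T * (2 * (2 ^ \<sigma> * (\<Sum>a\<le>N. S a)) + 2 ^ \<sigma> * (Q * (4 * E))) \<le> 1 / 2"
  obtains u where "nice u ((\<Sum>a\<le>N. S a) + 2 * E)"
    "\<And>t m. t \<in> {0..T} \<Longrightarrow> u t m = cis (\<phi> m * t) * (y m + r m) + D u u t m"
    "\<And>t x. t \<in> {0..T} \<Longrightarrow> cmod (trig (u t) x) \<le> (\<Sum>a\<le>N. S a) + Q * (2 * E)"
proof -
  define v where "v t m = (\<Sum>a\<le>N. Lv K y a t m)" for t m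
  have na: "nice (Lv K y a) (S a)" if "a \<le> N" for a
    unfolding nice_def using sb_xb[OF s[OF that]] cont_Lv by auto
  have v: "nice v (\<Sum>a\<le>N. S a)" unfolding v_def by (intro nice_sum na) auto
  have mv: "mult (v t) (2 ^ \<sigma> * (\<Sum>a\<le>N. S a))" if t: "t \<in> {0..T}" for t
    unfolding v_def sum_distrib_left
    by (rule mult_sum[where B = S]) (use t s in \<open>auto intro!: sb_mult xb_l2b sb_xb\<close>)
  have Dab: "xb (D (Lv K y a) (Lv K y b) t) (T * (2 ^ \<sigma> * (S a * S b)))" if "a \<le> N" "b \<le> N" "t \<in> {0..T}" for a b t
    using D_nice[OF na[of a] na[of b] sb_mult[OF s[of a]]] that by (simp add: nice_def mult_ac)
  have resid: "cis (\<phi> m * t) * (y m + r m) + D v v t m - v t m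
     = cis (\<phi> m * t) * r m + (\<Sum>a\<le>N. \<Sum>b\<le>N. if N \<le> a + b then D (Lv K y a) (Lv K y b) t m else 0)"
    if t: "t \<in> {0..T}" for t m
  proof -
    have dv: "D v v t m = (\<Sum>a\<le>N. \<Sum>b\<le>N. D (Lv K y a) (Lv K y b) t m)"
      unfolding v_def by (rule D_sum[OF na na t]) auto
    \<comment> \<open>The term of order \<open>n + 1\<close> collects the pairs with
      \<open>a + b = n\<close>, so \<open>v\<close> is the free evolution plus all pairs with
      \<open>a + b < N\<close>; of the pairs in \<open>D v v\<close> exactly those with
      \<open>a + b \<ge> N\<close> are left over.\<close>
    have "v t m = Lv K y 0 t m + (\<Sum>n<N. Lv K y (Suc n) t m)"
      unfolding v_def by (simp add: sum.atMost_shift)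
    also have "(\<Sum>n<N. Lv K y (Suc n) t m) = (\<Sum>n<N. \<Sum>a\<le>n. D (Lv K y a) (Lv K y (n - a)) t m)"
      by (simp add: Lv_Suc[OF K(1) t])
    also have "\<dots> = (\<Sum>(n, a)\<in>Sigma {..<N} (\<lambda>n. {..n}). D (Lv K y a) (Lv K y (n - a)) t m)"
      by (rule sum.Sigma) auto
    also have "\<dots> = (\<Sum>(a, b)\<in>{(a, b). a + b < N}. D (Lv K y a) (Lv K y b) t m)"
      by (rule sum.reindex_bij_witness[where i = "\<lambda>(a, b). (a + b, a)" and j = "\<lambda>(n, a). (a, n - a)"]) auto
    also have "\<dots> = (\<Sum>(a, b)\<in>{..N} \<times> {..N}. if N \<le> a + b then 0 else D (Lv K y a) (Lv K y b) t m)"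
      by (rule sum.mono_neutral_cong_left) (auto split: if_splits)
    also have "\<dots> = (\<Sum>a\<le>N. \<Sum>b\<le>N. if N \<le> a + b then 0 else D (Lv K y a) (Lv K y b) t m)"
      by (rule sum.cartesian_product[symmetric])
    finally have "D v v t m - v t m = (\<Sum>a\<le>N. \<Sum>b\<le>N. D (Lv K y a) (Lv K y b) t m - (if N \<le> a + b then 0 else D (Lv K y a) (Lv K y b) t m)) - cis (\<phi> m * t) * y m"
      unfolding dv sum_subtractf by (simp add: Lv_0[OF K])
    moreover have "(\<Sum>a\<le>N. \<Sum>b\<le>N. D (Lv K y a) (Lv K y b) t m - (if N \<le> a + b then 0 else D (Lv K y a) (Lv K y b) t m))
        = (\<Sum>a\<le>N. \<Sum>b\<le>N. if N \<le> a + b then D (Lv K y a) (Lv K y b) t m else 0)"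
      by (intro sum.cong refl) auto
    ultimately show ?thesis by (simp add: algebra_simps)
  qed
  have res: "xb (\<lambda>m. cis (\<phi> m * t) * (y m + r m) + D v v t m - v t m) E" if t: "t \<in> {0..T}" for t
  proof -
    have *: "xb (\<lambda>m. if N \<le> a + b then D (Lv K y a) (Lv K y b) t m else 0) (T * (2 ^ \<sigma> * (if N \<le> a + b then S a * S b else 0)))"
      if "a \<le> N" "b \<le> N" for a b using Dab[OF that t] xb_zero by auto
    have "xb (\<lambda>m. cis (\<phi> m * t) * r m + (\<Sum>a\<le>N. \<Sum>b\<le>N. if N \<le> a + b then D (Lv K y a) (Lv K y b) t m else 0))
      (\<rho> + (\<Sum>a\<le>N. \<Sum>b\<le>N. T * (2 ^ \<sigma> * (if N \<le> a + b then S a * S b else 0))))"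
      by (intro xb_add xb_cmult r xb_sum *) auto
    then show ?thesis unfolding resid[OF t] E by (simp add: sum_distrib_left)
  qed
  obtain u where u: "nice u ((\<Sum>a\<le>N. S a) + 2 * E)"
    "\<And>t m. t \<in> {0..T} \<Longrightarrow> u t m = cis (\<phi> m * t) * (y m + r m) + D u u t m"
    "\<And>t. t \<in> {0..T} \<Longrightarrow> xb (\<lambda>m. u t m - v t m) (2 * E)"
    using fixed_point[OF v mv res small] by blast
  have "cmod (trig (u t) x) \<le> (\<Sum>a\<le>N. S a) + Q * (2 * E)" if t: "t \<in> {0..T}" for t x
  proof -
    obtain i :: 'n where True by simp
    \<comment> \<open>The difference from the expansion is bounded in l1 at the price
      \<open>Q\<close>, which its smallness can afford; the expansion itself is bounded pointwise
      through \<open>sb\<close>.\<close>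
    have ld: "l1b (\<lambda>m. u t m - v t m) (Q * (2 * E))" using xb_l1b[OF u(3)[OF t], of 0 i] by simp
    have l1v: "l1 (Lv K y a t)" if "a \<le> N" for a
      using xb_l1b[OF sb_xb[OF s[OF that t]], of 0 i] by (intro l1b_l1) simp
    have l1vs: "l1 (\<lambda>m. \<Sum>a\<in>A. Lv K y a t m) \<and> trig (\<lambda>m. \<Sum>a\<in>A. Lv K y a t m) x = (\<Sum>a\<in>A. trig (Lv K y a t) x)" if "finite A" "A \<subseteq> {..N}" for A
      using that
    proof (induction A rule: finite_induct)
      case empty then show ?case by (simp add: trig_def)
    next
      case (insert a A)
      have "l1 (\<lambda>m. Lv K y a t m + (\<Sum>a\<in>A. Lv K y a t m))"
        by (rule summable_on_comparison_test[OF summable_on_add[OF l1v[of a] conjunct1[OF insert.IH]]])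
           (use insert in \<open>auto intro: norm_triangle_ineq\<close>)
      then show ?case using insert l1v[of a] by (simp add: trig_add)
    qed
    have "u t = (\<lambda>m. (u t m - v t m) + v t m)" by simp
    then have "trig (u t) x = trig (\<lambda>m. u t m - v t m) x + trig (v t) x"
      using trig_add[OF l1b_l1[OF ld], of "v t" x] l1vs[of "{..N}"] unfolding v_def by simp
    also have "trig (v t) x = (\<Sum>a\<le>N. trig (Lv K y a t) x)"
      using l1vs[of "{..N}"] unfolding v_def by simp
    also have "cmod (trig (\<lambda>m. u t m - v t m) x + (\<Sum>a\<le>N. trig (Lv K y a t) x)) \<le> Q * (2 * E) + (\<Sum>a\<le>N. S a)"
    proof (rule order_trans[OF norm_triangle_ineq], rule add_mono)
      show "cmod (trig (\<lambda>m. u t m - v t m) x) \<le> Q * (2 * E)"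
        by (rule order_trans[OF norm_trig_le[OF l1b_l1[OF ld]] l1b_infsum_le[OF ld]])
      have "cmod (trig (Lv K y a t) x) \<le> S a" if "a \<le> N" for a
        using s[OF that t, unfolded sb_def, THEN conjunct2, rule_format, of 0 i x] by simp
      then show "cmod (\<Sum>a\<le>N. trig (Lv K y a t) x) \<le> (\<Sum>a\<le>N. S a)" by (intro sum_norm_le) auto
    qed
    finally show ?thesis by simp
  qed
  with u show ?thesis using that by blast
qed

end

section \<open>Moments of complex Gaussians\<close>

context prob_space begin

definition nmom :: "nat \<Rightarrow> real" where "nmom n = (\<integral>x. std_normal_density x * x ^ n \<partial>lborel)"

lemma nmom_0: "nmom 0 = 1" using integral_std_normal_moment_even[of 0] by (simp add: nmom_def)
lemma nmom_1: "nmom (Suc 0) = 0" using integral_std_normal_moment_odd[of 0] by (simp add: nmom_def)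

text \<open>Integration by parts against the normal density, read off from the explicit
  moments.\<close>

lemma nmom_Suc_Suc: "nmom (Suc (Suc n)) = real (Suc n) * nmom n"
proof (cases "even n")
  case True
  then obtain k where k: "n = 2 * k" by auto
  have "nmom (2 * Suc k) = fact (2 * Suc k) / (2 ^ Suc k * fact (Suc k))"
    unfolding nmom_def by (rule integral_std_normal_moment_even)
  also have "\<dots> = ((2 * real k + 2) * (2 * real k + 1) * fact (2 * k)) / (2 * 2 ^ k * ((real k + 1) * fact k))"
    by (simp add: algebra_simps)
  also have "\<dots> = ((2 * (real k + 1)) * ((2 * real k + 1) * fact (2 * k))) / ((2 * (real k + 1)) * (2 ^ k * fact k))"
    by (simp add: algebra_simps)
  also have "\<dots> = (2 * real k + 1) * (fact (2 * k) / (2 ^ k * fact k))"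
    by (subst mult_divide_mult_cancel_left) auto
  also have "fact (2 * k) / (2 ^ k * fact k) = nmom (2 * k)"
    unfolding nmom_def by (rule integral_std_normal_moment_even[symmetric])
  finally show ?thesis by (simp add: k algebra_simps)
next
  case False
  then obtain k where k: "n = 2 * k + 1" by (elim oddE)
  show ?thesis using integral_std_normal_moment_odd[of k] integral_std_normal_moment_odd[of "Suc k"]
    by (simp add: nmom_def k)
qed

lemma std_normal_power:
  assumes "distributed M lborel \<eta> std_normal_density"
  shows "integrable M (\<lambda>\<omega>. \<eta> \<omega> ^ n)" "(\<integral>\<omega>. \<eta> \<omega> ^ n \<partial>M) = nmom n"
  using distributed_integrable[OF assms, of "\<lambda>x. x ^ n"] integrable_std_normal_moment[of n]
    distributed_integral[OF assms, of "\<lambda>x. x ^ n"] by (auto simp: nmom_def)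

lemma normal_pair_monomial:
  assumes "distributed M lborel \<eta>1 std_normal_density" "distributed M lborel \<eta>2 std_normal_density"
    "indep_var borel \<eta>1 borel \<eta>2"
  shows "integrable M (\<lambda>\<omega>. \<eta>1 \<omega> ^ a * \<eta>2 \<omega> ^ b)" "(\<integral>\<omega>. \<eta>1 \<omega> ^ a * \<eta>2 \<omega> ^ b \<partial>M) = nmom a * nmom b"
proof -
  have i: "indep_var borel (\<lambda>\<omega>. \<eta>1 \<omega> ^ a) borel (\<lambda>\<omega>. \<eta>2 \<omega> ^ b)"
    using indep_var_compose[OF assms(3), of "\<lambda>x. x ^ a" borel "\<lambda>x. x ^ b" borel] by (simp add: o_def)
  show "integrable M (\<lambda>\<omega>. \<eta>1 \<omega> ^ a * \<eta>2 \<omega> ^ b)" "(\<integral>\<omega>. \<eta>1 \<omega> ^ a * \<eta>2 \<omega> ^ b \<partial>M) = nmom a * nmom b"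
    using indep_var_integrable[OF i] indep_var_lebesgue_integral[OF i] std_normal_power[OF assms(1), of a] std_normal_power[OF assms(2), of b]
    by auto
qed

context
  fixes \<eta>1 \<eta>2 :: "'a \<Rightarrow> real"
  assumes n1: "distributed M lborel \<eta>1 std_normal_density" and n2: "distributed M lborel \<eta>2 std_normal_density"
    and ind: "indep_var borel \<eta>1 borel \<eta>2"
begin

definition gauss_Z :: "'a \<Rightarrow> complex" where "gauss_Z \<omega> = of_real (\<eta>1 \<omega>) + \<i> * of_real (\<eta>2 \<omega>)"

text \<open>Powers of the complex variable and its conjugate are mixed with powers of the two real
  variables, so that expanding one factor \<open>gauss_Z\<close> stays in the family; this closes
  the inductions below.\<close>

definition gauss_mon :: "nat \<Rightarrow> nat \<Rightarrow> nat \<Rightarrow> nat \<Rightarrow> 'a \<Rightarrow> complex" where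
  "gauss_mon i j a b \<omega> = gauss_Z \<omega> ^ i * cnj (gauss_Z \<omega>) ^ j * of_real (\<eta>1 \<omega>) ^ a * of_real (\<eta>2 \<omega>) ^ b"

lemma gauss_mon_Suc1: "gauss_mon (Suc i) j a b \<omega> = gauss_mon i j (Suc a) b \<omega> + \<i> * gauss_mon i j a (Suc b) \<omega>"
  by (simp add: gauss_mon_def gauss_Z_def algebra_simps)

lemma gauss_mon_Suc2: "gauss_mon i (Suc j) a b \<omega> = gauss_mon i j (Suc a) b \<omega> - \<i> * gauss_mon i j a (Suc b) \<omega>"
  by (simp add: gauss_mon_def gauss_Z_def algebra_simps)

lemma integrable_gauss_mon: "integrable M (gauss_mon i j a b)"
proof (induction i arbitrary: a b)
  case 0
  show ?case
  proof (induction j arbitrary: a b)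
    case 0
    have "integrable M (\<lambda>\<omega>. complex_of_real (\<eta>1 \<omega> ^ a * \<eta>2 \<omega> ^ b))"
      using normal_pair_monomial(1)[OF n1 n2 ind, of a b] by (rule integrable_of_real)
    then show ?case by (simp add: gauss_mon_def[abs_def])
  next
    case (Suc j)
    have "gauss_mon 0 (Suc j) a b = (\<lambda>\<omega>. gauss_mon 0 j (Suc a) b \<omega> - \<i> * gauss_mon 0 j a (Suc b) \<omega>)"
      by (rule ext) (rule gauss_mon_Suc2)
    then show ?case using Suc by simp
  qed
next
  case (Suc i)
  have "gauss_mon (Suc i) j a b = (\<lambda>\<omega>. gauss_mon i j (Suc a) b \<omega> + \<i> * gauss_mon i j a (Suc b) \<omega>)"
    by (rule ext) (rule gauss_mon_Suc1)
  then show ?case using Suc by simp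
qed

definition gauss_mom :: "nat \<Rightarrow> nat \<Rightarrow> nat \<Rightarrow> nat \<Rightarrow> complex" where "gauss_mom i j a b = (\<integral>\<omega>. gauss_mon i j a b \<omega> \<partial>M)"

lemma gauss_mom_Suc1: "gauss_mom (Suc i) j a b = gauss_mom i j (Suc a) b + \<i> * gauss_mom i j a (Suc b)"
  unfolding gauss_mom_def gauss_mon_Suc1 using integrable_gauss_mon by simp

lemma gauss_mom_Suc2: "gauss_mom i (Suc j) a b = gauss_mom i j (Suc a) b - \<i> * gauss_mom i j a (Suc b)"
  unfolding gauss_mom_def gauss_mon_Suc2 using integrable_gauss_mon by simp

lemma gauss_mom_00: "gauss_mom 0 0 a b = of_real (nmom a * nmom b)"
proof -
  have "gauss_mom 0 0 a b = (\<integral>\<omega>. complex_of_real (\<eta>1 \<omega> ^ a * \<eta>2 \<omega> ^ b) \<partial>M)"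
    by (simp add: gauss_mom_def gauss_mon_def)
  also have "\<dots> = of_real (nmom a * nmom b)"
    by (simp only: integral_complex_of_real normal_pair_monomial(2)[OF n1 n2 ind])
  finally show ?thesis .
qed

text \<open>Gaussian integration by parts: multiplying by \<open>\<eta>1\<close> or
  \<open>\<eta>2\<close> acts under the expectation as differentiation in that variable. The
  derivatives of \<open>gauss_Z\<close> are \<open>1\<close> and \<open>\<i>\<close>, those of its
  conjugate \<open>1\<close> and \<open>- \<i>\<close>. Where truncated subtraction is at work, the
  coefficient vanishes.\<close>

lemma stein:
  "gauss_mom i j (Suc a) b = of_nat i * gauss_mom (i - 1) j a b + of_nat j * gauss_mom i (j - 1) a b + of_nat a * gauss_mom i j (a - 1) b
   \<and> gauss_mom i j a (Suc b) = \<i> * of_nat i * gauss_mom (i - 1) j a b - \<i> * of_nat j * gauss_mom i (j - 1) a b + of_nat b * gauss_mom i j a (b - 1)"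
proof (induction i arbitrary: a b)
  case 0
  show ?case
  proof (induction j arbitrary: a b)
    case 0
    have n: "nmom (Suc a) = real a * nmom (a - 1)" for a
      by (cases a) (auto simp: nmom_1 nmom_Suc_Suc)
    show ?case by (simp add: gauss_mom_00 n)
  next
    case (Suc j)
    have 1: "of_nat j * gauss_mom 0 j a b = of_nat j * (gauss_mom 0 (j - 1) (Suc a) b - \<i> * gauss_mom 0 (j - 1) a (Suc b))" for a b
      by (cases j) (auto simp: gauss_mom_Suc2)
    have 2: "of_nat a * gauss_mom 0 (Suc j) (a - 1) b = of_nat a * (gauss_mom 0 j a b - \<i> * gauss_mom 0 j (a - 1) (Suc b))" for a b
      by (cases a) (auto simp: gauss_mom_Suc2)
    have 3: "of_nat b * gauss_mom 0 (Suc j) a (b - 1) = of_nat b * (gauss_mom 0 j (Suc a) (b - 1) - \<i> * gauss_mom 0 j a b)" for a b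
      by (cases b) (auto simp: gauss_mom_Suc2)
    have IH1: "gauss_mom 0 j (Suc a) b = of_nat j * gauss_mom 0 (j - 1) a b + of_nat a * gauss_mom 0 j (a - 1) b"
      and IH2: "gauss_mom 0 j a (Suc b) = - \<i> * of_nat j * gauss_mom 0 (j - 1) a b + of_nat b * gauss_mom 0 j a (b - 1)" for a b
      using Suc.IH[of a b] by auto
    have c1: "gauss_mom 0 (Suc j) (Suc a) b = of_nat (Suc j) * gauss_mom 0 j a b + of_nat a * gauss_mom 0 (Suc j) (a - 1) b"
    proof -
      have "gauss_mom 0 (Suc j) (Suc a) b = gauss_mom 0 j (Suc (Suc a)) b - \<i> * gauss_mom 0 j (Suc a) (Suc b)" by (rule gauss_mom_Suc2)
      also have "\<dots> = (of_nat j * gauss_mom 0 (j - 1) (Suc a) b + of_nat (Suc a) * gauss_mom 0 j a b) - \<i> * (of_nat j * gauss_mom 0 (j - 1) a (Suc b) + of_nat a * gauss_mom 0 j (a - 1) (Suc b))"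
        using IH1[of "Suc a" b] IH1[of a "Suc b"] by simp
      also have "\<dots> = of_nat j * gauss_mom 0 j a b + gauss_mom 0 j a b + of_nat a * gauss_mom 0 (Suc j) (a - 1) b"
        unfolding 1 2 by (simp add: algebra_simps)
      finally show ?thesis by (simp add: algebra_simps)
    qed
    have c2: "gauss_mom 0 (Suc j) a (Suc b) = - \<i> * of_nat (Suc j) * gauss_mom 0 j a b + of_nat b * gauss_mom 0 (Suc j) a (b - 1)"
    proof -
      have "gauss_mom 0 (Suc j) a (Suc b) = gauss_mom 0 j (Suc a) (Suc b) - \<i> * gauss_mom 0 j a (Suc (Suc b))" by (rule gauss_mom_Suc2)
      also have "\<dots> = (- \<i> * of_nat j * gauss_mom 0 (j - 1) (Suc a) b + of_nat b * gauss_mom 0 j (Suc a) (b - 1)) - \<i> * (- \<i> * of_nat j * gauss_mom 0 (j - 1) a (Suc b) + of_nat (Suc b) * gauss_mom 0 j a b)"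
        using IH2[of "Suc a" b] IH2[of a "Suc b"] by simp
      also have "\<dots> = - \<i> * (of_nat j * gauss_mom 0 j a b) - \<i> * gauss_mom 0 j a b + of_nat b * gauss_mom 0 (Suc j) a (b - 1)"
        unfolding 1 3 by (simp add: algebra_simps)
      finally show ?thesis by (simp add: algebra_simps)
    qed
    show ?case using c1 c2 by simp
  qed
next
  case (Suc i)
  have 1: "of_nat i * gauss_mom i j a b = of_nat i * (gauss_mom (i - 1) j (Suc a) b + \<i> * gauss_mom (i - 1) j a (Suc b))" for a b
    by (cases i) (auto simp: gauss_mom_Suc1)
  have 2: "of_nat a * gauss_mom (Suc i) j (a - 1) b = of_nat a * (gauss_mom i j a b + \<i> * gauss_mom i j (a - 1) (Suc b))" for a b
    by (cases a) (auto simp: gauss_mom_Suc1)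
  have 3: "of_nat b * gauss_mom (Suc i) j a (b - 1) = of_nat b * (gauss_mom i j (Suc a) (b - 1) + \<i> * gauss_mom i j a b)" for a b
    by (cases b) (auto simp: gauss_mom_Suc1)
  have 4: "gauss_mom (Suc i) (j - 1) a b = gauss_mom i (j - 1) (Suc a) b + \<i> * gauss_mom i (j - 1) a (Suc b)" for a b
    by (rule gauss_mom_Suc1)
  have c1: "gauss_mom (Suc i) j (Suc a) b = of_nat (Suc i) * gauss_mom i j a b + of_nat j * gauss_mom (Suc i) (j - 1) a b + of_nat a * gauss_mom (Suc i) j (a - 1) b"
  proof -
    have "gauss_mom (Suc i) j (Suc a) b = gauss_mom i j (Suc (Suc a)) b + \<i> * gauss_mom i j (Suc a) (Suc b)" by (rule gauss_mom_Suc1)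
    also have "\<dots> = (of_nat i * gauss_mom (i - 1) j (Suc a) b + of_nat j * gauss_mom i (j - 1) (Suc a) b + of_nat (Suc a) * gauss_mom i j a b)
       + \<i> * (of_nat i * gauss_mom (i - 1) j a (Suc b) + of_nat j * gauss_mom i (j - 1) a (Suc b) + of_nat a * gauss_mom i j (a - 1) (Suc b))"
      using Suc.IH[of "Suc a" b] Suc.IH[of a "Suc b"] by simp
    also have "\<dots> = of_nat i * gauss_mom i j a b + gauss_mom i j a b + of_nat j * gauss_mom (Suc i) (j - 1) a b + of_nat a * gauss_mom (Suc i) j (a - 1) b"
      unfolding 1 2 4 by (simp add: algebra_simps)
    finally show ?thesis by (simp add: algebra_simps)
  qed
  have c2: "gauss_mom (Suc i) j a (Suc b) = \<i> * of_nat (Suc i) * gauss_mom i j a b - \<i> * of_nat j * gauss_mom (Suc i) (j - 1) a b + of_nat b * gauss_mom (Suc i) j a (b - 1)"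
  proof -
    have "gauss_mom (Suc i) j a (Suc b) = gauss_mom i j (Suc a) (Suc b) + \<i> * gauss_mom i j a (Suc (Suc b))" by (rule gauss_mom_Suc1)
    also have "\<dots> = (\<i> * of_nat i * gauss_mom (i - 1) j (Suc a) b - \<i> * of_nat j * gauss_mom i (j - 1) (Suc a) b + of_nat b * gauss_mom i j (Suc a) (b - 1))
       + \<i> * (\<i> * of_nat i * gauss_mom (i - 1) j a (Suc b) - \<i> * of_nat j * gauss_mom i (j - 1) a (Suc b) + of_nat (Suc b) * gauss_mom i j a b)"
      using Suc.IH[of "Suc a" b] Suc.IH[of a "Suc b"] by simp
    also have "\<dots> = \<i> * (of_nat i * gauss_mom i j a b) + \<i> * gauss_mom i j a b - \<i> * of_nat j * gauss_mom (Suc i) (j - 1) a b + of_nat b * gauss_mom (Suc i) j a (b - 1)"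
      unfolding 1 3 4 by (simp add: algebra_simps)
    finally show ?thesis by (simp add: algebra_simps)
  qed
  show ?case using c1 c2 by simp
qed

text \<open>In \<open>\<eta>1 + \<i> * \<eta>2\<close> the derivatives falling on
  \<open>gauss_Z\<close> cancel and those falling on its conjugate double.\<close>

lemma gauss_mom_rec: "gauss_mom (Suc i) j 0 0 = 2 * of_nat j * gauss_mom i (j - 1) 0 0"
proof -
  have "gauss_mom i j (Suc 0) 0 = of_nat i * gauss_mom (i - 1) j 0 0 + of_nat j * gauss_mom i (j - 1) 0 0"
    and "gauss_mom i j 0 (Suc 0) = \<i> * of_nat i * gauss_mom (i - 1) j 0 0 - \<i> * of_nat j * gauss_mom i (j - 1) 0 0"
    using stein[of i j 0 0] by auto
  then show ?thesis unfolding gauss_mom_Suc1 by (simp only:) (simp add: algebra_simps)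
qed

lemma gauss_mom_diag: "gauss_mom i j 0 0 = (if i = j then 2 ^ i * fact i else 0)"
proof (induction i arbitrary: j)
  case 0
  show ?case
  proof (cases j)
    case 0
    then show ?thesis by (simp add: gauss_mom_00 nmom_0)
  next
    case (Suc k)
    \<comment> \<open>The recursion asks for a positive first index; a pure power of the conjugate
      is reached by conjugation.\<close>
    have "gauss_mom 0 j 0 0 = cnj (gauss_mom j 0 0 0)"
      by (simp add: gauss_mom_def gauss_mon_def flip: Bochner_Integration.integral_cnj)
    also have "gauss_mom j 0 0 0 = 0" using gauss_mom_rec[of k 0] Suc by simp
    finally show ?thesis using Suc by simp
  qed
next
  case (Suc i)
  show ?case by (cases j) (auto simp: gauss_mom_rec Suc.IH)
qed

end

lemma complex_gaussian_moment:
  assumes "complex_gaussian M g"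
  shows "(\<integral>\<omega>. g \<omega> ^ i * cnj (g \<omega>) ^ j \<partial>M) = (if i = j then fact i else 0)"
    and "integrable M (\<lambda>\<omega>. g \<omega> ^ i * cnj (g \<omega>) ^ j)"
proof -
  obtain \<eta>1 \<eta>2 where n: "distributed M lborel \<eta>1 std_normal_density" "distributed M lborel \<eta>2 std_normal_density"
    "indep_var borel \<eta>1 borel \<eta>2" and g: "\<And>\<omega>. \<omega> \<in> space M \<Longrightarrow> g \<omega> = (of_real (\<eta>1 \<omega>) + \<i> * of_real (\<eta>2 \<omega>)) / of_real (sqrt 2)"
    using assms unfolding complex_gaussian_def by blast
  have eq: "g \<omega> ^ i * cnj (g \<omega>) ^ j = inverse (of_real (sqrt 2) ^ (i + j)) * gauss_mon \<eta>1 \<eta>2 i j 0 0 \<omega>" if "\<omega> \<in> space M" for \<omega>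
    using g[OF that] by (simp add: gauss_mon_def[OF n] gauss_Z_def[OF n] power_divide power_add divide_inverse power_mult_distrib power_inverse)
  have "integrable M (\<lambda>\<omega>. inverse (of_real (sqrt 2) ^ (i + j)) * gauss_mon \<eta>1 \<eta>2 i j 0 0 \<omega>)"
    using integrable_gauss_mon[OF n, of i j 0 0] by (rule integrable_mult_right)
  moreover have "integrable M (\<lambda>\<omega>. g \<omega> ^ i * cnj (g \<omega>) ^ j) \<longleftrightarrow> integrable M (\<lambda>\<omega>. inverse (of_real (sqrt 2) ^ (i + j)) * gauss_mon \<eta>1 \<eta>2 i j 0 0 \<omega>)"
    by (rule Bochner_Integration.integrable_cong[OF refl eq])
  ultimately show "integrable M (\<lambda>\<omega>. g \<omega> ^ i * cnj (g \<omega>) ^ j)" by simp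
  have "(\<integral>\<omega>. g \<omega> ^ i * cnj (g \<omega>) ^ j \<partial>M) = (\<integral>\<omega>. inverse (of_real (sqrt 2) ^ (i + j)) * gauss_mon \<eta>1 \<eta>2 i j 0 0 \<omega> \<partial>M)"
    by (rule Bochner_Integration.integral_cong[OF refl eq])
  also have "\<dots> = inverse (of_real (sqrt 2) ^ (i + j)) * gauss_mom \<eta>1 \<eta>2 i j 0 0"
    by (simp add: gauss_mom_def[OF n])
  also have "\<dots> = (if i = j then fact i else 0)"
  proof -
    have "complex_of_real (sqrt 2) ^ (j + j) = 2 ^ j"
      unfolding mult_2[symmetric] power_mult of_real_power[symmetric] by simp
    then show ?thesis by (auto simp: gauss_mom_diag[OF n])
  qed
  finally show "(\<integral>\<omega>. g \<omega> ^ i * cnj (g \<omega>) ^ j \<partial>M) = (if i = j then fact i else 0)" .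
qed

lemma complex_gaussian_measurable:
  assumes "complex_gaussian M g" shows "g \<in> borel_measurable M"
proof -
  obtain \<eta>1 \<eta>2 where n: "distributed M lborel \<eta>1 std_normal_density" "distributed M lborel \<eta>2 std_normal_density"
    and g: "\<And>\<omega>. \<omega> \<in> space M \<Longrightarrow> g \<omega> = (of_real (\<eta>1 \<omega>) + \<i> * of_real (\<eta>2 \<omega>)) / of_real (sqrt 2)"
    using assms unfolding complex_gaussian_def by blast
  have [measurable]: "\<eta>1 \<in> borel_measurable M" "\<eta>2 \<in> borel_measurable M"
    using n[THEN distributed_measurable] by auto
  have "(\<lambda>\<omega>. (of_real (\<eta>1 \<omega>) + \<i> * of_real (\<eta>2 \<omega>)) / of_real (sqrt 2) :: complex) \<in> borel_measurable M" by measurable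
  then show ?thesis by (subst measurable_cong[OF g]) auto
qed

end

section \<open>Tails of Gaussian polynomials\<close>

context prob_space begin

lemma iid_moment:
  fixes g :: "'k \<Rightarrow> 'a \<Rightarrow> complex"
  assumes g: "iid_complex_gaussians M g" and A: "finite A"
  shows "(\<integral>\<omega>. (\<Prod>k\<in>A. g k \<omega> ^ p k * cnj (g k \<omega>) ^ q k) \<partial>M) = (\<Prod>k\<in>A. if p k = q k then fact (p k) else 0)"
    and "integrable M (\<lambda>\<omega>. \<Prod>k\<in>A. g k \<omega> ^ p k * cnj (g k \<omega>) ^ q k)"
proof -
  have cg: "complex_gaussian M (g k)" for k using g by (auto simp: iid_complex_gaussians_def)
  have "indep_vars (\<lambda>_. borel) g A"
    using g by (auto simp: iid_complex_gaussians_def intro: indep_vars_subset)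
  then have i: "indep_vars (\<lambda>_. borel) (\<lambda>k \<omega>. g k \<omega> ^ p k * cnj (g k \<omega>) ^ q k) A"
    by (rule indep_vars_compose2) (intro borel_measurable_continuous_onI continuous_intros)
  show "(\<integral>\<omega>. (\<Prod>k\<in>A. g k \<omega> ^ p k * cnj (g k \<omega>) ^ q k) \<partial>M) = (\<Prod>k\<in>A. if p k = q k then fact (p k) else 0)"
    using complex_gaussian_moment[OF cg] by (subst indep_vars_lebesgue_integral[OF A i]) auto
  show "integrable M (\<lambda>\<omega>. \<Prod>k\<in>A. g k \<omega> ^ p k * cnj (g k \<omega>) ^ q k)"
    using complex_gaussian_moment[OF cg] by (intro indep_vars_integrable[OF A i]) auto
qed

lemma prod_list_count:
  fixes f :: "'k \<Rightarrow> complex"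
  assumes "finite A" "set ks \<subseteq> A"
  shows "prod_list (map f ks) = (\<Prod>k\<in>A. f k ^ count (mset ks) k)"
proof -
  have "prod_list (map f ks) = prod_mset (image_mset f (mset ks))"
    by (simp flip: mset_map prod_mset_prod_list)
  also have "\<dots> = (\<Prod>k\<in>set ks. f k ^ count (mset ks) k)"
    by (simp add: image_prod_mset_multiplicity)
  also have "\<dots> = (\<Prod>k\<in>A. f k ^ count (mset ks) k)"
    using assms by (intro prod.mono_neutral_left) (auto simp: iffD2[OF count_mset_0_iff])
  finally show ?thesis .
qed

text \<open>Grouping equal letters turns the expectation into a product of one-variable moments,
  which vanishes unless every letter has the same multiplicity in both words.\<close>

lemma iid_list_moment:
  fixes g :: "'k \<Rightarrow> 'a \<Rightarrow> complex"
  assumes g: "iid_complex_gaussians M g"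
  shows "(\<integral>\<omega>. prod_list (map (\<lambda>k. g k \<omega>) ks) * cnj (prod_list (map (\<lambda>k. g k \<omega>) ls)) \<partial>M)
      = (if mset ks = mset ls then of_nat (\<Prod>k\<in>set ks. fact (count (mset ks) k)) else 0)"
    and "integrable M (\<lambda>\<omega>. prod_list (map (\<lambda>k. g k \<omega>) ks) * cnj (prod_list (map (\<lambda>k. g k \<omega>) ls)))"
proof -
  define A where "A = set ks \<union> set ls"
  have A: "finite A" "set ks \<subseteq> A" "set ls \<subseteq> A" by (auto simp: A_def)
  have eq: "prod_list (map (\<lambda>k. g k \<omega>) ks) * cnj (prod_list (map (\<lambda>k. g k \<omega>) ls))
      = (\<Prod>k\<in>A. g k \<omega> ^ count (mset ks) k * cnj (g k \<omega>) ^ count (mset ls) k)" for \<omega>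
    by (simp add: prod_list_count[OF A(1,2)] prod_list_count[OF A(1,3)] prod.distrib)
  show "integrable M (\<lambda>\<omega>. prod_list (map (\<lambda>k. g k \<omega>) ks) * cnj (prod_list (map (\<lambda>k. g k \<omega>) ls)))"
    unfolding eq by (rule iid_moment(2)[OF g A(1)])
  have "(\<Prod>k\<in>A. if count (mset ks) k = count (mset ls) k then fact (count (mset ks) k) else 0 :: complex)
     = (if mset ks = mset ls then of_nat (\<Prod>k\<in>set ks. fact (count (mset ks) k)) else 0)"
  proof (cases "mset ks = mset ls")
    case True
    then have "A = set ks" by (auto simp: A_def dest: mset_eq_setD)
    then show ?thesis using True by (simp add: of_nat_prod)
  next
    case False
    then obtain k where k: "count (mset ks) k \<noteq> count (mset ls) k" by (auto simp: multiset_eq_iff)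
    then have "k \<in> A" by (metis A_def UnCI count_mset_0_iff)
    then show ?thesis using k A(1) False by (auto simp: prod_zero_iff)
  qed
  then show "(\<integral>\<omega>. prod_list (map (\<lambda>k. g k \<omega>) ks) * cnj (prod_list (map (\<lambda>k. g k \<omega>) ls)) \<partial>M)
      = (if mset ks = mset ls then of_nat (\<Prod>k\<in>set ks. fact (count (mset ks) k)) else 0)"
    unfolding eq iid_moment(1)[OF g A(1)] .
qed

text \<open>Only words that are rearrangements of each other correlate, and the inequality of means
  bounds the cross terms by the diagonal. The number of rearrangements of a word times its
  correlation, the product of the factorials of the multiplicities, is \<open>fact d\<close> for
  every word, so \<open>F\<close> may be arbitrary.\<close>

lemma chaos_second_moment:
  fixes g :: "'k \<Rightarrow> 'a \<Rightarrow> complex" and F :: "'k list \<Rightarrow> complex" and d :: nat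
  assumes g: "iid_complex_gaussians M g" and K: "finite K"
  defines "P \<equiv> (\<lambda>\<omega>. \<Sum>ks\<in>Ls K d. F ks * prod_list (map (\<lambda>k. g k \<omega>) ks))"
  shows "integrable M (\<lambda>\<omega>. (cmod (P \<omega>))\<^sup>2)" "(\<integral>\<omega>. (cmod (P \<omega>))\<^sup>2 \<partial>M) \<le> fact d * (\<Sum>ks\<in>Ls K d. (cmod (F ks))\<^sup>2)"
proof -
  define c where "c ks = real (\<Prod>k\<in>set ks. fact (count (mset ks) k))" for ks :: "'k list"
  have cc: "complex_of_real (c ks) = of_nat (\<Prod>k\<in>set ks. fact (count (mset ks) k))" for ks
    by (simp only: c_def of_real_of_nat_eq)
  have c0: "c ks \<ge> 0" for ks by (auto simp: c_def intro!: prod_nonneg)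
  have cm: "c ks = c ls" if "mset ks = mset ls" for ks ls
    using that mset_eq_setD[OF that] by (simp add: c_def)
  have eq: "complex_of_real ((cmod (P \<omega>))\<^sup>2) = (\<Sum>ks\<in>Ls K d. \<Sum>ls\<in>Ls K d. (F ks * cnj (F ls)) *
     (prod_list (map (\<lambda>k. g k \<omega>) ks) * cnj (prod_list (map (\<lambda>k. g k \<omega>) ls))))" for \<omega>
    by (simp add: complex_norm_square P_def sum_product mult_ac del: of_real_power)
  have int: "integrable M (\<lambda>\<omega>. \<Sum>ks\<in>Ls K d. \<Sum>ls\<in>Ls K d. (F ks * cnj (F ls)) *
     (prod_list (map (\<lambda>k. g k \<omega>) ks) * cnj (prod_list (map (\<lambda>k. g k \<omega>) ls))))"
    by (intro Bochner_Integration.integrable_sum integrable_mult_right iid_list_moment(2)[OF g])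
  then have "integrable M (\<lambda>\<omega>. complex_of_real ((cmod (P \<omega>))\<^sup>2))" by (simp only: eq)
  then show "integrable M (\<lambda>\<omega>. (cmod (P \<omega>))\<^sup>2)" by (simp only: complex_of_real_integrable_eq)
  have "complex_of_real (\<integral>\<omega>. (cmod (P \<omega>))\<^sup>2 \<partial>M) = (\<integral>\<omega>. complex_of_real ((cmod (P \<omega>))\<^sup>2) \<partial>M)"
    by (simp only: integral_complex_of_real)
  also have "\<dots> = (\<Sum>ks\<in>Ls K d. \<Sum>ls\<in>Ls K d. (F ks * cnj (F ls)) * (if mset ks = mset ls then of_real (c ks) else 0))"
    unfolding eq using iid_list_moment[OF g] by (simp add: Bochner_Integration.integral_sum cc cong: if_cong)
  finally have e2: "complex_of_real (\<integral>\<omega>. (cmod (P \<omega>))\<^sup>2 \<partial>M) = (\<Sum>ks\<in>Ls K d. \<Sum>ls\<in>Ls K d. (F ks * cnj (F ls)) * (if mset ks = mset ls then of_real (c ks) else 0))" .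
  have "(\<integral>\<omega>. (cmod (P \<omega>))\<^sup>2 \<partial>M) \<le> cmod (complex_of_real (\<integral>\<omega>. (cmod (P \<omega>))\<^sup>2 \<partial>M))" by (simp add: norm_of_real)
  also have "\<dots> \<le> (\<Sum>ks\<in>Ls K d. \<Sum>ls\<in>Ls K d. if mset ks = mset ls then ((cmod (F ks))\<^sup>2 * c ks + (cmod (F ls))\<^sup>2 * c ks) / 2 else 0)"
    unfolding e2
  proof (intro sum_norm_le)
    fix ks ls
    have "cmod (F ks) * cmod (F ls) \<le> ((cmod (F ks))\<^sup>2 + (cmod (F ls))\<^sup>2) / 2"
      using sum_squares_bound[of "cmod (F ks)" "cmod (F ls)"] by simp
    then have "(cmod (F ks) * cmod (F ls)) * c ks \<le> ((cmod (F ks))\<^sup>2 + (cmod (F ls))\<^sup>2) / 2 * c ks"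
      by (rule mult_right_mono) (rule c0)
    then show "cmod (F ks * cnj (F ls) * (if mset ks = mset ls then of_real (c ks) else 0))
      \<le> (if mset ks = mset ls then ((cmod (F ks))\<^sup>2 * c ks + (cmod (F ls))\<^sup>2 * c ks) / 2 else 0)"
      using c0[of ks] by (auto simp: norm_mult algebra_simps)
  qed
  also have "\<dots> = (\<Sum>ks\<in>Ls K d. \<Sum>ls\<in>Ls K d. if mset ks = mset ls then (cmod (F ks))\<^sup>2 * c ks else 0)"
  proof -
    have "(\<Sum>ks\<in>Ls K d. \<Sum>ls\<in>Ls K d. if mset ks = mset ls then (cmod (F ls))\<^sup>2 * c ks else 0)
      = (\<Sum>ls\<in>Ls K d. \<Sum>ks\<in>Ls K d. if mset ks = mset ls then (cmod (F ls))\<^sup>2 * c ks else 0)" by (rule sum.swap)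
    also have "\<dots> = (\<Sum>ks\<in>Ls K d. \<Sum>ls\<in>Ls K d. if mset ks = mset ls then (cmod (F ks))\<^sup>2 * c ks else 0)"
      by (intro sum.cong refl) (auto dest: cm)
    finally have sw: "(\<Sum>ks\<in>Ls K d. \<Sum>ls\<in>Ls K d. if mset ks = mset ls then (cmod (F ls))\<^sup>2 * c ks else 0)
      = (\<Sum>ks\<in>Ls K d. \<Sum>ls\<in>Ls K d. if mset ks = mset ls then (cmod (F ks))\<^sup>2 * c ks else 0)" .
    have "(\<Sum>ks\<in>Ls K d. \<Sum>ls\<in>Ls K d. if mset ks = mset ls then ((cmod (F ks))\<^sup>2 * c ks + (cmod (F ls))\<^sup>2 * c ks) / 2 else 0)
      = (\<Sum>ks\<in>Ls K d. \<Sum>ls\<in>Ls K d. ((if mset ks = mset ls then (cmod (F ks))\<^sup>2 * c ks else 0)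
          + (if mset ks = mset ls then (cmod (F ls))\<^sup>2 * c ks else 0)) / 2)"
      by (intro sum.cong refl) auto
    also have "\<dots> = ((\<Sum>ks\<in>Ls K d. \<Sum>ls\<in>Ls K d. if mset ks = mset ls then (cmod (F ks))\<^sup>2 * c ks else 0)
      + (\<Sum>ks\<in>Ls K d. \<Sum>ls\<in>Ls K d. if mset ks = mset ls then (cmod (F ls))\<^sup>2 * c ks else 0)) / 2"
      by (simp only: sum.distrib sum_divide_distrib[symmetric])
    finally show ?thesis unfolding sw by simp
  qed
  also have "\<dots> = (\<Sum>ks\<in>Ls K d. (cmod (F ks))\<^sup>2 * fact d)"
  proof (intro sum.cong refl)
    fix ks assume ks: "ks \<in> Ls K d"
    have "{ls \<in> Ls K d. mset ks = mset ls} = permutations_of_multiset (mset ks)"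
      using ks by (auto simp: Ls_def permutations_of_multiset_def dest: mset_eq_setD mset_eq_length)
    then have "(\<Sum>ls\<in>Ls K d. if mset ks = mset ls then (cmod (F ks))\<^sup>2 * c ks else 0)
      = (cmod (F ks))\<^sup>2 * (c ks * card (permutations_of_multiset (mset ks)))"
      by (simp add: sum.inter_filter[symmetric] finite_Ls K)
    also have "c ks * card (permutations_of_multiset (mset ks)) = fact d"
      using arg_cong[OF card_permutations_of_multiset_aux[of "mset ks"], of real] ks
      by (simp add: c_def Ls_def mult.commute)
    finally show "(\<Sum>ls\<in>Ls K d. if mset ks = mset ls then (cmod (F ks))\<^sup>2 * c ks else 0) = (cmod (F ks))\<^sup>2 * fact d" .
  qed
  finally show "(\<integral>\<omega>. (cmod (P \<omega>))\<^sup>2 \<partial>M) \<le> fact d * (\<Sum>ks\<in>Ls K d. (cmod (F ks))\<^sup>2)"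
    by (simp add: sum_distrib_left mult.commute)
qed

text \<open>The \<open>p\<close>-th power of a homogeneous polynomial chaos is again one, with tensor power coefficients, so its
  second moment controls the moment of order \<open>2p\<close>.\<close>

lemma chaos_power:
  "\<exists>F'. (\<forall>g :: 'k \<Rightarrow> complex. (\<Sum>ks\<in>Ls K d. F ks * prod_list (map g ks)) ^ p = (\<Sum>ks\<in>Ls K (p * d). F' ks * prod_list (map g ks)))
    \<and> (\<Sum>ks\<in>Ls K (p * d). (cmod (F' ks))\<^sup>2) = (\<Sum>ks\<in>Ls K d. (cmod (F ks))\<^sup>2) ^ p"
proof (induction p)
  case 0
  have "Ls K 0 = {[]}" by (auto simp: Ls_def)
  then show ?case by (intro exI[of _ "\<lambda>_. 1"]) simp
next
  case (Suc p)
  then obtain F' where F': "\<And>g. (\<Sum>ks\<in>Ls K d. F ks * prod_list (map g ks)) ^ p = (\<Sum>ks\<in>Ls K (p * d). F' ks * prod_list (map g ks))"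
    "(\<Sum>ks\<in>Ls K (p * d). (cmod (F' ks))\<^sup>2) = (\<Sum>ks\<in>Ls K d. (cmod (F ks))\<^sup>2) ^ p" by blast
  have pl: "prod_list (map g (take d ks)) * prod_list (map g (drop d ks)) = prod_list (map g ks)" for g :: "'k \<Rightarrow> complex" and ks
    by (simp flip: prod_list.append map_append)
  show ?case
  proof (intro exI[of _ "\<lambda>ks. F (take d ks) * F' (drop d ks)"] conjI allI)
    fix g :: "'k \<Rightarrow> complex"
    have "(\<Sum>ks\<in>Ls K d. F ks * prod_list (map g ks)) ^ Suc p
      = (\<Sum>ks\<in>Ls K d. \<Sum>ls\<in>Ls K (p * d). (F ks * F' ls) * (prod_list (map g ks) * prod_list (map g ls)))"
      by (simp add: F' sum_product mult_ac)
    also have "\<dots> = (\<Sum>ks\<in>Ls K (d + p * d). (F (take d ks) * F' (drop d ks)) * (prod_list (map g (take d ks)) * prod_list (map g (drop d ks))))"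
      by (rule sum_Ls_append[symmetric, where F = "\<lambda>ks ls. (F ks * F' ls) * (prod_list (map g ks) * prod_list (map g ls))"])
    finally show "(\<Sum>ks\<in>Ls K d. F ks * prod_list (map g ks)) ^ Suc p
      = (\<Sum>ks\<in>Ls K (Suc p * d). F (take d ks) * F' (drop d ks) * prod_list (map g ks))"
      by (simp only: pl mult_Suc)
    show "(\<Sum>ks\<in>Ls K (Suc p * d). (cmod (F (take d ks) * F' (drop d ks)))\<^sup>2) = (\<Sum>ks\<in>Ls K d. (cmod (F ks))\<^sup>2) ^ Suc p"
      using sum_Ls_append[where F = "\<lambda>ks ls. (cmod (F ks * F' ls))\<^sup>2" and p = d and q = "p * d" and K = K]
      by (simp add: norm_mult power_mult_distrib F'(2)[symmetric] sum_product)
  qed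
qed

lemma chaos_measurable:
  fixes g :: "'k \<Rightarrow> 'a \<Rightarrow> complex"
  assumes g: "iid_complex_gaussians M g"
  shows "(\<lambda>\<omega>. \<Sum>ks\<in>Ls K d. F ks * prod_list (map (\<lambda>k. g k \<omega>) ks)) \<in> borel_measurable M"
proof -
  have [measurable]: "g k \<in> borel_measurable M" for k
    using g complex_gaussian_measurable by (auto simp: iid_complex_gaussians_def)
  have [measurable]: "(\<lambda>\<omega>. prod_list (map (\<lambda>k. g k \<omega>) ks)) \<in> borel_measurable M" for ks
    by (induction ks) auto
  show ?thesis by measurable
qed

text \<open>Markov's inequality for the moment of order \<open>2 * p\<close>. The number
  \<open>p\<close> stays free, to be taken later as a power of \<open>L\<close>.\<close>

lemma chaos_tail:
  fixes g :: "'k \<Rightarrow> 'a \<Rightarrow> complex" and F :: "'k list \<Rightarrow> complex" and d :: nat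
  assumes g: "iid_complex_gaussians M g" and K: "finite K" and l: "thr > 0"
  defines "P \<equiv> (\<lambda>\<omega>. \<Sum>ks\<in>Ls K d. F ks * prod_list (map (\<lambda>k. g k \<omega>) ks))"
  shows "measure M {\<omega> \<in> space M. cmod (P \<omega>) \<ge> thr} \<le> fact (p * d) * ((\<Sum>ks\<in>Ls K d. (cmod (F ks))\<^sup>2) / thr\<^sup>2) ^ p"
proof -
  obtain F' where F': "\<And>g. (\<Sum>ks\<in>Ls K d. F ks * prod_list (map g ks)) ^ p = (\<Sum>ks\<in>Ls K (p * d). F' ks * prod_list (map g ks))"
    "(\<Sum>ks\<in>Ls K (p * d). (cmod (F' ks))\<^sup>2) = (\<Sum>ks\<in>Ls K d. (cmod (F ks))\<^sup>2) ^ p"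
    using chaos_power[where K = K and d = d and F = F and p = p] by blast
  define u where "u \<omega> = (cmod (P \<omega> ^ p))\<^sup>2" for \<omega>
  have u: "u = (\<lambda>\<omega>. (cmod (\<Sum>ks\<in>Ls K (p * d). F' ks * prod_list (map (\<lambda>k. g k \<omega>) ks)))\<^sup>2)"
    unfolding u_def P_def F'(1) ..
  have u2: "u \<omega> = cmod (P \<omega>) ^ (2 * p)" for \<omega>
    by (simp add: u_def norm_power mult.commute flip: power_mult)
  have "measure M {\<omega> \<in> space M. cmod (P \<omega>) \<ge> thr} \<le> measure M {\<omega> \<in> space M. u \<omega> \<ge> thr ^ (2 * p)}"
  proof (rule finite_measure_mono)
    show "{\<omega> \<in> space M. cmod (P \<omega>) \<ge> thr} \<subseteq> {\<omega> \<in> space M. u \<omega> \<ge> thr ^ (2 * p)}"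
      using l by (auto simp: u2 intro!: power_mono)
    have [measurable]: "u \<in> borel_measurable M" unfolding u using chaos_measurable[OF g, where K = K and d = "p * d" and F = F'] by measurable
    show "{\<omega> \<in> space M. u \<omega> \<ge> thr ^ (2 * p)} \<in> sets M" by measurable
  qed
  also have "\<dots> \<le> (\<integral>\<omega>. u \<omega> \<partial>M) / thr ^ (2 * p)"
    by (rule integral_Markov_inequality_measure[of M u "{}"]) (use chaos_second_moment(1)[OF g K, where d = "p * d" and F = F'] l in \<open>auto simp: u\<close>)
  also have "\<dots> \<le> (fact (p * d) * (\<Sum>ks\<in>Ls K d. (cmod (F ks))\<^sup>2) ^ p) / thr ^ (2 * p)"
    using chaos_second_moment(2)[OF g K, where d = "p * d" and F = F'] l by (intro divide_right_mono) (auto simp: u F'(2))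
  also have "\<dots> = fact (p * d) * ((\<Sum>ks\<in>Ls K d. (cmod (F ks))\<^sup>2) / thr\<^sup>2) ^ p"
    by (simp add: power_divide power_mult)
  finally show ?thesis .
qed

end

section \<open>Uniqueness of Fourier coefficients\<close>

definition n1 :: "('i \<Rightarrow> complex) \<Rightarrow> real" where "n1 a = (\<Sum>\<^sub>\<infinity>m. cmod (a m))"

lemma n1_nonneg: "n1 a \<ge> 0" unfolding n1_def by (rule infsum_nonneg) auto

lemma l1_l1b: "l1 a \<Longrightarrow> l1b a (n1 a)"
  unfolding l1b_def n1_def by (auto intro!: finite_sum_le_infsum)

lemma l1b_n1: "l1b a A \<Longrightarrow> n1 a \<le> A"
  unfolding n1_def by (rule l1b_infsum_le)

lemma l1b_l2b: "l1b a A \<Longrightarrow> l2b a A"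
  unfolding l1b_def l2b_def by (meson L2_set_le_sum norm_ge_zero order_trans)

lemma l1_l2b: "l1 a \<Longrightarrow> l2b a (n1 a)"
  by (intro l1b_l2b l1_l1b)

lemma l1_add: "l1 a \<Longrightarrow> l1 b \<Longrightarrow> l1 (\<lambda>m. a m + b m)"
  by (rule summable_on_comparison_test[OF summable_on_add[of "\<lambda>m. norm (a m)" UNIV "\<lambda>m. norm (b m)"]])
     (auto intro: norm_triangle_ineq)

lemma l1_cmult: "l1 a \<Longrightarrow> l1 (\<lambda>m. c * a m :: complex)"
  by (simp add: norm_mult summable_on_cmult_right)

lemma l1_diff: "l1 a \<Longrightarrow> l1 b \<Longrightarrow> l1 (\<lambda>m. a m - b m :: complex)"
  using l1_add[of a "\<lambda>m. -1 * b m"] l1_cmult[of b "-1"] by simp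

lemma l1_finite: "finite K \<Longrightarrow> (\<And>m. m \<notin> K \<Longrightarrow> a m = 0) \<Longrightarrow> l1 a"
  by (rule summable_on_cong_neutral[THEN iffD2, of K UNIV "\<lambda>m. norm (a m)" "\<lambda>m. norm (a m)"]) auto

lemma l1_conv_pairs:
  fixes a b :: "'z::ab_group_add \<Rightarrow> complex"
  assumes a: "l1 a" and b: "l1 b"
  shows "((\<lambda>(m, l). cmod (a l * b (m - l))) has_sum n1 a * n1 b) (UNIV \<times> UNIV)"
proof -
  have s: "(\<lambda>(l, p). cmod (a l) * cmod (b p)) summable_on (UNIV \<times> UNIV)"
  proof (rule summable_on_SigmaI[where g = "\<lambda>l. cmod (a l) * n1 b"])
    show "((\<lambda>p. case (l, p) of (l, p) \<Rightarrow> cmod (a l) * cmod (b p)) has_sum cmod (a l) * n1 b) UNIV" for l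
      unfolding n1_def prod.case by (intro has_sum_cmult_right has_sum_infsum b)
  qed (auto intro!: summable_on_cmult_left a)
  have "infsum (\<lambda>(l, p). cmod (a l) * cmod (b p)) (UNIV \<times> UNIV) = (\<Sum>\<^sub>\<infinity>l. \<Sum>\<^sub>\<infinity>p. cmod (a l) * cmod (b p))"
    using infsum_Sigma_banach[OF s] by simp
  also have "\<dots> = n1 a * n1 b" by (simp add: infsum_cmult_right' infsum_cmult_left' n1_def)
  finally have hs: "((\<lambda>(l, p). cmod (a l) * cmod (b p)) has_sum n1 a * n1 b) (UNIV \<times> UNIV)"
    using s by (metis has_sum_infsum)
  have "((\<lambda>(m, l). cmod (a l * b (m - l))) has_sum n1 a * n1 b) (UNIV \<times> UNIV) \<longleftrightarrow>
     ((\<lambda>(l, p). cmod (a l) * cmod (b p)) has_sum n1 a * n1 b) (UNIV \<times> UNIV)"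
    by (rule has_sum_reindex_bij_witness[of _ "\<lambda>(l, p). (l + p, l)" "\<lambda>(m, l). (l, m - l)"])
       (auto simp: norm_mult)
  then show ?thesis using hs by simp
qed

lemma l1_conv:
  fixes a b :: "'z::ab_group_add \<Rightarrow> complex"
  assumes a: "l1 a" and b: "l1 b"
  shows "l1 (conv a b)" "n1 (conv a b) \<le> n1 a * n1 b"
proof -
  note hs = l1_conv_pairs[OF a b]
  have s1: "(\<lambda>l. cmod (a l * b (m - l))) summable_on UNIV" for m
    by (rule conv_l1[OF l1_l2b[OF a] l1_l2b[OF b]])
  have hs2: "((\<lambda>m. \<Sum>\<^sub>\<infinity>l. cmod (a l * b (m - l))) has_sum n1 a * n1 b) UNIV"
    using hs by (rule has_sum_SigmaD) (use s1 in auto)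
  have le: "cmod (conv a b m) \<le> (\<Sum>\<^sub>\<infinity>l. cmod (a l * b (m - l)))" for m
    unfolding conv_def by (rule norm_infsum_bound[OF s1])
  show l: "l1 (conv a b)"
    by (rule summable_on_comparison_test[OF has_sum_imp_summable[OF hs2]]) (use le in auto)
  show "n1 (conv a b) \<le> n1 a * n1 b"
    unfolding n1_def[of "conv a b"] using infsum_mono[OF l has_sum_imp_summable[OF hs2]] le infsumI[OF hs2] by simp
qed

lemma trig_mult:
  assumes a: "l1 a" and b: "l1 b"
  shows "trig a x * trig b x = trig (conv a b) x"
proof -
  define a' where "a' m = a m * ch m x" for m
  define b' where "b' m = b m * ch m x" for m
  have a': "l1 a'" and b': "l1 b'" unfolding a'_def b'_def using a b by (simp_all add: norm_mult)
  have eq: "(\<lambda>p. norm (case p of (m, l) \<Rightarrow> a' l * b' (m - l))) = (\<lambda>(m, l). cmod (a' l * b' (m - l)))" by auto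
  have "(\<lambda>(m, l). a' l * b' (m - l)) summable_on (UNIV \<times> UNIV)"
    by (rule Infinite_Sum.abs_summable_summable, subst eq, rule has_sum_imp_summable, rule l1_conv_pairs[OF a' b'])
  from infsum_swap_banach[of "\<lambda>m l. a' l * b' (m - l)" UNIV UNIV] this
  have "(\<Sum>\<^sub>\<infinity>m. \<Sum>\<^sub>\<infinity>l. a' l * b' (m - l)) = (\<Sum>\<^sub>\<infinity>l. \<Sum>\<^sub>\<infinity>m. a' l * b' (m - l))" by simp
  also have "\<dots> = (\<Sum>\<^sub>\<infinity>l. a' l * (\<Sum>\<^sub>\<infinity>m. b' m))"
  proof (intro infsum_cong)
    fix l
    have "(\<Sum>\<^sub>\<infinity>m. b' (m - l)) = (\<Sum>\<^sub>\<infinity>m. b' m)"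
      by (rule infsum_reindex_bij_witness[of _ "\<lambda>m. m + l" "\<lambda>m. m - l"]) auto
    then show "(\<Sum>\<^sub>\<infinity>m. a' l * b' (m - l)) = a' l * (\<Sum>\<^sub>\<infinity>m. b' m)" by (simp add: infsum_cmult_right')
  qed
  also have "\<dots> = trig a x * trig b x" by (simp add: infsum_cmult_left' trig_def a'_def b'_def)
  finally have "trig a x * trig b x = (\<Sum>\<^sub>\<infinity>m. \<Sum>\<^sub>\<infinity>l. a' l * b' (m - l))" by simp
  also have "\<dots> = trig (conv a b) x"
    unfolding trig_def
  proof (intro infsum_cong)
    fix m
    have "a' l * b' (m - l) = (a l * b (m - l)) * ch m x" for l
      using ch_add[of l "m - l" x] by (simp add: a'_def b'_def)
    then show "(\<Sum>\<^sub>\<infinity>l. a' l * b' (m - l)) = conv a b m * ch m x" by (simp add: conv_def infsum_cmult_left')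
  qed
  finally show ?thesis .
qed

lemma trig_borel [measurable]: "l1 a \<Longrightarrow> trig a \<in> borel_measurable borel"
  by (intro borel_measurable_continuous_onI continuous_on_trig)

text \<open>The series converges uniformly, hence it can be integrated term by term against an
  integrable function.\<close>

lemma integral_against_trig:
  fixes f :: "real ^ 'n \<Rightarrow> complex"
  assumes f: "integrable lborel f" and a: "l1 a"
  shows "integrable lborel (\<lambda>x. f x * trig a (c *\<^sub>R x))"
    and "((\<lambda>m. a m * (\<integral>x. f x * ch m (c *\<^sub>R x) \<partial>lborel)) has_sum (\<integral>x. f x * trig a (c *\<^sub>R x) \<partial>lborel)) UNIV"
proof -
  have [measurable]: "f \<in> borel_measurable borel" using borel_measurable_integrable[OF f] by simp
  have m: "(\<lambda>x. trig a (c *\<^sub>R x)) \<in> borel_measurable borel"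
    using trig_borel[OF a] by measurable
  show i: "integrable lborel (\<lambda>x. f x * trig a (c *\<^sub>R x))"
  proof (rule Bochner_Integration.integrable_bound)
    show "integrable lborel (\<lambda>x. (\<Sum>\<^sub>\<infinity>m. cmod (a m)) *\<^sub>R f x)" using f by simp
    have "0 \<le> (\<Sum>\<^sub>\<infinity>m. cmod (a m))" by (rule infsum_nonneg) auto
    then show "AE x in lborel. norm (f x * trig a (c *\<^sub>R x)) \<le> norm ((\<Sum>\<^sub>\<infinity>m. cmod (a m)) *\<^sub>R f x)"
      using norm_trig_le[OF a] by (intro AE_I2) (auto simp: norm_mult mult.commute[of _ "cmod (f _)"] intro!: mult_left_mono)
  qed (use m in measurable)
  have ic: "integrable lborel (\<lambda>x. f x * ch m (c *\<^sub>R x))" for m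
  proof (rule Bochner_Integration.integrable_bound[OF f])
    have "(\<lambda>x. ch m (c *\<^sub>R x)) \<in> borel_measurable borel" by (intro borel_measurable_continuous_onI continuous_intros)
    then show "(\<lambda>x. f x * ch m (c *\<^sub>R x)) \<in> borel_measurable lborel" by measurable
  qed (simp add: norm_mult)
  define If where "If = (\<integral>x. cmod (f x) \<partial>lborel)"
  have If: "If \<ge> 0" unfolding If_def by (rule Bochner_Integration.integral_nonneg) auto
  show "((\<lambda>m. a m * (\<integral>x. f x * ch m (c *\<^sub>R x) \<partial>lborel)) has_sum (\<integral>x. f x * trig a (c *\<^sub>R x) \<partial>lborel)) UNIV"
    unfolding has_sum_def
  proof (rule tendstoI)
    fix \<epsilon> :: real assume e: "\<epsilon> > 0"
    define \<eta> where "\<eta> = \<epsilon> / (If + 1)"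
    have \<eta>: "\<eta> > 0" using e If by (simp add: \<eta>_def)
    have "\<forall>\<^sub>F F in finite_subsets_at_top UNIV. \<forall>x\<in>UNIV. dist (\<Sum>m\<in>F. a m * ch m x) (trig a x) < \<eta>"
      using trig_uniform_limit[OF a, of UNIV] \<eta> by (auto simp: uniform_limit_iff)
    then show "\<forall>\<^sub>F F in finite_subsets_at_top UNIV. dist (\<Sum>m\<in>F. a m * (\<integral>x. f x * ch m (c *\<^sub>R x) \<partial>lborel)) (\<integral>x. f x * trig a (c *\<^sub>R x) \<partial>lborel) < \<epsilon>"
    proof eventually_elim
      case (elim F)
      have isum: "integrable lborel (\<lambda>x. \<Sum>m\<in>F. a m * (f x * ch m (c *\<^sub>R x)))"
        by (intro Bochner_Integration.integrable_sum integrable_mult_right ic)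
      have "(\<Sum>m\<in>F. a m * (\<integral>x. f x * ch m (c *\<^sub>R x) \<partial>lborel)) = (\<integral>x. (\<Sum>m\<in>F. a m * (f x * ch m (c *\<^sub>R x))) \<partial>lborel)"
        by (subst Bochner_Integration.integral_sum) (auto intro!: integrable_mult_right ic)
      then have "(\<Sum>m\<in>F. a m * (\<integral>x. f x * ch m (c *\<^sub>R x) \<partial>lborel)) - (\<integral>x. f x * trig a (c *\<^sub>R x) \<partial>lborel)
         = (\<integral>x. (\<Sum>m\<in>F. a m * (f x * ch m (c *\<^sub>R x))) - f x * trig a (c *\<^sub>R x) \<partial>lborel)"
        by (simp add: Bochner_Integration.integral_diff[OF isum i])
      also have "cmod \<dots> \<le> (\<integral>x. \<eta> * cmod (f x) \<partial>lborel)"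
      proof (rule Bochner_Integration.integral_norm_bound_integral)
        show "integrable lborel (\<lambda>x. (\<Sum>m\<in>F. a m * (f x * ch m (c *\<^sub>R x))) - f x * trig a (c *\<^sub>R x))"
          by (intro Bochner_Integration.integrable_diff isum i)
        show "integrable lborel (\<lambda>x. \<eta> * cmod (f x))" using f by simp
        fix x
        have "(\<Sum>m\<in>F. a m * (f x * ch m (c *\<^sub>R x))) - f x * trig a (c *\<^sub>R x) = f x * ((\<Sum>m\<in>F. a m * ch m (c *\<^sub>R x)) - trig a (c *\<^sub>R x))"
          by (simp add: right_diff_distrib sum_distrib_left mult_ac)
        then show "norm ((\<Sum>m\<in>F. a m * (f x * ch m (c *\<^sub>R x))) - f x * trig a (c *\<^sub>R x)) \<le> \<eta> * cmod (f x)"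
          using elim[rule_format, of "c *\<^sub>R x"] by (simp add: norm_mult dist_norm mult.commute[of \<eta>] mult_left_mono less_imp_le)
      qed
      also have "\<dots> = \<eta> * If" by (simp add: If_def)
      also have "\<dots> < \<epsilon>" using e If by (simp add: \<eta>_def field_simps)
      finally show ?case by (simp add: dist_norm)
    qed
  qed
qed

text \<open>The positive and the negative part of \<open>g\<close> are transported as measures to
  the product \<open>K\<close> of unit circles by \<open>e\<close>. Vanishing coefficients and
  Stone-Weierstrass make the two images equal. As \<open>e\<close> is injective on the open box, the
  set where \<open>g\<close> is positive is cut out by a Borel set \<open>A\<close> of the target,
  on which the image of the negative part vanishes.\<close>

lemma fourier_uniqueness_real:
  fixes g :: "real ^ 'n \<Rightarrow> real"
  assumes L: "L > 0" and g: "integrable lborel g" and supp: "\<And>x. x \<notin> box 0 (\<chi> i. L) \<Longrightarrow> g x = 0"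
    and zero: "\<And>m. (\<integral>x. complex_of_real (g x) * ch m ((1 / L) *\<^sub>R x) \<partial>lborel) = 0"
  shows "AE x in lborel. g x \<le> 0"
proof -
  define e :: "real ^ 'n \<Rightarrow> complex ^ 'n" where "e x = (\<chi> i. cis (2 * pi * x $ i / L))" for x
  define K :: "(complex ^ 'n) set" where "K = {z. \<forall>i. cmod (z $ i) = 1}"
  have eK: "e x \<in> K" for x by (simp add: e_def K_def)
  have ce: "continuous_on A e" for A
    unfolding e_def cis_conv_exp by (intro continuous_on_vec_lambda continuous_intros) (use L in auto)
  have [measurable]: "e \<in> borel_measurable borel" by (intro borel_measurable_continuous_onI ce)
  have [measurable]: "g \<in> borel_measurable borel" using borel_measurable_integrable[OF g] by simp
  have gc: "integrable lborel (\<lambda>x. complex_of_real (g x))" using g by simp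
  have z1: "(\<integral>x. complex_of_real (g x) * trig a ((1 / L) *\<^sub>R x) \<partial>lborel) = 0" if "l1 a" for a
    using integral_against_trig(2)[OF gc that, of "1 / L"] zero by (simp add: has_sum_0 has_sum_unique[of "\<lambda>_. 0"])
  \<comment> \<open>The algebra for Stone-Weierstrass: functions whose pullback has an absolutely
    convergent series. Products stay inside by \<open>trig_mult\<close>, and \<open>z1\<close> makes
    every member integrate to \<open>0\<close> against \<open>g\<close>.\<close>
  define R where "R = {h :: complex ^ 'n \<Rightarrow> real. continuous_on K h \<and> (\<exists>a. l1 a \<and> (\<forall>x. complex_of_real (h (e x)) = trig a ((1 / L) *\<^sub>R x)))}"
  have compK: "compact K"
  proof -
    have "bounded K" unfolding bounded_iff
    proof (intro exI ballI)
      fix z :: "complex ^ 'n" assume z: "z \<in> K"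
      have "norm z \<le> (\<Sum>i\<in>UNIV. cmod (z $ i))" unfolding norm_vec_def by (rule L2_set_le_sum) simp
      also have "\<dots> = real CARD('n)" using z by (simp add: K_def)
      finally show "norm z \<le> real CARD('n)" .
    qed
    moreover have "closed K" unfolding K_def
      by (intro closed_Collect_all closed_Collect_eq continuous_intros)
    ultimately show ?thesis by (simp add: compact_eq_bounded_closed)
  qed
  have chi: "ch (axis i 1) ((1 / L) *\<^sub>R x) = e x $ i" for i x
  proof -
    have "int_vec (axis i 1) = axis i (1::real)" by (auto simp: vec_eq_iff axis_def)
    then show ?thesis by (simp add: ch_def e_def inner_axis inner_commute[of "axis i 1"])
  qed
  define dl where "dl p c m = (if m = p then c else 0 :: complex)" for p m :: "int ^ 'n" and c
  have dl1: "l1 (dl p c)" for p c by (rule l1_finite[of "{p}"]) (auto simp: dl_def)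
  have tdl: "trig (dl p c) x = c * ch p x" for p c x
    by (subst trig_finite[of "{p}"]) (auto simp: dl_def)
  interpret R: function_ring_on R K
  proof
    show "compact K" by (rule compK)
    show "continuous_on K f" if "f \<in> R" for f using that by (simp add: R_def)
    show "(\<lambda>x. f x + h x) \<in> R" if f: "f \<in> R" and h: "h \<in> R" for f h
    proof -
      obtain a b where ab: "l1 a" "l1 b" "\<And>x. complex_of_real (f (e x)) = trig a ((1 / L) *\<^sub>R x)" "\<And>x. complex_of_real (h (e x)) = trig b ((1 / L) *\<^sub>R x)"
        using f h by (auto simp: R_def)
      then have "l1 (\<lambda>m. a m + b m) \<and> (\<forall>x. complex_of_real (f (e x) + h (e x)) = trig (\<lambda>m. a m + b m) ((1 / L) *\<^sub>R x))"
        by (simp add: trig_add l1_add)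
      then show ?thesis using f h unfolding R_def by (auto intro!: continuous_on_add)
    qed
    show "(\<lambda>x. f x * h x) \<in> R" if f: "f \<in> R" and h: "h \<in> R" for f h
    proof -
      obtain a b where ab: "l1 a" "l1 b" "\<And>x. complex_of_real (f (e x)) = trig a ((1 / L) *\<^sub>R x)" "\<And>x. complex_of_real (h (e x)) = trig b ((1 / L) *\<^sub>R x)"
        using f h by (auto simp: R_def)
      then have "l1 (conv a b) \<and> (\<forall>x. complex_of_real (f (e x) * h (e x)) = trig (conv a b) ((1 / L) *\<^sub>R x))"
        by (simp add: trig_mult l1_conv)
      then show ?thesis using f h unfolding R_def by (auto intro!: continuous_on_mult)
    qed
    show "(\<lambda>_. c) \<in> R" for c
      unfolding R_def by (auto intro!: exI[of _ "dl 0 (of_real c)"] dl1 simp: tdl)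
    fix z w assume zw: "z \<in> K" "w \<in> K" "z \<noteq> w"
    then obtain i where i: "z $ i \<noteq> w $ i" by (auto simp: vec_eq_iff)
    \<comment> \<open>The pullback belonging to \<open>tr c\<close> is twice the real part of
      \<open>c\<close> times a coordinate; \<open>c = 1\<close> and \<open>c = - \<i>\<close> give
      real and imaginary part, which separate points.\<close>
    define tr where "tr c m = dl (axis i 1) c m + dl (- axis i 1) (cnj c) m" for c m
    have tr1: "l1 (tr c)" for c unfolding tr_def by (intro l1_add dl1)
    have ttr: "trig (tr c) ((1 / L) *\<^sub>R x) = complex_of_real (2 * Re (c * e x $ i))" for c x
    proof -
      have "trig (tr c) ((1 / L) *\<^sub>R x) = c * e x $ i + cnj (c * e x $ i)"
        unfolding tr_def by (simp add: trig_add dl1 tdl ch_minus chi)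
      also have "\<dots> = complex_of_real (2 * Re (c * e x $ i))" by (rule complex_add_cnj)
      finally show ?thesis .
    qed
    have inR: "(\<lambda>z. 2 * Re (c * z $ i)) \<in> R" for c
      unfolding R_def using tr1[of c] ttr[of c] by (auto intro!: continuous_intros exI[of _ "tr c"])
    show "\<exists>f\<in>R. f z \<noteq> f w"
    proof (cases "Re (z $ i) = Re (w $ i)")
      case True
      then have "Im (z $ i) \<noteq> Im (w $ i)" using i by (simp add: complex_eq_iff)
      then show ?thesis using inR[of "- \<i>"] by (intro bexI[of _ "\<lambda>z. 2 * Re (- \<i> * z $ i)"]) auto
    next
      case False
      then show ?thesis using inR[of 1] by (intro bexI[of _ "\<lambda>z. 2 * Re (1 * z $ i)"]) auto
    qed
  qed
  define Ig where "Ig = (\<integral>x. \<bar>g x\<bar> \<partial>lborel)"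
  have Ig: "Ig \<ge> 0" unfolding Ig_def by (rule Bochner_Integration.integral_nonneg) auto
  have ib: "integrable lborel (\<lambda>x. g x * h (e x))" if h: "continuous_on UNIV h" "\<And>z. \<bar>h z\<bar> \<le> B" for h :: "complex ^ 'n \<Rightarrow> real" and B
  proof (rule Bochner_Integration.integrable_bound)
    show "integrable lborel (\<lambda>x. B * g x)" using g by simp
    have [measurable]: "h \<in> borel_measurable borel" by (intro borel_measurable_continuous_onI h)
    show "(\<lambda>x. g x * h (e x)) \<in> borel_measurable lborel" by measurable
    have "B \<ge> 0" using h(2)[of undefined] by linarith
    then show "AE x in lborel. norm (g x * h (e x)) \<le> norm (B * g x)"
      using h(2) by (auto simp: abs_mult mult.commute[of B] intro!: mult_left_mono)
  qed
  have z2: "(\<integral>x. g x * h (e x) \<partial>lborel) = 0" if h: "continuous_on UNIV h" "\<And>z. \<bar>h z\<bar> \<le> B" for h :: "complex ^ 'n \<Rightarrow> real" and B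
  proof -
    have "\<bar>\<integral>x. g x * h (e x) \<partial>lborel\<bar> \<le> 0 + \<epsilon>" if \<epsilon>: "\<epsilon> > 0" for \<epsilon>
    proof -
      define \<eta> where "\<eta> = \<epsilon> / (Ig + 1)"
      have \<eta>: "\<eta> > 0" using \<epsilon> Ig by (simp add: \<eta>_def)
      obtain r where r: "r \<in> R" "\<And>z. z \<in> K \<Longrightarrow> \<bar>h z - r z\<bar> < \<eta>"
        using R.Stone_Weierstrass_basic[OF continuous_on_subset[OF h(1)] \<eta>] by auto
      obtain a where a: "l1 a" "\<And>x. complex_of_real (r (e x)) = trig a ((1 / L) *\<^sub>R x)" using r(1) by (auto simp: R_def)
      have ir: "integrable lborel (\<lambda>x. g x * r (e x))"
        using integral_against_trig(1)[OF gc a(1), of "1 / L"] unfolding a(2)[symmetric] of_real_mult[symmetric]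
        by (simp only: complex_of_real_integrable_eq)
      have "complex_of_real (\<integral>x. g x * r (e x) \<partial>lborel) = (\<integral>x. complex_of_real (g x) * trig a ((1 / L) *\<^sub>R x) \<partial>lborel)"
        unfolding a(2)[symmetric] of_real_mult[symmetric] integral_complex_of_real ..
      then have r0: "(\<integral>x. g x * r (e x) \<partial>lborel) = 0" using z1[OF a(1)] by simp
      have "(\<integral>x. g x * h (e x) \<partial>lborel) = (\<integral>x. g x * h (e x) - g x * r (e x) \<partial>lborel)"
        using Bochner_Integration.integral_diff[OF ib[OF h] ir] r0 by simp
      also have "norm \<dots> \<le> (\<integral>x. \<eta> * \<bar>g x\<bar> \<partial>lborel)"
      proof (rule Bochner_Integration.integral_norm_bound_integral)
        show "integrable lborel (\<lambda>x. g x * h (e x) - g x * r (e x))" by (intro Bochner_Integration.integrable_diff ib[OF h] ir)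
        fix x
        have "\<bar>g x\<bar> * \<bar>h (e x) - r (e x)\<bar> \<le> \<bar>g x\<bar> * \<eta>" using r(2)[OF eK[of x]] by (intro mult_left_mono) auto
        then show "norm (g x * h (e x) - g x * r (e x)) \<le> \<eta> * \<bar>g x\<bar>"
          by (simp add: abs_mult mult.commute flip: right_diff_distrib)
      qed (use g in simp)
      also have "\<dots> = \<eta> * Ig" by (simp add: Ig_def)
      also have "\<dots> \<le> \<epsilon>" using \<epsilon> Ig by (simp add: \<eta>_def field_simps)
      finally show ?thesis by simp
    qed
    then have "\<bar>\<integral>x. g x * h (e x) \<partial>lborel\<bar> \<le> 0" by (rule field_le_epsilon)
    then show ?thesis by simp
  qed
  \<comment> \<open>Indicators of open sets are limits of the cutoffs \<open>h j\<close> built from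
    the distance to the complement. For \<open>U = UNIV\<close> the complement is empty and
    \<open>infdist\<close> is \<open>0\<close>, hence the separate case.\<close>
  have z3: "(\<integral>x. g x * indicator U (e x) \<partial>lborel) = 0" if U: "open U" for U
  proof (cases "U = UNIV")
    case True
    then show ?thesis using z2[of "\<lambda>_. 1" 1] by simp
  next
    case False
    define h where "h j z = min 1 (real j * infdist z (- U))" for j z
    have lim: "(\<lambda>j. h j z) \<longlonglongrightarrow> indicator U z" for z
    proof (cases "z \<in> U")
      case True
      have "infdist z (- U) > 0" using True U False infdist_pos_not_in_closed[of "- U" z] by auto
      then obtain n where n: "1 < real n * infdist z (- U)" using ex_less_of_nat_mult by blast
      have "\<forall>\<^sub>F j in sequentially. h j z = 1"
        unfolding eventually_sequentially
      proof (intro exI[of _ n] allI impI)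
        fix j assume "n \<le> j"
        then have "real n * infdist z (- U) \<le> real j * infdist z (- U)" by (intro mult_right_mono infdist_nonneg) auto
        then show "h j z = 1" using n by (simp add: h_def)
      qed
      then show ?thesis using True by (simp add: tendsto_eventually)
    next
      case False
      then show ?thesis by (simp add: h_def)
    qed
    have ch: "continuous_on UNIV (h j)" for j unfolding h_def by (intro continuous_intros)
    have bh: "\<bar>h j z\<bar> \<le> 1" for j z using infdist_nonneg[of z "- U"] by (simp add: h_def min_def)
    have mh [measurable]: "h j \<in> borel_measurable borel" for j by (intro borel_measurable_continuous_onI ch)
    have [measurable]: "U \<in> sets borel" using U by simp
    have "(\<lambda>j. \<integral>x. g x * h j (e x) \<partial>lborel) \<longlonglongrightarrow> (\<integral>x. g x * indicator U (e x) \<partial>lborel)"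
    proof (rule integral_dominated_convergence[where w = "\<lambda>x. \<bar>g x\<bar>"])
      show "AE x in lborel. (\<lambda>j. g x * h j (e x)) \<longlonglongrightarrow> g x * indicator U (e x)"
        by (intro AE_I2 tendsto_intros lim)
      show "AE x in lborel. norm (g x * h j (e x)) \<le> \<bar>g x\<bar>" for j
        using bh by (intro AE_I2) (simp add: abs_mult mult_left_le)
    qed (use g in auto)
    then show ?thesis using z2[OF ch bh] by (simp add: LIMSEQ_const_iff)
  qed
  \<comment> \<open>\<open>\<mu> 1\<close> and \<open>\<mu> (-1)\<close> are the images of the
    positive and of the negative part, because \<open>ennreal\<close> sends negative values to
    \<open>0\<close>.\<close>
  define \<mu> where "\<mu> s = distr (density lborel (\<lambda>x. ennreal (s * g x))) borel e" for s :: real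
  have em: "emeasure (\<mu> s) A = (\<integral>\<^sup>+x. ennreal (s * g x) * indicator A (e x) \<partial>lborel)" if [measurable]: "A \<in> sets borel" for A s
  proof -
    have "emeasure (\<mu> s) A = (\<integral>\<^sup>+x. ennreal (s * g x) * indicator (e -` A) x \<partial>lborel)"
      unfolding \<mu>_def using measurable_sets_borel[OF \<open>e \<in> borel_measurable borel\<close> that]
      by (simp add: emeasure_distr emeasure_density)
    then show ?thesis by (simp add: indicator_def vimage_def)
  qed
  have emr: "emeasure (\<mu> s) A = ennreal (\<integral>x. max 0 (s * g x) * indicator A (e x) \<partial>lborel)" if [measurable]: "A \<in> sets borel" for A s
  proof -
    have "emeasure (\<mu> s) A = (\<integral>\<^sup>+x. ennreal (max 0 (s * g x) * indicator A (e x)) \<partial>lborel)"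
      unfolding em[OF that] by (intro nn_integral_cong) (auto simp: indicator_def ennreal_neg max_def)
    also have "\<dots> = ennreal (\<integral>x. max 0 (s * g x) * indicator A (e x) \<partial>lborel)"
    proof (rule nn_integral_eq_integral)
      show "integrable lborel (\<lambda>x. max 0 (s * g x) * indicator A (e x))"
        by (rule Bochner_Integration.integrable_bound[of _ "\<lambda>x. s * g x"]) (use g in \<open>auto simp: indicator_def\<close>)
    qed (auto simp: indicator_def)
    finally show ?thesis .
  qed
  have "\<mu> 1 = \<mu> (-1)"
  proof (rule measure_eqI_generator_eq[where E = "{S. open S}" and \<Omega> = UNIV and A = "\<lambda>_. UNIV"])
    fix U :: "(complex ^ 'n) set" assume "U \<in> {S. open S}"
    then have U: "open U" and [measurable]: "U \<in> sets borel" by auto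
    have i: "integrable lborel (\<lambda>x. max 0 (s * g x) * indicator U (e x))" for s
      by (rule Bochner_Integration.integrable_bound[of _ "\<lambda>x. s * g x"]) (use g in \<open>auto simp: indicator_def\<close>)
    have "(\<integral>x. max 0 (1 * g x) * indicator U (e x) \<partial>lborel) - (\<integral>x. max 0 (- 1 * g x) * indicator U (e x) \<partial>lborel)
      = (\<integral>x. max 0 (1 * g x) * indicator U (e x) - max 0 (- 1 * g x) * indicator U (e x) \<partial>lborel)"
      by (rule Bochner_Integration.integral_diff[symmetric, OF i i])
    also have "\<dots> = (\<integral>x. g x * indicator U (e x) \<partial>lborel)"
      by (intro Bochner_Integration.integral_cong refl) (auto simp: max_def indicator_def)
    also have "\<dots> = 0" by (rule z3[OF U])
    finally show "emeasure (\<mu> 1) U = emeasure (\<mu> (-1)) U" by (simp add: emr)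
  next
    show "emeasure (\<mu> 1) UNIV \<noteq> \<infinity>" by (simp add: emr)
  qed (auto simp: Int_stable_def \<mu>_def borel_def)
  \<comment> \<open>A Borel left inverse of \<open>e\<close> on the open box; on the closed cube
    opposite faces would be identified.\<close>
  define iv :: "complex ^ 'n \<Rightarrow> real ^ 'n" where "iv z = (\<chi> i. L * Arg2pi (z $ i) / (2 * pi))" for z
  have [measurable]: "Arg2pi \<in> borel_measurable borel"
    by (intro borel_measurableI_greater) (simp add: open_Arg2pi2pi_gt)
  have "iv \<in> borel_measurable borel"
  proof (subst borel_measurable_euclidean_space, intro ballI)
    fix b :: "real ^ 'n" assume "b \<in> Basis"
    then obtain i where b: "b = axis i 1" by (auto simp: Basis_vec_def)
    have [measurable]: "(\<lambda>z :: complex ^ 'n. z $ i) \<in> borel_measurable borel"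
      by (intro borel_measurable_continuous_onI continuous_intros)
    show "(\<lambda>z. iv z \<bullet> b) \<in> borel_measurable borel" unfolding b iv_def by (simp add: inner_axis)
  qed
  note [measurable] = this
  have iv: "iv (e x) = x" if x: "x \<in> box 0 (\<chi> i. L)" for x
  proof -
    have "0 < x $ i \<and> x $ i < L" for i
      using x by (auto simp: mem_box Basis_vec_def inner_axis)
    moreover have "Arg2pi (cis \<theta>) = \<theta>" if "0 \<le> \<theta>" "\<theta> < 2 * pi" for \<theta>
      using Arg2pi_unique[of 1 \<theta> "cis \<theta>"] that by (simp add: cis_conv_exp)
    ultimately have "Arg2pi (cis (2 * pi * x $ i / L)) = 2 * pi * x $ i / L" for i
      using L by (auto simp: field_simps less_imp_le)
    then show ?thesis using L by (simp add: iv_def e_def vec_eq_iff)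
  qed
  define A where "A = {z. g (iv z) > 0}"
  have A [measurable]: "A \<in> sets borel" unfolding A_def by measurable
  have "emeasure (\<mu> 1) A = emeasure (\<mu> (-1)) A" using \<open>\<mu> 1 = \<mu> (-1)\<close> by simp
  moreover have "emeasure (\<mu> (-1)) A = 0"
  proof -
    have "ennreal (- 1 * g x) * indicator A (e x) = 0" for x
      using supp[of x] iv[of x] by (cases "x \<in> box 0 (\<chi> i. L)") (auto simp: A_def indicator_def ennreal_neg)
    then have "(\<integral>\<^sup>+x. ennreal (- 1 * g x) * indicator A (e x) \<partial>lborel) = (\<integral>\<^sup>+(x :: real ^ 'n). 0 \<partial>lborel)"
      by (intro nn_integral_cong) simp
    then show ?thesis unfolding em[OF A] by simp
  qed
  moreover have "emeasure (\<mu> 1) A = (\<integral>\<^sup>+x. ennreal (g x) \<partial>lborel)"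
    unfolding em[OF A]
  proof (intro nn_integral_cong)
    fix x
    show "ennreal (1 * g x) * indicator A (e x) = ennreal (g x)"
      using supp[of x] iv[of x] by (cases "x \<in> box 0 (\<chi> i. L)") (auto simp: A_def indicator_def ennreal_neg)
  qed
  ultimately have "(\<integral>\<^sup>+x. ennreal (g x) \<partial>lborel) = 0" by simp
  then show ?thesis by (subst (asm) nn_integral_0_iff_AE) (auto simp: ennreal_eq_0_iff)
qed

section \<open>Sobolev norms and the propagator in Fourier coefficients\<close>

text \<open>Normalized so that a sufficiently regular function is \<open>trig (coef L f)\<close> at
  \<open>x / L\<close>: the two factors \<open>L powr (- real CARD('n) / 2)\<close> combine to the
  mean over the cube.\<close>

definition coef :: "real \<Rightarrow> (real ^ 'n \<Rightarrow> complex) \<Rightarrow> int ^ 'n \<Rightarrow> complex" where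
  "coef L f m = of_real (L powr (- real CARD('n) / 2)) * fourier_x L f ((1 / L) *\<^sub>R int_vec m)"

definition phase :: "real \<Rightarrow> int ^ 'n \<Rightarrow> real" where
  "phase L m = 4 * pi\<^sup>2 * (norm ((1 / L) *\<^sub>R int_vec m))\<^sup>2"

lemma coef_integral:
  fixes f :: "real ^ 'n \<Rightarrow> complex"
  assumes L: "L > 0"
  shows "coef L f m = of_real (1 / L ^ CARD('n)) * (LINT x:cube L|lborel. f x * ch (- m) ((1 / L) *\<^sub>R x))"
proof -
  have e: "cis (- 2 * pi * (((1 / L) *\<^sub>R int_vec m) \<bullet> x)) = ch (- m) ((1 / L) *\<^sub>R x)" for x
    unfolding ch_def by (rule arg_cong[where f = cis]) simp
  have "L powr (- real CARD('n) / 2) * L powr (- real CARD('n) / 2) = 1 / L ^ CARD('n)"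
  proof -
    have "L powr (- real CARD('n) / 2) * L powr (- real CARD('n) / 2) = L powr (- real CARD('n) / 2 + - real CARD('n) / 2)"
      by (rule powr_add[symmetric])
    also have "- real CARD('n) / 2 + - real CARD('n) / 2 = - real CARD('n)" by simp
    also have "L powr (- real CARD('n)) = 1 / L ^ CARD('n)"
      using L by (simp only: powr_minus powr_realpow inverse_eq_divide)
    finally show ?thesis .
  qed
  then show ?thesis
    unfolding coef_def fourier_x_def e mult.assoc[symmetric] of_real_mult[symmetric] by simp
qed

lemma fourier_x_coef:
  "L > 0 \<Longrightarrow> fourier_x L f ((1 / L) *\<^sub>R int_vec m) = of_real (L powr (real CARD('n) / 2)) * coef L f m"
  for f :: "real ^ 'n \<Rightarrow> complex"
proof -
  assume L: "L > 0"
  have "L powr (real CARD('n) / 2) * L powr (- real CARD('n) / 2) = L powr (real CARD('n) / 2 + - real CARD('n) / 2)"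
    by (rule powr_add[symmetric])
  then have "L powr (real CARD('n) / 2) * L powr (- real CARD('n) / 2) = 1" using L by simp
  then show ?thesis unfolding coef_def mult.assoc[symmetric] of_real_mult[symmetric] by simp
qed

lemma coef_cong_AE:
  fixes f g :: "real ^ 'n \<Rightarrow> complex"
  assumes L: "L > 0" and [measurable]: "f \<in> borel_measurable borel" "g \<in> borel_measurable borel"
    and "AE x in lborel. x \<in> cube L \<longrightarrow> f x = g x"
  shows "coef L f m = coef L g m"
proof -
  have [measurable]: "(\<lambda>x. ch (- m) ((1 / L) *\<^sub>R x)) \<in> borel_measurable borel"
    by (intro borel_measurable_continuous_onI continuous_intros)
  have "(LINT x:cube L|lborel. f x * ch (- m) ((1 / L) *\<^sub>R x)) = (LINT x:cube L|lborel. g x * ch (- m) ((1 / L) *\<^sub>R x))"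
    unfolding set_lebesgue_integral_def
    by (rule integral_cong_AE) (use assms(4) in \<open>auto simp: indicator_def elim!: eventually_mono\<close>)
  then show ?thesis unfolding coef_integral[OF L] by simp
qed

lemma integrable_cube_continuous:
  fixes f :: "real ^ 'n \<Rightarrow> complex"
  shows "continuous_on UNIV f \<Longrightarrow> integrable lborel (\<lambda>x. indicator (cube L) x *\<^sub>R f x)"
  by (rule borel_integrable_compact) (auto simp: cube_def intro: continuous_on_subset)

lemma coef_trig:
  fixes a :: "int ^ 'n \<Rightarrow> complex"
  assumes L: "L > 0" and a: "l1 a"
  shows "coef L (\<lambda>x. trig a ((1 / L) *\<^sub>R x)) m = a m"
proof -
  define f where "f x = indicator (cube L) x *\<^sub>R ch (- m) ((1 / L) *\<^sub>R x)" for x :: "real ^ 'n"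
  have f: "integrable lborel f" unfolding f_def by (intro integrable_cube_continuous continuous_intros)
  have "(\<integral>x. f x * ch l ((1 / L) *\<^sub>R x) \<partial>lborel) = (if l = m then of_real (L ^ CARD('n)) else 0)" for l
  proof -
    have "f x * ch l ((1 / L) *\<^sub>R x) = indicator (cube L) x *\<^sub>R ch (l - m) ((1 / L) *\<^sub>R x)" for x
      using ch_add[of "l" "- m" "(1 / L) *\<^sub>R x"] by (simp add: f_def mult.commute)
    then show ?thesis using orthogonality[OF L, of "l - m"] by (simp add: set_lebesgue_integral_def)
  qed
  then have "((\<lambda>l. if l = m then a l * of_real (L ^ CARD('n)) else 0) has_sum (\<integral>x. f x * trig a ((1 / L) *\<^sub>R x) \<partial>lborel)) UNIV"
    using integral_against_trig(2)[OF f a, of "1 / L"] by (simp add: if_distrib[of "(*) (a _)"] cong: if_cong)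
  moreover have "((\<lambda>l. if l = m then a l * of_real (L ^ CARD('n)) else 0) has_sum (a m * of_real (L ^ CARD('n)))) UNIV"
    by (rule has_sum_finite_neutralI[where B = "{m}"]) auto
  ultimately have "(\<integral>x. f x * trig a ((1 / L) *\<^sub>R x) \<partial>lborel) = a m * of_real (L ^ CARD('n))"
    by (rule has_sum_unique)
  moreover have "(\<integral>x. f x * trig a ((1 / L) *\<^sub>R x) \<partial>lborel) = (LINT x:cube L|lborel. trig a ((1 / L) *\<^sub>R x) * ch (- m) ((1 / L) *\<^sub>R x))"
    by (simp add: f_def set_lebesgue_integral_def mult.commute)
  ultimately show ?thesis unfolding coef_integral[OF L] using L by simp
qed

text \<open>The real part of \<open>c * h\<close> involves \<open>h\<close> and its conjugate, whose
  coefficients are the conjugates of those of \<open>h\<close> at opposite frequencies. The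
  one-sided real case with \<open>c\<close> among \<open>1\<close>, \<open>-1\<close>,
  \<open>\<i>\<close>, \<open>- \<i>\<close> then gives \<open>h = 0\<close>.\<close>

lemma fourier_uniqueness:
  fixes h :: "real ^ 'n \<Rightarrow> complex"
  assumes L: "L > 0" and h: "integrable lborel h" and supp: "\<And>x. x \<notin> box 0 (\<chi> i. L) \<Longrightarrow> h x = 0"
    and zero: "\<And>m. (\<integral>x. h x * ch m ((1 / L) *\<^sub>R x) \<partial>lborel) = 0"
  shows "AE x in lborel. h x = 0"
proof -
  have mc: "(\<lambda>x. ch m ((1 / L) *\<^sub>R x)) \<in> borel_measurable borel" for m :: "int ^ 'n"
    by (intro borel_measurable_continuous_onI continuous_intros)
  have mh: "h \<in> borel_measurable borel" using borel_measurable_integrable[OF h] by simp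
  have i1: "integrable lborel (\<lambda>x. h x * ch m ((1 / L) *\<^sub>R x))" for m
    by (rule Bochner_Integration.integrable_bound[OF h]) (use mc[of m] mh in \<open>auto simp: norm_mult\<close>)
  have mhc: "(\<lambda>x. cnj (h x)) \<in> borel_measurable borel"
    by (rule measurable_compose[OF mh]) (intro borel_measurable_continuous_onI continuous_intros)
  have i2: "integrable lborel (\<lambda>x. cnj (h x) * ch m ((1 / L) *\<^sub>R x))" for m
    by (rule Bochner_Integration.integrable_bound[OF h]) (use mc[of m] mh mhc in \<open>auto simp: norm_mult\<close>)
  have zc: "(\<integral>x. cnj (h x) * ch m ((1 / L) *\<^sub>R x) \<partial>lborel) = 0" for m
  proof -
    have "(\<integral>x. cnj (h x) * ch m ((1 / L) *\<^sub>R x) \<partial>lborel) = (\<integral>x. cnj (h x * ch (- m) ((1 / L) *\<^sub>R x)) \<partial>lborel)"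
      by (simp add: ch_minus)
    also have "\<dots> = cnj (\<integral>x. h x * ch (- m) ((1 / L) *\<^sub>R x) \<partial>lborel)" by (rule Bochner_Integration.integral_cnj)
    finally show ?thesis by (simp add: zero)
  qed
  have *: "AE x in lborel. Re (c * h x) \<le> 0" for c
  proof (rule fourier_uniqueness_real[OF L])
    show "integrable lborel (\<lambda>x. Re (c * h x))" using h by (intro integrable_Re integrable_mult_right)
    show "Re (c * h x) = 0" if "x \<notin> box 0 (\<chi> i. L)" for x using supp[OF that] by simp
    fix m
    have "complex_of_real (Re (c * h x)) = (c * h x + cnj c * cnj (h x)) / 2" for x
      using complex_add_cnj[of "c * h x"] by simp
    then have "(\<integral>x. complex_of_real (Re (c * h x)) * ch m ((1 / L) *\<^sub>R x) \<partial>lborel)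
      = (\<integral>x. (c / 2) * (h x * ch m ((1 / L) *\<^sub>R x)) + (cnj c / 2) * (cnj (h x) * ch m ((1 / L) *\<^sub>R x)) \<partial>lborel)"
      by (intro Bochner_Integration.integral_cong) (auto simp: algebra_simps add_divide_distrib)
    also have "\<dots> = 0"
      by (subst Bochner_Integration.integral_add) (use i1 i2 zero zc in \<open>auto intro!: integrable_mult_right\<close>)
    finally show "(\<integral>x. complex_of_real (Re (c * h x)) * ch m ((1 / L) *\<^sub>R x) \<partial>lborel) = 0" .
  qed
  show ?thesis
    using *[of 1] *[of "-1"] *[of \<i>] *[of "-\<i>"] by eventually_elim (simp add: complex_eq_iff)
qed

lemma AE_cube_box: "AE x in lborel. x \<in> cube L \<longrightarrow> x \<in> box 0 (\<chi> i. L :: real ^ 'n)"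
proof -
  have "emeasure lborel (cube L - box 0 (\<chi> i. L) :: (real ^ 'n) set) = 0"
    unfolding cube_def
    by (subst emeasure_Diff) (auto simp: emeasure_lborel_cbox_eq emeasure_lborel_box_eq box_subset_cbox)
  then have "cube L - box 0 (\<chi> i. L) \<in> null_sets (lborel :: (real ^ 'n) measure)" by (auto simp: cube_def null_sets_def)
  then show ?thesis by (rule AE_I') auto
qed

lemma set_integrable_torus_L2:
  assumes "torus_L2 L (f :: real ^ 'n \<Rightarrow> complex)" shows "set_integrable lborel (cube L) f"
  unfolding set_integrable_def
proof (rule Bochner_Integration.integrable_bound)
  have [measurable]: "f \<in> borel_measurable borel" using assms by (simp add: torus_L2_def)
  show "integrable lborel (\<lambda>x. indicator (cube L) x *\<^sub>R (1::real) + indicator (cube L) x *\<^sub>R (cmod (f x))\<^sup>2)"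
    using assms
    by (intro Bochner_Integration.integrable_add) (auto simp: torus_L2_def set_integrable_def intro!: integrable_real_indicator cube_sets)
  have "cmod z \<le> 1 + (cmod z)\<^sup>2" for z
  proof -
    have "0 \<le> (cmod z - 1)\<^sup>2 + 1 + (cmod z)\<^sup>2" by simp
    then show ?thesis by (simp add: power2_eq_square algebra_simps)
  qed
  then show "AE x in lborel. norm (indicator (cube L) x *\<^sub>R f x) \<le> norm (indicator (cube L) x *\<^sub>R (1::real) + indicator (cube L) x *\<^sub>R (cmod (f x))\<^sup>2)"
    by (intro AE_I2) (auto simp: indicator_def)
  show "(\<lambda>x. indicator (cube L) x *\<^sub>R f x) \<in> borel_measurable lborel" by measurable
qed

text \<open>Uniqueness applied to the difference of \<open>f\<close> and its series on the open box;
  the boundary of the cube is a null set.\<close>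

lemma torus_completeness:
  fixes f :: "real ^ 'n \<Rightarrow> complex"
  assumes L: "L > 0" and f: "torus_L2 L f" and a: "l1 (coef L f)"
  shows "AE x in lborel. x \<in> cube L \<longrightarrow> f x = trig (coef L f) ((1 / L) *\<^sub>R x)"
proof -
  define h where "h x = indicator (box 0 (\<chi> i. L)) x *\<^sub>R (f x - trig (coef L f) ((1 / L) *\<^sub>R x))" for x
  define h' where "h' x = indicator (cube L) x *\<^sub>R f x - indicator (cube L) x *\<^sub>R trig (coef L f) ((1 / L) *\<^sub>R x)" for x
  have [measurable]: "f \<in> borel_measurable borel" using f by (simp add: torus_L2_def)
  have ct: "continuous_on UNIV (\<lambda>x :: real ^ 'n. trig (coef L f) ((1 / L) *\<^sub>R x))"
    by (rule continuous_on_compose2[OF continuous_on_trig[OF a, of UNIV]]) (auto intro!: continuous_intros)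
  note [measurable] = borel_measurable_continuous_onI[OF ct]
  have if1: "integrable lborel (\<lambda>x. indicator (cube L) x *\<^sub>R f x)"
    using set_integrable_torus_L2[OF f] by (simp add: set_integrable_def)
  have if2: "integrable lborel (\<lambda>x. indicator (cube L) x *\<^sub>R trig (coef L f) ((1 / L) *\<^sub>R x))"
    by (rule integrable_cube_continuous[OF ct])
  have ih': "integrable lborel h'" unfolding h'_def by (intro Bochner_Integration.integrable_diff if1 if2)
  have bc: "x \<in> box 0 (\<chi> i. L) \<Longrightarrow> x \<in> cube L" for x :: "real ^ 'n"
    using box_subset_cbox unfolding cube_def by blast
  have hh': "AE x in lborel. h x = h' x"
    using AE_cube_box[of L] by eventually_elim (auto simp: h_def h'_def indicator_def dest: bc)
  have mh [measurable]: "h \<in> borel_measurable borel" "h' \<in> borel_measurable borel" unfolding h_def h'_def by measurable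
  have ih: "integrable lborel h" using ih' hh' by (subst integrable_cong_AE[of h _ h']) auto
  have "AE x in lborel. h x = 0"
  proof (rule fourier_uniqueness[OF L ih])
    show "h x = 0" if "x \<notin> box 0 (\<chi> i. L)" for x using that by (simp add: h_def)
    fix m :: "int ^ 'n"
    have [measurable]: "(\<lambda>x. ch m ((1 / L) *\<^sub>R x)) \<in> borel_measurable borel"
      by (intro borel_measurable_continuous_onI continuous_intros)
    have im: "integrable lborel (\<lambda>x. w x * ch m ((1 / L) *\<^sub>R x))" if "integrable lborel w" for w :: "real ^ 'n \<Rightarrow> complex"
    proof (rule Bochner_Integration.integrable_bound[OF that])
      have "w \<in> borel_measurable borel" using borel_measurable_integrable[OF that] by simp
      then show "(\<lambda>x. w x * ch m ((1 / L) *\<^sub>R x)) \<in> borel_measurable lborel" by measurable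
    qed (simp add: norm_mult)
    have c: "(LINT x:cube L|lborel. w x * ch m ((1 / L) *\<^sub>R x)) = of_real (L ^ CARD('n)) * coef L w (- m)" for w
      using L by (simp add: coef_integral)
    have "(\<integral>x. h x * ch m ((1 / L) *\<^sub>R x) \<partial>lborel) = (\<integral>x. h' x * ch m ((1 / L) *\<^sub>R x) \<partial>lborel)"
      using hh' by (intro integral_cong_AE) auto
    also have "\<dots> = (LINT x:cube L|lborel. f x * ch m ((1 / L) *\<^sub>R x)) - (LINT x:cube L|lborel. trig (coef L f) ((1 / L) *\<^sub>R x) * ch m ((1 / L) *\<^sub>R x))"
      unfolding h'_def left_diff_distrib set_lebesgue_integral_def
      by (subst Bochner_Integration.integral_diff[OF im[OF if1] im[OF if2]]) simp
    also have "\<dots> = 0" unfolding c coef_trig[OF L a] by simp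
    finally show "(\<integral>x. h x * ch m ((1 / L) *\<^sub>R x) \<partial>lborel) = 0" .
  qed
  then show ?thesis using AE_cube_box[of L] by eventually_elim (auto simp: h_def)
qed

lemma propagator_trig:
  fixes f :: "real ^ 'n \<Rightarrow> complex"
  assumes "L > 0"
  shows "propagator L t f x = trig (\<lambda>m. cis (phase L m * t) * coef L f m) ((1 / L) *\<^sub>R x)"
proof -
  have inj: "inj (\<lambda>m :: int ^ 'n. (1 / L) *\<^sub>R int_vec m)"
    using assms inj_int_vec by (auto simp: inj_on_def)
  have "propagator L t f x = of_real (L powr (- real CARD('n) / 2)) *
      (\<Sum>\<^sub>\<infinity>m. cis (4 * pi\<^sup>2 * t * (norm ((1 / L) *\<^sub>R int_vec m :: real ^ 'n))\<^sup>2) * fourier_x L f ((1 / L) *\<^sub>R int_vec m) * cis (2 * pi * (((1 / L) *\<^sub>R int_vec m) \<bullet> x)))"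
    unfolding propagator_def lattice_def by (subst infsum_reindex[OF inj]) (simp add: o_def)
  also have "\<dots> = (\<Sum>\<^sub>\<infinity>m. of_real (L powr (- real CARD('n) / 2)) * (cis (4 * pi\<^sup>2 * t * (norm ((1 / L) *\<^sub>R int_vec m :: real ^ 'n))\<^sup>2) * fourier_x L f ((1 / L) *\<^sub>R int_vec m) * cis (2 * pi * (((1 / L) *\<^sub>R int_vec m) \<bullet> x))))"
    by (rule infsum_cmult_right'[symmetric])
  also have "\<dots> = trig (\<lambda>m. cis (phase L m * t) * coef L f m) ((1 / L) *\<^sub>R x)"
    unfolding trig_def by (intro infsum_cong) (simp add: coef_def phase_def ch_def mult_ac)
  finally show ?thesis .
qed

lemma ennsqrt_le_iff: "h \<ge> 0 \<Longrightarrow> ennsqrt x \<le> ennreal h \<longleftrightarrow> x \<le> ennreal (h\<^sup>2)"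
proof (cases x)
  case (real r)
  assume h: "h \<ge> 0"
  have "sqrt r \<le> h \<longleftrightarrow> r \<le> h\<^sup>2" using real h by (metis real_sqrt_le_iff real_sqrt_pow2 real_sqrt_power real_sqrt_abs abs_of_nonneg)
  then show ?thesis using real h by (simp add: ennsqrt_def ennreal_le_iff)
qed (simp add: ennsqrt_def top_unique)

lemma ennreal_infsum_le_iff:
  fixes f :: "'i \<Rightarrow> real"
  assumes "\<And>i. i \<in> A \<Longrightarrow> f i \<ge> 0" "B \<ge> 0"
  shows "(\<Sum>\<^sub>\<infinity>i\<in>A. ennreal (f i)) \<le> ennreal B \<longleftrightarrow> (\<forall>F. finite F \<and> F \<subseteq> A \<longrightarrow> sum f F \<le> B)"
proof
  assume *: "(\<Sum>\<^sub>\<infinity>i\<in>A. ennreal (f i)) \<le> ennreal B"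
  show "\<forall>F. finite F \<and> F \<subseteq> A \<longrightarrow> sum f F \<le> B"
  proof (intro allI impI)
    fix F assume F: "finite F \<and> F \<subseteq> A"
    have "ennreal (sum f F) = (\<Sum>i\<in>F. ennreal (f i))" using F assms by (subst sum_ennreal) auto
    also have "\<dots> \<le> (\<Sum>\<^sub>\<infinity>i\<in>A. ennreal (f i))" using F by (subst nonneg_infsum_complete) (auto intro!: SUP_upper)
    finally show "sum f F \<le> B" using * assms(2) by (simp add: ennreal_le_iff flip: ennreal_le_iff)
  qed
next
  assume *: "\<forall>F. finite F \<and> F \<subseteq> A \<longrightarrow> sum f F \<le> B"
  show "(\<Sum>\<^sub>\<infinity>i\<in>A. ennreal (f i)) \<le> ennreal B"
  proof (rule infsum_le_finite_sums)
    fix F assume F: "finite F" "F \<subseteq> A"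
    have "(\<Sum>i\<in>F. ennreal (f i)) = ennreal (sum f F)" using F assms by (subst sum_ennreal) auto
    also have "\<dots> \<le> ennreal B" using * F by (intro ennreal_leI) auto
    finally show "(\<Sum>i\<in>F. ennreal (f i)) \<le> ennreal B" .
  qed (rule nonneg_summable_on_complete, simp)
qed

lemma jap_ge_1: "jap x \<ge> 1" and jap_sq: "(jap x)\<^sup>2 = 1 + 4 * pi\<^sup>2 * (norm x)\<^sup>2"
  by (auto simp: jap_def)

text \<open>The powers of \<open>L\<close> in \<open>fourier_x\<close> and in the norm cancel, so
  this is a weighted l2 norm of \<open>coef\<close>, brought into the form of bounds on finite
  sums.\<close>

lemma Hs_norm_le_iff:
  fixes f :: "real ^ 'n \<Rightarrow> complex"
  assumes L: "L > 0" and h: "h \<ge> 0"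
  shows "Hs_norm L s f \<le> ennreal h \<longleftrightarrow> torus_L2 L f \<and>
    (\<forall>F. finite F \<longrightarrow> (\<Sum>m\<in>F. jap ((1 / L) *\<^sub>R int_vec m :: real ^ 'n) powr (2 * s) * (cmod (coef L f m))\<^sup>2) \<le> h\<^sup>2)"
proof (cases "torus_L2 L f")
  case True
  let ?d = "real CARD('n)"
  have inj: "inj (\<lambda>m :: int ^ 'n. (1 / L) *\<^sub>R int_vec m)"
    using L inj_int_vec by (auto simp: inj_on_def)
  define w where "w m = jap ((1 / L) *\<^sub>R int_vec m :: real ^ 'n) powr (2 * s) * (cmod (coef L f m))\<^sup>2" for m
  have w: "w m \<ge> 0" for m by (simp add: w_def)
  have fx: "jap ((1 / L) *\<^sub>R int_vec m :: real ^ 'n) powr (2 * s) * (cmod (fourier_x L f ((1 / L) *\<^sub>R int_vec m)))\<^sup>2 = L powr ?d * w m" for m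
  proof -
    have "(L powr (?d / 2))\<^sup>2 = L powr ?d" by (simp add: power2_eq_square flip: powr_add)
    then show ?thesis using L by (simp add: fourier_x_coef norm_mult power_mult_distrib w_def)
  qed
  have Ld: "L powr - ?d * L powr ?d = 1" using L by (simp flip: powr_add)
  have "Hs_norm L s f = ennsqrt (ennreal (L powr - ?d) * (\<Sum>\<^sub>\<infinity>m. ennreal (L powr ?d * w m)))"
    unfolding Hs_norm_def lattice_def using True by (subst infsum_reindex[OF inj]) (simp add: o_def fx del: scaleR_conv_of_real)
  then have "Hs_norm L s f \<le> ennreal h \<longleftrightarrow> ennreal (L powr - ?d) * (\<Sum>\<^sub>\<infinity>m. ennreal (L powr ?d * w m)) \<le> ennreal (h\<^sup>2)"
    using h by (simp add: ennsqrt_le_iff)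
  also have "\<dots> \<longleftrightarrow> (\<Sum>\<^sub>\<infinity>m. ennreal (L powr ?d * w m)) \<le> ennreal (L powr ?d * h\<^sup>2)"
  proof
    assume "ennreal (L powr - ?d) * (\<Sum>\<^sub>\<infinity>m. ennreal (L powr ?d * w m)) \<le> ennreal (h\<^sup>2)"
    then have "ennreal (L powr ?d) * (ennreal (L powr - ?d) * (\<Sum>\<^sub>\<infinity>m. ennreal (L powr ?d * w m))) \<le> ennreal (L powr ?d) * ennreal (h\<^sup>2)"
      by (intro mult_left_mono) auto
    then show "(\<Sum>\<^sub>\<infinity>m. ennreal (L powr ?d * w m)) \<le> ennreal (L powr ?d * h\<^sup>2)"
      using Ld by (simp add: mult.assoc[symmetric] mult.commute[of "L powr ?d"] flip: ennreal_mult')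
  next
    assume "(\<Sum>\<^sub>\<infinity>m. ennreal (L powr ?d * w m)) \<le> ennreal (L powr ?d * h\<^sup>2)"
    then have "ennreal (L powr - ?d) * (\<Sum>\<^sub>\<infinity>m. ennreal (L powr ?d * w m)) \<le> ennreal (L powr - ?d) * ennreal (L powr ?d * h\<^sup>2)"
      by (intro mult_left_mono) auto
    then show "ennreal (L powr - ?d) * (\<Sum>\<^sub>\<infinity>m. ennreal (L powr ?d * w m)) \<le> ennreal (h\<^sup>2)"
      using Ld by (simp add: mult.assoc[symmetric] flip: ennreal_mult')
  qed
  also have "\<dots> \<longleftrightarrow> (\<forall>F. finite F \<longrightarrow> sum w F \<le> h\<^sup>2)"
    using w L by (subst ennreal_infsum_le_iff) (auto simp: sum_distrib_left[symmetric])
  finally show ?thesis using True by (simp add: w_def)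
qed (simp add: Hs_norm_def top_unique)

text \<open>Comparison of the two weights. The powers of \<open>L\<close> lost here are harmless:
  the lemma serves membership in the function spaces and uniqueness, not the bounds that have to be
  sharp in \<open>L\<close>.\<close>

lemma hw_jap_bounds:
  fixes m :: "int ^ 'n"
  assumes L: "L \<ge> 1"
  shows "1 / (hw m)\<^sup>2 \<le> (2 * L\<^sup>2) ^ CARD('n) * (jap ((1 / L) *\<^sub>R int_vec m)) ^ (2 * CARD('n))"
    and "jap ((1 / L) *\<^sub>R int_vec m) \<le> 7 / hw m"
proof -
  define J where "J = jap ((1 / L) *\<^sub>R int_vec m :: real ^ 'n)"
  have J2: "J\<^sup>2 = 1 + 4 * pi\<^sup>2 * ((norm (int_vec m :: real ^ 'n))\<^sup>2 / L\<^sup>2)"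
    using L by (simp add: J_def jap_sq power_divide power_mult_distrib)
  have J1: "J \<ge> 1" by (simp add: J_def jap_ge_1)
  have pi2: "1 \<le> 4 * pi\<^sup>2" using pi_ge_two power_mono[of 2 pi 2] by simp
  have "(1 + \<bar>real_of_int (m $ i)\<bar>)\<^sup>2 \<le> 2 * L\<^sup>2 * J\<^sup>2" for i
  proof -
    have "\<bar>real_of_int (m $ i)\<bar> \<le> norm (int_vec m :: real ^ 'n)"
      using component_le_norm_cart[of "int_vec m :: real ^ 'n" i] by simp
    then have mi: "(real_of_int (m $ i))\<^sup>2 \<le> (norm (int_vec m :: real ^ 'n))\<^sup>2" by (metis abs_ge_zero power2_abs power_mono)
    have "(1 + \<bar>real_of_int (m $ i)\<bar>)\<^sup>2 \<le> 2 * (1 + (real_of_int (m $ i))\<^sup>2)"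
      using sum_squares_bound[of 1 "\<bar>real_of_int (m $ i)\<bar>"] by (simp add: power2_eq_square algebra_simps)
    also have "\<dots> \<le> 2 * (1 + (norm (int_vec m :: real ^ 'n))\<^sup>2)" using mi by simp
    also have "\<dots> \<le> 2 * (L\<^sup>2 * 1 + 4 * pi\<^sup>2 * (norm (int_vec m :: real ^ 'n))\<^sup>2)"
    proof -
      have "1 * (norm (int_vec m :: real ^ 'n))\<^sup>2 \<le> 4 * pi\<^sup>2 * (norm (int_vec m :: real ^ 'n))\<^sup>2"
        using pi2 by (intro mult_right_mono) auto
      moreover have "1 \<le> L\<^sup>2" using L by (simp add: one_le_power)
      ultimately show ?thesis by (intro mult_left_mono add_mono) simp_all
    qed
    also have "\<dots> = 2 * L\<^sup>2 * J\<^sup>2" using L by (simp add: J2 field_simps)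
    finally show ?thesis .
  qed
  then have "(\<Prod>i\<in>UNIV. (1 + \<bar>real_of_int (m $ i)\<bar>)\<^sup>2) \<le> (\<Prod>i\<in>(UNIV :: 'n set). 2 * L\<^sup>2 * J\<^sup>2)"
    by (intro prod_mono) auto
  moreover have "1 / (hw m)\<^sup>2 = (\<Prod>i\<in>UNIV. (1 + \<bar>real_of_int (m $ i)\<bar>)\<^sup>2)"
    by (simp add: hw_def prod_inversef[symmetric] o_def divide_inverse power_inverse prod_power_distrib)
  ultimately show "1 / (hw m)\<^sup>2 \<le> (2 * L\<^sup>2) ^ CARD('n) * (jap ((1 / L) *\<^sub>R int_vec m)) ^ (2 * CARD('n))"
    by (simp add: J_def[symmetric] power_mult_distrib power_mult)
  have "J\<^sup>2 \<le> (7 * (1 + norm (int_vec m :: real ^ 'n)))\<^sup>2"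
  proof -
    have "(norm (int_vec m :: real ^ 'n))\<^sup>2 / L\<^sup>2 \<le> (norm (int_vec m :: real ^ 'n))\<^sup>2"
      using L by (intro divide_le_eq[THEN iffD2]) (auto simp: one_le_power mult_left_le intro!: mult_le_cancel_left1[THEN iffD2])
    moreover have "4 * pi\<^sup>2 \<le> 49" using pi_less_4 power_mono[of pi "3.5" 2] pi_approx by (simp add: power2_eq_square)
    ultimately have "4 * pi\<^sup>2 * ((norm (int_vec m :: real ^ 'n))\<^sup>2 / L\<^sup>2) \<le> 49 * (norm (int_vec m :: real ^ 'n))\<^sup>2"
      by (intro mult_mono) auto
    moreover have "1 + X \<le> 49 + 49 * Y + 98 * N" if "X \<le> 49 * Y" "0 \<le> N" for X Y N :: real using that by linarith
    ultimately have "1 + 4 * pi\<^sup>2 * ((norm (int_vec m :: real ^ 'n))\<^sup>2 / L\<^sup>2) \<le> 49 + 49 * (norm (int_vec m :: real ^ 'n))\<^sup>2 + 98 * norm (int_vec m :: real ^ 'n)"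
      using norm_ge_zero by blast
    then show ?thesis unfolding J2 power_mult_distrib power2_sum by simp
  qed
  then have "J \<le> 7 * (1 + norm (int_vec m :: real ^ 'n))" by (rule power2_le_imp_le) simp
  also have "\<dots> \<le> 7 * (1 / hw m)" using norm_int_vec_le_hw[of m] by (intro mult_left_mono) auto
  finally show "jap ((1 / L) *\<^sub>R int_vec m) \<le> 7 / hw m" by (simp add: J_def)
qed

text \<open>Cauchy-Schwarz with \<open>hw\<close> and \<open>1 / hw\<close>. Up to powers of
  \<open>L\<close>, \<open>1 / hw\<close> is bounded by the power \<open>CARD('n)\<close> of the
  Japanese bracket, which is why \<open>s = CARD('n)\<close> is the exponent fitting this
  weight.\<close>

lemma Hs_l1b:
  fixes f :: "real ^ 'n \<Rightarrow> complex"
  assumes L: "L \<ge> 1" and h: "h \<ge> 0" "Hs_norm L (real CARD('n)) f \<le> ennreal h"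
  shows "l1b (coef L f) (sqrt (3 ^ CARD('n)) * (sqrt ((2 * L\<^sup>2) ^ CARD('n)) * h))"
  unfolding l1b_def
proof (intro allI impI)
  fix F :: "(int ^ 'n) set" assume F: "finite F"
  let ?J = "\<lambda>m. jap ((1 / L) *\<^sub>R int_vec m :: real ^ 'n)"
  have "(\<Sum>m\<in>F. cmod (coef L f m)) = (\<Sum>m\<in>F. \<bar>hw m\<bar> * \<bar>1 / hw m * cmod (coef L f m)\<bar>)"
    using hw_pos by (intro sum.cong refl) (simp add: abs_mult less_imp_neq[OF hw_pos, symmetric])
  also have "\<dots> \<le> L2_set hw F * L2_set (\<lambda>m. 1 / hw m * cmod (coef L f m)) F"
    by (rule L2_set_mult_ineq)
  also have "\<dots> \<le> sqrt (3 ^ CARD('n)) * (sqrt ((2 * L\<^sup>2) ^ CARD('n)) * h)"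
  proof (intro mult_mono)
    show "L2_set hw F \<le> sqrt (3 ^ CARD('n))" unfolding L2_set_def using hw_square_sum_le[OF F] by simp
    have "(\<Sum>m\<in>F. (1 / hw m * cmod (coef L f m))\<^sup>2) \<le> (\<Sum>m\<in>F. (2 * L\<^sup>2) ^ CARD('n) * (?J m powr (2 * real CARD('n)) * (cmod (coef L f m))\<^sup>2))"
    proof (intro sum_mono)
      fix m :: "int ^ 'n"
      have "?J m > 0" using jap_ge_1[of "(1 / L) *\<^sub>R int_vec m :: real ^ 'n"] by linarith
      then have p: "?J m powr (2 * real CARD('n)) = ?J m ^ (2 * CARD('n))"
        using powr_realpow[of "?J m" "2 * CARD('n)"] by simp
      have "(1 / hw m * cmod (coef L f m))\<^sup>2 = (1 / (hw m)\<^sup>2) * (cmod (coef L f m))\<^sup>2" by (simp add: power_divide)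
      also have "\<dots> \<le> ((2 * L\<^sup>2) ^ CARD('n) * ?J m ^ (2 * CARD('n))) * (cmod (coef L f m))\<^sup>2"
        by (intro mult_right_mono hw_jap_bounds L) auto
      finally show "(1 / hw m * cmod (coef L f m))\<^sup>2 \<le> (2 * L\<^sup>2) ^ CARD('n) * (?J m powr (2 * real CARD('n)) * (cmod (coef L f m))\<^sup>2)"
        unfolding p by (simp add: mult_ac)
    qed
    also have "\<dots> \<le> (2 * L\<^sup>2) ^ CARD('n) * h\<^sup>2"
      unfolding sum_distrib_left[symmetric]
      using h L F by (intro mult_left_mono) (auto simp: Hs_norm_le_iff)
    finally have "L2_set (\<lambda>m. 1 / hw m * cmod (coef L f m)) F \<le> sqrt ((2 * L\<^sup>2) ^ CARD('n) * h\<^sup>2)"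
      unfolding L2_set_def by simp
    then show "L2_set (\<lambda>m. 1 / hw m * cmod (coef L f m)) F \<le> sqrt ((2 * L\<^sup>2) ^ CARD('n)) * h"
      using h by (simp add: real_sqrt_mult)
  qed auto
  finally show "(\<Sum>m\<in>F. cmod (coef L f m)) \<le> sqrt (3 ^ CARD('n)) * (sqrt ((2 * L\<^sup>2) ^ CARD('n)) * h)" .
qed

lemma periodic_trig: "L > 0 \<Longrightarrow> periodic L (\<lambda>x. trig a ((1 / L) *\<^sub>R x))"
  by (simp add: periodic_def scaleR_add_right trig_period)

lemma torus_L2_trig:
  fixes a :: "int ^ 'n \<Rightarrow> complex"
  assumes L: "L > 0" and a: "l1 a"
  shows "torus_L2 L (\<lambda>x. trig a ((1 / L) *\<^sub>R x))"
proof -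
  have ct: "continuous_on UNIV (\<lambda>x :: real ^ 'n. trig a ((1 / L) *\<^sub>R x))"
    by (rule continuous_on_compose2[OF continuous_on_trig[OF a, of UNIV]]) (auto intro!: continuous_intros)
  have "set_integrable lborel (cube L) (\<lambda>x. (cmod (trig a ((1 / L) *\<^sub>R x)))\<^sup>2)"
    unfolding set_integrable_def
    by (rule borel_integrable_compact) (auto simp: cube_def intro!: continuous_intros continuous_on_subset[OF ct])
  then show ?thesis
    unfolding torus_L2_def using periodic_trig[OF L] borel_measurable_continuous_onI[OF ct] by blast
qed

text \<open>\<open>CARD('n)\<close> powers of \<open>hw\<close> absorb the Japanese bracket, and the
  remaining one is square summable.\<close>

lemma Hs_norm_trig_le:
  fixes a :: "int ^ 'n \<Rightarrow> complex"
  assumes L: "L \<ge> 1" and a: "\<And>m. cmod (a m) \<le> C * hw m ^ (CARD('n) + 1)" and C: "C \<ge> 0"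
  shows "Hs_norm L (real CARD('n)) (\<lambda>x. trig a ((1 / L) *\<^sub>R x)) \<le> ennreal (C * sqrt (49 ^ CARD('n) * 3 ^ CARD('n)))"
proof -
  have l1: "l1 a" by (rule hw_summable_bound[OF a]) simp
  have L0: "L > 0" using L by simp
  let ?J = "\<lambda>m. jap ((1 / L) *\<^sub>R int_vec m :: real ^ 'n)"
  have "(\<Sum>m\<in>F. ?J m powr (2 * real CARD('n)) * (cmod (a m))\<^sup>2) \<le> (C * sqrt (49 ^ CARD('n) * 3 ^ CARD('n)))\<^sup>2" if F: "finite F" for F
  proof -
    have "(\<Sum>m\<in>F. ?J m powr (2 * real CARD('n)) * (cmod (a m))\<^sup>2) \<le> (\<Sum>m\<in>F. (C\<^sup>2 * 49 ^ CARD('n)) * (hw m)\<^sup>2)"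
    proof (intro sum_mono)
      fix m :: "int ^ 'n"
      have J0: "?J m > 0" using jap_ge_1[of "(1 / L) *\<^sub>R int_vec m :: real ^ 'n"] by linarith
      then have p: "?J m powr (2 * real CARD('n)) = ?J m ^ (2 * CARD('n))"
        using powr_realpow[of "?J m" "2 * CARD('n)"] by simp
      have "?J m ^ (2 * CARD('n)) * (cmod (a m))\<^sup>2 \<le> (7 / hw m) ^ (2 * CARD('n)) * (C * hw m ^ (CARD('n) + 1))\<^sup>2"
        using hw_jap_bounds(2)[OF L, of m] J0 a[of m] hw_pos[of m] by (intro mult_mono power_mono) auto
      also have "\<dots> = (C\<^sup>2 * 49 ^ CARD('n)) * (hw m)\<^sup>2"
      proof -
        have "((7::real) ^ k)\<^sup>2 = 49 ^ k" for k by (simp add: power2_eq_square flip: power_mult_distrib)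
        then show ?thesis
          using hw_pos[of m] by (simp add: power_divide power_mult power_mult_distrib power_add field_simps)
      qed
      finally show "?J m powr (2 * real CARD('n)) * (cmod (a m))\<^sup>2 \<le> (C\<^sup>2 * 49 ^ CARD('n)) * (hw m)\<^sup>2" unfolding p .
    qed
    also have "\<dots> \<le> (C\<^sup>2 * 49 ^ CARD('n)) * 3 ^ CARD('n)"
      unfolding sum_distrib_left[symmetric] using hw_square_sum_le[OF F] by (intro mult_left_mono) auto
    finally show ?thesis by (simp add: power_mult_distrib)
  qed
  then show ?thesis
    using C by (subst Hs_norm_le_iff[OF L0]) (auto simp: coef_trig[OF L0 l1] torus_L2_trig[OF L0 l1])
qed

section \<open>Uniqueness of mild solutions\<close>

lemma infinite_UNIV_int_vec: "infinite (UNIV :: (int ^ 'n) set)"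
proof
  assume "finite (UNIV :: (int ^ 'n) set)"
  then have "finite (range (\<lambda>k :: int. (\<chi> i. k) :: int ^ 'n))" by (rule finite_subset[rotated]) simp
  moreover have "inj (\<lambda>k :: int. (\<chi> i. k) :: int ^ 'n)" by (auto simp: inj_on_def vec_eq_iff)
  ultimately have "finite (UNIV :: int set)" by (rule finite_imageD)
  then show False by simp
qed

text \<open>Fubini for a series and a time integral: the lattice is enumerated, and the integrals of
  the absolute values have bounded partial sums.\<close>

lemma integral_infsum_swap:
  fixes h :: "real \<Rightarrow> int ^ 'n \<Rightarrow> complex"
  assumes c: "\<And>m. continuous_on {0..t} (\<lambda>s. h s m)" and b: "\<And>s. s \<in> {0..t} \<Longrightarrow> l1b (h s) B" and t: "t \<ge> 0"
  shows "l1b (\<lambda>m. integral {0..t} (\<lambda>s. h s m)) (t * B)"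
    and "(LINT s:{0..t}|lborel. (\<Sum>\<^sub>\<infinity>m. h s m)) = (\<Sum>\<^sub>\<infinity>m. integral {0..t} (\<lambda>s. h s m))"
proof -
  have cn: "continuous_on {0..t} (\<lambda>s. cmod (h s m))" for m by (intro continuous_intros c)
  have le: "(\<Sum>m\<in>F. integral {0..t} (\<lambda>s. cmod (h s m))) \<le> t * B" if F: "finite F" for F
  proof -
    have "(\<Sum>m\<in>F. integral {0..t} (\<lambda>s. cmod (h s m))) = integral {0..t} (\<lambda>s. \<Sum>m\<in>F. cmod (h s m))"
      by (rule integral_sum[symmetric]) (auto intro!: F integrable_continuous_interval cn)
    also have "\<dots> \<le> integral {0..t} (\<lambda>s. B)"
      by (rule integral_le) (use b F in \<open>auto intro!: integrable_continuous_interval continuous_intros cn simp: l1b_def\<close>)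
    also have "\<dots> = t * B" using t by simp
    finally show ?thesis .
  qed
  have nle: "cmod (integral {0..t} (\<lambda>s. h s m)) \<le> integral {0..t} (\<lambda>s. cmod (h s m))" for m
    by (rule integral_norm_bound_integral) (auto intro!: integrable_continuous_interval c cn)
  show l1b: "l1b (\<lambda>m. integral {0..t} (\<lambda>s. h s m)) (t * B)"
    unfolding l1b_def by (auto intro!: order_trans[OF sum_mono[OF nle] le])
  define f where "f = from_nat_into (UNIV :: (int ^ 'n) set)"
  have f: "bij f" unfolding f_def
    using bij_betw_from_nat_into[of "UNIV :: (int ^ 'n) set"] infinite_UNIV_int_vec by auto
  have si: "set_integrable lborel {0..t} (\<lambda>s. h s m)" for m
    by (rule borel_integrable_atLeastAtMost'[OF c])
  have "l1 (h s)" if "s \<in> {0..t}" for s by (rule l1b_l1[OF b[OF that]])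
  then have l1f: "(\<lambda>i. norm (h s (f i))) summable_on UNIV" if "s \<in> {0..t}" for s
    using that summable_on_reindex_bij_betw[OF f, of "\<lambda>m. norm (h s m)"] by simp
  have sf: "(\<lambda>i. h s (f i)) sums (\<Sum>\<^sub>\<infinity>m. h s m)" if "s \<in> {0..t}" for s
  proof -
    have "((\<lambda>i. h s (f i)) has_sum (\<Sum>\<^sub>\<infinity>i. h s (f i))) UNIV"
      by (rule has_sum_infsum, rule Infinite_Sum.abs_summable_summable, rule l1f[OF that])
    then show ?thesis using has_sum_imp_sums infsum_reindex_bij_betw[OF f, of "h s"] by fastforce
  qed
  have "(LINT s:{0..t}|lborel. (\<Sum>\<^sub>\<infinity>m. h s m)) = (\<integral>s. (\<Sum>i. indicator {0..t} s *\<^sub>R h s (f i)) \<partial>lborel)"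
    unfolding set_lebesgue_integral_def
    by (intro Bochner_Integration.integral_cong refl) (auto simp: indicator_def sums_unique[OF sf])
  also have "\<dots> = (\<Sum>i. \<integral>s. indicator {0..t} s *\<^sub>R h s (f i) \<partial>lborel)"
  proof (rule integral_suminf)
    show "integrable lborel (\<lambda>s. indicator {0..t} s *\<^sub>R h s (f i))" for i using si[of "f i"] by (simp add: set_integrable_def)
    show "AE s in lborel. summable (\<lambda>i. norm (indicator {0..t} s *\<^sub>R h s (f i)))"
      using summable_on_imp_summable[OF l1f] by (intro AE_I2) (auto simp: indicator_def)
    have eq: "(\<integral>s. norm (indicator {0..t} s *\<^sub>R h s (f i)) \<partial>lborel) = integral {0..t} (\<lambda>s. cmod (h s (f i)))" for i
    proof -
      have "(\<integral>s. norm (indicator {0..t} s *\<^sub>R h s (f i)) \<partial>lborel) = (LINT s:{0..t}|lborel. cmod (h s (f i)))"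
        unfolding set_lebesgue_integral_def by (intro Bochner_Integration.integral_cong) (auto simp: indicator_def)
      also have "\<dots> = integral {0..t} (\<lambda>s. cmod (h s (f i)))"
        by (rule set_borel_integral_eq_integral(2)[OF borel_integrable_atLeastAtMost'[OF cn]])
      finally show ?thesis .
    qed
    show "summable (\<lambda>i. \<integral>s. norm (indicator {0..t} s *\<^sub>R h s (f i)) \<partial>lborel)"
      unfolding eq
    proof (rule summableI_nonneg_bounded)
      show "integral {0..t} (\<lambda>s. cmod (h s (f i))) \<ge> 0" for i
        by (rule integral_nonneg) (auto intro!: integrable_continuous_interval cn)
      fix n
      have "(\<Sum>i<n. integral {0..t} (\<lambda>s. cmod (h s (f i)))) = (\<Sum>m\<in>f ` {..<n}. integral {0..t} (\<lambda>s. cmod (h s m)))"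
        using f by (subst sum.reindex) (auto intro: inj_on_subset simp: bij_def)
      also have "\<dots> \<le> t * B" by (rule le) simp
      finally show "(\<Sum>i<n. integral {0..t} (\<lambda>s. cmod (h s (f i)))) \<le> t * B" .
    qed
  qed
  also have "\<dots> = (\<Sum>i. integral {0..t} (\<lambda>s. h s (f i)))"
    using set_borel_integral_eq_integral(2)[OF si] by (simp add: set_lebesgue_integral_def)
  also have "\<dots> = (\<Sum>\<^sub>\<infinity>m. integral {0..t} (\<lambda>s. h s m))"
  proof -
    have "(\<lambda>i. norm (integral {0..t} (\<lambda>s. h s (f i)))) summable_on UNIV"
      using l1b_l1[OF l1b] summable_on_reindex_bij_betw[OF f, of "\<lambda>m. norm (integral {0..t} (\<lambda>s. h s m))"] by simp
    then have "((\<lambda>i. integral {0..t} (\<lambda>s. h s (f i))) has_sum (\<Sum>\<^sub>\<infinity>i. integral {0..t} (\<lambda>s. h s (f i)))) UNIV"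
      by (intro has_sum_infsum) (rule Infinite_Sum.abs_summable_summable)
    then show ?thesis using sums_unique[OF has_sum_imp_sums] infsum_reindex_bij_betw[OF f, of "\<lambda>m. integral {0..t} (\<lambda>s. h s m)"] by fastforce
  qed
  finally show "(LINT s:{0..t}|lborel. (\<Sum>\<^sub>\<infinity>m. h s m)) = (\<Sum>\<^sub>\<infinity>m. integral {0..t} (\<lambda>s. h s m))" .
qed

text \<open>The Duhamel operator on the diagonal, outside its locale: uniqueness concerns arbitrary
  mild solutions, for which no bound \<open>xb\<close> is at hand.\<close>

definition duh :: "(int ^ 'n \<Rightarrow> real) \<Rightarrow> (real \<Rightarrow> int ^ 'n \<Rightarrow> complex) \<Rightarrow> real \<Rightarrow> int ^ 'n \<Rightarrow> complex" where
  "duh \<phi> a t m = - \<i> * integral {0..t} (\<lambda>s. cis (\<phi> m * (t - s)) * conv (a s) (a s) m)"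

text \<open>The propagator sees a function only through its coefficients, so the nonlinearity enters
  by them alone; the absolutely convergent series is then integrated term by term.\<close>

lemma duhamel_term_trig:
  fixes a :: "real \<Rightarrow> int ^ 'n \<Rightarrow> complex"
  assumes L: "L > 0" and t: "t \<ge> 0"
    and c: "\<And>m. continuous_on {0..t} (\<lambda>s. conv (a s) (a s) m)" and b: "\<And>s. s \<in> {0..t} \<Longrightarrow> l1b (a s) B"
    and w: "\<And>s. s \<in> {0..t} \<Longrightarrow> coef L (w s) = conv (a s) (a s)"
  shows "l1b (duh (phase L) a t) (t * (B * B))"
    and "- \<i> * (LINT t':{0..t}|lborel. propagator L (t - t') (w t') x) = trig (duh (phase L) a t) ((1 / L) *\<^sub>R x)"
proof -
  define h where "h y s m = - \<i> * (cis (phase L m * (t - s)) * conv (a s) (a s) m) * ch m y" for y s and m :: "int ^ 'n"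
  have hc: "continuous_on {0..t} (\<lambda>s. h y s m)" for y m
    unfolding h_def cis_conv_exp by (intro continuous_intros c)
  have B: "l1b (conv (a s) (a s)) (B * B)" if "s \<in> {0..t}" for s
  proof -
    have l: "l1 (a s)" "n1 (a s) \<le> B" using b[OF that] by (auto intro: l1b_l1 l1b_n1)
    have "n1 (conv (a s) (a s)) \<le> n1 (a s) * n1 (a s)" by (rule l1_conv(2)[OF l(1) l(1)])
    also have "\<dots> \<le> B * B" using l n1_nonneg[of "a s"] by (intro mult_mono) auto
    finally show ?thesis using l1_l1b[OF l1_conv(1)[OF l(1) l(1)]] by (auto simp: l1b_def intro: order_trans)
  qed
  have hB: "l1b (h y s) (B * B)" if "s \<in> {0..t}" for s y
    using B[OF that] by (simp add: l1b_def h_def norm_mult)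
  have eq: "integral {0..t} (\<lambda>s. h y s m) = duh (phase L) a t m * ch m y" for y m
    unfolding h_def duh_def by simp
  show "l1b (duh (phase L) a t) (t * (B * B))"
    using integral_infsum_swap(1)[OF hc hB t, of 0] unfolding eq by simp
  have "- \<i> * (LINT t':{0..t}|lborel. propagator L (t - t') (w t') x) = (LINT s:{0..t}|lborel. - \<i> * propagator L (t - s) (w s) x)"
    by (rule set_integral_mult_right[symmetric])
  also have "\<dots> = (LINT s:{0..t}|lborel. (\<Sum>\<^sub>\<infinity>m. h ((1 / L) *\<^sub>R x) s m))"
    unfolding set_lebesgue_integral_def
  proof (intro Bochner_Integration.integral_cong refl)
    fix s
    show "indicator {0..t} s *\<^sub>R (- \<i> * propagator L (t - s) (w s) x) = indicator {0..t} s *\<^sub>R (\<Sum>\<^sub>\<infinity>m. h ((1 / L) *\<^sub>R x) s m)"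
    proof (cases "s \<in> {0..t}")
      case True
      have "- \<i> * propagator L (t - s) (w s) x = (\<Sum>\<^sub>\<infinity>m. - \<i> * (cis (phase L m * (t - s)) * conv (a s) (a s) m * ch m ((1 / L) *\<^sub>R x)))"
        unfolding propagator_trig[OF L] w[OF True] trig_def by (rule infsum_cmult_right'[symmetric])
      also have "\<dots> = (\<Sum>\<^sub>\<infinity>m. h ((1 / L) *\<^sub>R x) s m)" unfolding h_def by (simp only: mult.assoc)
      finally show ?thesis by simp
    qed simp
  qed
  also have "\<dots> = (\<Sum>\<^sub>\<infinity>m. integral {0..t} (\<lambda>s. h ((1 / L) *\<^sub>R x) s m))" by (rule integral_infsum_swap(2)[OF hc hB t])
  also have "\<dots> = trig (duh (phase L) a t) ((1 / L) *\<^sub>R x)" unfolding eq trig_def ..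
  finally show "- \<i> * (LINT t':{0..t}|lborel. propagator L (t - t') (w t') x) = trig (duh (phase L) a t) ((1 / L) *\<^sub>R x)" .
qed

lemma n1_triangle: "l1 a \<Longrightarrow> l1 b \<Longrightarrow> n1 (\<lambda>m. a m + b m) \<le> n1 a + n1 b"
  unfolding n1_def by (subst infsum_add[symmetric]) (auto intro!: infsum_mono l1_add summable_on_add norm_triangle_ineq)

lemma n1_diff_le: "l1 a \<Longrightarrow> l1 b \<Longrightarrow> \<bar>n1 a - n1 b\<bar> \<le> n1 (\<lambda>m. a m - b m)"
proof -
  assume a: "l1 a" and b: "l1 b"
  have "n1 a \<le> n1 (\<lambda>m. a m - b m) + n1 b" using n1_triangle[OF l1_diff[OF a b] b] by simp
  moreover have "n1 b \<le> n1 (\<lambda>m. b m - a m) + n1 a" using n1_triangle[OF l1_diff[OF b a] a] by simp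
  moreover have "n1 (\<lambda>m. b m - a m) = n1 (\<lambda>m. a m - b m)" by (simp add: n1_def norm_minus_commute)
  ultimately show ?thesis by linarith
qed

lemma n1_point: "l1 a \<Longrightarrow> cmod (a m) \<le> n1 a"
  using l2b_point[OF l1_l2b] .

text \<open>Continuity with values in l1, the common ground of arbitrary mild solutions and of the
  constructed one.\<close>

definition cts_l1 :: "real \<Rightarrow> (real \<Rightarrow> int ^ 'n \<Rightarrow> complex) \<Rightarrow> bool" where
  "cts_l1 T a \<longleftrightarrow> (\<forall>t\<in>{0..T}. l1 (a t)) \<and> (\<forall>t\<in>{0..T}. ((\<lambda>s. n1 (\<lambda>m. a s m - a t m)) \<longlongrightarrow> 0) (at t within {0..T}))"

lemma cts_l1_props:
  assumes "cts_l1 T (a :: real \<Rightarrow> int ^ 'n \<Rightarrow> complex)"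
  shows "continuous_on {0..T} (\<lambda>t. a t m)" "continuous_on {0..T} (\<lambda>t. conv (a t) (a t) m)"
    "\<exists>B. \<forall>t\<in>{0..T}. l1b (a t) B"
proof -
  have l: "l1 (a t)" if "t \<in> {0..T}" for t using assms that by (auto simp: cts_l1_def)
  have lim: "((\<lambda>s. n1 (\<lambda>m. a s m - a t m)) \<longlongrightarrow> 0) (at t within {0..T})" if "t \<in> {0..T}" for t
    using assms that by (auto simp: cts_l1_def)
  have ev: "\<forall>\<^sub>F s in at t within {0..T}. s \<in> {0..T}" for t by (simp add: eventually_at_filter)
  show "continuous_on {0..T} (\<lambda>t. a t m)" unfolding continuous_on_def
  proof
    fix t assume t: "t \<in> {0..T}"
    show "((\<lambda>t. a t m) \<longlongrightarrow> a t m) (at t within {0..T})"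
    proof (rule LIM_zero_cancel, rule Lim_null_comparison[OF _ lim[OF t]])
      show "\<forall>\<^sub>F s in at t within {0..T}. cmod (a s m - a t m) \<le> n1 (\<lambda>m. a s m - a t m)"
        using ev by eventually_elim (auto intro!: n1_point[of "\<lambda>m. a _ m - a t m"] l1_diff l t)
    qed
  qed
  have "continuous_on {0..T} (\<lambda>t. n1 (a t))" unfolding continuous_on_def
  proof
    fix t assume t: "t \<in> {0..T}"
    show "((\<lambda>t. n1 (a t)) \<longlongrightarrow> n1 (a t)) (at t within {0..T})"
    proof (rule LIM_zero_cancel, rule Lim_null_comparison[OF _ lim[OF t]])
      show "\<forall>\<^sub>F s in at t within {0..T}. norm (n1 (a s) - n1 (a t)) \<le> n1 (\<lambda>m. a s m - a t m)"
        using ev by eventually_elim (auto intro!: n1_diff_le l t)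
    qed
  qed
  then have "compact ((\<lambda>t. n1 (a t)) ` {0..T})" by (intro compact_continuous_image) auto
  then obtain B where B: "\<And>t. t \<in> {0..T} \<Longrightarrow> \<bar>n1 (a t)\<bar> \<le> B"
    by (meson bounded_real compact_imp_bounded image_eqI)
  then have B': "l1b (a t) B" if "t \<in> {0..T}" for t
    using l1_l1b[OF l[OF that]] B[OF that] by (auto simp: l1b_def intro: order_trans)
  then show "\<exists>B. \<forall>t\<in>{0..T}. l1b (a t) B" by blast
  show "continuous_on {0..T} (\<lambda>t. conv (a t) (a t) m)" unfolding continuous_on_def
  proof
    fix t assume t: "t \<in> {0..T}"
    show "((\<lambda>t. conv (a t) (a t) m) \<longlongrightarrow> conv (a t) (a t) m) (at t within {0..T})"
    proof (rule LIM_zero_cancel, rule Lim_null_comparison)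
      have "((\<lambda>s. (2 * B) * n1 (\<lambda>m. a s m - a t m)) \<longlongrightarrow> (2 * B) * 0) (at t within {0..T})"
        by (intro tendsto_intros lim[OF t])
      then show "((\<lambda>s. (2 * B) * n1 (\<lambda>m. a s m - a t m)) \<longlongrightarrow> 0) (at t within {0..T})" by simp
      show "\<forall>\<^sub>F s in at t within {0..T}. cmod (conv (a s) (a s) m - conv (a t) (a t) m) \<le> (2 * B) * n1 (\<lambda>m. a s m - a t m)"
        using ev
      proof eventually_elim
        case (elim s)
        have "cmod (conv (a s) (a s) m - conv (a t) (a t) m) = cmod (conv (\<lambda>l. a s l + a t l) (\<lambda>l. a s l - a t l) m)"
          by (subst conv_square_diff[OF l1_l2b[OF l[OF elim]] l1_l2b[OF l[OF t]]]) simp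
        also have "\<dots> \<le> n1 (\<lambda>l. a s l + a t l) * n1 (\<lambda>l. a s l - a t l)"
          by (intro norm_conv_le l1_l2b l1_add l1_diff l elim t)
        also have "\<dots> \<le> (2 * B) * n1 (\<lambda>m. a s m - a t m)"
          using n1_triangle[OF l[OF elim] l[OF t]] B[OF elim] B[OF t] by (intro mult_right_mono n1_nonneg) auto
        finally show ?case .
      qed
    qed
  qed
qed

text \<open>At a maximum point \<open>s\<close> of \<open>z t = exp (- (2 * C * t)) * y t\<close>
  the hypothesis yields \<open>exp (2 * C * s) * z s \<le> (exp (2 * C * s) - 1) * z s / 2\<close>,
  which forces \<open>z s = 0\<close>.\<close>

lemma gronwall_zero:
  fixes y :: "real \<Rightarrow> real"
  assumes y: "continuous_on {0..T} y" "\<And>t. t \<in> {0..T} \<Longrightarrow> y t \<ge> 0"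
    and C: "C > 0" and le: "\<And>t. t \<in> {0..T} \<Longrightarrow> y t \<le> integral {0..t} (\<lambda>s. C * y s)"
    and t: "t \<in> {0..T}"
  shows "y t = 0"
proof -
  define z where "z t = exp (- (2 * C * t)) * y t" for t
  have cz: "continuous_on {0..T} z" unfolding z_def by (intro continuous_intros y)
  have ne: "{0..T} \<noteq> {}" using t by auto
  obtain s where s: "s \<in> {0..T}" "\<And>t. t \<in> {0..T} \<Longrightarrow> z t \<le> z s"
    using continuous_attains_sup[OF compact_Icc ne cz] by auto
  have ex: "((\<lambda>r. C * (exp (2 * C * r) * z s)) has_integral (exp (2 * C * s) * z s / 2 - exp (2 * C * 0) * z s / 2)) {0..s}"
  proof (rule fundamental_theorem_of_calculus)
    fix r assume "r \<in> {0..s}"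
    show "((\<lambda>r. exp (2 * C * r) * z s / 2) has_vector_derivative C * (exp (2 * C * r) * z s)) (at r within {0..s})"
      unfolding has_real_derivative_iff_has_vector_derivative[symmetric]
      by (auto intro!: derivative_eq_intros)
  qed (use s in auto)
  have yz: "y r = exp (2 * C * r) * z r" for r by (simp add: z_def mult.assoc[symmetric] exp_minus)
  have zs: "z s \<ge> 0" using y(2)[OF s(1)] by (simp add: z_def)
  have "exp (2 * C * s) * z s = y s" by (simp add: yz)
  also have "\<dots> \<le> integral {0..s} (\<lambda>r. C * y r)" by (rule le[OF s(1)])
  also have "\<dots> \<le> integral {0..s} (\<lambda>r. C * (exp (2 * C * r) * z s))"
  proof (rule integral_le)
    show "(\<lambda>r. C * y r) integrable_on {0..s}"
      by (intro integrable_continuous_interval continuous_intros continuous_on_subset[OF y(1)]) (use s in auto)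
    show "(\<lambda>r. C * (exp (2 * C * r) * z s)) integrable_on {0..s}" using ex by (rule has_integral_integrable)
    fix r assume "r \<in> {0..s}"
    then have "z r \<le> z s" using s by auto
    then show "C * y r \<le> C * (exp (2 * C * r) * z s)" unfolding yz using C by simp
  qed
  also have "\<dots> = exp (2 * C * s) * z s / 2 - exp (2 * C * 0) * z s / 2" by (rule integral_unique[OF ex])
  finally have "exp (2 * C * s) * z s \<le> 0" using zs by simp
  then have "z s = 0" using zs by (simp add: mult_le_0_iff)
  then have "z t \<le> 0" using s(2)[OF t] by simp
  then have "y t \<le> 0" by (simp add: z_def mult_le_0_iff)
  then show ?thesis using y(2)[OF t] by simp
qed

text \<open>Gronwall for the l1 norm of the difference: the phases are unimodular, and l1 is an
  algebra under convolution, so the quadratic term is Lipschitz with constant at most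
  \<open>A + B\<close>.\<close>

lemma duhamel_unique:
  fixes a b :: "real \<Rightarrow> int ^ 'n \<Rightarrow> complex"
  assumes a: "cts_l1 T a" "\<And>t m. t \<in> {0..T} \<Longrightarrow> a t m = cis (\<phi> m * t) * c m + duh \<phi> a t m"
    and b: "cts_l1 T b" "\<And>t m. t \<in> {0..T} \<Longrightarrow> b t m = cis (\<phi> m * t) * c m + duh \<phi> b t m"
    and t: "t \<in> {0..T}"
  shows "a t m = b t m"
proof -
  have l: "l1 (a t)" "l1 (b t)" if "t \<in> {0..T}" for t using a b that by (auto simp: cts_l1_def)
  obtain A where A: "\<And>t. t \<in> {0..T} \<Longrightarrow> l1b (a t) A" using cts_l1_props(3)[OF a(1)] by blast
  obtain B where B: "\<And>t. t \<in> {0..T} \<Longrightarrow> l1b (b t) B" using cts_l1_props(3)[OF b(1)] by blast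
  define y where "y t = n1 (\<lambda>m. a t m - b t m)" for t
  have "n1 (a t) \<le> A" "n1 (b t) \<le> B" using l1b_n1[OF A[OF t]] l1b_n1[OF B[OF t]] by auto
  then have AB: "A \<ge> 0" "B \<ge> 0" using n1_nonneg order_trans by blast+
  have "y t = 0"
  \<comment> \<open>The added \<open>1\<close> makes the constant strictly positive.\<close>
  proof (rule gronwall_zero[where C = "A + B + 1" and T = T and y = y and t = t])
    show "continuous_on {0..T} y" unfolding continuous_on_def
    proof
      fix t assume t: "t \<in> {0..T}"
      show "(y \<longlongrightarrow> y t) (at t within {0..T})"
      proof (rule LIM_zero_cancel, rule Lim_null_comparison)
        have "((\<lambda>s. n1 (\<lambda>m. a s m - a t m) + n1 (\<lambda>m. b s m - b t m)) \<longlongrightarrow> 0 + 0) (at t within {0..T})"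
          using a(1) b(1) t by (intro tendsto_add) (auto simp: cts_l1_def)
        then show "((\<lambda>s. n1 (\<lambda>m. a s m - a t m) + n1 (\<lambda>m. b s m - b t m)) \<longlongrightarrow> 0) (at t within {0..T})" by simp
        have "\<forall>\<^sub>F s in at t within {0..T}. s \<in> {0..T}" by (simp add: eventually_at_filter)
        then show "\<forall>\<^sub>F s in at t within {0..T}. norm (y s - y t) \<le> n1 (\<lambda>m. a s m - a t m) + n1 (\<lambda>m. b s m - b t m)"
        proof eventually_elim
          case (elim s)
          have "norm (y s - y t) \<le> n1 (\<lambda>m. (a s m - b s m) - (a t m - b t m))"
            unfolding y_def real_norm_def by (intro n1_diff_le l1_diff l elim t)
          also have "(\<lambda>m. (a s m - b s m) - (a t m - b t m)) = (\<lambda>m. (a s m - a t m) + (b t m - b s m))" by auto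
          also have "n1 \<dots> \<le> n1 (\<lambda>m. a s m - a t m) + n1 (\<lambda>m. b t m - b s m)"
            by (intro n1_triangle l1_diff l elim t)
          also have "n1 (\<lambda>m. b t m - b s m) = n1 (\<lambda>m. b s m - b t m)" by (simp add: n1_def norm_minus_commute)
          finally show ?case .
        qed
      qed
    qed
    then have cy: "continuous_on {0..t} y" if "t \<in> {0..T}" for t
      by (rule continuous_on_subset) (use that in auto)
    show "y t \<ge> 0" for t by (simp add: y_def n1_nonneg)
    show "A + B + 1 > 0" using AB by simp
    fix t assume t: "t \<in> {0..T}"
    have sq: "conv (a s) (a s) m - conv (b s) (b s) m = conv (\<lambda>l. a s l + b s l) (\<lambda>l. a s l - b s l) m" if "s \<in> {0..t}" for s m
      by (rule conv_square_diff) (use that t in \<open>auto intro!: l1_l2b l\<close>)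
    define g where "g s m = - \<i> * (cis (\<phi> m * (t - s)) * (conv (a s) (a s) m - conv (b s) (b s) m))" for s m
    have ca: "continuous_on {0..t} (\<lambda>s. conv (a s) (a s) m)" "continuous_on {0..t} (\<lambda>s. conv (b s) (b s) m)" for m
      using continuous_on_subset[OF cts_l1_props(2)[OF a(1)]] continuous_on_subset[OF cts_l1_props(2)[OF b(1)]] t by auto
    have cg: "continuous_on {0..t} (\<lambda>s. g s m)" for m
      unfolding g_def cis_conv_exp by (intro continuous_intros ca)
    have "a t m - b t m = integral {0..t} (\<lambda>s. g s m)" for m
    proof -
      have i: "(\<lambda>s. cis (\<phi> m * (t - s)) * conv (a s) (a s) m) integrable_on {0..t}" "(\<lambda>s. cis (\<phi> m * (t - s)) * conv (b s) (b s) m) integrable_on {0..t}"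
        unfolding cis_conv_exp by (intro integrable_continuous_interval continuous_intros ca)+
      have "integral {0..t} (\<lambda>s. g s m) = - \<i> * integral {0..t} (\<lambda>s. cis (\<phi> m * (t - s)) * conv (a s) (a s) m - cis (\<phi> m * (t - s)) * conv (b s) (b s) m)"
        unfolding g_def right_diff_distrib[symmetric] by simp
      also have "\<dots> = duh \<phi> a t m - duh \<phi> b t m"
        unfolding duh_def integral_diff[OF i] by (simp only: right_diff_distrib)
      finally show ?thesis using a(2)[OF t] b(2)[OF t] by simp
    qed
    then have "y t = n1 (\<lambda>m. integral {0..t} (\<lambda>s. g s m))" by (simp add: y_def)
    also have "\<dots> \<le> integral {0..t} (\<lambda>s. (A + B + 1) * y s)"
      unfolding n1_def
    proof (rule infsum_le_finite_sums)
      have gy: "l1b (g s) ((A + B + 1) * y s)" if s: "s \<in> {0..t}" for s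
      proof -
        have sT: "s \<in> {0..T}" using s t by auto
        have "l1 (conv (\<lambda>l. a s l + b s l) (\<lambda>l. a s l - b s l))" and n: "n1 (conv (\<lambda>l. a s l + b s l) (\<lambda>l. a s l - b s l)) \<le> n1 (\<lambda>l. a s l + b s l) * n1 (\<lambda>l. a s l - b s l)"
          by (intro l1_conv l1_add l1_diff l sT)+
        then have "l1b (conv (\<lambda>l. a s l + b s l) (\<lambda>l. a s l - b s l)) (n1 (conv (\<lambda>l. a s l + b s l) (\<lambda>l. a s l - b s l)))"
          by (intro l1_l1b)
        moreover have "n1 (\<lambda>l. a s l + b s l) * n1 (\<lambda>l. a s l - b s l) \<le> (A + B + 1) * y s"
          unfolding y_def using n1_triangle[OF l[OF sT]] l1b_n1[OF A[OF sT]] l1b_n1[OF B[OF sT]]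
          by (intro mult_right_mono n1_nonneg) auto
        ultimately have "l1b (conv (\<lambda>l. a s l + b s l) (\<lambda>l. a s l - b s l)) ((A + B + 1) * y s)"
          using n unfolding l1b_def by (meson order_trans)
        then show ?thesis unfolding l1b_def g_def sq[OF s] by (simp add: norm_mult)
      qed
      \<comment> \<open>The supremum of \<open>y\<close> bounds the integrand uniformly in
        \<open>s\<close>, which gives summability; the finer bound by the integral of
        \<open>y\<close> then follows from finite sums.\<close>
      have "(A + B + 1) * y s \<le> (A + B + 1) * (SUP s\<in>{0..t}. y s)" if "s \<in> {0..t}" for s
        using AB that compact_continuous_image[OF cy[OF t] compact_Icc]
        by (intro mult_left_mono cSUP_upper) (auto intro: bounded_imp_bdd_above compact_imp_bounded)
      then have "l1b (g s) ((A + B + 1) * (SUP s\<in>{0..t}. y s))" if "s \<in> {0..t}" for s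
        using gy[OF that] that unfolding l1b_def by (meson order_trans)
      then show "l1 (\<lambda>m. integral {0..t} (\<lambda>s. g s m))"
        by (intro l1b_l1[OF integral_infsum_swap(1)[where B = "(A + B + 1) * (SUP s\<in>{0..t}. y s)"]] cg) (use t in auto)
      fix F :: "(int ^ 'n) set" assume F: "finite F"
      have "(\<Sum>m\<in>F. cmod (integral {0..t} (\<lambda>s. g s m))) \<le> (\<Sum>m\<in>F. integral {0..t} (\<lambda>s. cmod (g s m)))"
        by (intro sum_mono integral_norm_bound_integral) (auto intro!: integrable_continuous_interval cg continuous_on_norm)
      also have "\<dots> = integral {0..t} (\<lambda>s. \<Sum>m\<in>F. cmod (g s m))"
        by (rule integral_sum[symmetric]) (auto intro!: F integrable_continuous_interval cg continuous_on_norm)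
      also have "\<dots> \<le> integral {0..t} (\<lambda>s. (A + B + 1) * y s)"
        by (rule integral_le) (use gy F in \<open>auto intro!: integrable_continuous_interval continuous_intros cg cy t simp: l1b_def\<close>)
      finally show "(\<Sum>m\<in>F. cmod (integral {0..t} (\<lambda>s. g s m))) \<le> integral {0..t} (\<lambda>s. (A + B + 1) * y s)" .
    qed
    finally show "y t \<le> integral {0..t} (\<lambda>s. (A + B + 1) * y s)" .
  qed (rule t)
  moreover have "cmod (a t m - b t m) \<le> y t"
    unfolding y_def by (rule n1_point[of "\<lambda>m. a t m - b t m"]) (intro l1_diff l t)
  ultimately show ?thesis by simp
qed

text \<open>The Duhamel formula holds at every point and its right-hand side is an absolutely
  convergent series, so \<open>u t\<close> equals its Fourier series everywhere and not just almost
  everywhere. This is what makes uniqueness pointwise.\<close>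

lemma mild_solution_coef:
  fixes u :: "real \<Rightarrow> real ^ 'n \<Rightarrow> complex"
  assumes L: "L \<ge> 1" and u: "mild_solution L (real CARD('n)) b T u0 u"
  shows "cts_l1 T (\<lambda>t. coef L (u t))"
    and "t \<in> {0..T} \<Longrightarrow> coef L (u t) m = cis (phase L m * t) * coef L u0 m + duh (phase L) (\<lambda>t. coef L (u t)) t m"
    and "t \<in> {0..T} \<Longrightarrow> u t x = trig (coef L (u t)) ((1 / L) *\<^sub>R x)"
proof -
  have L0: "L > 0" using L by simp
  define CL where "CL = sqrt (3 ^ CARD('n)) * sqrt ((2 * L\<^sup>2) ^ CARD('n))"
  have CL0: "CL \<ge> 0" by (simp add: CL_def)
  have H: "Hs_norm L (real CARD('n)) (u t) < \<infinity>" if "t \<in> {0..T}" for t using u that by (auto simp: mild_solution_def)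
  have lb: "l1b (coef L f) (CL * h)" if "h \<ge> 0" "Hs_norm L (real CARD('n)) f \<le> ennreal h" for f :: "real ^ 'n \<Rightarrow> complex" and h
    using Hs_l1b[OF L that] by (simp add: CL_def mult.assoc)
  have HE: "\<exists>h\<ge>0. Hs_norm L (real CARD('n)) f = ennreal h" if "Hs_norm L (real CARD('n)) f < \<infinity>" for f :: "real ^ 'n \<Rightarrow> complex"
    using that by (cases "Hs_norm L (real CARD('n)) f") auto
  have l1c: "l1 (coef L f)" if fin: "Hs_norm L (real CARD('n)) f < \<infinity>" for f :: "real ^ 'n \<Rightarrow> complex"
  proof -
    obtain h where "h \<ge> 0" "Hs_norm L (real CARD('n)) f = ennreal h" using HE[OF fin] by blast
    then show ?thesis by (intro l1b_l1[OF lb[of h]]) auto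
  qed
  have tL: "torus_L2 L f" if "Hs_norm L (real CARD('n)) f < \<infinity>" for f :: "real ^ 'n \<Rightarrow> complex"
    using that by (auto simp: Hs_norm_def split: if_splits)
  have cdiff: "coef L (\<lambda>x. f x - g x) m = coef L f m - coef L g m" if "torus_L2 L f" "torus_L2 L g" for f g :: "real ^ 'n \<Rightarrow> complex" and m
  proof -
    have i: "set_integrable lborel (cube L) (\<lambda>x. f x * ch (- m) ((1 / L) *\<^sub>R x))" if "torus_L2 L f" for f :: "real ^ 'n \<Rightarrow> complex"
    proof -
      have [measurable]: "f \<in> borel_measurable borel" using that by (simp add: torus_L2_def)
      have [measurable]: "(\<lambda>x. ch (- m) ((1 / L) *\<^sub>R x)) \<in> borel_measurable borel"
        by (intro borel_measurable_continuous_onI continuous_intros)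
      show ?thesis unfolding set_integrable_def
        by (rule Bochner_Integration.integrable_bound[OF set_integrable_torus_L2[OF that, unfolded set_integrable_def]]) (auto simp: norm_mult)
    qed
    show ?thesis unfolding coef_integral[OF L0] left_diff_distrib
      by (subst set_integral_diff(2)[OF i[OF that(1)] i[OF that(2)]]) (simp add: right_diff_distrib)
  qed
  show cts: "cts_l1 T (\<lambda>t. coef L (u t))"
    unfolding cts_l1_def
  proof (intro conjI ballI)
    fix t assume t: "t \<in> {0..T}"
    show "l1 (coef L (u t))" by (rule l1c[OF H[OF t]])
    have lim: "((\<lambda>t'. Hs_norm L (real CARD('n)) (\<lambda>x. u t' x - u t x)) \<longlongrightarrow> 0) (at t within {0..T})"
      using u t by (auto simp: mild_solution_def)
    show "((\<lambda>s. n1 (\<lambda>m. coef L (u s) m - coef L (u t) m)) \<longlongrightarrow> 0) (at t within {0..T})"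
    proof (rule tendstoI)
      fix e :: real assume e: "e > 0"
      define h where "h = e / (2 * (CL + 1))"
      have h: "h > 0" "CL * h < e" using e CL0 add_nonneg_pos[of "CL * e" "e * 2"] by (auto simp: h_def field_simps)
      have "\<forall>\<^sub>F s in at t within {0..T}. Hs_norm L (real CARD('n)) (\<lambda>x. u s x - u t x) < ennreal h"
        using order_tendstoD(2)[OF lim] h by simp
      moreover have "\<forall>\<^sub>F s in at t within {0..T}. s \<in> {0..T}" by (simp add: eventually_at_filter)
      ultimately show "\<forall>\<^sub>F s in at t within {0..T}. dist (n1 (\<lambda>m. coef L (u s) m - coef L (u t) m)) 0 < e"
      proof eventually_elim
        case (elim s)
        have "n1 (coef L (\<lambda>x. u s x - u t x)) \<le> CL * h"
          using elim h by (intro l1b_n1 lb) auto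
        also have "coef L (\<lambda>x. u s x - u t x) = (\<lambda>m. coef L (u s) m - coef L (u t) m)"
          using elim t by (intro ext cdiff tL H) auto
        finally show ?case using h by (simp add: dist_real_def n1_nonneg abs_of_nonneg)
      qed
    qed
  qed
  have csq: "coef L (\<lambda>y. (u t y)\<^sup>2) = conv (coef L (u t)) (coef L (u t))" if t: "t \<in> {0..T}" for t
  proof
    fix m
    note l = l1c[OF H[OF t]] and tl = tL[OF H[OF t]]
    have [measurable]: "u t \<in> borel_measurable borel" using tl by (simp add: torus_L2_def)
    \<comment> \<open>Agreement almost everywhere, from \<open>torus_completeness\<close>, is enough
      since coefficients ignore null sets.\<close>
    have "coef L (\<lambda>y. (u t y)\<^sup>2) m = coef L (\<lambda>y. trig (conv (coef L (u t)) (coef L (u t))) ((1 / L) *\<^sub>R y)) m"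
    proof (rule coef_cong_AE[OF L0])
      show "(\<lambda>y. trig (conv (coef L (u t)) (coef L (u t))) ((1 / L) *\<^sub>R y)) \<in> borel_measurable borel"
        using torus_L2_trig[OF L0 l1_conv(1)[OF l l]] by (simp add: torus_L2_def)
      show "AE y in lborel. y \<in> cube L \<longrightarrow> (u t y)\<^sup>2 = trig (conv (coef L (u t)) (coef L (u t))) ((1 / L) *\<^sub>R y)"
        using torus_completeness[OF L0 tl l] by eventually_elim (auto simp: power2_eq_square trig_mult[OF l l])
    qed measurable
    also have "\<dots> = conv (coef L (u t)) (coef L (u t)) m" by (rule coef_trig[OF L0 l1_conv(1)[OF l l]])
    finally show "coef L (\<lambda>y. (u t y)\<^sup>2) m = conv (coef L (u t)) (coef L (u t)) m" .
  qed
  have main: "coef L (u t) m = cis (phase L m * t) * coef L u0 m + duh (phase L) (\<lambda>t. coef L (u t)) t m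
      \<and> u t x = trig (coef L (u t)) ((1 / L) *\<^sub>R x)" if t: "t \<in> {0..T}" for t m x
  proof -
    obtain B where B: "\<And>t. t \<in> {0..T} \<Longrightarrow> l1b (coef L (u t)) B" using cts_l1_props(3)[OF cts] by blast
    have u0: "u0 = u 0" using u by (auto simp: mild_solution_def)
    have l0: "l1 (coef L u0)" unfolding u0 using t by (intro l1c H) auto
    have d: "l1b (duh (phase L) (\<lambda>t. coef L (u t)) t) (t * (B * B))"
      "\<And>x. - \<i> * (LINT t':{0..t}|lborel. propagator L (t - t') (\<lambda>y. (u t' y)\<^sup>2) x) = trig (duh (phase L) (\<lambda>t. coef L (u t)) t) ((1 / L) *\<^sub>R x)"
    proof -
      have p: "t \<ge> 0" "\<And>m. continuous_on {0..t} (\<lambda>s. conv (coef L (u s)) (coef L (u s)) m)"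
        "\<And>s. s \<in> {0..t} \<Longrightarrow> l1b (coef L (u s)) B" "\<And>s. s \<in> {0..t} \<Longrightarrow> coef L (\<lambda>y. (u s y)\<^sup>2) = conv (coef L (u s)) (coef L (u s))"
        using t B csq continuous_on_subset[OF cts_l1_props(2)[OF cts]] by auto
      note dt = duhamel_term_trig[where a = "\<lambda>s. coef L (u s)" and w = "\<lambda>s y. (u s y)\<^sup>2", OF L0 p]
      show "l1b (duh (phase L) (\<lambda>t. coef L (u t)) t) (t * (B * B))" by (rule dt(1))
      show "\<And>x. - \<i> * (LINT t':{0..t}|lborel. propagator L (t - t') (\<lambda>y. (u t' y)\<^sup>2) x) = trig (duh (phase L) (\<lambda>t. coef L (u t)) t) ((1 / L) *\<^sub>R x)"
        by (rule dt(2))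
    qed
    define c where "c m = cis (phase L m * t) * coef L u0 m + duh (phase L) (\<lambda>t. coef L (u t)) t m" for m
    have lc0: "l1 (\<lambda>m. cis (phase L m * t) * coef L u0 m)" using l0 by (simp add: norm_mult)
    have lc: "l1 c" unfolding c_def by (rule l1_add[OF lc0 l1b_l1[OF d(1)]])
    have "u t = (\<lambda>x. trig c ((1 / L) *\<^sub>R x))"
    proof
      fix x
      have "u t x = propagator L t u0 x - \<i> * (LINT t':{0..t}|lborel. propagator L (t - t') (\<lambda>y. (u t' y)\<^sup>2) x)"
        using u t unfolding mild_solution_def by blast
      also have "\<dots> = propagator L t u0 x + (- \<i> * (LINT t':{0..t}|lborel. propagator L (t - t') (\<lambda>y. (u t' y)\<^sup>2) x))" by simp
      also have "\<dots> = trig c ((1 / L) *\<^sub>R x)"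
        unfolding d(2) propagator_trig[OF L0, of t u0] c_def by (rule trig_add[symmetric, OF lc0 l1b_l1[OF d(1)]])
      finally show "u t x = trig c ((1 / L) *\<^sub>R x)" .
    qed
    moreover from this have "coef L (u t) = c" using coef_trig[OF L0 lc] by auto
    ultimately show ?thesis by (simp add: c_def)
  qed
  show "t \<in> {0..T} \<Longrightarrow> coef L (u t) m = cis (phase L m * t) * coef L u0 m + duh (phase L) (\<lambda>t. coef L (u t)) t m"
    "t \<in> {0..T} \<Longrightarrow> u t x = trig (coef L (u t)) ((1 / L) *\<^sub>R x)"
    using main by blast+
qed

theorem mild_solution_unique:
  fixes u v :: "real \<Rightarrow> real ^ 'n \<Rightarrow> complex"
  assumes L: "L \<ge> 1" and u: "mild_solution L (real CARD('n)) b T u0 u" and v: "mild_solution L (real CARD('n)) b T u0 v"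
    and t: "t \<in> {0..T}"
  shows "v t x = u t x"
proof -
  have "coef L (v t) = coef L (u t)"
    by (rule ext, rule duhamel_unique[OF mild_solution_coef(1)[OF L v] mild_solution_coef(2)[OF L v]
      mild_solution_coef(1)[OF L u] mild_solution_coef(2)[OF L u] t])
  then show ?thesis using mild_solution_coef(3)[OF L u t] mild_solution_coef(3)[OF L v t] by simp
qed

section \<open>Mild solutions from Fourier coefficients\<close>

lemma fourier_t_compact:
  fixes f :: "real \<Rightarrow> complex"
  assumes f: "continuous_on UNIV f" and supp: "\<And>t. t \<notin> {- rad..rad} \<Longrightarrow> f t = 0"
  defines "F0 \<equiv> (\<lambda>\<tau>. LINT t:{-rad..rad}|lborel. f t * cis (- 2 * pi * t * \<tau>))"
  shows "F0 \<in> borel_measurable borel" "fourier_t f \<in> borel_measurable borel" "AE \<tau> in lborel. fourier_t f \<tau> = F0 \<tau>"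
proof -
  have [measurable]: "f \<in> borel_measurable borel" by (rule borel_measurable_continuous_onI[OF f])
  have m: "(\<lambda>\<tau>. LINT t:{-R..R}|lborel. f t * cis (- 2 * pi * t * \<tau>)) \<in> borel_measurable borel" for R
    unfolding set_lebesgue_integral_def cis_conv_exp by measurable
  show F0m [measurable]: "F0 \<in> borel_measurable borel" unfolding F0_def by (rule m)
  define N where "N F R = (\<integral>\<^sup>+ \<tau>. ennreal ((cmod (F \<tau> - (LINT t:{-R..R}|lborel. f t * cis (- 2 * pi * t * \<tau>))))\<^sup>2) \<partial>lborel)" for F R
  have NR: "N F R = (\<integral>\<^sup>+ \<tau>. ennreal ((cmod (F \<tau> - F0 \<tau>))\<^sup>2) \<partial>lborel)" if "R \<ge> rad" for F R
  proof -
    have "(LINT t:{-R..R}|lborel. f t * cis (- 2 * pi * t * \<tau>)) = F0 \<tau>" for \<tau>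
      unfolding F0_def set_lebesgue_integral_def
      by (intro Bochner_Integration.integral_cong refl) (use that supp in \<open>auto simp: indicator_def\<close>)
    then show ?thesis by (simp add: N_def)
  qed
  have ev: "\<forall>\<^sub>F R in at_top. N F R = (\<integral>\<^sup>+ \<tau>. ennreal ((cmod (F \<tau> - F0 \<tau>))\<^sup>2) \<partial>lborel)" for F
    using eventually_ge_at_top[of rad] by eventually_elim (rule NR)
  have "(N F0 \<longlongrightarrow> 0) at_top"
    by (rule tendsto_eventually) (use ev[of F0] in \<open>auto elim!: eventually_mono\<close>)
  define P where "P F \<longleftrightarrow> F \<in> borel_measurable borel \<and> (N F \<longlongrightarrow> 0) at_top" for F
  have "fourier_t f = (SOME F. P F)" unfolding fourier_t_def P_def N_def ..
  moreover have "P F0" unfolding P_def using F0m \<open>(N F0 \<longlongrightarrow> 0) at_top\<close> by blast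
  ultimately have "P (fourier_t f)" using someI[of P F0] by simp
  then have G: "fourier_t f \<in> borel_measurable borel \<and> (N (fourier_t f) \<longlongrightarrow> 0) at_top" by (simp add: P_def)
  then show Gm [measurable]: "fourier_t f \<in> borel_measurable borel" by blast
  have "(N (fourier_t f) \<longlongrightarrow> (\<integral>\<^sup>+ \<tau>. ennreal ((cmod (fourier_t f \<tau> - F0 \<tau>))\<^sup>2) \<partial>lborel)) at_top"
    by (rule tendsto_eventually[OF ev])
  with G have "(\<integral>\<^sup>+ \<tau>. ennreal ((cmod (fourier_t f \<tau> - F0 \<tau>))\<^sup>2) \<partial>lborel) = 0"
    using tendsto_unique trivial_limit_at_top_linorder by blast
  then show "AE \<tau> in lborel. fourier_t f \<tau> = F0 \<tau>"
    by (subst (asm) nn_integral_0_iff_AE) auto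
qed

text \<open>Two powers of \<open>hw\<close> pay for the summation over \<open>l\<close>, the others
  pass to \<open>hw m\<close> by \<open>hw_mult_le\<close>.\<close>

lemma conv_decay:
  fixes f g :: "int ^ 'n \<Rightarrow> complex"
  assumes f: "\<And>m. cmod (f m) \<le> A * hw m ^ (p + 2)" and g: "\<And>m. cmod (g m) \<le> B * hw m ^ (p + 2)" and AB: "A \<ge> 0" "B \<ge> 0"
  shows "(\<Sum>\<^sub>\<infinity>l. cmod (f l * g (m - l))) \<le> A * B * 3 ^ CARD('n) * hw m ^ p"
    and "cmod (conv f g m) \<le> A * B * 3 ^ CARD('n) * hw m ^ p"
proof -
  have le: "cmod (f l * g (m - l)) \<le> (A * B * hw m ^ p) * (hw l)\<^sup>2" for l
  proof -
    have "cmod (f l * g (m - l)) \<le> (A * hw l ^ (p + 2)) * (B * hw (m - l) ^ (p + 2))"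
      unfolding norm_mult using f[of l] g[of "m - l"] AB hw_pos[of l] by (intro mult_mono) auto
    also have "\<dots> = (A * B) * (hw l * hw (m - l)) ^ p * ((hw l)\<^sup>2 * (hw (m - l))\<^sup>2)"
      by (simp add: power_add power_mult_distrib power2_eq_square mult_ac)
    also have "\<dots> \<le> (A * B) * hw m ^ p * ((hw l)\<^sup>2 * 1)"
      using AB hw_pos[of l] hw_pos[of "m - l"] hw_pos[of m] hw_le_1[of "m - l"]
      by (intro mult_mono power_mono hw_mult_le power_le_one) auto
    finally show ?thesis by simp
  qed
  have s: "(\<lambda>l. (A * B * hw m ^ p) * (hw l)\<^sup>2) summable_on (UNIV :: (int ^ 'n) set)"
    by (intro summable_on_cmult_right hw_square_summable)
  have l1: "l1 (\<lambda>l. f l * g (m - l))" by (rule summable_on_comparison_test[OF s]) (use le in auto)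
  have "(\<Sum>\<^sub>\<infinity>l. cmod (f l * g (m - l))) \<le> (\<Sum>\<^sub>\<infinity>l :: int ^ 'n. (A * B * hw m ^ p) * (hw l)\<^sup>2)"
    by (rule infsum_mono[OF l1 s]) (rule le)
  also have "\<dots> = (A * B * hw m ^ p) * (\<Sum>\<^sub>\<infinity>l :: int ^ 'n. (hw l)\<^sup>2)" by (rule infsum_cmult_right')
  also have "\<dots> \<le> (A * B * hw m ^ p) * 3 ^ CARD('n)"
    using AB hw_pos[of m] by (intro mult_left_mono infsum_le_finite_sums hw_square_summable hw_square_sum_le) auto
  finally show "(\<Sum>\<^sub>\<infinity>l. cmod (f l * g (m - l))) \<le> A * B * 3 ^ CARD('n) * hw m ^ p" by (simp add: mult_ac)
  then show "cmod (conv f g m) \<le> A * B * 3 ^ CARD('n) * hw m ^ p"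
    unfolding conv_def using norm_infsum_bound[OF l1] by linarith
qed

text \<open>The phase, and with it a time derivative, costs two powers of \<open>hw\<close>;
  \<open>40\<close> bounds \<open>4 * pi^2\<close>.\<close>

lemma phase_le: assumes "L \<ge> 1" shows "0 \<le> phase L m" "phase L m \<le> 40 / (hw m)\<^sup>2"
proof -
  show "0 \<le> phase L m" by (simp add: phase_def)
  have pi40: "4 * pi\<^sup>2 \<le> 40" using power_mono[of pi "3.16" 2] pi_approx by (simp add: power2_eq_square)
  have "norm ((1 / L) *\<^sub>R int_vec m) \<le> 1 * norm (int_vec m)"
    unfolding norm_scaleR using assms by (intro mult_right_mono) (auto simp: divide_le_eq)
  also have "\<dots> \<le> 1 / hw m" using norm_int_vec_le_hw[of m] by linarith
  finally have "(norm ((1 / L) *\<^sub>R int_vec m))\<^sup>2 \<le> (1 / hw m)\<^sup>2" by (intro power_mono) auto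
  then have "phase L m \<le> 40 * (1 / hw m)\<^sup>2" unfolding phase_def using pi40 by (intro mult_mono) auto
  then show "phase L m \<le> 40 / (hw m)\<^sup>2" by (simp add: power_divide)
qed

section \<open>Integration by parts in oscillatory time integrals\<close>

definition osc :: "real \<Rightarrow> real \<Rightarrow> complex" where "osc \<tau> t = cis (- 2 * pi * t * \<tau>)"

lemma norm_osc [simp]: "cmod (osc \<tau> t) = 1" by (simp add: osc_def)

lemma continuous_on_osc [continuous_intros]: "continuous_on A (osc \<tau>)"
  unfolding osc_def cis_conv_exp by (intro continuous_intros)

lemma osc_parts:
  fixes f :: "real \<Rightarrow> complex"
  assumes pq: "p \<le> q" and \<tau>: "\<tau> \<noteq> 0"
    and f: "\<And>t. t \<in> {p..q} \<Longrightarrow> (f has_vector_derivative f' t) (at t within {p..q})" and f': "continuous_on {p..q} f'"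
  defines "\<kappa> \<equiv> - 2 * pi * \<i> * of_real \<tau>"
  shows "integral {p..q} (\<lambda>t. f t * osc \<tau> t) = (f q * osc \<tau> q - f p * osc \<tau> p) / \<kappa> - integral {p..q} (\<lambda>t. f' t * osc \<tau> t) / \<kappa>"
proof -
  have k0: "\<kappa> \<noteq> 0" using \<tau> by (simp add: \<kappa>_def)
  have cf: "continuous_on {p..q} f"
    unfolding continuous_on_eq_continuous_within using has_vector_derivative_continuous[OF f] by blast
  have do: "(osc \<tau> has_vector_derivative \<kappa> * osc \<tau> t) (at t within S)" for t S
  proof -
    have e: "osc \<tau> = (\<lambda>t. exp (\<kappa> * of_real t))"
      by (rule ext) (simp add: osc_def cis_conv_exp \<kappa>_def mult_ac)
    have "((\<lambda>z. exp (\<kappa> * z)) has_field_derivative \<kappa> * exp (\<kappa> * of_real t)) (at (of_real t))"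
      by (auto intro!: derivative_eq_intros)
    then show ?thesis unfolding e by (rule has_vector_derivative_real_field)
  qed
  have "((\<lambda>t. f t * (\<kappa> * osc \<tau> t) + f' t * osc \<tau> t) has_integral (f q * osc \<tau> q - f p * osc \<tau> p)) {p..q}"
    by (rule fundamental_theorem_of_calculus[OF pq]) (intro has_vector_derivative_mult f do)
  then have "integral {p..q} (\<lambda>t. f t * (\<kappa> * osc \<tau> t) + f' t * osc \<tau> t) = f q * osc \<tau> q - f p * osc \<tau> p" by (rule integral_unique)
  moreover have "integral {p..q} (\<lambda>t. f t * (\<kappa> * osc \<tau> t) + f' t * osc \<tau> t) = integral {p..q} (\<lambda>t. \<kappa> * (f t * osc \<tau> t)) + integral {p..q} (\<lambda>t. f' t * osc \<tau> t)"
  proof -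
    have "(\<lambda>t. \<kappa> * (f t * osc \<tau> t)) integrable_on {p..q}" "(\<lambda>t. f' t * osc \<tau> t) integrable_on {p..q}"
      by (intro integrable_continuous_interval continuous_intros cf f')+
    from integral_add[OF this] show ?thesis by (simp add: mult_ac)
  qed
  ultimately have "\<kappa> * integral {p..q} (\<lambda>t. f t * osc \<tau> t) = (f q * osc \<tau> q - f p * osc \<tau> p) - integral {p..q} (\<lambda>t. f' t * osc \<tau> t)"
    by (simp add: algebra_simps)
  then show ?thesis using k0 by (simp add: diff_divide_distrib[symmetric] nonzero_eq_divide_eq mult.commute)
qed

lemma osc_bound:
  fixes f :: "real \<Rightarrow> complex"
  assumes pq: "p \<le> q" and \<tau>: "\<tau> \<noteq> 0"
    and f: "\<And>t. t \<in> {p..q} \<Longrightarrow> (f has_vector_derivative f' t) (at t within {p..q})" and f': "continuous_on {p..q} f'"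
    and M: "\<And>t. t \<in> {p..q} \<Longrightarrow> cmod (f t) \<le> M" and K: "\<And>t. t \<in> {p..q} \<Longrightarrow> cmod (f' t) \<le> K"
  shows "cmod (integral {p..q} (\<lambda>t. f t * osc \<tau> t)) \<le> (2 * M + K * (q - p)) / \<bar>\<tau>\<bar>"
proof -
  define \<kappa> where "\<kappa> = - 2 * pi * \<i> * of_real \<tau>"
  have nk: "cmod \<kappa> = 2 * pi * \<bar>\<tau>\<bar>" by (simp add: \<kappa>_def norm_mult)
  have t0: "\<bar>\<tau>\<bar> > 0" using \<tau> by simp
  have "1 * \<bar>\<tau>\<bar> \<le> (2 * pi) * \<bar>\<tau>\<bar>" using pi_ge_two by (intro mult_right_mono) auto
  then have nk2: "\<bar>\<tau>\<bar> \<le> cmod \<kappa>" by (simp add: nk)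
  have M0: "M \<ge> 0" "K \<ge> 0" using order_trans[OF norm_ge_zero M[of p]] order_trans[OF norm_ge_zero K[of p]] pq by auto
  have "cmod (integral {p..q} (\<lambda>t. f t * osc \<tau> t)) = cmod ((f q * osc \<tau> q - f p * osc \<tau> p - integral {p..q} (\<lambda>t. f' t * osc \<tau> t)) / \<kappa>)"
    by (simp only: osc_parts[OF pq \<tau> f f', folded \<kappa>_def] diff_divide_distrib)
  also have "\<dots> \<le> (2 * M + K * (q - p)) / cmod \<kappa>"
    unfolding norm_divide
  proof (intro divide_right_mono)
    have "cmod (integral {p..q} (\<lambda>t. f' t * osc \<tau> t)) \<le> K * (q - p)"
      by (rule integral_bound[OF pq]) (auto intro!: continuous_intros f' K simp: norm_mult)
    moreover have "cmod (f q * osc \<tau> q) \<le> M" "cmod (f p * osc \<tau> p) \<le> M" using M pq by (auto simp: norm_mult)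
    ultimately show "cmod (f q * osc \<tau> q - f p * osc \<tau> p - integral {p..q} (\<lambda>t. f' t * osc \<tau> t)) \<le> 2 * M + K * (q - p)"
      using norm_triangle_ineq4[of "f q * osc \<tau> q - f p * osc \<tau> p" "integral {p..q} (\<lambda>t. f' t * osc \<tau> t)"]
        norm_triangle_ineq4[of "f q * osc \<tau> q" "f p * osc \<tau> p"] by linarith
  qed simp
  also have "\<dots> \<le> (2 * M + K * (q - p)) / \<bar>\<tau>\<bar>"
    using t0 nk2 M0 pq by (intro divide_left_mono mult_pos_pos add_nonneg_nonneg mult_nonneg_nonneg) auto
  finally show ?thesis .
qed

text \<open>Origin of the exponent, with \<open>d = CARD('n)\<close>: from \<open>d + 5\<close>, a
  convolution or one time derivative leaves \<open>d + 3\<close>, and a second loss of two leaves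
  \<open>d + 1\<close>, which the Sobolev exponent \<open>s = d\<close> asks for.\<close>

context
  fixes L T C :: real and a :: "real \<Rightarrow> int ^ 'n \<Rightarrow> complex"
  assumes L: "L \<ge> 1" and T: "T > 0" and C0: "C \<ge> 0" and cont_a: "\<And>m. continuous_on {0..T} (\<lambda>t. a t m)"
    and dec: "\<And>t m. t \<in> {0..T} \<Longrightarrow> cmod (a t m) \<le> C * hw m ^ (CARD('n) + 5)"
    and eq: "\<And>t m. t \<in> {0..T} \<Longrightarrow> a t m = cis (phase L m * t) * a 0 m + duh (phase L) a t m"
begin

lemma L_pos: "L > 0" using L by simp

definition cv :: "real \<Rightarrow> int ^ 'n \<Rightarrow> complex" where "cv t = conv (a t) (a t)"

definition C1 :: real where "C1 = C * C * 3 ^ CARD('n)"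

lemma C1_nonneg: "C1 \<ge> 0" using C0 by (simp add: C1_def)

lemma cv_bound: "t \<in> {0..T} \<Longrightarrow> cmod (cv t m) \<le> C1 * hw m ^ (CARD('n) + 3)"
  unfolding cv_def C1_def using conv_decay(2)[of "a t" C "CARD('n) + 3" "a t" C m] dec[of t] C0 by (simp add: numeral_eq_Suc)

lemma dec_le: "t \<in> {0..T} \<Longrightarrow> j \<le> CARD('n) + 5 \<Longrightarrow> cmod (a t m) \<le> C * hw m ^ j"
proof -
  assume "t \<in> {0..T}" "j \<le> CARD('n) + 5"
  then have "C * hw m ^ (CARD('n) + 5) \<le> C * hw m ^ j"
    using C0 hw_pos[of m] hw_le_1[of m] by (intro mult_left_mono power_decreasing) auto
  then show "cmod (a t m) \<le> C * hw m ^ j" using dec[OF \<open>t \<in> {0..T}\<close>, of m] by linarith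
qed

lemma l1_a: "t \<in> {0..T} \<Longrightarrow> l1 (a t)"
  by (rule hw_summable_bound[OF dec]) auto

lemma cv_cont: "continuous_on {0..T} (\<lambda>t. cv t m)"
proof -
  have "uniform_limit {0..T} (\<lambda>F s. \<Sum>l\<in>F. a s l * a s (m - l)) (\<lambda>s. cv s m) (finite_subsets_at_top UNIV)"
    unfolding cv_def conv_def
  proof (rule Weierstrass_m_test_general[where M = "\<lambda>l. (C * C) * hw l ^ 2"])
    fix l s assume s: "s \<in> {0..T}"
    have "cmod (a s l) * cmod (a s (m - l)) \<le> (C * hw l ^ 2) * C"
      using dec_le[OF s, of 2 l] dec_le[OF s, of 0 "m - l"] C0 by (intro mult_mono) auto
    then show "cmod (a s l * a s (m - l)) \<le> (C * C) * hw l ^ 2" by (simp add: norm_mult mult_ac)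
  qed (intro summable_on_cmult_right hw_square_summable)
  then show ?thesis
    by (rule uniform_limit_theorem[rotated]) (auto intro!: always_eventually continuous_intros cont_a)
qed

definition da :: "real \<Rightarrow> int ^ 'n \<Rightarrow> complex" where
  "da t m = \<i> * of_real (phase L m) * a t m - \<i> * cv t m"

lemma da_cont: "continuous_on {0..T} (\<lambda>t. da t m)"
  unfolding da_def by (intro continuous_intros cont_a cv_cont)

text \<open>Taking the phase out of the Duhamel formula leaves an indefinite integral of a
  continuous function; the product rule then gives the differential equation.\<close>

lemma a_deriv:
  assumes t: "t \<in> {0..T}"
  shows "((\<lambda>t. a t m) has_vector_derivative da t m) (at t within {0..T})"
proof -
  define G where "G t = integral {0..t} (\<lambda>s. cis (- (phase L m * s)) * cv s m)" for t
  have G: "(G has_vector_derivative cis (- (phase L m * t)) * cv t m) (at t within {0..T})"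
    unfolding G_def by (rule integral_has_vector_derivative[OF _ t])
      (unfold cis_conv_exp, intro continuous_intros cv_cont)
  have dc: "((\<lambda>t. cis (phase L m * t)) has_vector_derivative \<i> * of_real (phase L m) * cis (phase L m * t)) (at t within {0..T})"
  proof -
    have "((\<lambda>z. exp (\<i> * of_real (phase L m) * z)) has_field_derivative \<i> * of_real (phase L m) * exp (\<i> * of_real (phase L m) * of_real t)) (at (of_real t))"
      by (auto intro!: derivative_eq_intros)
    from has_vector_derivative_real_field[OF this, of "{0..T}"] show ?thesis by (simp add: cis_conv_exp mult.assoc)
  qed
  have aG: "a t m = cis (phase L m * t) * (a 0 m - \<i> * G t)" if "t \<in> {0..T}" for t
  proof -
    have "cis (phase L m * (t - s)) = cis (phase L m * t) * cis (- (phase L m * s))" for s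
      by (simp add: cis_mult algebra_simps)
    then have "duh (phase L) a t m = - \<i> * (cis (phase L m * t) * G t)"
      unfolding duh_def G_def cv_def by (simp add: mult.assoc)
    then show ?thesis using eq[OF that, of m] by (simp add: algebra_simps)
  qed
  have "((\<lambda>t. cis (phase L m * t) * (a 0 m - \<i> * G t)) has_vector_derivative
     cis (phase L m * t) * (0 - \<i> * (cis (- (phase L m * t)) * cv t m)) + \<i> * of_real (phase L m) * cis (phase L m * t) * (a 0 m - \<i> * G t)) (at t within {0..T})"
    by (intro has_vector_derivative_mult has_vector_derivative_diff has_vector_derivative_const has_vector_derivative_mult_right G dc)
  moreover have "cis (phase L m * t) * (0 - \<i> * (cis (- (phase L m * t)) * cv t m)) + \<i> * of_real (phase L m) * cis (phase L m * t) * (a 0 m - \<i> * G t) = da t m"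
  proof -
    have "cis (phase L m * t) * (0 - \<i> * (cis (- (phase L m * t)) * cv t m)) = - \<i> * (cis (phase L m * t) * cis (- (phase L m * t))) * cv t m"
      by (simp add: mult_ac)
    also have "cis (phase L m * t) * cis (- (phase L m * t)) = 1" by (simp add: cis_mult)
    finally show ?thesis unfolding da_def using aG[OF t] by (simp add: mult.assoc)
  qed
  ultimately have D: "((\<lambda>t. cis (phase L m * t) * (a 0 m - \<i> * G t)) has_vector_derivative da t m) (at t within {0..T})"
    by (simp only:)
  show ?thesis by (rule has_vector_derivative_transform[OF t aG D])
qed

definition C2 :: real where "C2 = 40 * C + C1"

lemma C2_nonneg: "C2 \<ge> 0" using C0 C1_nonneg by (simp add: C2_def)

lemma phase_mult_hw: "phase L m * hw m ^ (j + 2) \<le> 40 * hw m ^ j"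
proof -
  have "phase L m * hw m ^ (j + 2) \<le> 40 / (hw m)\<^sup>2 * hw m ^ (j + 2)"
    using phase_le(2)[OF L, of m] hw_pos[of m] by (intro mult_right_mono) auto
  also have "\<dots> = 40 * hw m ^ j" using hw_pos[of m] by (simp add: power_add power2_eq_square)
  finally show ?thesis .
qed

lemma da_bound:
  assumes t: "t \<in> {0..T}" shows "cmod (da t m) \<le> C2 * hw m ^ (CARD('n) + 3)"
proof -
  have "cmod (da t m) \<le> phase L m * cmod (a t m) + cmod (cv t m)"
    unfolding da_def using norm_triangle_ineq4[of "\<i> * of_real (phase L m) * a t m" "\<i> * cv t m"] phase_le(1)[OF L, of m]
    by (simp add: norm_mult)
  also have "\<dots> \<le> phase L m * (C * hw m ^ (CARD('n) + 3 + 2)) + C1 * hw m ^ (CARD('n) + 3)"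
    using dec[OF t, of m] phase_le(1)[OF L, of m] by (intro add_mono mult_left_mono cv_bound t) (auto simp: numeral_eq_Suc)
  also have "\<dots> \<le> C * (40 * hw m ^ (CARD('n) + 3)) + C1 * hw m ^ (CARD('n) + 3)"
    using mult_left_mono[OF phase_mult_hw[of m "CARD('n) + 3"] C0] by (simp add: mult_ac)
  finally show ?thesis by (simp add: C2_def algebra_simps)
qed

lemma a_lipschitz:
  assumes "s \<in> {0..T}" "t \<in> {0..T}"
  shows "cmod (a s m - a t m) \<le> C2 * \<bar>s - t\<bar> * hw m ^ (CARD('n) + 3)"
proof -
  have *: "cmod (a t m - a s m) \<le> C2 * hw m ^ (CARD('n) + 3) * (t - s)" if "s \<le> t" "s \<in> {0..T}" "t \<in> {0..T}" for s t
  proof -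
    have sub: "{s..t} \<subseteq> {0..T}" using that by auto
    have "((\<lambda>t. da t m) has_integral (a t m - a s m)) {s..t}"
      by (rule fundamental_theorem_of_calculus[OF \<open>s \<le> t\<close>])
         (rule has_vector_derivative_within_subset[OF a_deriv sub], use sub in auto)
    then have "a t m - a s m = integral {s..t} (\<lambda>t. da t m)" by (rule integral_unique[symmetric])
    also have "cmod \<dots> \<le> C2 * hw m ^ (CARD('n) + 3) * (t - s)"
      by (rule integral_bound[OF \<open>s \<le> t\<close> continuous_on_subset[OF da_cont sub]]) (use sub da_bound in auto)
    finally show ?thesis .
  qed
  show ?thesis using *[of s t] *[of t s] assms
    by (cases "s \<le> t") (auto simp: norm_minus_commute mult_ac)
qed

lemma a_cts: "cts_l1 T a"
  unfolding cts_l1_def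
proof (intro conjI ballI l1_a)
  fix t assume t: "t \<in> {0..T}"
  define H where "H = (\<Sum>\<^sub>\<infinity>m :: int ^ 'n. hw m ^ (CARD('n) + 3))"
  have sm: "(\<lambda>m :: int ^ 'n. hw m ^ (CARD('n) + 3)) summable_on UNIV" by (rule hw_power_summable) simp
  show "((\<lambda>s. n1 (\<lambda>m. a s m - a t m)) \<longlongrightarrow> 0) (at t within {0..T})"
  proof (rule Lim_null_comparison)
    have "((\<lambda>s. C2 * \<bar>s - t\<bar> * H) \<longlongrightarrow> C2 * \<bar>t - t\<bar> * H) (at t within {0..T})" by (intro tendsto_intros)
    then show "((\<lambda>s. C2 * \<bar>s - t\<bar> * H) \<longlongrightarrow> 0) (at t within {0..T})" by simp
    have "\<forall>\<^sub>F s in at t within {0..T}. s \<in> {0..T}" by (simp add: eventually_at_filter)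
    then show "\<forall>\<^sub>F s in at t within {0..T}. norm (n1 (\<lambda>m. a s m - a t m)) \<le> C2 * \<bar>s - t\<bar> * H"
    proof eventually_elim
      case (elim s)
      have "n1 (\<lambda>m. a s m - a t m) \<le> (\<Sum>\<^sub>\<infinity>m :: int ^ 'n. C2 * \<bar>s - t\<bar> * hw m ^ (CARD('n) + 3))"
        unfolding n1_def
        by (rule infsum_mono) (auto intro!: l1_diff l1_a summable_on_cmult_right sm a_lipschitz elim t)
      also have "\<dots> = C2 * \<bar>s - t\<bar> * H" unfolding H_def by (rule infsum_cmult_right')
      finally show ?case by (simp add: n1_nonneg abs_of_nonneg)
    qed
  qed
qed

definition sol :: "real \<Rightarrow> real ^ 'n \<Rightarrow> complex" where "sol t x = trig (a t) ((1 / L) *\<^sub>R x)"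

lemma sol_Hs:
  assumes t: "t \<in> {0..T}"
  shows "Hs_norm L (real CARD('n)) (sol t) < \<infinity>"
    and "((\<lambda>s. Hs_norm L (real CARD('n)) (\<lambda>x. sol s x - sol t x)) \<longlongrightarrow> 0) (at t within {0..T})"
proof -
  have "Hs_norm L (real CARD('n)) (sol t) \<le> ennreal (C * sqrt (49 ^ CARD('n) * 3 ^ CARD('n)))"
    unfolding sol_def by (rule Hs_norm_trig_le[OF L dec_le C0]) (use t in auto)
  then show "Hs_norm L (real CARD('n)) (sol t) < \<infinity>" by (rule order_le_less_trans) simp
  define R where "R = sqrt (49 ^ CARD('n) * 3 ^ CARD('n))"
  have le: "Hs_norm L (real CARD('n)) (\<lambda>x. sol s x - sol t x) \<le> ennreal (C2 * \<bar>s - t\<bar> * R)" if s: "s \<in> {0..T}" for s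
  proof -
    have "(\<lambda>x. sol s x - sol t x) = (\<lambda>x. trig (\<lambda>m. a s m - a t m) ((1 / L) *\<^sub>R x))"
      unfolding sol_def by (rule ext) (rule trig_diff[OF l1_a[OF s] l1_a[OF t], symmetric])
    then show ?thesis unfolding R_def
    proof (simp only:, intro Hs_norm_trig_le[OF L])
      fix m
      have "cmod (a s m - a t m) \<le> C2 * \<bar>s - t\<bar> * hw m ^ (CARD('n) + 3)" by (rule a_lipschitz[OF s t])
      also have "\<dots> \<le> C2 * \<bar>s - t\<bar> * hw m ^ (CARD('n) + 1)"
        using C2_nonneg hw_pos[of m] hw_le_1[of m] by (intro mult_left_mono power_decreasing) auto
      finally show "cmod (a s m - a t m) \<le> C2 * \<bar>s - t\<bar> * hw m ^ (CARD('n) + 1)" .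
    qed (use C2_nonneg in auto)
  qed
  have "((\<lambda>s. ennreal (C2 * \<bar>s - t\<bar> * R)) \<longlongrightarrow> ennreal (C2 * \<bar>t - t\<bar> * R)) (at t within {0..T})"
    by (intro tendsto_intros)
  then have lim: "((\<lambda>s. ennreal (C2 * \<bar>s - t\<bar> * R)) \<longlongrightarrow> 0) (at t within {0..T})" by simp
  have "\<forall>\<^sub>F s in at t within {0..T}. s \<in> {0..T}" by (simp add: eventually_at_filter)
  then have ev: "\<forall>\<^sub>F s in at t within {0..T}. Hs_norm L (real CARD('n)) (\<lambda>x. sol s x - sol t x) \<le> ennreal (C2 * \<bar>s - t\<bar> * R)"
    by eventually_elim (rule le)
  show "((\<lambda>s. Hs_norm L (real CARD('n)) (\<lambda>x. sol s x - sol t x)) \<longlongrightarrow> 0) (at t within {0..T})"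
    by (rule tendsto_sandwich[OF _ ev tendsto_const lim]) simp
qed

lemma sol_mild:
  assumes t: "t \<in> {0..T}"
  shows "sol t x = propagator L t (sol 0) x - \<i> * (LINT t':{0..t}|lborel. propagator L (t - t') (\<lambda>y. (sol t' y)\<^sup>2) x)"
proof -
  have z: "0 \<in> {0..T}" using T by auto
  have c0: "coef L (sol 0) = a 0" unfolding sol_def by (rule ext) (rule coef_trig[OF L_pos l1_a[OF z]])
  obtain B where B: "\<And>t. t \<in> {0..T} \<Longrightarrow> l1b (a t) B" using cts_l1_props(3)[OF a_cts] by blast
  have w: "coef L (\<lambda>y. (sol s y)\<^sup>2) = conv (a s) (a s)" if "s \<in> {0..t}" for s
  proof -
    have l: "l1 (a s)" using that t by (intro l1_a) auto
    have "(\<lambda>y. (sol s y)\<^sup>2) = (\<lambda>y. trig (conv (a s) (a s)) ((1 / L) *\<^sub>R y))"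
      by (rule ext) (simp add: sol_def power2_eq_square trig_mult[OF l l])
    then show ?thesis using coef_trig[OF L_pos l1_conv(1)[OF l l]] by auto
  qed
  have d: "l1b (duh (phase L) a t) (t * (B * B))"
    "- \<i> * (LINT t':{0..t}|lborel. propagator L (t - t') (\<lambda>y. (sol t' y)\<^sup>2) x) = trig (duh (phase L) a t) ((1 / L) *\<^sub>R x)"
  proof -
    have p: "t \<ge> 0" "\<And>m. continuous_on {0..t} (\<lambda>s. conv (a s) (a s) m)" "\<And>s. s \<in> {0..t} \<Longrightarrow> l1b (a s) B"
      "\<And>s. s \<in> {0..t} \<Longrightarrow> coef L (\<lambda>y. (sol s y)\<^sup>2) = conv (a s) (a s)"
      using t B w continuous_on_subset[OF cv_cont[unfolded cv_def]] by auto
    note dt = duhamel_term_trig[where a = a and w = "\<lambda>s y. (sol s y)\<^sup>2", OF L_pos p]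
    show "l1b (duh (phase L) a t) (t * (B * B))" by (rule dt(1))
    show "- \<i> * (LINT t':{0..t}|lborel. propagator L (t - t') (\<lambda>y. (sol t' y)\<^sup>2) x) = trig (duh (phase L) a t) ((1 / L) *\<^sub>R x)"
      by (rule dt(2))
  qed
  have "sol t x = trig (\<lambda>m. cis (phase L m * t) * a 0 m + duh (phase L) a t m) ((1 / L) *\<^sub>R x)"
    unfolding sol_def by (rule arg_cong2[where f = trig, OF _ refl]) (rule ext, rule eq[OF t])
  also have "\<dots> = propagator L t (sol 0) x + trig (duh (phase L) a t) ((1 / L) *\<^sub>R x)"
    unfolding propagator_trig[OF L_pos] c0
    using trig_add[OF _ l1b_l1[OF d(1)], of "\<lambda>m. cis (phase L m * t) * a 0 m"] l1_a[OF z] by (simp add: norm_mult)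
  finally show ?thesis using d(2) by simp
qed

text \<open>Extending the solution by constants and cutting off linearly outside \<open>[0,T]\<close> makes the Fourier
  transform in time \<open>O(\<tau>\<^sup>-\<^sup>2)\<close>, which is enough for every \<open>b \<le> 1\<close>.\<close>

definition cut :: "real \<Rightarrow> real" where "cut t = max 0 (min 1 (min (1 + t) (T + 1 - t)))"
definition clampT :: "real \<Rightarrow> real" where "clampT t = max 0 (min T t)"
definition ext :: "real \<Rightarrow> int ^ 'n \<Rightarrow> complex" where "ext t m = of_real (cut t) * a (clampT t) m"
definition solx :: "real \<Rightarrow> real ^ 'n \<Rightarrow> complex" where "solx t x = trig (ext t) ((1 / L) *\<^sub>R x)"

lemma clampT_in: "clampT t \<in> {0..T}" using T by (auto simp: clampT_def)

lemma ext_bound: "cmod (ext t m) \<le> C * hw m ^ (CARD('n) + 5)"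
proof -
  have "cmod (ext t m) \<le> 1 * cmod (a (clampT t) m)"
    unfolding ext_def norm_mult by (intro mult_right_mono) (auto simp: cut_def)
  then show ?thesis using dec[OF clampT_in, of t m] by simp
qed

lemma l1_ext: "l1 (ext t)" by (rule hw_summable_bound[OF ext_bound]) auto

lemma ext_cont: "continuous_on A (\<lambda>t. ext t m)"
proof -
  have "continuous_on A (\<lambda>t. a (clampT t) m)"
    by (rule continuous_on_compose2[OF cont_a, of A clampT]) (auto simp: clampT_in[simplified] clampT_def[abs_def] T less_imp_le intro!: continuous_intros)
  then show ?thesis unfolding ext_def cut_def by (intro continuous_intros)
qed

lemma ext_zero: "t \<notin> {-1..T + 1} \<Longrightarrow> ext t m = 0" by (auto simp: ext_def cut_def)

lemma solx_eq: "t \<in> {0<..<T} \<Longrightarrow> solx t x = sol t x"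
proof -
  assume t: "t \<in> {0<..<T}"
  then have "cut t = 1" "clampT t = t" by (auto simp: cut_def clampT_def)
  then have "ext t = a t" by (auto simp: ext_def)
  then show ?thesis by (simp add: solx_def sol_def)
qed

lemma solx_cont: "continuous_on A (\<lambda>(t, x). solx t x)"
proof -
  have "uniform_limit A (\<lambda>F p. \<Sum>m\<in>F. ext (fst p) m * ch m ((1 / L) *\<^sub>R snd p)) (\<lambda>p. solx (fst p) (snd p)) (finite_subsets_at_top UNIV)"
    unfolding solx_def trig_def
    by (rule Weierstrass_m_test_general[where M = "\<lambda>m. C * hw m ^ (CARD('n) + 5)"])
       (auto simp: norm_mult ext_bound intro!: summable_on_cmult_right hw_power_summable)
  then have "continuous_on A (\<lambda>p. solx (fst p) (snd p))"
    by (rule uniform_limit_theorem[rotated])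
       (auto intro!: always_eventually continuous_intros continuous_on_compose2[OF ext_cont[of UNIV]])
  then show ?thesis by (simp add: case_prod_unfold)
qed

lemma solx_L2: "spacetime_L2 L solx"
  unfolding spacetime_L2_def
proof (intro conjI allI)
  show "case_prod solx \<in> borel_measurable (borel \<Otimes>\<^sub>M borel)"
    unfolding borel_prod using solx_cont[of UNIV] by (intro borel_measurable_continuous_onI) simp
  show "periodic L (solx t)" for t using periodic_trig[OF L_pos, of "ext t"] by (simp add: solx_def[abs_def])
  define S where "S = cbox (- 1) (T + 1) \<times> (cube L :: (real ^ 'n) set)"
  have "compact S" unfolding S_def cube_def by (intro compact_Times compact_cbox)
  moreover have "continuous_on S (\<lambda>p. (cmod (solx (fst p) (snd p)))\<^sup>2)"
    using solx_cont[of S] by (intro continuous_intros) (simp add: case_prod_unfold)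
  ultimately have "integrable lborel (\<lambda>p. indicator S p *\<^sub>R (cmod (solx (fst p) (snd p)))\<^sup>2)"
    by (rule borel_integrable_compact)
  moreover have "indicator S p *\<^sub>R (cmod (solx (fst p) (snd p)))\<^sup>2 = indicator (UNIV \<times> cube L) p *\<^sub>R (case p of (t, x) \<Rightarrow> (cmod (solx t x))\<^sup>2)" for p
  proof (cases "fst p \<in> {-1..T + 1}")
    case False
    then have "ext (fst p) = (\<lambda>_. 0)" using ext_zero by blast
    then show ?thesis by (simp add: solx_def trig_def case_prod_unfold)
  qed (auto simp: S_def indicator_def case_prod_unfold split: prod.splits)
  ultimately show "set_integrable (lborel \<Otimes>\<^sub>M lborel) (UNIV \<times> cube L) (\<lambda>(t, x). (cmod (solx t x))\<^sup>2)"
    unfolding set_integrable_def lborel_prod by simp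
qed

section \<open>Decay of the Fourier transform in time of the extended solution\<close>

definition Ft :: "int ^ 'n \<Rightarrow> real \<Rightarrow> complex" where "Ft m \<tau> = integral {-1..T + 1} (\<lambda>t. ext t m * osc \<tau> t)"

lemma Ft_bound1: "cmod (Ft m \<tau>) \<le> (C * (T + 2)) * hw m ^ (CARD('n) + 5)"
proof -
  have "cmod (Ft m \<tau>) \<le> C * hw m ^ (CARD('n) + 5) * ((T + 1) - (- 1))"
    unfolding Ft_def by (rule integral_bound) (use T ext_bound in \<open>auto intro!: continuous_intros ext_cont simp: norm_mult\<close>)
  then show ?thesis by (simp add: algebra_simps)
qed

definition C3 :: real where
  "C3 = 4 * C + 40 * (2 * C + C2 * T) + (2 * (C * C) + 2 * (C * C2) * T) * 3 ^ CARD('n)"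

lemma C3_nonneg: "C3 \<ge> 0" using C0 C2_nonneg T by (simp add: C3_def)

text \<open>The integration by parts is done for each product \<open>a t l * a t (m - l)\<close>
  separately and summed over \<open>l\<close> afterwards, so the convolution is never differentiated
  in time as a whole.\<close>

lemma cv_osc:
  assumes \<tau>: "\<tau> \<noteq> 0"
  shows "cmod (integral {0..T} (\<lambda>t. cv t m * osc \<tau> t)) \<le> (2 * (C * C) + 2 * (C * C2) * T) * 3 ^ CARD('n) * hw m ^ (CARD('n) + 1) / \<bar>\<tau>\<bar>"
proof -
  define D where "D = (2 * (C * C) + 2 * (C * C2) * T) / \<bar>\<tau>\<bar>"
  have D0: "D \<ge> 0" using C0 C2_nonneg T by (simp add: D_def)
  define h where "h t l = a t l * a t (m - l) * osc \<tau> t" for t l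
  have hc: "continuous_on {0..T} (\<lambda>t. h t l)" for l unfolding h_def by (intro continuous_intros cont_a)
  have each: "cmod (integral {0..T} (\<lambda>t. h t l)) \<le> D * cmod (complex_of_real (hw l ^ (CARD('n) + 3)) * of_real (hw (m - l) ^ (CARD('n) + 3)))" for l
  proof -
    define w where "w = hw l ^ (CARD('n) + 3) * hw (m - l) ^ (CARD('n) + 3)"
    have w0: "w \<ge> 0" unfolding w_def using hw_pos[of l] hw_pos[of "m - l"] by simp
    have "cmod (integral {0..T} (\<lambda>t. h t l)) \<le> (2 * (C * C * w) + (2 * (C * C2) * w) * (T - 0)) / \<bar>\<tau>\<bar>"
      unfolding h_def
    proof (rule osc_bound[OF _ \<tau>])
      show "((\<lambda>t. a t l * a t (m - l)) has_vector_derivative (a t l * da t (m - l) + da t l * a t (m - l))) (at t within {0..T})" if "t \<in> {0..T}" for t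
        by (rule has_vector_derivative_mult[OF a_deriv[OF that] a_deriv[OF that]])
      show "continuous_on {0..T} (\<lambda>t. a t l * da t (m - l) + da t l * a t (m - l))"
        by (intro continuous_intros cont_a da_cont)
      fix t assume t: "t \<in> {0..T}"
      have a1: "cmod (a t l) \<le> C * hw l ^ (CARD('n) + 3)" for l using dec_le[OF t, of "CARD('n) + 3" l] by simp
      have m0: "0 \<le> C * hw l ^ (CARD('n) + 3)" "0 \<le> C2 * hw l ^ (CARD('n) + 3)" for l using C0 C2_nonneg hw_pos[of l] by auto
      have "cmod (a t l * a t (m - l)) \<le> (C * hw l ^ (CARD('n) + 3)) * (C * hw (m - l) ^ (CARD('n) + 3))"
        unfolding norm_mult by (intro mult_mono a1 m0) auto
      then show "cmod (a t l * a t (m - l)) \<le> C * C * w" by (simp add: w_def mult_ac)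
      have "cmod (a t l * da t (m - l)) \<le> (C * hw l ^ (CARD('n) + 3)) * (C2 * hw (m - l) ^ (CARD('n) + 3))"
        unfolding norm_mult by (intro mult_mono a1 m0 da_bound t) auto
      moreover have "cmod (da t l * a t (m - l)) \<le> (C2 * hw l ^ (CARD('n) + 3)) * (C * hw (m - l) ^ (CARD('n) + 3))"
        unfolding norm_mult by (intro mult_mono a1 m0 da_bound t) auto
      moreover have "(C * hw l ^ (CARD('n) + 3)) * (C2 * hw (m - l) ^ (CARD('n) + 3)) + (C2 * hw l ^ (CARD('n) + 3)) * (C * hw (m - l) ^ (CARD('n) + 3)) = 2 * (C * C2) * w"
        by (simp add: w_def algebra_simps)
      ultimately show "cmod (a t l * da t (m - l) + da t l * a t (m - l)) \<le> 2 * (C * C2) * w"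
        using norm_triangle_ineq[of "a t l * da t (m - l)" "da t l * a t (m - l)"] by linarith
    qed (use T in auto)
    also have "\<dots> = D * w" by (simp add: D_def algebra_simps add_divide_distrib)
    also have "w = cmod (complex_of_real (hw l ^ (CARD('n) + 3)) * of_real (hw (m - l) ^ (CARD('n) + 3)))"
      unfolding of_real_mult[symmetric] norm_of_real w_def[symmetric] using w0 by simp
    finally show ?thesis .
  qed
  have hb: "l1b (h t) (C * C * 3 ^ CARD('n))" if t: "t \<in> {0..T}" for t
  proof -
    have le: "cmod (h t l) \<le> C * C * (hw l)\<^sup>2" for l
    proof -
      have "cmod (h t l) \<le> (C * hw l ^ 2) * C"
        unfolding h_def norm_mult norm_osc mult_1_right using dec_le[OF t, of 2 l] dec_le[OF t, of 0 "m - l"] C0 by (intro mult_mono) auto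
      then show ?thesis by (simp add: mult_ac)
    qed
    show ?thesis unfolding l1b_def
    proof (intro allI impI)
      fix F :: "(int ^ 'n) set" assume F: "finite F"
      have "(\<Sum>l\<in>F. cmod (h t l)) \<le> (\<Sum>l\<in>F. C * C * (hw l)\<^sup>2)" by (intro sum_mono le)
      also have "\<dots> \<le> C * C * 3 ^ CARD('n)"
        unfolding sum_distrib_left[symmetric] using hw_square_sum_le[OF F] C0 by (intro mult_left_mono) auto
      finally show "(\<Sum>l\<in>F. cmod (h t l)) \<le> C * C * 3 ^ CARD('n)" .
    qed
  qed
  have "integral {0..T} (\<lambda>t. cv t m * osc \<tau> t) = (LINT t:{0..T}|lborel. cv t m * osc \<tau> t)"
    by (rule set_borel_integral_eq_integral(2)[symmetric]) (intro borel_integrable_atLeastAtMost' continuous_intros cv_cont)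
  also have "\<dots> = (LINT t:{0..T}|lborel. (\<Sum>\<^sub>\<infinity>l. h t l))"
    unfolding h_def cv_def conv_def by (simp add: infsum_cmult_left')
  also have "\<dots> = (\<Sum>\<^sub>\<infinity>l. integral {0..T} (\<lambda>t. h t l))"
    by (rule integral_infsum_swap(2)[OF hc hb]) (use T in auto)
  finally have e: "integral {0..T} (\<lambda>t. cv t m * osc \<tau> t) = (\<Sum>\<^sub>\<infinity>l. integral {0..T} (\<lambda>t. h t l))" .
  have hw1: "cmod (complex_of_real (hw l ^ (CARD('n) + 3))) \<le> 1 * hw l ^ (CARD('n) + 1 + 2)" for l :: "int ^ 'n"
  proof -
    have e: "CARD('n) + 1 + 2 = CARD('n) + 3" by simp
    show ?thesis using hw_pos[of l] unfolding e norm_of_real by simp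
  qed
  have l1i: "l1 (\<lambda>l. integral {0..T} (\<lambda>t. h t l))"
    by (rule l1b_l1[OF integral_infsum_swap(1)[OF hc hb]]) (use T in auto)
  have sl: "l1 (\<lambda>l. complex_of_real (hw l ^ (CARD('n) + 3)) * of_real (hw (m - l) ^ (CARD('n) + 3)))"
  proof (rule conv_l1[where g = "\<lambda>l. of_real (hw l ^ (CARD('n) + 3))"])
    have "l1 (\<lambda>l :: int ^ 'n. complex_of_real (hw l ^ (CARD('n) + 3)))" by (rule hw_summable_bound[OF hw1]) auto
    then show "l2b (\<lambda>l :: int ^ 'n. complex_of_real (hw l ^ (CARD('n) + 3))) (n1 (\<lambda>l :: int ^ 'n. complex_of_real (hw l ^ (CARD('n) + 3))))"
      "l2b (\<lambda>l :: int ^ 'n. complex_of_real (hw l ^ (CARD('n) + 3))) (n1 (\<lambda>l :: int ^ 'n. complex_of_real (hw l ^ (CARD('n) + 3))))"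
      by (rule l1_l2b)+
  qed
  have "cmod (\<Sum>\<^sub>\<infinity>l. integral {0..T} (\<lambda>t. h t l)) \<le> (\<Sum>\<^sub>\<infinity>l. cmod (integral {0..T} (\<lambda>t. h t l)))"
    by (rule norm_infsum_bound[OF l1i])
  also have "\<dots> \<le> (\<Sum>\<^sub>\<infinity>l. D * cmod (complex_of_real (hw l ^ (CARD('n) + 3)) * of_real (hw (m - l) ^ (CARD('n) + 3))))"
    by (rule infsum_mono[OF l1i summable_on_cmult_right[OF sl]]) (rule each)
  also have "\<dots> = D * (\<Sum>\<^sub>\<infinity>l. cmod (complex_of_real (hw l ^ (CARD('n) + 3)) * of_real (hw (m - l) ^ (CARD('n) + 3))))"
    by (rule infsum_cmult_right')
  also have "\<dots> \<le> D * (1 * 1 * 3 ^ CARD('n) * hw m ^ (CARD('n) + 1))"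
    by (intro mult_left_mono D0 conv_decay(1)[where f = "\<lambda>l. of_real (hw l ^ (CARD('n) + 3))" and g = "\<lambda>l. of_real (hw l ^ (CARD('n) + 3))"] hw1) auto
  finally show ?thesis unfolding e D_def by simp
qed

text \<open>The extension is continuous and vanishes at \<open>-1\<close> and \<open>T + 1\<close>,
  so the boundary terms of the first integration by parts cancel. The derivative may jump at
  \<open>0\<close> and \<open>T\<close>; on each piece a second integration by parts gains the other
  factor \<open>1 / |\<tau>|\<close>.\<close>

lemma Ft_bound2:
  assumes \<tau>: "\<tau> \<noteq> 0"
  shows "cmod (Ft m \<tau>) \<le> C3 * hw m ^ (CARD('n) + 1) / \<tau>\<^sup>2"
proof -
  define \<kappa> where "\<kappa> = - 2 * pi * \<i> * of_real \<tau>"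
  have nk: "cmod \<kappa> = 2 * pi * \<bar>\<tau>\<bar>" by (simp add: \<kappa>_def norm_mult)
  have t0: "\<bar>\<tau>\<bar> > 0" using \<tau> by simp
  have "1 * \<bar>\<tau>\<bar> \<le> (2 * pi) * \<bar>\<tau>\<bar>" using pi_ge_two by (intro mult_right_mono) auto
  then have nk2: "\<bar>\<tau>\<bar> \<le> cmod \<kappa>" by (simp add: nk)
  define w where "w = hw m ^ (CARD('n) + 1)"
  have w0: "w \<ge> 0" unfolding w_def using hw_pos[of m] by simp
  have aw: "cmod (a t m) \<le> C * w" if "t \<in> {0..T}" for t unfolding w_def by (rule dec_le[OF that]) simp
  have I1: "integral {-1..0} (\<lambda>t. ext t m * osc \<tau> t) = a 0 m * osc \<tau> 0 / \<kappa> - integral {-1..0} (\<lambda>t. a 0 m * osc \<tau> t) / \<kappa>"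
  proof -
    have "integral {-1..0} (\<lambda>t. ext t m * osc \<tau> t) = integral {-1..0} (\<lambda>t. (of_real (1 + t) * a 0 m) * osc \<tau> t)"
      by (rule integral_cong) (use T in \<open>auto simp: ext_def cut_def clampT_def\<close>)
    also have "\<dots> = (of_real (1 + 0) * a 0 m * osc \<tau> 0 - of_real (1 + (- 1)) * a 0 m * osc \<tau> (- 1)) / \<kappa> - integral {-1..0} (\<lambda>t. a 0 m * osc \<tau> t) / \<kappa>"
      unfolding \<kappa>_def
    proof (rule osc_parts[OF _ \<tau>])
      show "((\<lambda>t. of_real (1 + t) * a 0 m) has_vector_derivative a 0 m) (at t within {-1..0})" for t
        by (auto intro!: derivative_eq_intros simp: has_vector_derivative_def scaleR_conv_of_real)
    qed auto
    finally show ?thesis by simp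
  qed
  have I3: "integral {T..T + 1} (\<lambda>t. ext t m * osc \<tau> t) = - (a T m * osc \<tau> T / \<kappa>) - integral {T..T + 1} (\<lambda>t. - a T m * osc \<tau> t) / \<kappa>"
  proof -
    have "integral {T..T + 1} (\<lambda>t. ext t m * osc \<tau> t) = integral {T..T + 1} (\<lambda>t. (of_real (T + 1 - t) * a T m) * osc \<tau> t)"
      by (rule integral_cong) (use T in \<open>auto simp: ext_def cut_def clampT_def\<close>)
    also have "\<dots> = (of_real (T + 1 - (T + 1)) * a T m * osc \<tau> (T + 1) - of_real (T + 1 - T) * a T m * osc \<tau> T) / \<kappa> - integral {T..T + 1} (\<lambda>t. - a T m * osc \<tau> t) / \<kappa>"
      unfolding \<kappa>_def
    proof (rule osc_parts[OF _ \<tau>])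
      show "((\<lambda>t. of_real (T + 1 - t) * a T m) has_vector_derivative - a T m) (at t within {T..T + 1})" for t
        by (auto intro!: derivative_eq_intros simp: has_vector_derivative_def scaleR_conv_of_real)
    qed auto
    finally show ?thesis by simp
  qed
  have I2: "integral {0..T} (\<lambda>t. ext t m * osc \<tau> t) = (a T m * osc \<tau> T - a 0 m * osc \<tau> 0) / \<kappa> - integral {0..T} (\<lambda>t. da t m * osc \<tau> t) / \<kappa>"
  proof -
    have "integral {0..T} (\<lambda>t. ext t m * osc \<tau> t) = integral {0..T} (\<lambda>t. a t m * osc \<tau> t)"
      by (rule integral_cong) (use T in \<open>auto simp: ext_def cut_def clampT_def\<close>)
    also have "\<dots> = (a T m * osc \<tau> T - a 0 m * osc \<tau> 0) / \<kappa> - integral {0..T} (\<lambda>t. da t m * osc \<tau> t) / \<kappa>"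
      unfolding \<kappa>_def by (rule osc_parts[OF _ \<tau> a_deriv da_cont]) (use T in auto)
    finally show ?thesis .
  qed
  have int: "(\<lambda>t. ext t m * osc \<tau> t) integrable_on {p..q}" for p q
    by (intro integrable_continuous_interval continuous_intros ext_cont)
  have "Ft m \<tau> = integral {-1..0} (\<lambda>t. ext t m * osc \<tau> t) + (integral {0..T} (\<lambda>t. ext t m * osc \<tau> t) + integral {T..T + 1} (\<lambda>t. ext t m * osc \<tau> t))"
  proof -
    have "integral {0..T} (\<lambda>t. ext t m * osc \<tau> t) + integral {T..T + 1} (\<lambda>t. ext t m * osc \<tau> t) = integral {0..T + 1} (\<lambda>t. ext t m * osc \<tau> t)"
      by (rule Henstock_Kurzweil_Integration.integral_combine) (use T int in auto)
    moreover have "integral {-1..0} (\<lambda>t. ext t m * osc \<tau> t) + integral {0..T + 1} (\<lambda>t. ext t m * osc \<tau> t) = integral {-1..T + 1} (\<lambda>t. ext t m * osc \<tau> t)"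
      by (rule Henstock_Kurzweil_Integration.integral_combine) (use T int in auto)
    ultimately show ?thesis by (simp add: Ft_def)
  qed
  also have "\<dots> = - (integral {-1..0} (\<lambda>t. a 0 m * osc \<tau> t) + integral {0..T} (\<lambda>t. da t m * osc \<tau> t) + integral {T..T + 1} (\<lambda>t. - a T m * osc \<tau> t)) / \<kappa>"
  proof -
    have "(p / \<kappa> - X / \<kappa>) + (((q - p) / \<kappa> - Y / \<kappa>) + (- (q / \<kappa>) - Z / \<kappa>)) = - (X + Y + Z) / \<kappa>" for p q X Y Z :: complex
      by (cases "\<kappa> = 0") (auto simp: field_simps)
    then show ?thesis unfolding I1 I2 I3 .
  qed
  finally have F: "cmod (Ft m \<tau>) = cmod (integral {-1..0} (\<lambda>t. a 0 m * osc \<tau> t) + integral {0..T} (\<lambda>t. da t m * osc \<tau> t) + integral {T..T + 1} (\<lambda>t. - a T m * osc \<tau> t)) / cmod \<kappa>"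
    by (simp only: norm_divide norm_minus_cancel)
  have B1: "cmod (integral {-1..0} (\<lambda>t. a 0 m * osc \<tau> t)) \<le> (2 * (C * w) + 0 * (0 - (- 1))) / \<bar>\<tau>\<bar>"
    by (rule osc_bound[OF _ \<tau>, where f' = "\<lambda>_. 0"]) (use aw T in auto)
  have B3: "cmod (integral {T..T + 1} (\<lambda>t. - a T m * osc \<tau> t)) \<le> (2 * (C * w) + 0 * (T + 1 - T)) / \<bar>\<tau>\<bar>"
    by (rule osc_bound[OF _ \<tau>, where f' = "\<lambda>_. 0"]) (use aw T in auto)
  have B2a: "cmod (integral {0..T} (\<lambda>t. a t m * osc \<tau> t)) \<le> (2 * (C * hw m ^ (CARD('n) + 3)) + C2 * hw m ^ (CARD('n) + 3) * (T - 0)) / \<bar>\<tau>\<bar>"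
    by (rule osc_bound[OF _ \<tau> a_deriv da_cont dec_le da_bound]) (use T in auto)
  have ph: "phase L m \<ge> 0" by (rule phase_le(1)[OF L])
  \<comment> \<open>\<open>da\<close> itself is not differentiated: its linear part is the phase
    times \<open>a\<close>, and its quadratic part falls under \<open>cv_osc\<close>.\<close>
  have "integral {0..T} (\<lambda>t. da t m * osc \<tau> t) = \<i> * of_real (phase L m) * integral {0..T} (\<lambda>t. a t m * osc \<tau> t) - \<i> * integral {0..T} (\<lambda>t. cv t m * osc \<tau> t)"
  proof -
    have "(\<lambda>t. (\<i> * of_real (phase L m)) * (a t m * osc \<tau> t)) integrable_on {0..T}" "(\<lambda>t. \<i> * (cv t m * osc \<tau> t)) integrable_on {0..T}"
      by (intro integrable_continuous_interval continuous_intros cont_a cv_cont)+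
    from integral_diff[OF this] show ?thesis by (simp add: da_def left_diff_distrib mult.assoc)
  qed
  then have "cmod (integral {0..T} (\<lambda>t. da t m * osc \<tau> t)) \<le> phase L m * cmod (integral {0..T} (\<lambda>t. a t m * osc \<tau> t)) + cmod (integral {0..T} (\<lambda>t. cv t m * osc \<tau> t))"
    using norm_triangle_ineq4[of "\<i> * of_real (phase L m) * integral {0..T} (\<lambda>t. a t m * osc \<tau> t)" "\<i> * integral {0..T} (\<lambda>t. cv t m * osc \<tau> t)"] ph
    by (simp add: norm_mult)
  also have "\<dots> \<le> (40 * (2 * C + C2 * T)) * w / \<bar>\<tau>\<bar> + (2 * (C * C) + 2 * (C * C2) * T) * 3 ^ CARD('n) * w / \<bar>\<tau>\<bar>"
  proof (rule add_mono)
    have "phase L m * cmod (integral {0..T} (\<lambda>t. a t m * osc \<tau> t)) \<le> phase L m * ((2 * (C * hw m ^ (CARD('n) + 3)) + C2 * hw m ^ (CARD('n) + 3) * (T - 0)) / \<bar>\<tau>\<bar>)"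
      by (rule mult_left_mono[OF B2a ph])
    also have "\<dots> = (2 * C + C2 * T) / \<bar>\<tau>\<bar> * (phase L m * hw m ^ (CARD('n) + 1 + 2))"
      by (simp add: field_simps numeral_eq_Suc)
    also have "\<dots> \<le> (2 * C + C2 * T) / \<bar>\<tau>\<bar> * (40 * hw m ^ (CARD('n) + 1))"
      using C0 C2_nonneg T by (intro mult_left_mono phase_mult_hw) auto
    finally show "phase L m * cmod (integral {0..T} (\<lambda>t. a t m * osc \<tau> t)) \<le> (40 * (2 * C + C2 * T)) * w / \<bar>\<tau>\<bar>"
      by (simp add: w_def mult_ac)
    show "cmod (integral {0..T} (\<lambda>t. cv t m * osc \<tau> t)) \<le> (2 * (C * C) + 2 * (C * C2) * T) * 3 ^ CARD('n) * w / \<bar>\<tau>\<bar>"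
      unfolding w_def by (rule cv_osc[OF \<tau>])
  qed
  finally have B2: "cmod (integral {0..T} (\<lambda>t. da t m * osc \<tau> t)) \<le> (40 * (2 * C + C2 * T)) * w / \<bar>\<tau>\<bar> + (2 * (C * C) + 2 * (C * C2) * T) * 3 ^ CARD('n) * w / \<bar>\<tau>\<bar>" .
  have "cmod (Ft m \<tau>) \<le> (C3 * w / \<bar>\<tau>\<bar>) / cmod \<kappa>"
    unfolding F
  proof (rule divide_right_mono)
    have "C3 * w / \<bar>\<tau>\<bar> = 2 * (C * w) / \<bar>\<tau>\<bar> + ((40 * (2 * C + C2 * T)) * w / \<bar>\<tau>\<bar> + (2 * (C * C) + 2 * (C * C2) * T) * 3 ^ CARD('n) * w / \<bar>\<tau>\<bar>) + 2 * (C * w) / \<bar>\<tau>\<bar>"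
      unfolding C3_def add_divide_distrib[symmetric] by (rule arg_cong[where f = "\<lambda>z. z / \<bar>\<tau>\<bar>"]) (simp add: algebra_simps)
    then show "cmod (integral {-1..0} (\<lambda>t. a 0 m * osc \<tau> t) + integral {0..T} (\<lambda>t. da t m * osc \<tau> t) + integral {T..T + 1} (\<lambda>t. - a T m * osc \<tau> t)) \<le> C3 * w / \<bar>\<tau>\<bar>"
      using B1 B2 B3 norm_triangle_ineq[of "integral {-1..0} (\<lambda>t. a 0 m * osc \<tau> t) + integral {0..T} (\<lambda>t. da t m * osc \<tau> t)" "integral {T..T + 1} (\<lambda>t. - a T m * osc \<tau> t)"]
        norm_triangle_ineq[of "integral {-1..0} (\<lambda>t. a 0 m * osc \<tau> t)" "integral {0..T} (\<lambda>t. da t m * osc \<tau> t)"]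
      by simp
  qed simp
  also have "\<dots> \<le> (C3 * w / \<bar>\<tau>\<bar>) / \<bar>\<tau>\<bar>"
    using C3_nonneg w0 nk2 t0 by (intro divide_left_mono mult_pos_pos) auto
  finally show ?thesis by (simp add: w_def power2_eq_square)
qed

text \<open>The trivial bound serves small \<open>\<tau>\<close>, the decay the rest; the combined
  form is free of the singularity at \<open>0\<close>.\<close>

lemma Ft_bound:
  "cmod (Ft m \<tau>) \<le> 2 * (C * (T + 2) + C3) * hw m ^ (CARD('n) + 1) / (1 + \<tau>\<^sup>2)"
proof -
  define w where "w = hw m ^ (CARD('n) + 1)"
  define C4 where "C4 = C * (T + 2) + C3"
  have w0: "w \<ge> 0" unfolding w_def using hw_pos[of m] by simp
  have C: "0 \<le> C * (T + 2)" using C0 T by simp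
  have p: "1 + \<tau>\<^sup>2 > 0" by (simp add: add_pos_nonneg)
  have "cmod (Ft m \<tau>) * (1 + \<tau>\<^sup>2) \<le> 2 * C4 * w"
  proof (cases "\<tau>\<^sup>2 \<le> 1")
    case True
    have "cmod (Ft m \<tau>) \<le> C * (T + 2) * hw m ^ (CARD('n) + 5)" by (rule Ft_bound1)
    also have "\<dots> \<le> C * (T + 2) * w"
      unfolding w_def using C hw_pos[of m] hw_le_1[of m] by (intro mult_left_mono power_decreasing) auto
    also have "\<dots> \<le> C4 * w" using C3_nonneg w0 by (intro mult_right_mono) (auto simp: C4_def)
    finally have "cmod (Ft m \<tau>) * (1 + \<tau>\<^sup>2) \<le> (C4 * w) * 2" using True w0 C C3_nonneg by (intro mult_mono) (auto simp: C4_def)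
    then show ?thesis by simp
  next
    case False
    then have t0: "\<tau> \<noteq> 0" by auto
    have "cmod (Ft m \<tau>) * (1 + \<tau>\<^sup>2) \<le> (C3 * w / \<tau>\<^sup>2) * (2 * \<tau>\<^sup>2)"
      using Ft_bound2[OF t0, of m] False C3_nonneg w0 by (intro mult_mono) (auto simp: w_def)
    also have "\<dots> = 2 * (C3 * w)" using t0 by simp
    also have "\<dots> \<le> 2 * (C4 * w)" using C w0 by (intro mult_left_mono mult_right_mono) (auto simp: C4_def)
    finally show ?thesis by simp
  qed
  then show ?thesis unfolding C4_def[symmetric] w_def[symmetric] using p by (simp add: pos_le_divide_eq)
qed

text \<open>The squared transform decays like \<open>(1 + \<tau>^2)\<close> to the power
  \<open>-2\<close>. For \<open>b \<le> 1\<close> the time weight takes back at most one such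
  factor, so an integrable function of \<open>\<tau>\<close> remains.\<close>

lemma h_norm_solx:
  assumes b: "0 \<le> b" "b \<le> 1"
  shows "h_norm L (real CARD('n)) b solx < \<infinity>"
proof -
  let ?lat = "\<lambda>m :: int ^ 'n. (1 / L) *\<^sub>R int_vec m :: real ^ 'n"
  let ?J = "\<lambda>m. jap (?lat m)"
  define c where "c = complex_of_real (L powr (real CARD('n) / 2))"
  define C4 where "C4 = 2 * (C * (T + 2) + C3)"
  have C40: "C4 \<ge> 0" using C0 T C3_nonneg by (simp add: C4_def)
  define I where "I = (\<integral>\<tau>. inverse (1 + \<tau>\<^sup>2) \<partial>(lborel :: real measure))"
  have ii: "integrable lborel (\<lambda>\<tau>::real. inverse (1 + \<tau>\<^sup>2))"
    using integrable_inverse_1_plus_square by (simp add: set_integrable_def)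
  have I0: "I \<ge> 0" unfolding I_def by (rule Bochner_Integration.integral_nonneg) simp
  have fx: "fourier_x L (solx t) (?lat m) = c * ext t m" for t m
    unfolding fourier_x_coef[OF L_pos] c_def solx_def coef_trig[OF L_pos l1_ext] ..
  have ftx: "AE \<tau> in lborel. fourier_tx L solx \<tau> (?lat m) = c * Ft m \<tau>"
    "(\<lambda>\<tau>. fourier_tx L solx \<tau> (?lat m)) \<in> borel_measurable borel" for m
  proof -
    have cf: "continuous_on UNIV (\<lambda>t. c * ext t m)" by (intro continuous_intros ext_cont)
    have z: "c * ext t m = 0" if "t \<notin> {- (T + 1)..T + 1}" for t
      using that ext_zero[of t m] T by auto
    note F = fourier_t_compact[where rad = "T + 1", OF cf z]
    have X: "(LINT t:{- (T + 1)..T + 1}|lborel. c * ext t m * cis (- 2 * pi * t * \<tau>)) = c * Ft m \<tau>" for \<tau>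
    proof -
      have "(LINT t:{- (T + 1)..T + 1}|lborel. c * ext t m * cis (- 2 * pi * t * \<tau>)) = (LINT t:{-1..T + 1}|lborel. c * (ext t m * osc \<tau> t))"
        unfolding set_lebesgue_integral_def
        by (intro Bochner_Integration.integral_cong refl) (use T ext_zero in \<open>auto simp: indicator_def osc_def\<close>)
      also have "\<dots> = integral {-1..T + 1} (\<lambda>t. c * (ext t m * osc \<tau> t))"
        by (rule set_borel_integral_eq_integral(2)) (intro borel_integrable_atLeastAtMost' continuous_intros ext_cont)
      finally show ?thesis by (simp add: Ft_def)
    qed
    show "AE \<tau> in lborel. fourier_tx L solx \<tau> (?lat m) = c * Ft m \<tau>"
      using F(3) unfolding fourier_tx_def fx X .
    show "(\<lambda>\<tau>. fourier_tx L solx \<tau> (?lat m)) \<in> borel_measurable borel"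
      using F(2) unfolding fourier_tx_def fx by simp
  qed
  define B where "B = 49 ^ CARD('n) * (cmod c)\<^sup>2 * (40 * C4\<^sup>2) * I"
  have B0: "B \<ge> 0" using I0 by (simp add: B_def)
  have each: "(\<integral>\<^sup>+ \<tau>. ennreal (?J m powr (2 * real CARD('n)) * jap \<tau> powr (2 * b) * (cmod (fourier_tx L solx \<tau> (?lat m)))\<^sup>2) \<partial>lborel) \<le> ennreal (B * (hw m)\<^sup>2)" for m
  proof -
    have J0: "?J m > 0" using jap_ge_1[of "?lat m"] by linarith
    then have p: "?J m powr (2 * real CARD('n)) = ?J m ^ (2 * CARD('n))"
      using powr_realpow[of "?J m" "2 * CARD('n)"] by simp
    have "(\<integral>\<^sup>+ \<tau>. ennreal (?J m powr (2 * real CARD('n)) * jap \<tau> powr (2 * b) * (cmod (fourier_tx L solx \<tau> (?lat m)))\<^sup>2) \<partial>lborel)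
      \<le> (\<integral>\<^sup>+ \<tau>. ennreal ((49 ^ CARD('n) * (cmod c)\<^sup>2 * (40 * C4\<^sup>2) * (hw m)\<^sup>2) * inverse (1 + \<tau>\<^sup>2)) \<partial>lborel)"
    proof (rule nn_integral_mono_AE)
      show "AE \<tau> in lborel. ennreal (?J m powr (2 * real CARD('n)) * jap \<tau> powr (2 * b) * (cmod (fourier_tx L solx \<tau> (?lat m)))\<^sup>2)
        \<le> ennreal ((49 ^ CARD('n) * (cmod c)\<^sup>2 * (40 * C4\<^sup>2) * (hw m)\<^sup>2) * inverse (1 + \<tau>\<^sup>2))"
        using ftx(1)[of m]
      proof eventually_elim
        case (elim \<tau>)
        have p1: "1 + \<tau>\<^sup>2 > 0" by (simp add: add_pos_nonneg)
        have j1: "jap \<tau> powr (2 * b) \<le> 40 * (1 + \<tau>\<^sup>2)"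
        proof -
          have "jap \<tau> powr (2 * b) \<le> jap \<tau> powr (real 2)" using jap_ge_1[of \<tau>] b by (intro powr_mono) auto
          also have "\<dots> = (jap \<tau>)\<^sup>2" using jap_ge_1[of \<tau>] by (intro powr_realpow) linarith
          also have "\<dots> = 1 + 4 * pi\<^sup>2 * \<tau>\<^sup>2" by (simp add: jap_sq)
          also have "\<dots> \<le> 40 + 40 * \<tau>\<^sup>2"
          proof -
            have "4 * pi\<^sup>2 \<le> 40" using power_mono[of pi "3.16" 2] pi_approx by (simp add: power2_eq_square)
            then have "4 * pi\<^sup>2 * \<tau>\<^sup>2 \<le> 40 * \<tau>\<^sup>2" by (intro mult_right_mono) auto
            then show ?thesis by linarith
          qed
          finally show ?thesis by simp
        qed
        have j2: "?J m ^ (2 * CARD('n)) * (hw m ^ (CARD('n) + 1))\<^sup>2 \<le> 49 ^ CARD('n) * (hw m)\<^sup>2"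
        proof -
          have "?J m * hw m \<le> 7" using hw_jap_bounds(2)[OF L, of m] hw_pos[of m] by (simp add: pos_le_divide_eq)
          then have "(?J m * hw m) ^ (2 * CARD('n)) \<le> 7 ^ (2 * CARD('n))" using J0 hw_pos[of m] by (intro power_mono) auto
          then have "(?J m * hw m) ^ (2 * CARD('n)) * (hw m)\<^sup>2 \<le> 49 ^ CARD('n) * (hw m)\<^sup>2"
            by (intro mult_right_mono) (auto simp: power_mult)
          moreover have "(?J m * hw m) ^ (2 * CARD('n)) * (hw m)\<^sup>2 = ?J m ^ (2 * CARD('n)) * (hw m ^ (CARD('n) + 1))\<^sup>2"
            by (simp add: power_mult_distrib power_add power_mult[symmetric] mult_ac)
          ultimately show ?thesis by simp
        qed
        have f: "(cmod (fourier_tx L solx \<tau> (?lat m)))\<^sup>2 \<le> (cmod c)\<^sup>2 * (C4\<^sup>2 * (hw m ^ (CARD('n) + 1))\<^sup>2 / (1 + \<tau>\<^sup>2)\<^sup>2)"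
        proof -
          have "(cmod (Ft m \<tau>))\<^sup>2 \<le> (C4 * hw m ^ (CARD('n) + 1) / (1 + \<tau>\<^sup>2))\<^sup>2"
            unfolding C4_def using Ft_bound by (intro power_mono) auto
          then show ?thesis unfolding elim norm_mult power_mult_distrib by (intro mult_left_mono) (auto simp: power_divide power_mult_distrib)
        qed
        have "?J m powr (2 * real CARD('n)) * jap \<tau> powr (2 * b) * (cmod (fourier_tx L solx \<tau> (?lat m)))\<^sup>2
          \<le> ?J m ^ (2 * CARD('n)) * (40 * (1 + \<tau>\<^sup>2)) * ((cmod c)\<^sup>2 * (C4\<^sup>2 * (hw m ^ (CARD('n) + 1))\<^sup>2 / (1 + \<tau>\<^sup>2)\<^sup>2))"
          unfolding p using j1 f J0 p1 by (intro mult_mono) auto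
        also have "\<dots> = (?J m ^ (2 * CARD('n)) * (hw m ^ (CARD('n) + 1))\<^sup>2) * ((40 * (cmod c)\<^sup>2 * C4\<^sup>2) * ((1 + \<tau>\<^sup>2) / (1 + \<tau>\<^sup>2)\<^sup>2))"
          by (simp add: mult_ac)
        also have "(1 + \<tau>\<^sup>2) / (1 + \<tau>\<^sup>2)\<^sup>2 = inverse (1 + \<tau>\<^sup>2)"
          using p1 by (simp add: power2_eq_square[of "1 + \<tau>\<^sup>2"] inverse_eq_divide)
        also have "(?J m ^ (2 * CARD('n)) * (hw m ^ (CARD('n) + 1))\<^sup>2) * ((40 * (cmod c)\<^sup>2 * C4\<^sup>2) * inverse (1 + \<tau>\<^sup>2))
          \<le> (49 ^ CARD('n) * (hw m)\<^sup>2) * ((40 * (cmod c)\<^sup>2 * C4\<^sup>2) * inverse (1 + \<tau>\<^sup>2))"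
          using p1 by (intro mult_right_mono j2) auto
        finally show ?case by (intro ennreal_leI) (simp add: mult_ac)
      qed
    qed
    also have "\<dots> = ennreal ((49 ^ CARD('n) * (cmod c)\<^sup>2 * (40 * C4\<^sup>2) * (hw m)\<^sup>2) * I)"
    proof -
      have "(\<integral>\<^sup>+ \<tau>. ennreal ((49 ^ CARD('n) * (cmod c)\<^sup>2 * (40 * C4\<^sup>2) * (hw m)\<^sup>2) * inverse (1 + \<tau>\<^sup>2)) \<partial>lborel)
        = ennreal (\<integral>\<tau>. (49 ^ CARD('n) * (cmod c)\<^sup>2 * (40 * C4\<^sup>2) * (hw m)\<^sup>2) * inverse (1 + \<tau>\<^sup>2) \<partial>lborel)"
        by (rule nn_integral_eq_integral) (auto intro!: integrable_mult_right ii)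
      then show ?thesis by (simp add: I_def)
    qed
    finally show ?thesis by (simp add: B_def mult_ac)
  qed
  have inj: "inj ?lat" using L_pos inj_int_vec by (auto simp: inj_on_def)
  have "(\<Sum>\<^sub>\<infinity>k\<in>lattice L. \<integral>\<^sup>+ \<tau>. ennreal (jap k powr (2 * real CARD('n)) * jap \<tau> powr (2 * b) * (cmod (fourier_tx L solx \<tau> k))\<^sup>2) \<partial>lborel)
    = (\<Sum>\<^sub>\<infinity>m. \<integral>\<^sup>+ \<tau>. ennreal (?J m powr (2 * real CARD('n)) * jap \<tau> powr (2 * b) * (cmod (fourier_tx L solx \<tau> (?lat m)))\<^sup>2) \<partial>lborel)"
    unfolding lattice_def by (subst infsum_reindex[OF inj]) (simp add: o_def)
  also have "\<dots> \<le> (\<Sum>\<^sub>\<infinity>m :: int ^ 'n. ennreal (B * (hw m)\<^sup>2))"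
    by (rule infsum_mono) (auto intro!: nonneg_summable_on_complete each)
  also have "\<dots> \<le> ennreal (B * 3 ^ CARD('n))"
    using B0 by (subst ennreal_infsum_le_iff) (auto simp: sum_distrib_left[symmetric] intro!: mult_left_mono hw_square_sum_le)
  finally have "ennreal (L powr - real CARD('n)) * (\<Sum>\<^sub>\<infinity>k\<in>lattice L. \<integral>\<^sup>+ \<tau>. ennreal (jap k powr (2 * real CARD('n)) * jap \<tau> powr (2 * b) * (cmod (fourier_tx L solx \<tau> k))\<^sup>2) \<partial>lborel)
     \<le> ennreal (L powr - real CARD('n)) * ennreal (B * 3 ^ CARD('n))" by (rule mult_left_mono) simp
  also have "\<dots> < \<infinity>" by (simp add: ennreal_mult_less_top)
  finally show ?thesis using solx_L2 by (simp add: h_norm_def ennsqrt_def less_top[symmetric])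
qed

theorem mild_solution_sol:
  assumes b: "0 \<le> b" "b \<le> 1"
  shows "mild_solution L (real CARD('n)) b T (sol 0) sol"
  unfolding mild_solution_def
proof (intro conjI ballI allI)
  have "h_norm_restr L (real CARD('n)) b T sol \<le> h_norm L (real CARD('n)) b solx"
    unfolding h_norm_restr_def
    by (rule Inf_lower) (auto intro!: exI[of _ solx] AE_I2 solx_eq simp: case_prod_unfold)
  then show "h_norm_restr L (real CARD('n)) b T sol < \<infinity>" using h_norm_solx[OF b] by (rule order_le_less_trans)
qed (use sol_Hs sol_mild in auto)

text \<open>Bounding the outer of the two essential suprema requires the inner one to be measurable
  in \<open>t\<close>. It is Lipschitz there, because \<open>sol\<close> is Lipschitz in time
  uniformly in space.\<close>

lemma sol_Linf:
  assumes B: "\<And>t x. t \<in> {0..T} \<Longrightarrow> cmod (trig (a t) x) \<le> B"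
  shows "Linf_norm L T sol \<le> ereal B"
proof -
  define \<phi> where "\<phi> t = esssup (restrict_space lborel (cube L)) (\<lambda>x. ereal (cmod (sol t x)))" for t
  have B0: "B \<ge> 0" using order_trans[OF norm_ge_zero B[of 0 0]] T by auto
  have ms: "sol t \<in> borel_measurable borel" if "t \<in> {0..T}" for t
    using torus_L2_trig[OF L_pos l1_a[OF that]] by (simp add: torus_L2_def sol_def[abs_def])
  have mr: "(\<lambda>x. ereal (cmod (sol t x))) \<in> borel_measurable (restrict_space lborel (cube L))" if "t \<in> {0..T}" for t
    using ms[OF that] by (intro measurable_restrict_space1) simp
  have le: "\<phi> t \<le> ereal B" if "t \<in> {0..T}" for t
    unfolding \<phi>_def by (rule esssup_I[OF mr[OF that]]) (use B[OF that] in \<open>auto simp: sol_def\<close>)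
  define H where "H = C2 * (\<Sum>\<^sub>\<infinity>m :: int ^ 'n. hw m ^ (CARD('n) + 3))"
  have H0: "H \<ge> 0" unfolding H_def using C2_nonneg
    by (intro mult_nonneg_nonneg infsum_nonneg zero_le_power less_imp_le[OF hw_pos]) auto
  have sm: "(\<lambda>m :: int ^ 'n. hw m ^ (CARD('n) + 3)) summable_on UNIV" by (rule hw_power_summable) simp
  have lip: "cmod (sol s x - sol t x) \<le> H * \<bar>s - t\<bar>" if "s \<in> {0..T}" "t \<in> {0..T}" for s t x
  proof -
    have "sol s x - sol t x = trig (\<lambda>m. a s m - a t m) ((1 / L) *\<^sub>R x)"
      unfolding sol_def by (rule trig_diff[OF l1_a l1_a, symmetric]) (use that in auto)
    also have "cmod \<dots> \<le> (\<Sum>\<^sub>\<infinity>m. cmod (a s m - a t m))" by (rule norm_trig_le) (intro l1_diff l1_a that)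
    also have "\<dots> \<le> (\<Sum>\<^sub>\<infinity>m :: int ^ 'n. C2 * \<bar>s - t\<bar> * hw m ^ (CARD('n) + 3))"
      by (rule infsum_mono) (auto intro!: l1_diff l1_a summable_on_cmult_right sm a_lipschitz that)
    also have "\<dots> = H * \<bar>s - t\<bar>" by (simp add: infsum_cmult_right' H_def)
    finally show ?thesis .
  qed
  have lip2: "\<phi> s \<le> \<phi> t + ereal (H * \<bar>s - t\<bar>)" if s: "s \<in> {0..T}" and t: "t \<in> {0..T}" for s t
    unfolding \<phi>_def
  proof (rule esssup_I[OF mr[OF s]])
    show "AE x in restrict_space lborel (cube L). ereal (cmod (sol s x)) \<le> esssup (restrict_space lborel (cube L)) (\<lambda>x. ereal (cmod (sol t x))) + ereal (H * \<bar>s - t\<bar>)"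
      using esssup_AE[of "\<lambda>x. ereal (cmod (sol t x))" "restrict_space lborel (cube L)"]
    proof eventually_elim
      case (elim x)
      have "cmod (sol s x) \<le> cmod (sol t x) + H * \<bar>s - t\<bar>"
        using lip[OF s t, of x] norm_triangle_ineq2[of "sol s x" "sol t x"] by linarith
      then have "ereal (cmod (sol s x)) \<le> ereal (cmod (sol t x)) + ereal (H * \<bar>s - t\<bar>)" by simp
      also have "\<dots> \<le> esssup (restrict_space lborel (cube L)) (\<lambda>x. ereal (cmod (sol t x))) + ereal (H * \<bar>s - t\<bar>)"
        by (intro add_right_mono elim)
      finally show ?case .
    qed
  qed
  \<comment> \<open>Together with the upper bound \<open>B\<close> this makes the inner supremum a
    real number. The sign uses that the cube has positive measure.\<close>
  have nn: "\<phi> t \<ge> 0" if t: "t \<in> {0..T}" for t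
  proof -
    have mc: "measure lborel (cube L :: (real ^ 'n) set) = L ^ CARD('n)" by (rule measure_cube) (use L_pos in simp)
    have fin: "emeasure lborel (cube L :: (real ^ 'n) set) \<noteq> \<infinity>" by (rule cube_sets)
    have "emeasure (restrict_space lborel (cube L)) (space (restrict_space lborel (cube L :: (real ^ 'n) set))) = emeasure lborel (cube L :: (real ^ 'n) set)"
      using cube_sets by (simp add: emeasure_restrict_space space_restrict_space)
    also have "\<dots> = ennreal (L ^ CARD('n))" using fin mc by (simp add: emeasure_eq_ennreal_measure)
    finally have "emeasure (restrict_space lborel (cube L)) (space (restrict_space lborel (cube L :: (real ^ 'n) set))) \<noteq> 0"
      using L_pos by simp
    then have "esssup (restrict_space lborel (cube L)) (\<lambda>x :: real ^ 'n. 0 :: ereal) = 0" by (rule esssup_const)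
    then show ?thesis unfolding \<phi>_def
      using esssup_mono[of "\<lambda>x. 0" "restrict_space lborel (cube L)" "\<lambda>x. ereal (cmod (sol t x))"] mr[OF t] by simp
  qed
  define \<psi> where "\<psi> t = real_of_ereal (\<phi> t)" for t
  have ps: "\<phi> t = ereal (\<psi> t)" if "t \<in> {0..T}" for t
    using le[OF that] nn[OF that] by (cases "\<phi> t") (auto simp: \<psi>_def)
  have "continuous_on {0<..<T} \<psi>"
  proof (rule lipschitz_on_continuous_on[of H], rule lipschitz_onI)
    fix s t assume st: "s \<in> {0<..<T}" "t \<in> {0<..<T}"
    then have "s \<in> {0..T}" "t \<in> {0..T}" by auto
    then show "dist (\<psi> s) (\<psi> t) \<le> H * dist s t"
      using lip2[of s t] lip2[of t s] ps[of s] ps[of t] by (auto simp: dist_real_def abs_minus_commute)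
  qed (rule H0)
  then have "\<psi> \<in> borel_measurable (restrict_space borel {0<..<T})" by (rule borel_measurable_continuous_on_restrict)
  then have "(\<lambda>t. ereal (\<psi> t)) \<in> borel_measurable (restrict_space lborel {0<..<T})"
    by (intro borel_measurable_ereal) (simp cong: measurable_cong_sets add: sets_restrict_space)
  then have "\<phi> \<in> borel_measurable (restrict_space lborel {0<..<T})"
    by (subst measurable_cong[where g = "\<lambda>t. ereal (\<psi> t)"]) (auto simp: space_restrict_space ps)
  then show ?thesis
    unfolding Linf_norm_def \<phi>_def[symmetric]
    by (rule esssup_I) (auto simp: AE_restrict_space_iff le)
qed

end

section \<open>Frequency cutoff of the initial datum\<close>

definition qbox :: "real \<Rightarrow> (int ^ 'n) set" where
  "qbox R = {m. \<forall>i. \<bar>real_of_int (m $ i)\<bar> \<le> R}"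

lemma inverse_hw: "1 / hw m = (\<Prod>i\<in>UNIV. 1 + \<bar>real_of_int (m $ i)\<bar>)"
  by (simp add: hw_def prod_inversef[symmetric] o_def divide_inverse)

lemma inverse_hw_le_norm: "1 / hw m \<le> (1 + norm (int_vec m)) ^ CARD('n)" for m :: "int ^ 'n"
proof -
  have "1 / hw m \<le> (\<Prod>i\<in>(UNIV::'n set). 1 + norm (int_vec m))"
    unfolding inverse_hw
  proof (intro prod_mono conjI)
    fix i
    show "1 + \<bar>real_of_int (m $ i)\<bar> \<le> 1 + norm (int_vec m)"
      using component_le_norm_cart[of "int_vec m" i] by simp
  qed auto
  then show ?thesis by simp
qed

lemma inverse_hw_qbox: "m \<in> qbox R \<Longrightarrow> 1 / hw m \<le> (1 + R) ^ CARD('n)" for m :: "int ^ 'n"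
proof -
  assume m: "m \<in> qbox R"
  have "1 / hw m \<le> (\<Prod>i\<in>(UNIV::'n set). 1 + R)"
    unfolding inverse_hw by (intro prod_mono conjI) (use m in \<open>auto simp: qbox_def\<close>)
  then show ?thesis by simp
qed

text \<open>On the box \<open>hw\<close> is at least the inverse of
  \<open>(1 + R) ^ CARD('n)\<close>, so the square sum of \<open>hw\<close> counts the
  points.\<close>

lemma card_qbox:
  assumes "R \<ge> 0"
  shows "finite (qbox R :: (int ^ 'n) set)" "real (card (qbox R :: (int ^ 'n) set)) \<le> 3 ^ CARD('n) * (1 + R) ^ (2 * CARD('n))"
proof -
  have le: "real (card F) \<le> 3 ^ CARD('n) * (1 + R) ^ (2 * CARD('n))" if F: "F \<subseteq> (qbox R :: (int ^ 'n) set)" "finite F" for F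
  proof -
    have "real (card F) = (\<Sum>m\<in>F. 1)" by simp
    also have "\<dots> \<le> (\<Sum>m\<in>F. (hw m)\<^sup>2 * ((1 + R) ^ CARD('n))\<^sup>2)"
    proof (rule sum_mono)
      fix m assume "m \<in> F"
      then have "1 / hw m \<le> (1 + R) ^ CARD('n)" using F inverse_hw_qbox by blast
      then have "1 \<le> hw m * (1 + R) ^ CARD('n)" using hw_pos[of m] by (simp add: field_simps)
      then have "1\<^sup>2 \<le> (hw m * (1 + R) ^ CARD('n))\<^sup>2" by (intro power_mono) auto
      then show "1 \<le> (hw m)\<^sup>2 * ((1 + R) ^ CARD('n))\<^sup>2" by (simp add: power_mult_distrib)
    qed
    also have "\<dots> = (\<Sum>m\<in>F. (hw m)\<^sup>2) * (1 + R) ^ (2 * CARD('n))"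
      by (simp add: sum_distrib_right power_mult[symmetric] mult.commute)
    also have "\<dots> \<le> 3 ^ CARD('n) * (1 + R) ^ (2 * CARD('n))"
      using assms by (intro mult_right_mono hw_square_sum_le F) auto
    finally show ?thesis .
  qed
  have "card F \<le> nat \<lfloor>3 ^ CARD('n) * (1 + R) ^ (2 * CARD('n))\<rfloor>" if "F \<subseteq> (qbox R :: (int ^ 'n) set)" "finite F" for F
    using le[OF that] by linarith
  then show fin: "finite (qbox R :: (int ^ 'n) set)"
    using finite_if_finite_subsets_card_bdd by blast
  show "real (card (qbox R :: (int ^ 'n) set)) \<le> 3 ^ CARD('n) * (1 + R) ^ (2 * CARD('n))"
    by (rule le) (auto simp: fin)
qed

lemma sum_list_qbox: "ks \<in> Ls (qbox R) n \<Longrightarrow> sum_list ks \<in> qbox (real n * R)"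
proof (induction ks arbitrary: n)
  case (Cons k ks)
  then obtain n' where n: "n = Suc n'" by (auto simp: Ls_def)
  have k: "k \<in> qbox R" and "ks \<in> Ls (qbox R) n'" using Cons(2) by (auto simp: Ls_def n)
  then have s: "sum_list ks \<in> qbox (real n' * R)" using Cons(1) by blast
  have "\<bar>real_of_int (k $ i) + real_of_int (sum_list ks $ i)\<bar> \<le> real n * R" for i
  proof -
    have "\<bar>real_of_int (k $ i)\<bar> \<le> R" "\<bar>real_of_int (sum_list ks $ i)\<bar> \<le> real n' * R" using k s by (auto simp: qbox_def)
    moreover have "real n * R = R + real n' * R" by (simp add: n distrib_right)
    ultimately show ?thesis by linarith
  qed
  then show ?case by (simp add: qbox_def)
qed (auto simp: Ls_def qbox_def)

lemma qbox_mono: "R \<le> R' \<Longrightarrow> qbox R \<subseteq> qbox R'"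
  by (auto simp: qbox_def intro: order_trans)

text \<open>For a non-negative spectrum, the standard deviation of the Fourier coefficients of the
  datum, divided by \<open>\<alpha>\<close>.\<close>

definition amp :: "real \<Rightarrow> (real ^ 'n \<Rightarrow> real) \<Rightarrow> int ^ 'n \<Rightarrow> real" where
  "amp L n m = sqrt (n ((1 / L) *\<^sub>R int_vec m)) / L powr (real CARD('n) / 2)"

lemma schwartz_decay:
  assumes "schwartz n"
  obtains B where "B \<ge> 0" "\<And>x. \<bar>n x\<bar> \<le> B / (1 + norm x) ^ N"
proof -
  obtain B where B: "\<And>x. (1 + norm x) ^ N * \<bar>iter_partial [] n x\<bar> \<le> B" using assms unfolding schwartz_def by blast
  have p: "(1 + norm x) ^ N > 0" for x :: "real ^ 'n" by (intro zero_less_power) (simp add: add_pos_nonneg)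
  show ?thesis
  proof (rule that)
    show "0 \<le> B" using order_trans[OF _ B[of 0]] by simp
    show "\<bar>n x\<bar> \<le> B / (1 + norm x) ^ N" for x
      using B[of x] p[of x] by (simp add: pos_le_divide_eq mult.commute)
  qed
qed

lemma amp_sq:
  fixes n :: "real ^ 'n \<Rightarrow> real"
  assumes "\<And>x. n x \<ge> 0" "L > 0"
  shows "(amp L n m)\<^sup>2 = n ((1 / L) *\<^sub>R int_vec m) / L ^ CARD('n)"
proof -
  have "(L powr (real CARD('n) / 2))\<^sup>2 = L powr (real CARD('n))"
    using powr_add[of L "real CARD('n) / 2" "real CARD('n) / 2"] by (simp add: power2_eq_square)
  also have "\<dots> = L ^ CARD('n)" using assms by (simp add: powr_realpow)
  finally show ?thesis using assms by (simp add: amp_def power_divide)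
qed

lemma amp_nonneg: "(\<And>x. n x \<ge> 0) \<Longrightarrow> amp L n m \<ge> 0"
  by (simp add: amp_def)

text \<open>A Riemann sum for the integral of \<open>n\<close>: Schwartz decay dominates
  \<open>n\<close> by a product of inverse squares, each coordinate sum is at most
  \<open>3 * L\<close>, and the powers of \<open>L\<close> cancel.\<close>

lemma amp_square_sum:
  fixes n :: "real ^ 'n \<Rightarrow> real"
  assumes "schwartz n" and nn: "\<And>x. n x \<ge> 0"
  obtains C where "C \<ge> 0" "\<And>L F. L \<ge> 1 \<Longrightarrow> finite F \<Longrightarrow> (\<Sum>m\<in>F. (amp L n m)\<^sup>2) \<le> C"
proof -
  obtain B where B: "B \<ge> 0" "\<And>x. \<bar>n x\<bar> \<le> B / (1 + norm x) ^ (2 * CARD('n))" by (rule schwartz_decay[OF assms(1)]) blast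
  show ?thesis
  proof (rule that)
    show "0 \<le> B * 3 ^ CARD('n)" using B by simp
    fix L :: real and F :: "(int ^ 'n) set" assume L: "L \<ge> 1" and F: "finite F"
    have e: "n ((1 / L) *\<^sub>R int_vec m) \<le> B * (\<Prod>i\<in>UNIV. (inverse (1 + \<bar>real_of_int (m $ i)\<bar> / L))\<^sup>2)" for m
    proof -
      let ?x = "(1 / L) *\<^sub>R int_vec m :: real ^ 'n"
      have "inverse ((1 + norm ?x) ^ (2 * CARD('n))) = (\<Prod>i\<in>(UNIV :: 'n set). (inverse (1 + norm ?x))\<^sup>2)"
        by (simp add: power_mult power_inverse)
      also have "\<dots> \<le> (\<Prod>i\<in>UNIV. (inverse (1 + \<bar>real_of_int (m $ i)\<bar> / L))\<^sup>2)"
      proof (intro prod_mono conjI power_mono le_imp_inverse_le add_left_mono)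
        fix i
        show "\<bar>real_of_int (m $ i)\<bar> / L \<le> norm ?x" using component_le_norm_cart[of ?x i] L by simp
      qed (use L in \<open>auto intro!: add_pos_nonneg\<close>)
      finally have "B * inverse ((1 + norm ?x) ^ (2 * CARD('n))) \<le> B * (\<Prod>i\<in>UNIV. (inverse (1 + \<bar>real_of_int (m $ i)\<bar> / L))\<^sup>2)"
        using B by (intro mult_left_mono) auto
      then show ?thesis using B(2)[of ?x] by (simp add: divide_inverse)
    qed
    have "(\<Sum>m\<in>F. (amp L n m)\<^sup>2) = (\<Sum>m\<in>F. n ((1 / L) *\<^sub>R int_vec m)) / L ^ CARD('n)"
      using amp_sq[of n L] nn L by (simp add: sum_divide_distrib)
    also have "\<dots> \<le> (\<Sum>m\<in>F. B * (\<Prod>i\<in>UNIV. (inverse (1 + \<bar>real_of_int (m $ i)\<bar> / L))\<^sup>2)) / L ^ CARD('n)"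
      using L by (intro divide_right_mono sum_mono e) auto
    also have "\<dots> \<le> (B * (3 * L) ^ CARD('n)) / L ^ CARD('n)"
      unfolding sum_distrib_left[symmetric]
      using L B by (intro divide_right_mono mult_left_mono sum_prod_coords_le int_sum_inverse_square_le F) auto
    finally show "(\<Sum>m\<in>F. (amp L n m)\<^sup>2) \<le> B * 3 ^ CARD('n)" using L by (simp add: power_mult_distrib)
  qed
qed

text \<open>Beyond the cutoff \<open>L\<^sup>2\<close> one has \<open>1 + |m|/L \<ge> (1 + |m|)\<^sup>1\<^sup>/\<^sup>2\<close>, so the decay of \<open>n\<close> beats every power of \<open>L\<close>.\<close>

lemma amp_tail:
  fixes n :: "real ^ 'n \<Rightarrow> real"
  assumes "schwartz n" and nn: "\<And>x. n x \<ge> 0"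
  obtains B where "B \<ge> 0"
    "\<And>L m. L \<ge> 1 \<Longrightarrow> m \<notin> qbox (L\<^sup>2) \<Longrightarrow> amp L n m * (1 / hw m) ^ q * L ^ p \<le> B * hw m"
proof -
  \<comment> \<open>With \<open>s\<close> the square root of \<open>1 + norm (int_vec m)\<close>,
    the factors \<open>(1 / hw m) ^ (q + 1)\<close> and \<open>L ^ p\<close> are at most
    \<open>s ^ (2 * CARD('n) * (q + 1))\<close> and \<open>s ^ p\<close>. The spectrum enters under
    a square root, hence decay of order \<open>2 * P\<close>.\<close>
  define P where "P = 2 * (CARD('n) * (q + 1)) + p"
  obtain B where B: "B \<ge> 0" "\<And>x. \<bar>n x\<bar> \<le> B / (1 + norm x) ^ (2 * P)" by (rule schwartz_decay[OF assms(1)]) blast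
  show ?thesis
  proof (rule that)
    show "0 \<le> sqrt B" using B by simp
    fix L :: real and m :: "int ^ 'n" assume L: "L \<ge> 1" and m: "m \<notin> qbox (L\<^sup>2)"
    define X where "X = 1 + norm (int_vec m)"
    define h where "h = 1 / hw m"
    have h1: "h \<ge> 1" using hw_pos[of m] hw_le_1[of m] by (simp add: h_def)
    obtain i where i: "\<bar>real_of_int (m $ i)\<bar> > L\<^sup>2" using m by (auto simp: qbox_def not_le)
    have XL: "X \<ge> L\<^sup>2" using i component_le_norm_cart[of "int_vec m" i] by (simp add: X_def)
    have X1: "X \<ge> 1" by (simp add: X_def)
    define s where "s = sqrt X"
    have s: "s * s = X" "s \<ge> L" "s \<ge> 1" using XL X1 L real_le_rsqrt[of L X] by (auto simp: s_def)
    have hs: "h \<le> s ^ (2 * CARD('n))"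
    proof -
      have "h \<le> X ^ CARD('n)" unfolding h_def X_def by (rule inverse_hw_le_norm)
      also have "\<dots> = s ^ (2 * CARD('n))" by (simp add: s(1)[symmetric] power_mult power2_eq_square)
      finally show ?thesis .
    qed
    have ys: "1 + norm ((1 / L) *\<^sub>R int_vec m) \<ge> s"
    proof -
      have "s * L \<le> s * s" using s by (intro mult_left_mono) auto
      also have "\<dots> = 1 + norm (int_vec m)" by (simp add: s X_def)
      also have "\<dots> \<le> L + norm (int_vec m)" using L by simp
      finally have "s \<le> (L + norm (int_vec m)) / L" using L by (simp add: pos_le_divide_eq)
      also have "\<dots> = 1 + norm ((1 / L) *\<^sub>R int_vec m)" using L by (simp add: add_divide_distrib)
      finally show ?thesis .
    qed
    have "n ((1 / L) *\<^sub>R int_vec m) \<le> B / (1 + norm ((1 / L) *\<^sub>R int_vec m)) ^ (2 * P)"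
      using B(2)[of "(1 / L) *\<^sub>R int_vec m"] by simp
    also have "\<dots> \<le> B / s ^ (2 * P)" using B s ys by (intro divide_left_mono power_mono mult_pos_pos zero_less_power) auto
    finally have "sqrt (n ((1 / L) *\<^sub>R int_vec m)) \<le> sqrt (B / s ^ (2 * P))" by simp
    also have "\<dots> = sqrt B / s ^ P" using s by (simp add: real_sqrt_divide mult.commute[of 2] power_mult)
    finally have sq: "sqrt (n ((1 / L) *\<^sub>R int_vec m)) \<le> sqrt B / s ^ P" .
    have "amp L n m \<le> sqrt (n ((1 / L) *\<^sub>R int_vec m)) / 1"
      unfolding amp_def using L nn by (intro divide_left_mono) (auto intro!: ge_one_powr_ge_zero)
    then have a: "amp L n m \<le> sqrt B / s ^ P" using sq by simp
    have "amp L n m * h ^ q * L ^ p * h \<le> (sqrt B / s ^ P) * (s ^ (2 * CARD('n))) ^ q * s ^ p * s ^ (2 * CARD('n))"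
      using a hs s L h1 B by (intro mult_mono power_mono mult_nonneg_nonneg) auto
    also have "\<dots> = sqrt B"
    proof -
      have "s ^ P = (s ^ (2 * CARD('n))) ^ q * s ^ p * s ^ (2 * CARD('n))"
        unfolding power_mult[symmetric] power_add[symmetric] by (rule arg_cong[where f = "power s"]) (simp add: P_def algebra_simps)
      then show ?thesis using s by simp
    qed
    finally have "amp L n m * h ^ q * L ^ p * h \<le> sqrt B" .
    then show "amp L n m * (1 / hw m) ^ q * L ^ p \<le> sqrt B * hw m"
      using hw_pos[of m] by (simp add: h_def field_simps)
  qed
qed

section \<open>Reduction to a finite net in space-time\<close>

lemma norm_ch_diff_le: "cmod (ch m x - ch m x') \<le> 2 * pi * norm (int_vec m) * norm (x - x')"
proof -
  have "cmod (ch m x - ch m x') \<le> \<bar>2 * pi * (int_vec m \<bullet> x) - 2 * pi * (int_vec m \<bullet> x')\<bar>"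
    unfolding ch_def by (rule cmod_cis_diff_le)
  also have "\<dots> = 2 * pi * \<bar>int_vec m \<bullet> (x - x')\<bar>" by (simp add: inner_diff_right right_diff_distrib[symmetric] abs_mult)
  also have "\<dots> \<le> 2 * pi * (norm (int_vec m) * norm (x - x'))"
    by (intro mult_left_mono Cauchy_Schwarz_ineq2) auto
  finally show ?thesis by simp
qed

lemma sum_Ls_prod: "(\<Sum>ks\<in>Ls K n. prod_list (map f ks)) = (sum f K) ^ n" for f :: "'k \<Rightarrow> real"
proof (induction n)
  case 0
  have "Ls K 0 = {[]}" by (auto simp: Ls_def)
  then show ?case by simp
next
  case (Suc n)
  have "(\<Sum>ks\<in>Ls K (1 + n). prod_list (map f (take 1 ks)) * prod_list (map f (drop 1 ks))) = (\<Sum>ks\<in>Ls K 1. \<Sum>ls\<in>Ls K n. prod_list (map f ks) * prod_list (map f ls))"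
    by (rule sum_Ls_append)
  also have "\<dots> = sum f K * (sum f K) ^ n"
    unfolding sum_distrib_left[symmetric] sum_distrib_right[symmetric] Suc Ls_1
    by (simp add: sum.reindex inj_on_def)
  finally have "(\<Sum>ks\<in>Ls K (1 + n). prod_list (map f (take 1 ks)) * prod_list (map f (drop 1 ks))) = sum f K * (sum f K) ^ n" .
  then show ?case by (simp only: prod_list.append[symmetric] map_append[symmetric] append_take_drop_id) simp
qed

lemma prod_list_map_power: "prod_list (map (\<lambda>k. f k ^ n) ks) = (prod_list (map f ks)) ^ n" for f :: "'k \<Rightarrow> real"
  by (induction ks) (auto simp: power_mult_distrib)

lemma norm_prod_list_le:
  assumes "\<And>k. k \<in> set ks \<Longrightarrow> cmod (f k) \<le> Y" "Y \<ge> 0"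
  shows "cmod (prod_list (map f ks)) \<le> Y ^ length ks"
  using assms by (induction ks) (auto simp: norm_mult intro!: mult_mono)

definition tnet :: "real \<Rightarrow> nat \<Rightarrow> real set" where
  "tnet T H = (\<lambda>j. T * real j / real H) ` {..H}"

text \<open>A grid in a single cell: \<open>trig\<close> has period \<open>1\<close> in every
  coordinate.\<close>

definition xnet :: "nat \<Rightarrow> (real ^ 'n) set" where
  "xnet H = (\<lambda>l. \<chi> i. real (l i) / real H) ` PiE UNIV (\<lambda>_. {..<H})"

lemma tnet_finite: "finite (tnet T H)" and tnet_card: "card (tnet T H) \<le> Suc H"
  using card_image_le[of "{..H}" "\<lambda>j. T * real j / real H"] by (auto simp: tnet_def)

lemma xnet_finite: "finite (xnet H :: (real ^ 'n) set)" and xnet_card: "card (xnet H :: (real ^ 'n) set) \<le> H ^ CARD('n)"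
proof -
  have f: "finite (PiE (UNIV :: 'n set) (\<lambda>_. {..<H}))" by (intro finite_PiE) auto
  then show "finite (xnet H :: (real ^ 'n) set)" by (simp add: xnet_def)
  show "card (xnet H :: (real ^ 'n) set) \<le> H ^ CARD('n)"
    unfolding xnet_def by (rule order_trans[OF card_image_le[OF f]]) (simp add: card_PiE)
qed

lemma tnet_subset: "T \<ge> 0 \<Longrightarrow> H > 0 \<Longrightarrow> tnet T H \<subseteq> {0..T}"
  by (auto simp: tnet_def field_simps mult_left_mono)

lemma floor_div_approx:
  fixes z :: real
  assumes "0 \<le> z" "H > 0"
  shows "\<bar>z - real (nat \<lfloor>z * real H\<rfloor>) / real H\<bar> \<le> 1 / real H"
proof -
  have "0 \<le> z * real H" using assms by simp
  then have "\<bar>z * real H - real (nat \<lfloor>z * real H\<rfloor>)\<bar> \<le> 1" by linarith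
  then have "\<bar>z * real H - real (nat \<lfloor>z * real H\<rfloor>)\<bar> / real H \<le> 1 / real H" using assms by (intro divide_right_mono) auto
  moreover have "\<bar>z * real H - real (nat \<lfloor>z * real H\<rfloor>)\<bar> / real H = \<bar>(z * real H - real (nat \<lfloor>z * real H\<rfloor>)) / real H\<bar>" by simp
  ultimately show ?thesis using assms by (simp add: diff_divide_distrib)
qed

lemma tnet_approx:
  assumes t: "t \<in> {0..T}" and H: "H > 0"
  obtains t' where "t' \<in> tnet T H" "\<bar>t - t'\<bar> \<le> T / real H"
proof (cases "T = 0")
  case True
  then show ?thesis using t by (intro that[of 0]) (auto simp: tnet_def)
next
  case False
  then have T: "T > 0" using t by auto
  define z where "z = t / T"
  have z: "0 \<le> z" "z \<le> 1" "t = T * z" using t T by (auto simp: z_def)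
  define j where "j = nat \<lfloor>z * real H\<rfloor>"
  have "z * real H \<le> real H" using z by (simp add: mult_left_le_one_le)
  then have j: "j \<le> H" unfolding j_def using z by linarith
  have "\<bar>t - T * real j / real H\<bar> = T * \<bar>z - real j / real H\<bar>"
  proof -
    have "t - T * real j / real H = T * (z - real j / real H)" by (simp add: z right_diff_distrib)
    then show ?thesis using T by (simp add: abs_mult)
  qed
  also have "\<dots> \<le> T * (1 / real H)" unfolding j_def using T z H by (intro mult_left_mono floor_div_approx) auto
  finally show ?thesis using j by (intro that[of "T * real j / real H"]) (auto simp: tnet_def)
qed

lemma xnet_approx:
  fixes x :: "real ^ 'n"
  assumes H: "H > 0"
  obtains x' k where "x' \<in> xnet H" "norm (x + int_vec k - x') \<le> real CARD('n) / real H"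
proof -
  define k :: "int ^ 'n" where "k = (\<chi> i. - \<lfloor>x $ i\<rfloor>)"
  define z where "z i = x $ i + real_of_int (k $ i)" for i
  have z: "0 \<le> z i" "z i < 1" for i unfolding z_def k_def by (auto simp: floor_correct, linarith)
  define l where "l i = nat \<lfloor>z i * real H\<rfloor>" for i
  have l: "l i < H" for i
  proof -
    have "z i * real H < 1 * real H" using z[of i] H by (intro mult_strict_right_mono) auto
    then show ?thesis unfolding l_def using z[of i] H by linarith
  qed
  define x' :: "real ^ 'n" where "x' = (\<chi> i. real (l i) / real H)"
  show ?thesis
  proof (rule that)
    have "l \<in> PiE UNIV (\<lambda>_. {..<H})" using l by auto
    then show "x' \<in> xnet H" unfolding xnet_def x'_def by blast
    have "norm (x + int_vec k - x') \<le> (\<Sum>i\<in>UNIV. \<bar>(x + int_vec k - x') $ i\<bar>)" by (rule norm_le_l1_cart)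
    also have "\<dots> \<le> (\<Sum>i\<in>(UNIV :: 'n set). 1 / real H)"
    proof (rule sum_mono)
      fix i
      show "\<bar>(x + int_vec k - x') $ i\<bar> \<le> 1 / real H"
        using floor_div_approx[OF z(1)[of i] H] by (simp add: x'_def z_def l_def)
    qed
    finally show "norm (x + int_vec k - x') \<le> real CARD('n) / real H" by simp
  qed
qed

section \<open>Sup bounds from the net and tails at a single point\<close>

context duhamel begin

lemma wt_le_1: "m \<in> qbox \<Lambda> \<Longrightarrow> cmod (wt i j m) \<le> 1"
proof -
  assume "m \<in> qbox \<Lambda>"
  then have "\<bar>real_of_int (m $ i) / \<Lambda>\<bar> \<le> 1" using \<Lambda> by (simp add: qbox_def)
  then have "\<bar>real_of_int (m $ i) / \<Lambda>\<bar> ^ j \<le> 1" by (intro power_le_one) auto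
  then show ?thesis unfolding wt_def norm_of_real by (simp add: power_abs)
qed

text \<open>A crude Lipschitz constant; its polynomial growth in \<open>L\<close> is what matters,
  since it determines the mesh of the net. \<open>Y\<close> is meant to be the number of frequencies
  times the largest coefficient, so that its power accounts for all words.\<close>

definition lipc :: "real \<Rightarrow> real \<Rightarrow> nat \<Rightarrow> real" where
  "lipc Y \<Phi> a = Y ^ Suc a * (fact a * (1 + T) ^ a * (\<Phi> + 1 + 7 * (1 + \<Lambda>) ^ CARD('n)))"

lemma trig_Lv_lipschitz:
  assumes R: "R \<ge> 0" "real (Suc a) * R \<le> \<Lambda>" and y: "\<And>m. m \<in> qbox R \<Longrightarrow> cmod (y m) \<le> Y"
    and ph: "\<And>m. m \<in> qbox \<Lambda> \<Longrightarrow> \<bar>\<phi> m\<bar> \<le> \<Phi>" and t: "t \<in> {0..T}" "t' \<in> {0..T}"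
  shows "cmod (trig (\<lambda>m. wt i j m * Lv (qbox R) y a t m) x - trig (\<lambda>m. wt i j m * Lv (qbox R) y a t' m) x')
     \<le> lipc (real (card (qbox R :: (int ^ 'n) set)) * Y) \<Phi> a * (\<bar>t - t'\<bar> + norm (x - x'))"
proof -
  let ?K = "qbox R :: (int ^ 'n) set"
  have fK: "finite ?K" by (rule card_qbox[OF R(1)])
  have "0 \<in> ?K" using R by (simp add: qbox_def)
  then have Y: "Y \<ge> 0" using order_trans[OF norm_ge_zero y] by blast
  have "0 \<in> (qbox \<Lambda> :: (int ^ 'n) set)" using \<Lambda> by (simp add: qbox_def)
  then have \<Phi>: "\<Phi> \<ge> 0" using order_trans[OF abs_ge_zero ph] by blast
  define B where "B = Y ^ Suc a * (fact a * (1 + T) ^ a * (\<Phi> + 1 + 7 * (1 + \<Lambda>) ^ CARD('n)))"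
  define e where "e = \<bar>t - t'\<bar> + norm (x - x')"
  have e0: "e \<ge> 0" by (simp add: e_def)
  have each: "cmod (wt i j (sum_list ks) * Th a t ks * ch (sum_list ks) x * prod_list (map y ks)
      - wt i j (sum_list ks) * Th a t' ks * ch (sum_list ks) x' * prod_list (map y ks)) \<le> B * e" if ks: "ks \<in> Ls ?K (Suc a)" for ks
  proof -
    let ?m = "sum_list ks"
    have m: "?m \<in> qbox \<Lambda>" using sum_list_qbox[OF ks] qbox_mono[OF R(2)] by blast
    have n7: "2 * pi * norm (int_vec ?m) \<le> 7 * (1 + \<Lambda>) ^ CARD('n)"
    proof (rule mult_mono)
      show "norm (int_vec ?m) \<le> (1 + \<Lambda>) ^ CARD('n)"
        using norm_int_vec_le_hw[of ?m] inverse_hw_qbox[OF m] by linarith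
    qed (use pi_less_4 pi_approx in auto)
    have th: "cmod (Th a t ks - Th a t' ks) \<le> (fact a * (1 + T) ^ a * (\<Phi> + 1)) * \<bar>t - t'\<bar>"
    proof -
      have "cmod (Th a t ks - Th a t' ks) \<le> \<bar>t - t'\<bar> * ((\<bar>\<phi> ?m\<bar> + 1) * fact a * (1 + T) ^ a)"
        by (rule Th_lipschitz[OF t])
      also have "\<dots> \<le> \<bar>t - t'\<bar> * ((\<Phi> + 1) * fact a * (1 + T) ^ a)"
        using T by (intro mult_left_mono mult_right_mono add_right_mono ph m) auto
      finally show ?thesis by (simp add: mult_ac)
    qed
    have tb: "cmod (Th a t' ks) \<le> fact a * (1 + T) ^ a"
      using order_trans[OF Th_bound[OF t(2)] mult_left_mono[OF power_mono[of T "1 + T" a]]] T by simp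
    have "cmod (Th a t ks * ch ?m x - Th a t' ks * ch ?m x')
        = cmod ((Th a t ks - Th a t' ks) * ch ?m x + Th a t' ks * (ch ?m x - ch ?m x'))" by (simp add: algebra_simps)
    also have "\<dots> \<le> cmod (Th a t ks - Th a t' ks) + cmod (Th a t' ks) * cmod (ch ?m x - ch ?m x')"
      using norm_triangle_ineq[of "(Th a t ks - Th a t' ks) * ch ?m x" "Th a t' ks * (ch ?m x - ch ?m x')"] by (simp add: norm_mult)
    also have "\<dots> \<le> (fact a * (1 + T) ^ a * (\<Phi> + 1)) * \<bar>t - t'\<bar> + (fact a * (1 + T) ^ a) * (7 * (1 + \<Lambda>) ^ CARD('n) * norm (x - x'))"
      using order_trans[OF norm_ch_diff_le mult_right_mono[OF n7]] T by (intro add_mono th mult_mono tb) auto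
    also have "\<dots> \<le> (fact a * (1 + T) ^ a * (\<Phi> + 1 + 7 * (1 + \<Lambda>) ^ CARD('n))) * e"
    proof -
      have "(\<Phi> + 1) * \<bar>t - t'\<bar> + 7 * (1 + \<Lambda>) ^ CARD('n) * norm (x - x') \<le> (\<Phi> + 1) * e + 7 * (1 + \<Lambda>) ^ CARD('n) * e"
        using \<Phi> \<Lambda> by (intro add_mono mult_left_mono) (auto simp: e_def)
      then have "fact a * (1 + T) ^ a * ((\<Phi> + 1) * \<bar>t - t'\<bar> + 7 * (1 + \<Lambda>) ^ CARD('n) * norm (x - x')) \<le> fact a * (1 + T) ^ a * ((\<Phi> + 1) * e + 7 * (1 + \<Lambda>) ^ CARD('n) * e)"
        using T by (intro mult_left_mono) auto
      then show ?thesis by (simp add: distrib_left distrib_right mult.assoc)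
    qed
    finally have d: "cmod (Th a t ks * ch ?m x - Th a t' ks * ch ?m x') \<le> (fact a * (1 + T) ^ a * (\<Phi> + 1 + 7 * (1 + \<Lambda>) ^ CARD('n))) * e" .
    have pl: "cmod (prod_list (map y ks)) \<le> Y ^ Suc a"
      using norm_prod_list_le[of ks y Y] y Y ks by (auto simp: Ls_def)
    have "cmod (wt i j ?m * Th a t ks * ch ?m x * prod_list (map y ks) - wt i j ?m * Th a t' ks * ch ?m x' * prod_list (map y ks))
      = cmod (wt i j ?m) * cmod (Th a t ks * ch ?m x - Th a t' ks * ch ?m x') * cmod (prod_list (map y ks))"
      unfolding norm_mult[symmetric] by (simp add: algebra_simps)
    also have "\<dots> \<le> 1 * ((fact a * (1 + T) ^ a * (\<Phi> + 1 + 7 * (1 + \<Lambda>) ^ CARD('n))) * e) * Y ^ Suc a"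
      using T \<Phi> \<Lambda> e0 by (intro mult_mono d pl wt_le_1 m mult_nonneg_nonneg add_nonneg_nonneg) auto
    finally show ?thesis by (simp add: B_def mult_ac)
  qed
  have "cmod (trig (\<lambda>m. wt i j m * Lv ?K y a t m) x - trig (\<lambda>m. wt i j m * Lv ?K y a t' m) x')
    \<le> (\<Sum>ks\<in>Ls ?K (Suc a). B * e)"
    unfolding trig_Lv[OF fK] sum_subtractf[symmetric] by (rule order_trans[OF norm_sum sum_mono[OF each]])
  also have "\<dots> = lipc (real (card ?K) * Y) \<Phi> a * e"
    by (simp add: card_Ls[OF fK] lipc_def B_def power_mult_distrib mult_ac)
  finally show ?thesis by (simp add: e_def)
qed

text \<open>Half of \<open>S\<close> is allotted to the points of the net, half to the Lipschitz
  error of moving to a nearby one; periodicity brings \<open>x\<close> into the cell of the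
  net.\<close>

lemma sb_from_net:
  assumes R: "R \<ge> 0" "real (Suc a) * R \<le> \<Lambda>" and y: "\<And>m. m \<in> qbox R \<Longrightarrow> cmod (y m) \<le> Y"
    and ph: "\<And>m. m \<in> qbox \<Lambda> \<Longrightarrow> \<bar>\<phi> m\<bar> \<le> \<Phi>" and t: "t \<in> {0..T}"
    and H: "H > 0" "lipc (real (card (qbox R :: (int ^ 'n) set)) * Y) \<Phi> a * (T + real CARD('n)) / real H \<le> S / 2"
    and net: "\<And>i j t x. j \<le> \<sigma> \<Longrightarrow> t \<in> tnet T H \<Longrightarrow> x \<in> xnet H \<Longrightarrow> cmod (trig (\<lambda>m. wt i j m * Lv (qbox R) y a t m) x) \<le> S / 2"
  shows "sb (Lv (qbox R) y a t) S"
  unfolding sb_def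
proof (intro conjI allI impI)
  let ?K = "qbox R :: (int ^ 'n) set"
  have fK: "finite ?K" by (rule card_qbox[OF R(1)])
  have "{m. Lv ?K y a t m \<noteq> 0} \<subseteq> sum_list ` Ls ?K (Suc a)" using Lv_support by blast
  then show "finite {m. Lv ?K y a t m \<noteq> 0}" using finite_imageI[OF finite_Ls[OF fK]] by (rule finite_subset)
  have "0 \<in> ?K" using R by (simp add: qbox_def)
  then have Y: "Y \<ge> 0" using order_trans[OF norm_ge_zero y] by blast
  have "0 \<in> (qbox \<Lambda> :: (int ^ 'n) set)" using \<Lambda> by (simp add: qbox_def)
  then have \<Phi>: "\<Phi> \<ge> 0" using order_trans[OF abs_ge_zero ph] by blast
  have l0: "lipc (real (card ?K) * Y) \<Phi> a \<ge> 0" unfolding lipc_def using Y \<Phi> T \<Lambda> by simp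
  fix i j and x :: "real ^ 'n" assume j: "j \<le> \<sigma>"
  obtain t' where t': "t' \<in> tnet T H" "\<bar>t - t'\<bar> \<le> T / real H" by (rule tnet_approx[OF t H(1)])
  obtain x' k where x': "x' \<in> xnet H" "norm (x + int_vec k - x') \<le> real CARD('n) / real H" by (rule xnet_approx[OF H(1)])
  define f where "f t x = trig (\<lambda>m. wt i j m * Lv ?K y a t m) x" for t x
  have "cmod (f t (x + int_vec k) - f t' x') \<le> lipc (real (card ?K) * Y) \<Phi> a * (\<bar>t - t'\<bar> + norm (x + int_vec k - x'))"
    unfolding f_def by (rule trig_Lv_lipschitz[OF R y ph t]) (use t' tnet_subset[OF T H(1)] in auto)
  also have "\<dots> \<le> lipc (real (card ?K) * Y) \<Phi> a * (T / real H + real CARD('n) / real H)"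
    by (intro mult_left_mono add_mono t' x' l0)
  also have "\<dots> \<le> S / 2" using H(2) unfolding add_divide_distrib[symmetric] times_divide_eq_right .
  finally have "cmod (f t (x + int_vec k) - f t' x') \<le> S / 2" .
  moreover have "cmod (f t' x') \<le> S / 2" unfolding f_def by (rule net[OF j t'(1) x'(1)])
  ultimately have "cmod (f t (x + int_vec k)) \<le> S"
    using norm_triangle_ineq2[of "f t (x + int_vec k)" "f t' x'"] by linarith
  then show "cmod (trig (\<lambda>m. wt i j m * Lv ?K y a t m) x) \<le> S" by (simp add: f_def trig_period)
qed

text \<open>The square sum over words factors into the power \<open>a + 1\<close> of the square sum
  of the amplitudes; weights, characters and tree integrals enter through their sup bounds.\<close>

lemma Lv_tail:
  fixes g :: "int ^ 'n \<Rightarrow> 'w \<Rightarrow> complex" and c :: "int ^ 'n \<Rightarrow> real"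
    and i :: 'n and j :: nat and x :: "real ^ 'n"
  assumes M: "prob_space M" and g: "iid_complex_gaussians M g"
    and R: "R \<ge> 0" "real (Suc a) * R \<le> \<Lambda>" and V: "(\<Sum>m\<in>qbox R. (c m)\<^sup>2) \<le> V"
    and y: "\<And>\<omega> m. m \<in> qbox R \<Longrightarrow> y \<omega> m = of_real (c m) * g m \<omega>" and t: "t \<in> {0..T}" and thr: "thr > 0"
  defines "bad \<equiv> {\<omega> \<in> space M. cmod (trig (\<lambda>m. wt i j m * Lv (qbox R) (y \<omega>) a t m) x) \<ge> thr}"
  shows "bad \<in> sets M" "measure M bad \<le> fact (p * Suc a) * ((fact a * T ^ a)\<^sup>2 * V ^ Suc a / thr\<^sup>2) ^ p"
proof -
  let ?K = "qbox R :: (int ^ 'n) set"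
  have fK: "finite ?K" by (rule card_qbox[OF R(1)])
  define F where "F ks = wt i j (sum_list ks) * Th a t ks * ch (sum_list ks) x * of_real (prod_list (map c ks))" for ks
  have pl: "prod_list (map (y \<omega>) ks) = of_real (prod_list (map c ks)) * prod_list (map (\<lambda>k. g k \<omega>) ks)"
    if "set ks \<subseteq> ?K" for ks \<omega>
    using that by (induction ks) (auto simp: y)
  have e: "trig (\<lambda>m. wt i j m * Lv ?K (y \<omega>) a t m) x = (\<Sum>ks\<in>Ls ?K (Suc a). F ks * prod_list (map (\<lambda>k. g k \<omega>) ks))" for \<omega>
    unfolding trig_Lv[OF fK] by (intro sum.cong refl) (auto simp: F_def Ls_def pl)
  have [measurable]: "(\<lambda>\<omega>. \<Sum>ks\<in>Ls ?K (Suc a). F ks * prod_list (map (\<lambda>k. g k \<omega>) ks)) \<in> borel_measurable M"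
    by (rule prob_space.chaos_measurable[OF M g])
  show "bad \<in> sets M" unfolding bad_def e by measurable
  have "(\<Sum>ks\<in>Ls ?K (Suc a). (cmod (F ks))\<^sup>2) \<le> (\<Sum>ks\<in>Ls ?K (Suc a). (fact a * T ^ a)\<^sup>2 * prod_list (map (\<lambda>k. (c k)\<^sup>2) ks))"
  proof (rule sum_mono)
    fix ks assume ks: "ks \<in> Ls ?K (Suc a)"
    have m: "sum_list ks \<in> qbox \<Lambda>" using sum_list_qbox[OF ks] qbox_mono[OF R(2)] by blast
    have "cmod (F ks) \<le> 1 * (fact a * T ^ a) * \<bar>prod_list (map c ks)\<bar>"
      unfolding F_def norm_mult norm_ch norm_of_real using T
      by (simp only: mult_1_right) (intro mult_mono wt_le_1 m Th_bound t mult_nonneg_nonneg; simp)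
    then have "(cmod (F ks))\<^sup>2 \<le> (1 * (fact a * T ^ a) * \<bar>prod_list (map c ks)\<bar>)\<^sup>2" by (intro power_mono) auto
    then show "(cmod (F ks))\<^sup>2 \<le> (fact a * T ^ a)\<^sup>2 * prod_list (map (\<lambda>k. (c k)\<^sup>2) ks)"
      by (simp add: power_mult_distrib prod_list_map_power)
  qed
  also have "\<dots> = (fact a * T ^ a)\<^sup>2 * (\<Sum>m\<in>?K. (c m)\<^sup>2) ^ Suc a"
    by (simp only: sum_distrib_left[symmetric] sum_Ls_prod)
  also have "\<dots> \<le> (fact a * T ^ a)\<^sup>2 * V ^ Suc a"
    by (intro mult_left_mono power_mono V sum_nonneg) auto
  finally have s: "(\<Sum>ks\<in>Ls ?K (Suc a). (cmod (F ks))\<^sup>2) \<le> (fact a * T ^ a)\<^sup>2 * V ^ Suc a" .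
  have "measure M bad \<le> fact (p * Suc a) * ((\<Sum>ks\<in>Ls ?K (Suc a). (cmod (F ks))\<^sup>2) / thr\<^sup>2) ^ p"
    unfolding bad_def e by (rule prob_space.chaos_tail[OF M g fK thr])
  also have "\<dots> \<le> fact (p * Suc a) * ((fact a * T ^ a)\<^sup>2 * V ^ Suc a / thr\<^sup>2) ^ p"
    by (intro mult_left_mono power_mono divide_right_mono s divide_nonneg_nonneg sum_nonneg) auto
  finally show "measure M bad \<le> fact (p * Suc a) * ((fact a * T ^ a)\<^sup>2 * V ^ Suc a / thr\<^sup>2) ^ p" .
qed

end

section \<open>Solutions on the good event\<close>

text \<open>With \<open>d = CARD('n)\<close>: \<open>N_large\<close> makes the interactions missing
  from the expansion smaller by \<open>L ^ (2 * d + 1)\<close>, against a loss \<open>Q\<close> of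
  order \<open>L ^ (2 * d)\<close>. The room between \<open>\<theta>\<close> and
  \<open>\<delta>\<close> pays for moments and thresholds, \<open>\<theta>_half\<close> for the size
  of single Gaussians. In \<open>B0\<close> one power of \<open>1 / hw\<close> and one of
  \<open>L\<close> are reserved for the bound \<open>L / hw\<close> on the Gaussians.\<close>

locale wave_box =
  fixes n :: "real ^ 'n \<Rightarrow> real" and L \<alpha> \<delta> \<theta> C0 B0 :: real and N :: nat
  assumes L1: "L \<ge> 1" and \<alpha>_pos: "\<alpha> > 0" and \<alpha>_le: "\<alpha> \<le> L powr (- \<delta>)" and \<delta>_pos: "\<delta> > 0"
    and \<theta>_pos: "\<theta> > 0" and \<theta>_\<delta>: "4 * \<theta> \<le> \<delta>" and \<theta>_half: "\<theta> \<le> 1 / 2"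
    and N_large: "4 * (real CARD('n) + 1) \<le> real N * \<delta>"
    and n_nonneg: "\<And>x. n x \<ge> 0"
    and C0_nonneg: "C0 \<ge> 0" and C0: "\<And>F. finite F \<Longrightarrow> (\<Sum>m\<in>F. (amp L n m)\<^sup>2) \<le> C0"
    and B0_nonneg: "B0 \<ge> 0"
    and B0: "\<And>m. m \<notin> qbox (L\<^sup>2) \<Longrightarrow>
      amp L n m * (1 / hw m) ^ (CARD('n) * (CARD('n) + 5) + 1) * L ^ (2 * CARD('n) + 2) \<le> B0 * hw m"
begin

definition tm :: real where "tm = inverse \<alpha> * L powr (- \<delta>)"

lemma L0: "L > 0" using L1 by simp

lemma \<alpha>_le_1: "\<alpha> \<le> 1"
  using \<alpha>_le powr_mono[of "- \<delta>" 0 L] L1 \<delta>_pos by simp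

lemma \<alpha>_tm: "\<alpha> * tm = L powr (- \<delta>)"
  using \<alpha>_pos by (simp add: tm_def)

lemma tm_ge_1: "tm \<ge> 1"
  using \<alpha>_le \<alpha>_pos by (simp add: tm_def field_simps)

text \<open>At most \<open>N + 1\<close> frequencies from the box of size \<open>L^2\<close> are
  added in a tree, so with this \<open>\<Lambda>\<close> all weights are at most \<open>1\<close> on
  the expansion. The number of derivatives is chosen such that \<open>nice_decay\<close> yields the
  decay \<open>hw ^ (CARD('n) + 5)\<close> from which mild solutions are built.\<close>

sublocale duhamel "phase L :: int ^ 'n \<Rightarrow> real" "real (Suc N) * L\<^sup>2" tm "CARD('n) * (CARD('n) + 5)"
proof
  have "1 * 1 \<le> real (Suc N) * L\<^sup>2" using L1 by (intro mult_mono one_le_power) auto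
  then show "1 \<le> real (Suc N) * L\<^sup>2" by simp
  show "0 \<le> tm" using tm_ge_1 by simp
  have "CARD('n) * 2 \<le> CARD('n) * (CARD('n) + 5)" by (intro mult_left_mono) auto
  then show "2 * CARD('n) \<le> CARD('n) * (CARD('n) + 5)" by simp
qed

text \<open>The size of the \<open>a\<close>-th Picard term on the good event: the mean square is \<open>(\<alpha> L\<^sup>-\<^sup>\<delta>\<^sup>a)\<^sup>2\<close> up to constants, and half of the
  gain \<open>L\<^sup>-\<^sup>\<delta>\<^sup>a\<close> is spent on the large deviation estimate.\<close>

definition thr :: "nat \<Rightarrow> real" where
  "thr a = \<alpha> * L powr (3 * \<theta> / 4 - real a * \<delta> / 2)"

lemma thr_pos: "thr a > 0" using \<alpha>_pos L0 by (simp add: thr_def)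

lemma thr_mono: "a \<le> b \<Longrightarrow> thr b \<le> thr a"
proof -
  assume "a \<le> b"
  then have "real a * \<delta> \<le> real b * \<delta>" using \<delta>_pos by (intro mult_right_mono) auto
  then show ?thesis unfolding thr_def using L1 \<alpha>_pos by (intro mult_left_mono powr_mono) auto
qed

definition low :: "(int ^ 'n \<Rightarrow> complex) \<Rightarrow> int ^ 'n \<Rightarrow> complex" where
  "low G m = (if m \<in> qbox (L\<^sup>2) then of_real (\<alpha> * amp L n m) * G m else 0)"

definition high :: "(int ^ 'n \<Rightarrow> complex) \<Rightarrow> int ^ 'n \<Rightarrow> complex" where
  "high G m = (if m \<in> qbox (L\<^sup>2) then 0 else of_real (\<alpha> * amp L n m) * G m)"

definition ymax :: real where "ymax = (1 + C0) * (L * (1 + L\<^sup>2) ^ CARD('n))"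

lemma low_bound:
  assumes G: "\<And>m. cmod (G m) \<le> L / hw m" and m: "m \<in> qbox (L\<^sup>2)"
  shows "cmod (low G m) \<le> ymax"
proof -
  have "(amp L n m)\<^sup>2 \<le> C0" using C0[of "{m}"] by simp
  also have "C0 \<le> (1 + C0)\<^sup>2" using C0_nonneg by (simp add: power2_eq_square algebra_simps)
  finally have a: "amp L n m \<le> 1 + C0" by (rule power2_le_imp_le) (use C0_nonneg in simp)
  have "cmod (low G m) = \<alpha> * amp L n m * cmod (G m)"
    using m \<alpha>_pos amp_nonneg[of n L m, OF n_nonneg] by (simp add: low_def norm_mult)
  also have "\<dots> \<le> 1 * (1 + C0) * (L * (1 + L\<^sup>2) ^ CARD('n))"
  proof (intro mult_mono \<alpha>_le_1 a)
    have "cmod (G m) \<le> L * (1 / hw m)" using G[of m] by simp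
    also have "\<dots> \<le> L * (1 + L\<^sup>2) ^ CARD('n)" using L1 by (intro mult_left_mono inverse_hw_qbox m) auto
    finally show "cmod (G m) \<le> L * (1 + L\<^sup>2) ^ CARD('n)" .
  qed (use C0_nonneg amp_nonneg[of n L m, OF n_nonneg] \<alpha>_pos in auto)
  finally show ?thesis by (simp add: ymax_def)
qed

text \<open>Beyond the cutoff the decay of the spectrum pays at once for all derivative weights, for
  the growth of the Gaussians, and for the power of \<open>L\<close> that the contraction will
  lose.\<close>

lemma high_xb:
  assumes G: "\<And>m. cmod (G m) \<le> L / hw m"
  shows "xb (high G) (\<alpha> * B0 * 3 ^ CARD('n) / L ^ (2 * CARD('n) + 1))"
  unfolding xb_def l2b_def
proof (intro allI impI)
  fix i j and F :: "(int ^ 'n) set" assume j: "j \<le> CARD('n) * (CARD('n) + 5)" and F: "finite F"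
  define h where "h m = 1 / hw m" for m :: "int ^ 'n"
  have h1: "h m \<ge> 1" for m using hw_pos[of m] hw_le_1[of m] by (simp add: h_def)
  define c where "c = \<alpha> * B0 / L ^ (2 * CARD('n) + 1)"
  have c0: "c \<ge> 0" using \<alpha>_pos B0_nonneg L0 by (simp add: c_def)
  have each: "cmod (wt i j m * high G m) \<le> c * hw m" for m
  proof (cases "m \<in> qbox (L\<^sup>2)")
    case True
    then show ?thesis using c0 hw_pos[of m] by (simp add: high_def)
  next
    case False
    have a0: "amp L n m \<ge> 0" by (rule amp_nonneg[OF n_nonneg])
    have "cmod (wt i j m) \<le> h m ^ (CARD('n) * (CARD('n) + 5))"
    proof -
      have "\<bar>real_of_int (m $ i)\<bar> / (real (Suc N) * L\<^sup>2) \<le> \<bar>real_of_int (m $ i)\<bar> / 1"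
        using \<Lambda> by (intro divide_left_mono) auto
      also have "\<dots> \<le> norm (int_vec m)" using component_le_norm_cart[of "int_vec m" i] by simp
      also have "\<dots> \<le> h m" using norm_int_vec_le_hw[of m] by (simp add: h_def)
      finally have "\<bar>real_of_int (m $ i)\<bar> / (real (Suc N) * L\<^sup>2) \<le> h m" .
      then have "(\<bar>real_of_int (m $ i)\<bar> / (real (Suc N) * L\<^sup>2)) ^ j \<le> h m ^ j"
        using \<Lambda> by (intro power_mono divide_nonneg_nonneg) auto
      also have "\<dots> \<le> h m ^ (CARD('n) * (CARD('n) + 5))" by (rule power_increasing[OF j h1])
      finally have "(\<bar>real_of_int (m $ i)\<bar> / (real (Suc N) * L\<^sup>2)) ^ j \<le> h m ^ (CARD('n) * (CARD('n) + 5))" .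
      moreover have "cmod (wt i j m) = (\<bar>real_of_int (m $ i)\<bar> / (real (Suc N) * L\<^sup>2)) ^ j"
        unfolding wt_def norm_of_real power_abs by (simp add: abs_mult)
      ultimately show ?thesis by simp
    qed
    then have "cmod (wt i j m * high G m) \<le> h m ^ (CARD('n) * (CARD('n) + 5)) * (\<alpha> * amp L n m * (L * h m))"
      unfolding norm_mult
    proof (rule mult_mono)
      have "cmod (high G m) = \<alpha> * amp L n m * cmod (G m)" using False \<alpha>_pos a0 by (simp add: high_def norm_mult)
      also have "\<dots> \<le> \<alpha> * amp L n m * (L * h m)" using G[of m] \<alpha>_pos a0 by (intro mult_left_mono) (auto simp: h_def)
      finally show "cmod (high G m) \<le> \<alpha> * amp L n m * (L * h m)" .
    qed (use h1[of m] in auto)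
    also have "\<dots> = \<alpha> * (amp L n m * h m ^ (CARD('n) * (CARD('n) + 5) + 1) * L ^ (2 * CARD('n) + 2)) / L ^ (2 * CARD('n) + 1)"
      using L0 by (simp add: power_add field_simps)
    also have "\<dots> \<le> \<alpha> * (B0 * hw m) / L ^ (2 * CARD('n) + 1)"
      using B0[OF False] \<alpha>_pos L0 by (intro divide_right_mono mult_left_mono) (auto simp: h_def)
    finally show ?thesis by (simp add: c_def)
  qed
  have "L2_set (\<lambda>m. cmod (wt i j m * high G m)) F \<le> L2_set (\<lambda>m. c * hw m) F"
    by (intro L2_set_mono each) auto
  also have "\<dots> = c * sqrt (\<Sum>m\<in>F. (hw m)\<^sup>2)"
    using c0 by (simp add: L2_set_def power_mult_distrib sum_distrib_left[symmetric] real_sqrt_mult)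
  also have "\<dots> \<le> c * 3 ^ CARD('n)"
  proof (intro mult_left_mono c0)
    have "(\<Sum>m\<in>F. (hw m)\<^sup>2) \<le> 3 ^ CARD('n) * 1" using hw_square_sum_le[OF F] by simp
    also have "\<dots> \<le> 3 ^ CARD('n) * 3 ^ CARD('n)" by (intro mult_left_mono one_le_power) auto
    finally show "sqrt (\<Sum>m\<in>F. (hw m)\<^sup>2) \<le> 3 ^ CARD('n)" by (intro real_le_lsqrt) (auto simp: power2_eq_square)
  qed
  finally show "L2_set (\<lambda>m. cmod (wt i j m * high G m)) F \<le> \<alpha> * B0 * 3 ^ CARD('n) / L ^ (2 * CARD('n) + 1)"
    by (simp add: c_def mult_ac)
qed

definition phmax :: real where "phmax = 40 * (1 + real (Suc N) * L\<^sup>2) ^ (2 * CARD('n))"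

lemma phase_qbox: "m \<in> qbox (real (Suc N) * L\<^sup>2) \<Longrightarrow> \<bar>phase L m\<bar> \<le> phmax" for m :: "int ^ 'n"
proof -
  assume m: "m \<in> qbox (real (Suc N) * L\<^sup>2)"
  have "\<bar>phase L m\<bar> \<le> 40 * (1 / hw m)\<^sup>2" using phase_le[OF L1, of m] by (simp add: power_divide)
  also have "\<dots> \<le> 40 * ((1 + real (Suc N) * L\<^sup>2) ^ CARD('n))\<^sup>2"
    using hw_pos[of m] by (intro mult_left_mono power_mono inverse_hw_qbox m) auto
  finally show ?thesis by (simp add: phmax_def power_mult[symmetric] mult.commute)
qed

definition lmax :: real where
  "lmax = (1 + 3 ^ CARD('n) * (1 + L\<^sup>2) ^ (2 * CARD('n)) * ymax) ^ Suc N *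
     (fact N * (1 + tm) ^ N * (phmax + 1 + 7 * (1 + real (Suc N) * L\<^sup>2) ^ CARD('n)))"

text \<open>Fine enough for the Lipschitz error to stay below half of the smallest threshold
  \<open>thr N\<close>. Its growth in \<open>L\<close> is polynomial, which the union bound can
  afford.\<close>

definition mesh :: nat where "mesh = Suc (nat \<lceil>2 * (lmax * (tm + real CARD('n))) / thr N\<rceil>)"

lemma ymax_nonneg: "ymax \<ge> 0" using C0_nonneg L0 by (simp add: ymax_def)

lemma phmax_nonneg: "phmax \<ge> 0" by (simp add: phmax_def)

lemma lipc_le: "a \<le> N \<Longrightarrow> lipc (real (card (qbox (L\<^sup>2) :: (int ^ 'n) set)) * ymax) phmax a \<le> lmax"
proof -
  assume a: "a \<le> N"
  let ?c = "real (card (qbox (L\<^sup>2) :: (int ^ 'n) set)) * ymax"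
  let ?d = "1 + 3 ^ CARD('n) * (1 + L\<^sup>2) ^ (2 * CARD('n)) * ymax"
  have cd: "?c \<le> ?d" using mult_right_mono[OF card_qbox(2)[of "L\<^sup>2", where 'n = 'n] ymax_nonneg] by simp
  have d1: "?d \<ge> 1" using ymax_nonneg by simp
  have "?c ^ Suc a \<le> ?d ^ Suc a" using cd ymax_nonneg by (intro power_mono) auto
  also have "\<dots> \<le> ?d ^ Suc N" using a by (intro power_increasing d1) auto
  finally have 1: "?c ^ Suc a \<le> ?d ^ Suc N" .
  have 2: "fact a * (1 + tm) ^ a * (phmax + 1 + 7 * (1 + real (Suc N) * L\<^sup>2) ^ CARD('n)) \<le> fact N * (1 + tm) ^ N * (phmax + 1 + 7 * (1 + real (Suc N) * L\<^sup>2) ^ CARD('n))"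
    using a tm_ge_1 phmax_nonneg by (intro mult_right_mono mult_mono fact_mono power_increasing) auto
  show ?thesis unfolding lipc_def lmax_def
    using phmax_nonneg tm_ge_1 d1 by (intro mult_mono 1 2) auto
qed

lemma mesh: "mesh > 0" "lmax * (tm + real CARD('n)) / real mesh \<le> thr N / 2"
proof -
  show m: "mesh > 0" by (simp add: mesh_def)
  have "2 * (lmax * (tm + real CARD('n))) / thr N \<le> real mesh" unfolding mesh_def by linarith
  then have "2 * (lmax * (tm + real CARD('n))) \<le> real mesh * thr N" using thr_pos[of N] by (simp add: pos_divide_le_eq)
  then show "lmax * (tm + real CARD('n)) / real mesh \<le> thr N / 2" using m by (simp add: field_simps)
qed

definition wave :: "(int ^ 'n \<Rightarrow> complex) \<Rightarrow> nat \<Rightarrow> 'n \<Rightarrow> nat \<Rightarrow> real \<Rightarrow> real ^ 'n \<Rightarrow> complex" where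
  "wave G a i j t x = trig (\<lambda>m. wt i j m * Lv (qbox (L\<^sup>2)) (low G) a t m) x"

text \<open>A condition on one realization of the Gaussians, free of probability. The first clause
  controls the high frequencies and the Lipschitz constants, the second the Picard terms on the
  net.\<close>

definition good :: "(int ^ 'n \<Rightarrow> complex) \<Rightarrow> bool" where
  "good G \<longleftrightarrow> (\<forall>m. cmod (G m) \<le> L / hw m) \<and>
     (\<forall>a\<le>N. \<forall>i. \<forall>j\<le>CARD('n) * (CARD('n) + 5). \<forall>t\<in>tnet tm mesh. \<forall>x\<in>xnet mesh. cmod (wave G a i j t x) \<le> thr a / 2)"

lemma good_sb:
  assumes G: "good G" and a: "a \<le> N" and t: "t \<in> {0..tm}"
  shows "sb (Lv (qbox (L\<^sup>2)) (low G) a t) (thr a)"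
proof (rule sb_from_net[where H = mesh and Y = ymax and \<Phi> = phmax, OF _ _ _ _ t])
  show "real (Suc a) * L\<^sup>2 \<le> real (Suc N) * L\<^sup>2" using a by (intro mult_right_mono) auto
  show "cmod (low G m) \<le> ymax" if "m \<in> qbox (L\<^sup>2)" for m
    by (rule low_bound[OF _ that]) (use G in \<open>auto simp: good_def\<close>)
  show "lipc (real (card (qbox (L\<^sup>2) :: (int ^ 'n) set)) * ymax) phmax a * (tm + real CARD('n)) / real mesh \<le> thr a / 2"
  proof -
    have "lipc (real (card (qbox (L\<^sup>2) :: (int ^ 'n) set)) * ymax) phmax a * (tm + real CARD('n)) / real mesh \<le> lmax * (tm + real CARD('n)) / real mesh"
      using tm_ge_1 by (intro divide_right_mono mult_right_mono lipc_le a) auto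
    also have "\<dots> \<le> thr N / 2" by (rule mesh)
    also have "\<dots> \<le> thr a / 2" using thr_mono[OF a] by simp
    finally show ?thesis .
  qed
  show "cmod (trig (\<lambda>m. wt i j m * Lv (qbox (L\<^sup>2)) (low G) a s m) x) \<le> thr a / 2"
    if "j \<le> CARD('n) * (CARD('n) + 5)" "s \<in> tnet tm mesh" "x \<in> xnet mesh" for i j s x
    using G that a by (simp add: good_def wave_def)
qed (use mesh phase_qbox in auto)

text \<open>\<open>CQ\<close> is \<open>Q\<close> without its power of \<open>L\<close>,
  \<open>CE\<close> the constant of the remainder in units of
  \<open>\<alpha> / L ^ (2 * CARD('n) + 1)\<close>, and \<open>Csol\<close> the constant to be
  absorbed by \<open>L powr (- \<theta> / 4)\<close>.\<close>

definition CQ :: real where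
  "CQ = 3 ^ CARD('n) * real (Suc N) ^ CARD('n) * 2 ^ (CARD('n) * (CARD('n) + 5)) * (1 + real CARD('n))"

definition CE :: real where
  "CE = B0 * 3 ^ CARD('n) + 2 ^ (CARD('n) * (CARD('n) + 5)) * (real (Suc N))\<^sup>2"

definition Csol :: real where
  "Csol = 2 ^ (CARD('n) * (CARD('n) + 5)) * (2 * real (Suc N) + 4 * (CQ * CE))"

lemma C_nonneg: "CQ \<ge> 0" "CE \<ge> 0" "Csol \<ge> 0"
  using B0_nonneg by (auto simp: CQ_def CE_def Csol_def)

lemma thr_sum: "(\<Sum>a\<le>N. thr a) \<le> real (Suc N) * (\<alpha> * L powr (3 * \<theta> / 4))"
proof -
  have "(\<Sum>a\<le>N. thr a) \<le> (\<Sum>a\<le>N. thr 0)" by (intro sum_mono thr_mono) auto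
  then show ?thesis by (simp add: thr_def)
qed

text \<open>\<open>tm * (thr a * thr b)\<close> is \<open>\<alpha>\<close> times \<open>L\<close> to
  the power \<open>- \<delta> + 3 * \<theta> / 2 - (a + b) * \<delta> / 2\<close>. For
  \<open>a + b \<ge> N\<close> this outweighs the loss \<open>Q\<close>, with one power of
  \<open>L\<close> to spare.\<close>

lemma remainder_bound:
  fixes E defines "E \<equiv> \<alpha> * B0 * 3 ^ CARD('n) / L ^ (2 * CARD('n) + 1) + tm * (2 ^ (CARD('n) * (CARD('n) + 5)) * (\<Sum>a\<le>N. \<Sum>b\<le>N. if N \<le> a + b then thr a * thr b else 0))"
  shows "0 \<le> E" "Q * E \<le> \<alpha> * (CQ * CE)"
proof -
  show E0: "0 \<le> E" unfolding E_def using \<alpha>_pos B0_nonneg L0 tm_ge_1 less_imp_le[OF thr_pos]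
    by (intro add_nonneg_nonneg mult_nonneg_nonneg sum_nonneg divide_nonneg_nonneg) auto
  have each: "tm * (if N \<le> a + b then thr a * thr b else 0) \<le> \<alpha> / L ^ (2 * CARD('n) + 1)" for a b
  proof (cases "N \<le> a + b")
    case True
    have "tm * (thr a * thr b) = \<alpha> * (\<alpha> * tm) * (L powr (3 * \<theta> / 4 - real a * \<delta> / 2) * L powr (3 * \<theta> / 4 - real b * \<delta> / 2))"
      by (simp add: thr_def mult_ac)
    also have "\<dots> = \<alpha> * L powr (- \<delta> + (3 * \<theta> / 4 - real a * \<delta> / 2 + (3 * \<theta> / 4 - real b * \<delta> / 2)))"
      unfolding \<alpha>_tm powr_add by (simp add: mult_ac)
    also have "\<dots> \<le> \<alpha> * L powr (- real (2 * CARD('n) + 1))"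
    proof (intro mult_left_mono powr_mono)
      have "real N * \<delta> \<le> (real a + real b) * \<delta>" using True \<delta>_pos by (intro mult_right_mono) auto
      then have "4 * (real CARD('n) + 1) \<le> real a * \<delta> + real b * \<delta>" using N_large by (simp add: distrib_right)
      then show "- \<delta> + (3 * \<theta> / 4 - real a * \<delta> / 2 + (3 * \<theta> / 4 - real b * \<delta> / 2)) \<le> - real (2 * CARD('n) + 1)"
        using \<theta>_\<delta> \<theta>_pos by simp
    qed (use L1 \<alpha>_pos in auto)
    also have "\<dots> = \<alpha> / L ^ (2 * CARD('n) + 1)" using L0 by (subst powr_minus, subst powr_realpow) (auto simp: divide_inverse)
    finally show ?thesis using True by simp
  qed (use \<alpha>_pos L0 in simp)
  have "E = \<alpha> * B0 * 3 ^ CARD('n) / L ^ (2 * CARD('n) + 1) + 2 ^ (CARD('n) * (CARD('n) + 5)) * (\<Sum>a\<le>N. \<Sum>b\<le>N. tm * (if N \<le> a + b then thr a * thr b else 0))"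
    unfolding E_def sum_distrib_left by (simp add: mult.left_commute)
  also have "\<dots> \<le> \<alpha> * B0 * 3 ^ CARD('n) / L ^ (2 * CARD('n) + 1) + 2 ^ (CARD('n) * (CARD('n) + 5)) * (\<Sum>a\<le>N. \<Sum>b\<le>N. \<alpha> / L ^ (2 * CARD('n) + 1))"
    by (intro add_left_mono mult_left_mono sum_mono each) auto
  also have "\<dots> = \<alpha> * CE / L ^ (2 * CARD('n) + 1)"
  proof -
    have "(\<Sum>a\<le>N. \<Sum>b\<le>N. \<alpha> / L ^ (2 * CARD('n) + 1)) = (real (Suc N))\<^sup>2 * (\<alpha> / L ^ (2 * CARD('n) + 1))"
      by (simp only: sum_constant card_atMost power2_eq_square mult.assoc)
    then show ?thesis
      unfolding CE_def by (simp only: distrib_left add_divide_distrib times_divide_eq_right mult_ac)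
  qed
  finally have E: "E \<le> \<alpha> * CE / L ^ (2 * CARD('n) + 1)" .
  have Q: "Q = CQ * L ^ (2 * CARD('n))"
    unfolding Q_def CQ_def by (simp add: power_mult_distrib power_mult[symmetric] mult_ac)
  have "Q * E \<le> (CQ * L ^ (2 * CARD('n))) * (\<alpha> * CE / L ^ (2 * CARD('n) + 1))"
    unfolding Q using C_nonneg L0 by (intro mult_left_mono E) auto
  also have "\<dots> = \<alpha> * (CQ * CE) / L" using L0 by (simp add: field_simps)
  also have "\<dots> \<le> \<alpha> * (CQ * CE) / 1" using L1 \<alpha>_pos C_nonneg by (intro divide_left_mono) auto
  finally show "Q * E \<le> \<alpha> * (CQ * CE)" by simp
qed

lemma initial_datum_trig:
  "initial_datum L \<alpha> n G x = trig (\<lambda>m. low G m + high G m) ((1 / L) *\<^sub>R x)"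
proof -
  have "initial_datum L \<alpha> n G x = (\<Sum>\<^sub>\<infinity>k. of_real (\<alpha> / L powr (real CARD('n) / 2)) * (of_real (sqrt (n ((1 / L) *\<^sub>R int_vec k))) * G k *
        cis (2 * pi * (((1 / L) *\<^sub>R int_vec k) \<bullet> x))))"
    unfolding initial_datum_def by (rule infsum_cmult_right'[symmetric])
  also have "\<dots> = trig (\<lambda>m. low G m + high G m) ((1 / L) *\<^sub>R x)"
    unfolding trig_def by (intro infsum_cong) (simp add: low_def high_def amp_def ch_def mult_ac)
  finally show ?thesis .
qed

theorem good_solution:
  assumes G: "good G" and small: "Csol * L powr (- \<theta> / 4) \<le> 1 / 2" and b: "0 \<le> b" "b \<le> 1"
  shows "\<exists>u. mild_solution L (real CARD('n)) b tm (initial_datum L \<alpha> n G) u \<and> Linf_norm L tm u \<le> ereal (\<alpha> * L powr \<theta>)"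
proof -
  let ?\<sigma> = "CARD('n) * (CARD('n) + 5)"
  define \<rho> where "\<rho> = \<alpha> * B0 * 3 ^ CARD('n) / L ^ (2 * CARD('n) + 1)"
  define E where "E = \<rho> + tm * (2 ^ ?\<sigma> * (\<Sum>a\<le>N. \<Sum>b\<le>N. if N \<le> a + b then thr a * thr b else 0))"
  have E: "0 \<le> E" "Q * E \<le> \<alpha> * (CQ * CE)" using remainder_bound by (simp_all add: E_def \<rho>_def)
  have CC: "0 \<le> CQ * CE" using C_nonneg by simp
  have p34: "L powr (3 * \<theta> / 4) \<ge> 1" using L1 \<theta>_pos by (intro ge_one_powr_ge_zero) auto
  have small2: "tm * (2 * (2 ^ ?\<sigma> * (\<Sum>a\<le>N. thr a)) + 2 ^ ?\<sigma> * (Q * (4 * E))) \<le> 1 / 2"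
  proof -
    have "2 * (2 ^ ?\<sigma> * (\<Sum>a\<le>N. thr a)) + 2 ^ ?\<sigma> * (Q * (4 * E)) = 2 ^ ?\<sigma> * (2 * (\<Sum>a\<le>N. thr a) + 4 * (Q * E))"
      by (simp add: algebra_simps)
    also have "\<dots> \<le> 2 ^ ?\<sigma> * (2 * (real (Suc N) * (\<alpha> * L powr (3 * \<theta> / 4))) + 4 * (\<alpha> * (CQ * CE) * L powr (3 * \<theta> / 4)))"
    proof (intro mult_left_mono add_mono thr_sum)
      have "\<alpha> * (CQ * CE) * 1 \<le> \<alpha> * (CQ * CE) * L powr (3 * \<theta> / 4)" using \<alpha>_pos CC p34 by (intro mult_left_mono) auto
      then show "Q * E \<le> \<alpha> * (CQ * CE) * L powr (3 * \<theta> / 4)" using E(2) by linarith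
    qed auto
    also have "\<dots> = \<alpha> * Csol * L powr (3 * \<theta> / 4)" by (simp add: Csol_def algebra_simps)
    finally have "tm * (2 * (2 ^ ?\<sigma> * (\<Sum>a\<le>N. thr a)) + 2 ^ ?\<sigma> * (Q * (4 * E))) \<le> tm * (\<alpha> * Csol * L powr (3 * \<theta> / 4))"
      using tm_ge_1 by (intro mult_left_mono) auto
    \<comment> \<open>The length of the time interval enters here through
      \<open>\<alpha> * tm = L powr (- \<delta>)\<close>; the gap between \<open>\<delta>\<close>
      and \<open>\<theta>\<close> leaves a negative power of \<open>L\<close>.\<close>
    also have "\<dots> = Csol * ((\<alpha> * tm) * L powr (3 * \<theta> / 4))" by (simp only: mult_ac)
    also have "\<dots> = Csol * L powr (- \<delta> + 3 * \<theta> / 4)" unfolding \<alpha>_tm powr_add ..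
    also have "\<dots> \<le> Csol * L powr (- \<theta> / 4)"
      using \<theta>_\<delta> \<theta>_pos L1 C_nonneg by (intro mult_left_mono powr_mono) auto
    finally show ?thesis using small by linarith
  qed
  obtain u where u: "nice u ((\<Sum>a\<le>N. thr a) + 2 * E)"
    "\<And>t m. t \<in> {0..tm} \<Longrightarrow> u t m = cis (phase L m * t) * (low G m + high G m) + D u u t m"
    "\<And>t x. t \<in> {0..tm} \<Longrightarrow> cmod (trig (u t) x) \<le> (\<Sum>a\<le>N. thr a) + Q * (2 * E)"
  proof (rule solution_near_trees[of "qbox (L\<^sup>2)" "low G" "high G" \<rho> N thr, OF _ _ _ good_sb[OF G] E_def small2])
    show "xb (high G) \<rho>" unfolding \<rho>_def by (rule high_xb) (use G in \<open>auto simp: good_def\<close>)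
  qed (auto simp: card_qbox low_def)
  obtain C where C: "C \<ge> 0" "\<And>t m. t \<in> {0..tm} \<Longrightarrow> cmod (u t m) \<le> C * hw m ^ (CARD('n) + 5)"
    using nice_decay[OF u(1), of "CARD('n) + 5"] by auto
  have u0: "u 0 m = low G m + high G m" for m
    using u(2)[of 0 m] tm_ge_1 by (simp add: D_def)
  have eq: "u t m = cis (phase L m * t) * u 0 m + duh (phase L) u t m" if "t \<in> {0..tm}" for t m
    unfolding u0 using u(2)[OF that] by (simp add: D_def duh_def)
  have ct: "continuous_on {0..tm} (\<lambda>t. u t m)" for m using u(1) unfolding nice_def cont_def by blast
  have tm0: "tm > 0" using tm_ge_1 by simp
  have init: "sol L u 0 = initial_datum L \<alpha> n G"
  proof
    have "u 0 = (\<lambda>m. low G m + high G m)" by (rule ext) (rule u0)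
    moreover have "sol L u 0 x = trig (u 0) ((1 / L) *\<^sub>R x)" for x by (rule sol_def[OF L1 tm0 C(1) ct C(2) eq])
    ultimately show "sol L u 0 x = initial_datum L \<alpha> n G x" for x
      unfolding initial_datum_trig by simp
  qed
  have "mild_solution L (real CARD('n)) b tm (initial_datum L \<alpha> n G) (sol L u)"
    using mild_solution_sol[OF L1 tm0 C(1) ct C(2) eq b] unfolding init .
  moreover have "Linf_norm L tm (sol L u) \<le> ereal (\<alpha> * L powr \<theta>)"
  proof (rule sol_Linf[OF L1 tm0 C(1) ct C(2) eq])
    fix t x assume t: "t \<in> {0..tm}"
    have "cmod (trig (u t) x) \<le> (\<Sum>a\<le>N. thr a) + 2 * (Q * E)" using u(3)[OF t, of x] by (simp only: mult.left_commute)
    also have "\<dots> \<le> real (Suc N) * (\<alpha> * L powr (3 * \<theta> / 4)) + 2 * (\<alpha> * (CQ * CE) * L powr (3 * \<theta> / 4))"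
    proof (intro add_mono mult_left_mono thr_sum)
      have "\<alpha> * (CQ * CE) * 1 \<le> \<alpha> * (CQ * CE) * L powr (3 * \<theta> / 4)" using \<alpha>_pos CC p34 by (intro mult_left_mono) auto
      then show "Q * E \<le> \<alpha> * (CQ * CE) * L powr (3 * \<theta> / 4)" using E(2) by linarith
    qed auto
    also have "\<dots> = \<alpha> * L powr (3 * \<theta> / 4) * (real (Suc N) + 2 * (CQ * CE))" by (simp add: algebra_simps)
    also have "\<dots> \<le> \<alpha> * L powr (3 * \<theta> / 4) * Csol"
    proof (intro mult_left_mono)
      have "1 * (real (Suc N) + 2 * (CQ * CE)) \<le> 2 ^ ?\<sigma> * (2 * real (Suc N) + 4 * (CQ * CE))"
        using CC by (intro mult_mono one_le_power) auto
      then show "real (Suc N) + 2 * (CQ * CE) \<le> Csol" by (simp add: Csol_def)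
    qed (use \<alpha>_pos in auto)
    \<comment> \<open>Raising the exponent from \<open>3 * \<theta> / 4\<close> to
      \<open>\<theta>\<close> is what absorbs the constant.\<close>
    also have "\<dots> = \<alpha> * L powr \<theta> * (Csol * L powr (- \<theta> / 4))"
    proof -
      have "L powr (3 * \<theta> / 4) = L powr \<theta> * L powr (- \<theta> / 4)" by (simp add: powr_add[symmetric])
      then show ?thesis by simp
    qed
    also have "\<dots> \<le> \<alpha> * L powr \<theta> * 1" using small \<alpha>_pos by (intro mult_left_mono) auto
    finally show "cmod (trig (u t) x) \<le> \<alpha> * L powr \<theta>" by simp
  qed
  ultimately show ?thesis by blast
qed

end

section \<open>Probability of the good event\<close>

context wave_box begin

definition Cprob :: real where
  "Cprob = 4 * (fact N)\<^sup>2 * (1 + C0) ^ Suc N * (2 * real (Suc N)) ^ Suc N"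

text \<open>The moment order \<open>p\<close>. Per power of the ratio the factorial costs about
  \<open>p ^ (a + 1)\<close>, while the threshold gains
  \<open>L powr (3 * \<theta> / 2 + a * \<delta>)\<close>: with the exponent
  \<open>5 * \<theta> / 4\<close> a factor \<open>L powr (- \<theta> / 4)\<close> is left. Being
  larger than \<open>\<theta>\<close>, it also lets \<open>exp (- p)\<close> absorb polynomial
  factors.\<close>

definition mom :: nat where "mom = nat \<lceil>L powr (5 * \<theta> / 4)\<rceil>"

lemma mom: "L powr (5 * \<theta> / 4) \<le> real mom" "real mom \<le> 2 * L powr (5 * \<theta> / 4)" "mom > 0"
proof -
  have "L powr (5 * \<theta> / 4) \<ge> 1" using L1 \<theta>_pos by (intro ge_one_powr_ge_zero) auto
  then show "L powr (5 * \<theta> / 4) \<le> real mom" "real mom \<le> 2 * L powr (5 * \<theta> / 4)" "mom > 0"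
    unfolding mom_def by linarith+
qed

lemma fact_mult_power_le: "fact (p * k) * X ^ p \<le> (real (p * k) ^ k * X) ^ p" if "X \<ge> 0" for X :: real
proof -
  have "fact (p * k) * X ^ p \<le> real (p * k) ^ (p * k) * X ^ p"
    using that fact_le_power[of "p * k", where 'a = real] by (intro mult_right_mono) auto
  also have "\<dots> = (real (p * k) ^ k * X) ^ p"
    by (simp add: power_mult_distrib power_mult[symmetric] mult.commute)
  finally show ?thesis .
qed

lemma power_mom_le:
  assumes "0 \<le> X" "X \<le> Cprob * L powr (- \<theta> / 4)" and small: "Cprob * L powr (- \<theta> / 4) \<le> exp (- 1)"
  shows "X ^ mom \<le> exp (- (L powr (5 * \<theta> / 4)))"
proof -
  have "X ^ mom \<le> exp (- 1) ^ mom" using assms by (intro power_mono) auto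
  also have "\<dots> = exp (- real mom)" by (simp add: exp_of_nat_mult[symmetric])
  also have "\<dots> \<le> exp (- (L powr (5 * \<theta> / 4)))" using mom by simp
  finally show ?thesis .
qed

lemma wave_tail_ratio:
  assumes a: "a \<le> N"
  shows "real (mom * Suc a) ^ Suc a * ((fact a * tm ^ a)\<^sup>2 * (\<alpha>\<^sup>2 * C0) ^ Suc a / (thr a / 2)\<^sup>2) \<le> Cprob * L powr (- \<theta> / 4)"
proof -
  \<comment> \<open>Of the \<open>a + 1\<close> amplitudes and \<open>a\<close> time integrations,
    \<open>a\<close> pairs combine to \<open>\<alpha> * tm\<close>; the remaining square of
    \<open>\<alpha>\<close> cancels against the threshold.\<close>
  have "(tm ^ a)\<^sup>2 * (\<alpha>\<^sup>2) ^ Suc a = \<alpha>\<^sup>2 * (\<alpha> * tm) ^ (2 * a)"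
    by (simp add: power_mult_distrib power_mult[symmetric] mult_ac)
  also have "(\<alpha> * tm) ^ (2 * a) = L powr (- 2 * real a * \<delta>)"
    unfolding \<alpha>_tm using L0 by (simp add: powr_power mult_ac)
  finally have 1: "(tm ^ a)\<^sup>2 * (\<alpha>\<^sup>2) ^ Suc a = \<alpha>\<^sup>2 * L powr (- 2 * real a * \<delta>)" .
  have 2: "(thr a / 2)\<^sup>2 = \<alpha>\<^sup>2 * L powr (3 * \<theta> / 2 - real a * \<delta>) / 4"
    using L0 by (simp add: thr_def power_divide power_mult_distrib powr_power)
  have "(fact a * tm ^ a)\<^sup>2 * (\<alpha>\<^sup>2 * C0) ^ Suc a / (thr a / 2)\<^sup>2 = (fact a)\<^sup>2 * C0 ^ Suc a * ((tm ^ a)\<^sup>2 * (\<alpha>\<^sup>2) ^ Suc a) / (thr a / 2)\<^sup>2"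
    by (simp add: power_mult_distrib mult_ac)
  also have "\<dots> = 4 * (fact a)\<^sup>2 * C0 ^ Suc a * (L powr (- 2 * real a * \<delta>) / L powr (3 * \<theta> / 2 - real a * \<delta>))"
    unfolding 1 2 using \<alpha>_pos by simp
  also have "L powr (- 2 * real a * \<delta>) / L powr (3 * \<theta> / 2 - real a * \<delta>) = L powr (- real a * \<delta> - 3 * \<theta> / 2)"
    unfolding powr_diff[symmetric] by (rule arg_cong[where f = "(powr) L"]) (simp add: algebra_simps)
  finally have X: "(fact a * tm ^ a)\<^sup>2 * (\<alpha>\<^sup>2 * C0) ^ Suc a / (thr a / 2)\<^sup>2 = 4 * (fact a)\<^sup>2 * C0 ^ Suc a * L powr (- real a * \<delta> - 3 * \<theta> / 2)" .
  have "real (mom * Suc a) \<le> 2 * real (Suc N) * L powr (5 * \<theta> / 4)"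
  proof -
    have "real mom * real (Suc a) \<le> (2 * L powr (5 * \<theta> / 4)) * real (Suc N)" using a by (intro mult_mono mom) auto
    then show ?thesis by (simp only: of_nat_mult mult_ac)
  qed
  then have "real (mom * Suc a) ^ Suc a \<le> (2 * real (Suc N) * L powr (5 * \<theta> / 4)) ^ Suc a" by (intro power_mono) auto
  also have "\<dots> = (2 * real (Suc N)) ^ Suc a * L powr (5 * \<theta> / 4 * real (Suc a))"
    unfolding power_mult_distrib using L0 by (subst powr_power) (auto simp: mult.commute)
  also have "\<dots> \<le> (2 * real (Suc N)) ^ Suc N * L powr (5 * \<theta> / 4 * real (Suc a))"
    using a by (intro mult_right_mono power_increasing) auto
  finally have Y: "real (mom * Suc a) ^ Suc a \<le> (2 * real (Suc N)) ^ Suc N * L powr (5 * \<theta> / 4 * real (Suc a))" .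
  have Z: "4 * (fact a)\<^sup>2 * C0 ^ Suc a \<le> 4 * (fact N)\<^sup>2 * (1 + C0) ^ Suc N"
  proof (intro mult_mono power_mono fact_mono a)
    have "C0 ^ Suc a \<le> (1 + C0) ^ Suc a" using C0_nonneg by (intro power_mono) auto
    also have "\<dots> \<le> (1 + C0) ^ Suc N" using a C0_nonneg by (intro power_increasing) auto
    finally show "C0 ^ Suc a \<le> (1 + C0) ^ Suc N" .
  qed (use C0_nonneg in auto)
  have "real (mom * Suc a) ^ Suc a * (4 * (fact a)\<^sup>2 * C0 ^ Suc a * L powr (- real a * \<delta> - 3 * \<theta> / 2))
    \<le> ((2 * real (Suc N)) ^ Suc N * L powr (5 * \<theta> / 4 * real (Suc a))) * (4 * (fact N)\<^sup>2 * (1 + C0) ^ Suc N * L powr (- real a * \<delta> - 3 * \<theta> / 2))"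
    using C0_nonneg by (intro mult_mono[OF Y] mult_right_mono[OF Z]) auto
  also have "\<dots> = Cprob * L powr (5 * \<theta> / 4 * real (Suc a) + (- real a * \<delta> - 3 * \<theta> / 2))"
    unfolding powr_add Cprob_def by (simp only: mult_ac)
  also have "\<dots> \<le> Cprob * L powr (- \<theta> / 4)"
  proof (intro mult_left_mono powr_mono)
    have "real a * (4 * \<theta>) \<le> real a * \<delta>" by (intro mult_left_mono \<theta>_\<delta>) auto
    moreover have "0 \<le> real a * \<theta>" using \<theta>_pos by simp
    ultimately show "5 * \<theta> / 4 * real (Suc a) + (- real a * \<delta> - 3 * \<theta> / 2) \<le> - \<theta> / 4"
      by (simp add: algebra_simps)
  qed (use L1 C0_nonneg in \<open>auto simp: Cprob_def\<close>)
  finally show ?thesis unfolding X .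
qed

lemma wave_tail:
  assumes M: "prob_space M" and g: "iid_complex_gaussians M g" and small: "Cprob * L powr (- \<theta> / 4) \<le> exp (- 1)"
    and a: "a \<le> N" and t: "t \<in> {0..tm}"
  shows "{\<omega> \<in> space M. cmod (wave (\<lambda>m. g m \<omega>) a i j t x) \<ge> thr a / 2} \<in> sets M"
    and "measure M {\<omega> \<in> space M. cmod (wave (\<lambda>m. g m \<omega>) a i j t x) \<ge> thr a / 2} \<le> exp (- (L powr (5 * \<theta> / 4)))"
proof -
  have R: "L\<^sup>2 \<ge> 0" "real (Suc a) * L\<^sup>2 \<le> real (Suc N) * L\<^sup>2" using a by (auto intro!: mult_right_mono)
  have V: "(\<Sum>m\<in>qbox (L\<^sup>2). (\<alpha> * amp L n m)\<^sup>2) \<le> \<alpha>\<^sup>2 * C0"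
    unfolding power_mult_distrib sum_distrib_left[symmetric] by (intro mult_left_mono C0 card_qbox) auto
  have y: "low (\<lambda>m. g m \<omega>) m = of_real (\<alpha> * amp L n m) * g m \<omega>" if "m \<in> qbox (L\<^sup>2)" for \<omega> m
    using that by (simp add: low_def)
  have tp: "thr a / 2 > 0" using thr_pos[of a] by simp
  define X where "X = (fact a * tm ^ a)\<^sup>2 * (\<alpha>\<^sup>2 * C0) ^ Suc a / (thr a / 2)\<^sup>2"
  have X0: "X \<ge> 0" unfolding X_def using C0_nonneg by simp
  show "{\<omega> \<in> space M. cmod (wave (\<lambda>m. g m \<omega>) a i j t x) \<ge> thr a / 2} \<in> sets M"
    unfolding wave_def by (rule Lv_tail(1)[OF M g R V y t tp])
  have "measure M {\<omega> \<in> space M. cmod (wave (\<lambda>m. g m \<omega>) a i j t x) \<ge> thr a / 2} \<le> fact (mom * Suc a) * X ^ mom"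
    unfolding wave_def X_def by (rule Lv_tail(2)[OF M g R V y t tp])
  also have "\<dots> \<le> (real (mom * Suc a) ^ Suc a * X) ^ mom" by (rule fact_mult_power_le[OF X0])
  also have "\<dots> \<le> exp (- (L powr (5 * \<theta> / 4)))"
    by (rule power_mom_le[OF mult_nonneg_nonneg[OF zero_le_power X0] wave_tail_ratio[OF a, folded X_def] small]) simp
  finally show "measure M {\<omega> \<in> space M. cmod (wave (\<lambda>m. g m \<omega>) a i j t x) \<ge> thr a / 2} \<le> exp (- (L powr (5 * \<theta> / 4)))" .
qed

text \<open>A single Gaussian is a chaos of degree one. The square of \<open>hw m\<close> is kept in
  the bound so that it can be summed over all frequencies.\<close>

lemma gaussian_tail:
  assumes M: "prob_space M" and g: "iid_complex_gaussians M g" and small: "Cprob * L powr (- \<theta> / 4) \<le> exp (- 1)"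
  shows "{\<omega> \<in> space M. cmod (g m \<omega>) \<ge> L / hw m} \<in> sets M"
    and "measure M {\<omega> \<in> space M. cmod (g m \<omega>) \<ge> L / hw m} \<le> (hw m)\<^sup>2 * exp (- (L powr (5 * \<theta> / 4)))"
proof -
  have [measurable]: "g m \<in> borel_measurable M"
    using g prob_space.complex_gaussian_measurable[OF M] by (auto simp: iid_complex_gaussians_def)
  show "{\<omega> \<in> space M. cmod (g m \<omega>) \<ge> L / hw m} \<in> sets M" by measurable
  have Lh: "L / hw m > 0" using L0 hw_pos[of m] by simp
  have Ls: "Ls {m} 1 = {[m]}" using Ls_1[of "{m}"] by simp
  have "measure M {\<omega> \<in> space M. cmod (g m \<omega>) \<ge> L / hw m} \<le> fact (mom * 1) * (1 / (L / hw m)\<^sup>2) ^ mom"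
    using prob_space.chaos_tail[OF M g, where K = "{m}" and thr = "L / hw m" and d = 1 and F = "\<lambda>_. 1" and p = mom] Lh unfolding Ls by simp
  also have "\<dots> \<le> (real (mom * 1) ^ 1 * (1 / (L / hw m)\<^sup>2)) ^ mom" by (rule fact_mult_power_le) simp
  also have "\<dots> = ((hw m)\<^sup>2) ^ mom * (real mom / L\<^sup>2) ^ mom"
    unfolding power_mult_distrib[symmetric] by (simp add: power_divide mult_ac)
  also have "\<dots> \<le> (hw m)\<^sup>2 * exp (- (L powr (5 * \<theta> / 4)))"
  proof (intro mult_mono power_mom_le small)
    have "(hw m)\<^sup>2 \<le> 1\<^sup>2" using hw_pos[of m] hw_le_1[of m] by (intro power_mono) auto
    then have "((hw m)\<^sup>2) ^ mom \<le> ((hw m)\<^sup>2) ^ 1" using mom(3) by (intro power_decreasing) auto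
    then show "((hw m)\<^sup>2) ^ mom \<le> (hw m)\<^sup>2" by simp
    have "real mom / L\<^sup>2 \<le> 2 * L powr (5 * \<theta> / 4) / L powr 2" using mom L0 by (auto simp: divide_right_mono)
    also have "\<dots> = 2 * L powr (5 * \<theta> / 4 - 2)" by (simp add: powr_diff)
    also have "\<dots> \<le> Cprob * L powr (- \<theta> / 4)"
    proof (intro mult_mono powr_mono)
      have "2 * (1 * 1 * 1) \<le> 4 * ((fact N)\<^sup>2 * (1 + C0) ^ Suc N * (2 * real (Suc N)) ^ Suc N)"
        using C0_nonneg by (intro mult_mono one_le_power) auto
      then show "2 \<le> Cprob" by (simp add: Cprob_def mult.assoc)
      then show "0 \<le> Cprob" by simp
      show "5 * \<theta> / 4 - 2 \<le> - \<theta> / 4" using \<theta>_half by simp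
    qed (use L1 in auto)
    finally show "real mom / L\<^sup>2 \<le> Cprob * L powr (- \<theta> / 4)" .
  qed auto
  finally show "measure M {\<omega> \<in> space M. cmod (g m \<omega>) \<ge> L / hw m} \<le> (hw m)\<^sup>2 * exp (- (L powr (5 * \<theta> / 4)))" .
qed

text \<open>Union bound: over the infinitely many Gaussians, summable thanks to the squares of
  \<open>hw\<close>, and over the finite net together with all orders and derivative
  weights.\<close>

theorem good_event:
  assumes M: "prob_space M" and g: "iid_complex_gaussians M g" and small: "Cprob * L powr (- \<theta> / 4) \<le> exp (- 1)"
  shows "\<exists>E\<in>sets M. (\<forall>\<omega>\<in>E. good (\<lambda>m. g m \<omega>)) \<and> measure M (space M - E) \<le>
    (3 ^ CARD('n) + real (Suc N * CARD('n) * Suc (CARD('n) * (CARD('n) + 5)) * Suc mesh ^ Suc CARD('n))) * exp (- (L powr (5 * \<theta> / 4)))"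
proof -
  interpret M: prob_space M by (rule M)
  define e where "e = exp (- (L powr (5 * \<theta> / 4)))"
  let ?\<sigma> = "CARD('n) * (CARD('n) + 5)"
  define I where "I = {..N} \<times> (UNIV :: 'n set) \<times> {..?\<sigma>} \<times> tnet tm mesh \<times> (xnet mesh :: (real ^ 'n) set)"
  define B where "B = (\<lambda>(a, i, j, t, x). {\<omega> \<in> space M. cmod (wave (\<lambda>m. g m \<omega>) a i j t x) \<ge> thr a / 2})"
  define A where "A m = {\<omega> \<in> space M. cmod (g m \<omega>) \<ge> L / hw m}" for m
  have sub: "tnet tm mesh \<subseteq> {0..tm}" using tnet_subset[OF T mesh(1)] .
  have fI: "finite I" unfolding I_def by (intro finite_cartesian_product tnet_finite xnet_finite) auto
  have B: "B k \<in> sets M" "measure M (B k) \<le> e" if k: "k \<in> I" for k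
  proof -
    obtain a i j t x where k': "k = (a, i, j, t, x)" "a \<le> N" "t \<in> {0..tm}" using k sub unfolding I_def by blast
    show "B k \<in> sets M" "measure M (B k) \<le> e"
      unfolding B_def k' e_def prod.case by (rule wave_tail[OF M g small k'(2,3)])+
  qed
  have A: "A m \<in> sets M" "measure M (A m) \<le> (hw m)\<^sup>2 * e" for m
    unfolding A_def e_def by (rule gaussian_tail[OF M g small])+
  have e0: "e > 0" by (simp add: e_def)
  have UB: "(\<Union>k\<in>I. B k) \<in> sets M" using B(1) fI by (intro sets.finite_UN) auto
  have UA: "(\<Union>m. A m) \<in> sets M" using A(1) by (intro sets.countable_UN') auto
  define E where "E = space M - ((\<Union>m. A m) \<union> (\<Union>k\<in>I. B k))"
  have E: "E \<in> sets M" using UA UB by (auto simp: E_def)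
  have compl: "space M - E = (\<Union>m. A m) \<union> (\<Union>k\<in>I. B k)"
    using sets.sets_into_space[OF UA] sets.sets_into_space[OF UB] by (auto simp: E_def)
  have mA: "measure M (\<Union>m. A m) \<le> 3 ^ CARD('n) * e"
  proof -
    define f where "f = from_nat_into (UNIV :: (int ^ 'n) set)"
    have f: "bij f" unfolding f_def by (intro bij_betw_from_nat_into infinite_UNIV_int_vec) auto
    have part: "(\<Sum>k<K. (hw (f k))\<^sup>2) \<le> 3 ^ CARD('n)" for K
    proof -
      have "(\<Sum>k<K. (hw (f k))\<^sup>2) = (\<Sum>m\<in>f ` {..<K}. (hw m)\<^sup>2)"
        using f by (subst sum.reindex) (auto simp: bij_def intro: inj_on_subset)
      then show ?thesis using hw_square_sum_le[of "f ` {..<K}"] by simp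
    qed
    have sm: "summable (\<lambda>k. (hw (f k))\<^sup>2)" by (rule summableI_nonneg_bounded[OF _ part]) simp
    have sA: "summable (\<lambda>k. measure M (A (f k)))"
      by (rule summable_comparison_test'[where g = "\<lambda>k. (hw (f k))\<^sup>2 * e"]) (use sm A(2) in \<open>auto intro: summable_mult2\<close>)
    have "(\<Union>m. A m) = (\<Union>k. A (f k))" using bij_is_surj[OF f] by (metis image_image)
    then have "measure M (\<Union>m. A m) \<le> (\<Sum>k. measure M (A (f k)))"
      using M.finite_measure_subadditive_countably[of "\<lambda>k. A (f k)"] A(1) sA by auto
    also have "\<dots> \<le> (\<Sum>k. (hw (f k))\<^sup>2 * e)" by (intro suminf_le A(2) sA summable_mult2 sm)
    also have "\<dots> = (\<Sum>k. (hw (f k))\<^sup>2) * e" by (rule suminf_mult2[OF sm, symmetric])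
    also have "\<dots> \<le> 3 ^ CARD('n) * e" using e0 by (intro mult_right_mono suminf_le_const sm part) auto
    finally show ?thesis .
  qed
  have mB: "measure M (\<Union>k\<in>I. B k) \<le> real (Suc N * CARD('n) * Suc ?\<sigma> * Suc mesh ^ Suc CARD('n)) * e"
  proof -
    have "measure M (\<Union>k\<in>I. B k) \<le> (\<Sum>k\<in>I. measure M (B k))"
      using B(1) by (intro M.finite_measure_subadditive_finite fI) auto
    also have "\<dots> \<le> (\<Sum>k\<in>I. e)" by (intro sum_mono B(2))
    also have "\<dots> = real (card I) * e" by simp
    also have "\<dots> \<le> real (Suc N * CARD('n) * Suc ?\<sigma> * Suc mesh ^ Suc CARD('n)) * e"
    proof (intro mult_right_mono of_nat_mono)
      have "card I = Suc N * (CARD('n) * (Suc ?\<sigma> * (card (tnet tm mesh) * card (xnet mesh :: (real ^ 'n) set))))"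
        unfolding I_def card_cartesian_product by simp
      also have "\<dots> \<le> Suc N * (CARD('n) * (Suc ?\<sigma> * (Suc mesh * Suc mesh ^ CARD('n))))"
        by (intro mult_le_mono order_refl tnet_card order_trans[OF xnet_card power_mono]) auto
      finally show "card I \<le> Suc N * CARD('n) * Suc ?\<sigma> * Suc mesh ^ Suc CARD('n)" by (simp only: power_Suc mult.assoc)
    qed (use e0 in simp)
    finally show ?thesis .
  qed
  have "measure M (space M - E) \<le> measure M (\<Union>m. A m) + measure M (\<Union>k\<in>I. B k)"
    unfolding compl by (rule measure_subadditive) (use UA UB in auto)
  also have "\<dots> \<le> (3 ^ CARD('n) + real (Suc N * CARD('n) * Suc ?\<sigma> * Suc mesh ^ Suc CARD('n))) * e"
    using mA mB by (simp only: distrib_right)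
  finally have "measure M (space M - E) \<le> (3 ^ CARD('n) + real (Suc N * CARD('n) * Suc ?\<sigma> * Suc mesh ^ Suc CARD('n))) * e" .
  moreover have "good (\<lambda>m. g m \<omega>)" if \<omega>: "\<omega> \<in> E" for \<omega>
    unfolding good_def
  proof (intro conjI allI impI ballI)
    have sp: "\<omega> \<in> space M" and nA: "\<omega> \<notin> A m" for m using \<omega> by (auto simp: E_def)
    show "cmod (g m \<omega>) \<le> L / hw m" for m using nA[of m] sp by (simp add: A_def)
    fix a i j t x assume "a \<le> N" "j \<le> ?\<sigma>" "t \<in> tnet tm mesh" "x \<in> (xnet mesh :: (real ^ 'n) set)"
    then have "(a, i, j, t, x) \<in> I" by (auto simp: I_def)
    then have "\<omega> \<notin> B (a, i, j, t, x)" using \<omega> by (auto simp: E_def)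
    then show "cmod (wave (\<lambda>m. g m \<omega>) a i j t x) \<le> thr a / 2" using sp by (simp add: B_def)
  qed
  ultimately show ?thesis using E by (auto simp: e_def)
qed

end

section \<open>The limit of large boxes\<close>

text \<open>\<open>L ^ k\<close> dominates \<open>tm\<close>, at most
  \<open>L powr \<gamma>\<close>, and \<open>1 / thr N\<close>, at most
  \<open>L powr (\<gamma> + N * \<delta> / 2)\<close>; the lower bound on \<open>\<alpha>\<close>
  enters here. The right-hand side is kept explicit so that it is built from sums, products and
  powers.\<close>

lemma (in wave_box) mesh_le:
  assumes \<gamma>: "L powr (- \<gamma>) \<le> \<alpha>" and k: "\<gamma> + real N * \<delta> / 2 \<le> real k" "0 \<le> \<gamma>"
  shows "real (Suc mesh) \<le> 3 + 2 * (((1 + 3 ^ CARD('n) * (1 + L\<^sup>2) ^ (2 * CARD('n)) * ((1 + C0) * (L * (1 + L\<^sup>2) ^ CARD('n)))) ^ Suc N *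
     (fact N * (1 + L ^ k) ^ N * (40 * (1 + real (Suc N) * L\<^sup>2) ^ (2 * CARD('n)) + 1 + 7 * (1 + real (Suc N) * L\<^sup>2) ^ CARD('n)))) *
     (L ^ k + real CARD('n))) * L ^ k"
proof -
  have L0: "L > 0" using L1 by simp
  have "inverse \<alpha> \<le> inverse (L powr (- \<gamma>))" using \<gamma> L0 by (intro le_imp_inverse_le) auto
  then have i: "inverse \<alpha> \<le> L powr \<gamma>" by (simp add: powr_minus)
  have Nd: "0 \<le> real N * \<delta> / 2" using \<delta>_pos by simp
  have "tm \<le> L powr \<gamma> * 1" unfolding tm_def
    using i powr_mono[of "- \<delta>" 0 L] L1 \<delta>_pos by (intro mult_mono) auto
  also have "\<dots> \<le> L powr (real k)" using k Nd L1 by (simp add: powr_mono)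
  finally have tm: "tm \<le> L ^ k" using L0 by (simp add: powr_realpow)
  have "inverse (thr N) = inverse \<alpha> * L powr (real N * \<delta> / 2 - 3 * \<theta> / 4)"
    unfolding thr_def by (simp add: powr_minus[symmetric] inverse_mult_distrib)
  also have "\<dots> \<le> L powr \<gamma> * L powr (real N * \<delta> / 2)" using i L1 \<theta>_pos by (intro mult_mono powr_mono) auto
  also have "\<dots> \<le> L powr (real k)" unfolding powr_add[symmetric] using k L1 by (intro powr_mono) auto
  finally have th: "inverse (thr N) \<le> L ^ k" using L0 by (simp add: powr_realpow)
  have ph: "0 \<le> 7 * (1 + real (Suc N) * L\<^sup>2) ^ CARD('n)" by simp
  have lm: "lmax \<le> (1 + 3 ^ CARD('n) * (1 + L\<^sup>2) ^ (2 * CARD('n)) * ymax) ^ Suc N *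
     (fact N * (1 + L ^ k) ^ N * (phmax + 1 + 7 * (1 + real (Suc N) * L\<^sup>2) ^ CARD('n)))" (is "_ \<le> ?P")
    unfolding lmax_def using L0 tm tm_ge_1 ymax_nonneg phmax_nonneg ph
    by (intro mult_left_mono mult_right_mono power_mono add_left_mono zero_le_power add_nonneg_nonneg mult_nonneg_nonneg) auto
  have l0: "lmax \<ge> 0" unfolding lmax_def using tm_ge_1 ymax_nonneg phmax_nonneg by simp
  have "2 * (lmax * (tm + real CARD('n))) * inverse (thr N) \<ge> 0" using l0 tm_ge_1 thr_pos[of N] by simp
  then have "real (Suc mesh) \<le> 3 + 2 * (lmax * (tm + real CARD('n))) * inverse (thr N)"
    unfolding mesh_def divide_inverse by linarith
  also have "\<dots> \<le> 3 + 2 * (?P * (L ^ k + real CARD('n))) * L ^ k"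
    using lm tm th l0 tm_ge_1 thr_pos[of N] by (intro add_left_mono mult_mono) auto
  finally show ?thesis by (simp only: ymax_def phmax_def)
qed

definition poly_bounded :: "(real \<Rightarrow> real) \<Rightarrow> bool" where
  "poly_bounded f \<longleftrightarrow> (\<exists>C k. \<forall>L\<ge>1. \<bar>f L\<bar> \<le> C * L ^ k)"

lemma poly_bounded_const: "poly_bounded (\<lambda>_. c)"
  unfolding poly_bounded_def by (intro exI[of _ "\<bar>c\<bar>"] exI[of _ 0]) auto

lemma poly_bounded_id: "poly_bounded (\<lambda>L. L)"
  unfolding poly_bounded_def by (intro exI[of _ 1]) auto

lemma poly_bounded_mult: "poly_bounded f \<Longrightarrow> poly_bounded g \<Longrightarrow> poly_bounded (\<lambda>L. f L * g L)"
proof -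
  assume "poly_bounded f" "poly_bounded g"
  then obtain C k C' k' where f: "\<And>L. L \<ge> 1 \<Longrightarrow> \<bar>f L\<bar> \<le> C * L ^ k" and g: "\<And>L. L \<ge> 1 \<Longrightarrow> \<bar>g L\<bar> \<le> C' * L ^ k'"
    unfolding poly_bounded_def by blast
  have "\<bar>f L * g L\<bar> \<le> (C * C') * L ^ (k + k')" if "L \<ge> 1" for L
    using mult_mono[OF f[OF that] g[OF that]] order_trans[OF abs_ge_zero f[OF that]]
    by (simp add: abs_mult power_add mult_ac)
  then show ?thesis unfolding poly_bounded_def by blast
qed

lemma poly_bounded_add: "poly_bounded f \<Longrightarrow> poly_bounded g \<Longrightarrow> poly_bounded (\<lambda>L. f L + g L)"
proof -
  assume "poly_bounded f" "poly_bounded g"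
  then obtain C k C' k' where f: "\<And>L. L \<ge> 1 \<Longrightarrow> \<bar>f L\<bar> \<le> C * L ^ k" and g: "\<And>L. L \<ge> 1 \<Longrightarrow> \<bar>g L\<bar> \<le> C' * L ^ k'"
    unfolding poly_bounded_def by blast
  have C: "C \<ge> 0" "C' \<ge> 0" using order_trans[OF abs_ge_zero f[of 1]] order_trans[OF abs_ge_zero g[of 1]] by auto
  have "\<bar>f L + g L\<bar> \<le> (C + C') * L ^ (k + k')" if L: "L \<ge> 1" for L
  proof -
    have "\<bar>f L + g L\<bar> \<le> C * L ^ k + C' * L ^ k'" using f[OF L] g[OF L] by linarith
    also have "\<dots> \<le> C * L ^ (k + k') + C' * L ^ (k + k')"
      using C L by (intro add_mono mult_left_mono power_increasing) auto
    finally show ?thesis by (simp add: distrib_right)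
  qed
  then show ?thesis unfolding poly_bounded_def by blast
qed

lemma poly_bounded_power: "poly_bounded f \<Longrightarrow> poly_bounded (\<lambda>L. f L ^ k)"
  by (induction k) (auto intro: poly_bounded_const poly_bounded_mult)

lemmas poly_bounded_intros = poly_bounded_const poly_bounded_id poly_bounded_mult poly_bounded_add poly_bounded_power

text \<open>The gap between the exponents \<open>5 * \<theta> / 4\<close> and
  \<open>\<theta>\<close> swallows every power of \<open>L\<close>, and with it the size of the
  net.\<close>

lemma poly_bounded_exp_decay:
  assumes f: "poly_bounded f" and \<theta>: "0 < \<theta>"
  shows "\<forall>\<^sub>F L in at_top. f L * exp (- (L powr (5 * \<theta> / 4))) \<le> exp (- (L powr \<theta>))"
proof -
  obtain C k where f: "\<And>L. L \<ge> 1 \<Longrightarrow> \<bar>f L\<bar> \<le> C * L ^ k" using f unfolding poly_bounded_def by blast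
  have "\<forall>\<^sub>F L in at_top. C * L ^ k * exp (- (L powr (5 * \<theta> / 4))) \<le> exp (- (L powr \<theta>))"
    using \<theta> by real_asymp
  then show ?thesis using eventually_ge_at_top[of 1]
  proof eventually_elim
    case (elim L)
    have "f L * exp (- (L powr (5 * \<theta> / 4))) \<le> C * L ^ k * exp (- (L powr (5 * \<theta> / 4)))"
      using f[OF elim(2)] by (intro mult_right_mono) auto
    then show ?case using elim by linarith
  qed
qed

lemma eventually_powr_small: "0 < \<theta> \<Longrightarrow> 0 < q \<Longrightarrow> \<forall>\<^sub>F L in at_top. C * L powr (- \<theta> / 4) \<le> q" for \<theta> q C :: real
  by real_asymp

theorem theorem1p2:
  shows "\<exists>K c :: real \<Rightarrow> real \<Rightarrow> real.
    (\<forall>\<theta>>0. \<forall>\<gamma>>0. K \<theta> \<gamma> > 0 \<and> c \<theta> \<gamma> > 0) \<and>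
    (\<forall>(\<delta>::real) (\<gamma>::real) (\<alpha> :: real \<Rightarrow> real) (n_in :: real ^ 'n \<Rightarrow> real)
       (M :: 'w measure) (g :: int ^ 'n \<Rightarrow> 'w \<Rightarrow> complex).
      \<delta> > 0 \<longrightarrow> \<gamma> > \<delta> \<longrightarrow>
      (\<forall>L\<ge>1. L powr (- \<gamma>) \<le> \<alpha> L \<and> \<alpha> L \<le> L powr (- \<delta>)) \<longrightarrow>
      schwartz n_in \<longrightarrow> (\<forall>x. n_in x \<ge> 0) \<longrightarrow>
      prob_space M \<longrightarrow> iid_complex_gaussians M g \<longrightarrow>
      (\<exists>\<theta>>0. \<exists>s>real CARD('n) / 2. \<exists>C>0. \<forall>\<epsilon>>0. \<exists>b. 1/2 < b \<and> b < 1/2 + \<epsilon> \<and>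
        (\<exists>L0\<ge>1. \<forall>L\<ge>L0. \<exists>E\<in>sets M.
          measure M (space M - E) \<le> K \<theta> \<gamma> * exp (- c \<theta> \<gamma> * L powr \<theta>) \<and>
          (\<forall>\<omega>\<in>E. let T = inverse (\<alpha> L) * L powr (- \<delta>);
                     u0 = initial_datum L (\<alpha> L) n_in (\<lambda>k. g k \<omega>)
            in \<exists>u. mild_solution L s b T u0 u \<and>
                 (\<forall>v. mild_solution L s b T u0 v \<longrightarrow> (\<forall>t\<in>{0..T}. \<forall>x. v t x = u t x)) \<and>
                 Linf_norm L T u \<le> ereal (\<alpha> L * L powr (\<theta> + C * (b - 1/2)))))))"
proof (rule exI[of _ "\<lambda>_ _. 1"], rule exI[of _ "\<lambda>_ _. 1"], intro conjI allI impI)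
  fix \<delta> \<gamma> :: real and \<alpha> :: "real \<Rightarrow> real" and n :: "real ^ 'n \<Rightarrow> real" and M :: "'w measure"
    and g :: "int ^ 'n \<Rightarrow> 'w \<Rightarrow> complex"
  assume \<delta>: "\<delta> > 0" and \<gamma>: "\<gamma> > \<delta>" and \<alpha>: "\<forall>L\<ge>1. L powr (- \<gamma>) \<le> \<alpha> L \<and> \<alpha> L \<le> L powr (- \<delta>)"
    and n: "schwartz n" "\<forall>x. n x \<ge> 0" and M: "prob_space M" and g: "iid_complex_gaussians M g"
  let ?d = "CARD('n)" and ?\<sigma> = "CARD('n) * (CARD('n) + 5)"
  \<comment> \<open>\<open>\<delta> / 4\<close> leaves room for moments and thresholds,
    \<open>1 / 2\<close> serves the tails of single Gaussians.\<close>
  define \<theta> where "\<theta> = min (\<delta> / 4) (1 / 2)"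
  have \<theta>: "\<theta> > 0" "4 * \<theta> \<le> \<delta>" "\<theta> \<le> 1 / 2" using \<delta> by (auto simp: \<theta>_def)
  obtain N :: nat where "4 * (real ?d + 1) / \<delta> \<le> real N" using real_arch_simple by blast
  then have N: "4 * (real ?d + 1) \<le> real N * \<delta>" using \<delta> by (simp add: pos_divide_le_eq)
  obtain k :: nat where k: "\<gamma> + real N * \<delta> / 2 \<le> real k" using real_arch_simple by blast
  obtain C0 where C0: "C0 \<ge> 0" "\<And>L F. L \<ge> 1 \<Longrightarrow> finite F \<Longrightarrow> (\<Sum>m\<in>F. (amp L n m)\<^sup>2) \<le> C0"
    using amp_square_sum[OF n(1)] n(2) by blast
  obtain B0 where B0: "B0 \<ge> 0" "\<And>L m. L \<ge> 1 \<Longrightarrow> m \<notin> qbox (L\<^sup>2) \<Longrightarrow>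
      amp L n m * (1 / hw m) ^ (?\<sigma> + 1) * L ^ (2 * ?d + 2) \<le> B0 * hw m"
    using amp_tail[OF n(1), of "?\<sigma> + 1" "2 * ?d + 2"] n(2) by blast
  \<comment> \<open>\<open>csol\<close> and \<open>cprob\<close> restate \<open>Csol\<close> and
    \<open>Cprob\<close> outside the locale, visibly independent of \<open>L\<close>, and
    \<open>P\<close> restates the mesh bound as a function of \<open>L\<close>; thus
    \<open>L0\<close> can be fixed before \<open>L\<close>.\<close>
  define csol where "csol = 2 ^ ?\<sigma> * (2 * real (Suc N) + 4 * ((3 ^ ?d * real (Suc N) ^ ?d * 2 ^ ?\<sigma> * (1 + real ?d)) *
    (B0 * 3 ^ ?d + 2 ^ ?\<sigma> * (real (Suc N))\<^sup>2)))"
  define cprob where "cprob = 4 * (fact N)\<^sup>2 * (1 + C0) ^ Suc N * (2 * real (Suc N)) ^ Suc N"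
  define P where "P L = 3 + 2 * (((1 + 3 ^ ?d * (1 + L\<^sup>2) ^ (2 * ?d) * ((1 + C0) * (L * (1 + L\<^sup>2) ^ ?d))) ^ Suc N *
     (fact N * (1 + L ^ k) ^ N * (40 * (1 + real (Suc N) * L\<^sup>2) ^ (2 * ?d) + 1 + 7 * (1 + real (Suc N) * L\<^sup>2) ^ ?d))) *
     (L ^ k + real ?d)) * L ^ k" for L :: real
  define F where "F L = 3 ^ ?d + real (Suc N * ?d * Suc ?\<sigma>) * P L ^ Suc ?d" for L
  have "poly_bounded F" unfolding F_def P_def by (intro poly_bounded_intros)
  \<comment> \<open>The last condition leaves no constant in front of the exponential, which is why
    \<open>K\<close> and \<open>c\<close> can both be \<open>1\<close>. None of the conditions
    involves \<open>b\<close>.\<close>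
  then have "\<forall>\<^sub>F L in at_top. L \<ge> 1 \<and> csol * L powr (- \<theta> / 4) \<le> 1 / 2 \<and> cprob * L powr (- \<theta> / 4) \<le> exp (- 1)
      \<and> F L * exp (- (L powr (5 * \<theta> / 4))) \<le> exp (- (L powr \<theta>))"
    using \<theta>(1) by (intro eventually_conj eventually_ge_at_top eventually_powr_small poly_bounded_exp_decay) auto
  then obtain L0 where L0: "\<And>L. L \<ge> L0 \<Longrightarrow> L \<ge> 1 \<and> csol * L powr (- \<theta> / 4) \<le> 1 / 2 \<and> cprob * L powr (- \<theta> / 4) \<le> exp (- 1)
      \<and> F L * exp (- (L powr (5 * \<theta> / 4))) \<le> exp (- (L powr \<theta>))"
    unfolding eventually_at_top_linorder by blast
  have main: "\<exists>E\<in>sets M. measure M (space M - E) \<le> 1 * exp (- 1 * L powr \<theta>) \<and>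
      (\<forall>\<omega>\<in>E. let T = inverse (\<alpha> L) * L powr (- \<delta>); u0 = initial_datum L (\<alpha> L) n (\<lambda>k. g k \<omega>)
        in \<exists>u. mild_solution L (real ?d) b T u0 u \<and>
          (\<forall>v. mild_solution L (real ?d) b T u0 v \<longrightarrow> (\<forall>t\<in>{0..T}. \<forall>x. v t x = u t x)) \<and>
          Linf_norm L T u \<le> ereal (\<alpha> L * L powr (\<theta> + 1 * (b - 1/2))))"
    if b: "1 / 2 < b" "b \<le> 1" and L: "L \<ge> L0" for b L
  proof -
    have L1: "L \<ge> 1" and small: "csol * L powr (- \<theta> / 4) \<le> 1 / 2" "cprob * L powr (- \<theta> / 4) \<le> exp (- 1)"
      "F L * exp (- (L powr (5 * \<theta> / 4))) \<le> exp (- (L powr \<theta>))" using L0[OF L] by auto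
    have al: "L powr (- \<gamma>) \<le> \<alpha> L" "\<alpha> L \<le> L powr (- \<delta>)" using \<alpha> L1 by auto
    have "0 < L powr (- \<gamma>)" using L1 by simp
    then have al0: "\<alpha> L > 0" using al by linarith
    interpret W: wave_box n L "\<alpha> L" \<delta> \<theta> C0 B0 N
      by unfold_locales (use L1 al0 al \<delta> \<theta> N n C0 B0 in auto)
    have cs: "W.Csol = csol" unfolding W.Csol_def W.CQ_def W.CE_def csol_def ..
    have cp: "W.Cprob = cprob" unfolding W.Cprob_def cprob_def ..
    obtain E where E: "E \<in> sets M" "\<And>\<omega>. \<omega> \<in> E \<Longrightarrow> W.good (\<lambda>m. g m \<omega>)"
      "measure M (space M - E) \<le> (3 ^ ?d + real (Suc N * ?d * Suc ?\<sigma> * Suc W.mesh ^ Suc ?d)) * exp (- (L powr (5 * \<theta> / 4)))"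
      using W.good_event[OF M g small(2)[folded cp]] by blast
    have "real (Suc W.mesh) \<le> P L" unfolding P_def by (rule W.mesh_le[OF al(1) k]) (use \<gamma> \<delta> in simp)
    then have "real (Suc N * ?d * Suc ?\<sigma>) * real (Suc W.mesh) ^ Suc ?d \<le> real (Suc N * ?d * Suc ?\<sigma>) * P L ^ Suc ?d"
      by (intro mult_left_mono power_mono) auto
    then have "3 ^ ?d + real (Suc N * ?d * Suc ?\<sigma> * Suc W.mesh ^ Suc ?d) \<le> F L"
      unfolding F_def of_nat_mult[of _ "Suc W.mesh ^ Suc ?d"] of_nat_power by simp
    then have "(3 ^ ?d + real (Suc N * ?d * Suc ?\<sigma> * Suc W.mesh ^ Suc ?d)) * exp (- (L powr (5 * \<theta> / 4))) \<le> F L * exp (- (L powr (5 * \<theta> / 4)))"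
      by (rule mult_right_mono) simp
    then have meas: "measure M (space M - E) \<le> exp (- (L powr \<theta>))" using E(3) small(3) by linarith
    have "\<exists>u. mild_solution L (real ?d) b W.tm (initial_datum L (\<alpha> L) n (\<lambda>k. g k \<omega>)) u \<and>
          (\<forall>v. mild_solution L (real ?d) b W.tm (initial_datum L (\<alpha> L) n (\<lambda>k. g k \<omega>)) v \<longrightarrow> (\<forall>t\<in>{0..W.tm}. \<forall>x. v t x = u t x)) \<and>
          Linf_norm L W.tm u \<le> ereal (\<alpha> L * L powr (\<theta> + 1 * (b - 1/2)))" if \<omega>: "\<omega> \<in> E" for \<omega>
    proof -
      obtain u where u: "mild_solution L (real ?d) b W.tm (initial_datum L (\<alpha> L) n (\<lambda>k. g k \<omega>)) u"
        "Linf_norm L W.tm u \<le> ereal (\<alpha> L * L powr \<theta>)"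
        using W.good_solution[OF E(2)[OF \<omega>] small(1)[folded cs], of b] b by auto
      \<comment> \<open>The bound is already obtained without the term in \<open>b\<close>; since
        \<open>b > 1/2\<close> and \<open>L \<ge> 1\<close>, the claimed exponent is only
        larger.\<close>
      have "\<alpha> L * L powr \<theta> \<le> \<alpha> L * L powr (\<theta> + 1 * (b - 1/2))"
        using al0 L1 b by (intro mult_left_mono powr_mono) auto
      then have "Linf_norm L W.tm u \<le> ereal (\<alpha> L * L powr (\<theta> + 1 * (b - 1/2)))" using u(2) by (meson ereal_less_eq(3) order_trans)
      then show ?thesis using u(1) mild_solution_unique[OF L1 u(1)] by blast
    qed
    then show ?thesis using E(1) meas by (auto simp: W.tm_def Let_def)
  qed
  show "\<exists>\<theta>>0. \<exists>s>real CARD('n) / 2. \<exists>C>0. \<forall>\<epsilon>>0. \<exists>b. 1/2 < b \<and> b < 1/2 + \<epsilon> \<and>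
        (\<exists>L0\<ge>1. \<forall>L\<ge>L0. \<exists>E\<in>sets M.
          measure M (space M - E) \<le> 1 * exp (- 1 * L powr \<theta>) \<and>
          (\<forall>\<omega>\<in>E. let T = inverse (\<alpha> L) * L powr (- \<delta>);
                     u0 = initial_datum L (\<alpha> L) n (\<lambda>k. g k \<omega>)
            in \<exists>u. mild_solution L s b T u0 u \<and>
                 (\<forall>v. mild_solution L s b T u0 v \<longrightarrow> (\<forall>t\<in>{0..T}. \<forall>x. v t x = u t x)) \<and>
                 Linf_norm L T u \<le> ereal (\<alpha> L * L powr (\<theta> + C * (b - 1/2)))))"
  \<comment> \<open>The solutions lie in the space with \<open>s = CARD('n)\<close> for every
    \<open>b\<close> in the range from \<open>1/2\<close> to \<open>1\<close>, so \<open>b\<close>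
    can be taken as close to \<open>1/2\<close> as desired.\<close>
  proof (rule exI[of _ \<theta>], rule conjI[OF \<theta>(1)], rule exI[of _ "real CARD('n)"], rule conjI, simp, rule exI[of _ 1], rule conjI, simp, intro allI impI)
    fix \<epsilon> :: real assume "\<epsilon> > 0"
    then obtain b where b: "1/2 < b" "b < 1/2 + \<epsilon>" "b \<le> 1"
      using that[of "min (1/2 + \<epsilon>/2) 1"] by auto
    show "\<exists>b. 1/2 < b \<and> b < 1/2 + \<epsilon> \<and>
        (\<exists>L0\<ge>1. \<forall>L\<ge>L0. \<exists>E\<in>sets M.
          measure M (space M - E) \<le> 1 * exp (- 1 * L powr \<theta>) \<and>
          (\<forall>\<omega>\<in>E. let T = inverse (\<alpha> L) * L powr (- \<delta>);
                     u0 = initial_datum L (\<alpha> L) n (\<lambda>k. g k \<omega>)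
            in \<exists>u. mild_solution L (real CARD('n)) b T u0 u \<and>
                 (\<forall>v. mild_solution L (real CARD('n)) b T u0 v \<longrightarrow> (\<forall>t\<in>{0..T}. \<forall>x. v t x = u t x)) \<and>
                 Linf_norm L T u \<le> ereal (\<alpha> L * L powr (\<theta> + 1 * (b - 1/2)))))"
    proof (rule exI[of _ b], intro conjI b, rule exI[of _ "max 1 L0"], rule conjI, simp, intro allI impI)
      fix L assume "max 1 L0 \<le> L"
      then have "L0 \<le> L" by simp
      then show "\<exists>E\<in>sets M. measure M (space M - E) \<le> 1 * exp (- 1 * L powr \<theta>) \<and>
          (\<forall>\<omega>\<in>E. let T = inverse (\<alpha> L) * L powr (- \<delta>); u0 = initial_datum L (\<alpha> L) n (\<lambda>k. g k \<omega>)
            in \<exists>u. mild_solution L (real CARD('n)) b T u0 u \<and>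
              (\<forall>v. mild_solution L (real CARD('n)) b T u0 v \<longrightarrow> (\<forall>t\<in>{0..T}. \<forall>x. v t x = u t x)) \<and>
              Linf_norm L T u \<le> ereal (\<alpha> L * L powr (\<theta> + 1 * (b - 1/2))))"
        by (rule main[OF b(1,3)])
    qed
  qed
qed auto

end
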